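(* Let $X$ be a reflexive Banach space, $Y$ a separable Hilbert space, $B:Y\to X$ bounded and linear, $x_0\in X$, and let $A$ be a closed linear operator in $X$. Assume: (T) $A$ generates a $C_0$-semigroup $\{T(t)\}_{t\ge0}$ on $X$ which is compact for $t>0$; (C) the linear fractional control system ${}^{H}D^{\alpha,\beta;\psi}_{a+}q(t)=Aq(t)+Bu(t)$, $t\in[a,b]$, $(I^{1-\gamma;\psi}_{a+}q)(a)=x_0$, is approximately controllable in $[a,b]$. Let $F:[a,b]\times X\multimap X$ be a multivalued map with nonempty values such that: (F1) $(t,x)\mapsto F(t,x)$ is graph measurable; (F2) $F$ has closed and convex values; (F3) for each $t\in[a,b]$, $F(t,\cdot):X\multimap X$ is lower semicontinuous; (F4) there is a function $m\in L^{1/r}([a,b],\mathbb{R}^+)$, $r\in(0,\alpha)$, such that $I^{\alpha;\psi}_{a+}m\in C((a,b],\mathbb{R}^+)$, $\lim_{t\to a+}(\Psi(t,a))^{1-\gamma}I^{\alpha;\psi}_{a+}m(t)=0$, and $\|F(t,x)\|:=\sup\{\|z\|:z\in F(t,x)\}\le m(t)$ for all $x\in X$ and $t\in[a,b]$. Then the system $${}^{H}D^{\alpha,\beta;\psi}_{a+}q(t)\in Aq(t)+F(t,q(t))+Bu(t),\ t\in[a,b],\qquad (I^{1-\gamma;\psi}_{a+}q)(a)=x_0,$$ is approximately controllable in $[a,b]$.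
   Context: Setting: $-\infty<a<b<\infty$, $\frac12<\alpha\le 1$, $0\le\beta\le 1$, $\gamma=\alpha+\beta(1-\alpha)$; $\psi\in C^1([a,b],\mathbb{R})$ is increasing with $\psi'(t)\ne 0$ for all $t$; $\Psi(t,s)=\psi(t)-\psi(s)$. All vector integrals are Bochner integrals. Fractional integral: $I^{\delta;\psi}_{a+}f(t)=\frac{1}{\Gamma(\delta)}\int_a^t\psi'(s)(\Psi(t,s))^{\delta-1}f(s)\,ds$ for $\delta>0$, and $I^{0;\psi}_{a+}f=f$. The $\psi$-Hilfer derivative is ${}^{H}D^{\alpha,\beta;\psi}_{a+}f=I^{\beta(1-\alpha);\psi}_{a+}\left(\frac{1}{\psi'(t)}\frac{d}{dt}\right)I^{(1-\beta)(1-\alpha);\psi}_{a+}f$ (the systems are understood only through the mild solutions below). Space: $C^{1-\gamma;\psi}([a,b],X)=\{q\in C((a,b],X):(\Psi(t,a))^{1-\gamma}q(t)\in C([a,b],X)\}$ (i.e. $t\mapsto(\Psi(t,a))^{1-\gamma}q(t)$ extends continuously to $[a,b]$). Operators: for $t>0$, $P_\alpha(t)=\int_0^\infty\alpha\theta M_\alpha(\theta)T(t^\alpha\theta)\,d\theta$, where $M_\alpha(\theta)=\sum_{n=1}^\infty\frac{(-\theta)^{n-1}}{(n-1)!\,\Gamma(1-\alpha n)}$ is the Wright (Mainardi) function for $0<\alpha<1$, and $P_1(t)=T(t)$ when $\alpha=1$; $K_\alpha(t)=t^{\alpha-1}P_\alpha(t)$; $S_{\alpha,\beta}(t)=\frac{1}{\Gamma(\gamma-\alpha)}\int_0^t(t-s)^{\gamma-\alpha-1}K_\alpha(s)\,ds$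 (strong integral) if $\gamma>\alpha$, and $S_{\alpha,\beta}(t)=K_\alpha(t)$ if $\gamma=\alpha$. Mild solutions: for $u\in L^2([a,b],Y)$, a mild solution of the inclusion is a $q\in C^{1-\gamma;\psi}([a,b],X)$ for which there is $f\in L^1([a,b],X)$ with $f(t)\in F(t,q(t))$ for a.a. $t\in[a,b]$ and $q(t)=S_{\alpha,\beta}(\Psi(t,a))x_0+\int_a^tK_\alpha(\Psi(t,s))[f(s)+Bu(s)]\psi'(s)\,ds$ for $t\in(a,b]$. The mild solution of the linear system is given by the same formula with $f=0$. Approximate controllability in $[a,b]$ of either system: for every $x_1\in X$ and every $\varepsilon>0$ there are a control $u\in L^2([a,b],Y)$ and a corresponding mild solution $q$ with $\|q(b)-x_1\|<\varepsilon$. Graph measurable: the graph $\{(t,x,z):z\in F(t,x)\}$ belongs to the product of the Lebesgue $\sigma$-algebra of $[a,b]$ and the Borel $\sigma$-algebra of $X\times X$. Lower semicontinuous: $\{x:F(t,x)\cap V\neq\emptyset\}$ is open for every open $V\subset X$. *)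

theory Defs
  imports "HOL-Analysis.Analysis"
begin

section \<open>The Bochner integral without separability\<close>

text \<open>The library's \<open>has_bochner_integral\<close> lives on second countable spaces only.
  The following is the same definition on an arbitrary normed space. Approximation by
  simple functions forces \<open>f\<close> to be almost everywhere separably valued, so this is the
  usual Bochner integral.\<close>

definition has_bochner :: "'s measure \<Rightarrow> ('s \<Rightarrow> 'a::real_normed_vector) \<Rightarrow> 'a \<Rightarrow> bool" where
  "has_bochner M f x \<longleftrightarrow>
     f \<in> borel_measurable M \<and>
     (\<exists>s. (\<forall>i. Bochner_Integration.simple_bochner_integrable M (s i)) \<and>
          ((\<lambda>i. \<integral>\<^sup>+ w. ennreal (norm (f w - s i w)) \<partial>M) \<longlonglongrightarrow> 0) \<and>
          ((\<lambda>i. Bochner_Integration.simple_bochner_integral M (s i)) \<longlonglongrightarrow> x))"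

definition bochner_integrable :: "'s measure \<Rightarrow> ('s \<Rightarrow> 'a::real_normed_vector) \<Rightarrow> bool" where
  "bochner_integrable M f \<longleftrightarrow> (\<exists>x. has_bochner M f x)"

definition bochner_integral :: "'s measure \<Rightarrow> ('s \<Rightarrow> 'a::real_normed_vector) \<Rightarrow> 'a" where
  "bochner_integral M f = (if bochner_integrable M f then THE x. has_bochner M f x else 0)"

lemma has_bochner_iff_library:
  fixes f :: "'s \<Rightarrow> 'a::{real_normed_vector, second_countable_topology}"
  shows "has_bochner M f x \<longleftrightarrow> has_bochner_integral M f x"
  unfolding has_bochner_def has_bochner_integral.simps by blast

lemma bochner_integral_eq_library:
  fixes f :: "'s \<Rightarrow> 'a::{real_normed_vector, second_countable_topology}"
  shows "bochner_integrable M f \<longleftrightarrow> integrable M f"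
    and "bochner_integral M f = integral\<^sup>L M f"
proof -
  have "has_bochner M f = has_bochner_integral M f"
    by (rule ext) (rule has_bochner_iff_library)
  then show "bochner_integrable M f \<longleftrightarrow> integrable M f"
    and "bochner_integral M f = integral\<^sup>L M f"
    by (simp_all add: bochner_integrable_def bochner_integral_def integrable.simps
        lebesgue_integral_def)
qed

lemma borel_measurable_norm_diff_simple:
  fixes f :: "'s \<Rightarrow> 'a::real_normed_vector"
  assumes f: "f \<in> borel_measurable M" and s: "simple_function M s"
  shows "(\<lambda>w. norm (f w - s w)) \<in> borel_measurable M"
proof (rule measurable_compose_countable'[where f = "\<lambda>y w. norm (f w - y)" and I = "s ` space M"])
  show "(\<lambda>w. norm (f w - y)) \<in> borel_measurable M" for y
    by (rule measurable_compose[OF f borel_measurable_continuous_onI]) (intro continuous_intros)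
  show "s \<in> measurable M (count_space (s ` space M))"
    using s by (subst measurable_count_space_eq2) (auto simp: simple_function_def)
  show "countable (s ` space M)"
    using s by (auto simp: simple_function_def intro: countable_finite)
qed

lemma has_bochner_unique:
  fixes f :: "'s \<Rightarrow> 'a::real_normed_vector"
  assumes "has_bochner M f x" and "has_bochner M f y"
  shows "x = y"
proof -
  from assms obtain s t where f: "f \<in> borel_measurable M"
    and s: "\<And>i. Bochner_Integration.simple_bochner_integrable M (s i)"
    and t: "\<And>i. Bochner_Integration.simple_bochner_integrable M (t i)"
    and S: "(\<lambda>i. \<integral>\<^sup>+ w. ennreal (norm (f w - s i w)) \<partial>M) \<longlonglongrightarrow> 0" (is "?S \<longlonglongrightarrow> 0")
    and T: "(\<lambda>i. \<integral>\<^sup>+ w. ennreal (norm (f w - t i w)) \<partial>M) \<longlonglongrightarrow> 0" (is "?T \<longlonglongrightarrow> 0")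
    and x: "(\<lambda>i. Bochner_Integration.simple_bochner_integral M (s i)) \<longlonglongrightarrow> x" (is "?s \<longlonglongrightarrow> x")
    and y: "(\<lambda>i. Bochner_Integration.simple_bochner_integral M (t i)) \<longlonglongrightarrow> y" (is "?t \<longlonglongrightarrow> y")
    unfolding has_bochner_def by blast
  have simple: "simple_function M (s i)" "simple_function M (t i)" for i
    using s t by (auto elim: simple_bochner_integrable.cases)
  have sM: "(\<lambda>w. ennreal (norm (f w - s i w))) \<in> borel_measurable M" for i
    by (rule measurable_compose[OF borel_measurable_norm_diff_simple[OF f simple(1)] measurable_ennreal])
  have tM: "(\<lambda>w. ennreal (norm (f w - t i w))) \<in> borel_measurable M" for i
    by (rule measurable_compose[OF borel_measurable_norm_diff_simple[OF f simple(2)] measurable_ennreal])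
  have le: "ennreal (norm (?s i - ?t i)) \<le> ?S i + ?T i" for i
  proof -
    have "ennreal (norm (?s i - ?t i)) =
        norm (Bochner_Integration.simple_bochner_integral M (\<lambda>w. s i w - t i w))"
      using s t by (subst simple_bochner_integral_diff) auto
    also have "\<dots> \<le> Bochner_Integration.simple_bochner_integral M (\<lambda>w. norm (s i w - t i w))"
      using simple_bochner_integrable_compose2[of "(-)" M "s i" "t i"] s t
      by (auto intro!: simple_bochner_integral_norm_bound)
    also have "\<dots> = (\<integral>\<^sup>+ w. norm (s i w - t i w) \<partial>M)"
      using simple_bochner_integrable_compose2[of "\<lambda>x y. norm (x - y)" M "s i" "t i"] s t
      by (auto intro!: simple_bochner_integral_eq_nn_integral)
    also have "\<dots> \<le> (\<integral>\<^sup>+ w. ennreal (norm (f w - s i w)) + ennreal (norm (f w - t i w)) \<partial>M)"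
    proof (rule nn_integral_mono)
      fix w
      have "norm (s i w - t i w) \<le> norm (f w - s i w) + norm (f w - t i w)"
        using norm_triangle_ineq4[of "f w - t i w" "f w - s i w"] by (simp add: add.commute)
      then show "ennreal (norm (s i w - t i w)) \<le> ennreal (norm (f w - s i w)) + ennreal (norm (f w - t i w))"
        by (simp flip: ennreal_plus)
    qed
    also have "\<dots> = ?S i + ?T i"
      by (rule nn_integral_add[OF sM tM])
    finally show ?thesis .
  qed
  have "(\<lambda>i. ennreal (norm (?s i - ?t i))) \<longlonglongrightarrow> ennreal 0"
    unfolding ennreal_0
  proof (rule tendsto_sandwich[OF _ _ tendsto_const])
    show "(\<lambda>i. ?S i + ?T i) \<longlonglongrightarrow> 0"
      using tendsto_add[OF S T] by simp
  qed (use le in auto)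
  then have "(\<lambda>i. norm (?s i - ?t i)) \<longlonglongrightarrow> 0"
    by (subst (asm) tendsto_ennreal_iff) auto
  then have "(\<lambda>i. ?s i - ?t i) \<longlonglongrightarrow> 0"
    by (rule tendsto_norm_zero_cancel)
  moreover have "(\<lambda>i. ?s i - ?t i) \<longlonglongrightarrow> x - y"
    using x y by (rule tendsto_diff)
  ultimately have "0 = x - y"
    by (rule LIMSEQ_unique)
  then show ?thesis
    by simp
qed

lemma bochner_integral_eqI: "has_bochner M f x \<Longrightarrow> bochner_integral M f = x"
  unfolding bochner_integral_def bochner_integrable_def
  by (auto intro: has_bochner_unique)


section \<open>Banach spaces and operators\<close>

text \<open>The canonical embedding into the bidual is onto.\<close>

definition reflexive_space :: "'a::real_normed_vector itself \<Rightarrow> bool" where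
  "reflexive_space _ \<longleftrightarrow>
     (\<forall>\<phi> :: ('a \<Rightarrow>\<^sub>L real) \<Rightarrow>\<^sub>L real. \<exists>x::'a. \<forall>g. blinfun_apply \<phi> g = blinfun_apply g x)"

text \<open>An unbounded operator is given by its domain \<open>D\<close> and a total function \<open>A\<close>
  whose values outside \<open>D\<close> are irrelevant.\<close>

definition closed_linear_operator ::
  "'a::real_normed_vector set \<Rightarrow> ('a \<Rightarrow> 'a) \<Rightarrow> bool" where
  "closed_linear_operator D A \<longleftrightarrow>
     subspace D \<and>
     (\<forall>x\<in>D. \<forall>y\<in>D. A (x + y) = A x + A y) \<and>
     (\<forall>c. \<forall>x\<in>D. A (c *\<^sub>R x) = c *\<^sub>R A x) \<and>
     closed {(x, A x) |x. x \<in> D}"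

text \<open>Only the values \<open>T t\<close> with \<open>t \<ge> 0\<close> matter.\<close>

definition C0_semigroup :: "(real \<Rightarrow> 'a::real_normed_vector \<Rightarrow>\<^sub>L 'a) \<Rightarrow> bool" where
  "C0_semigroup T \<longleftrightarrow>
     T 0 = id_blinfun \<and>
     (\<forall>s\<ge>0. \<forall>t\<ge>0. T (s + t) = T s o\<^sub>L T t) \<and>
     (\<forall>x. ((\<lambda>t. blinfun_apply (T t) x) \<longlongrightarrow> x) (at_right 0))"

definition generates ::
  "'a::real_normed_vector set \<Rightarrow> ('a \<Rightarrow> 'a) \<Rightarrow> (real \<Rightarrow> 'a \<Rightarrow>\<^sub>L 'a) \<Rightarrow> bool" where
  "generates D A T \<longleftrightarrow>
     D = {x. \<exists>y. ((\<lambda>h. (blinfun_apply (T h) x - x) /\<^sub>R h) \<longlongrightarrow> y) (at_right 0)} \<and>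
     (\<forall>x\<in>D. ((\<lambda>h. (blinfun_apply (T h) x - x) /\<^sub>R h) \<longlongrightarrow> A x) (at_right 0))"

definition compact_operator ::
  "('a::real_normed_vector \<Rightarrow>\<^sub>L 'b::real_normed_vector) \<Rightarrow> bool" where
  "compact_operator L \<longleftrightarrow> (\<forall>S. bounded S \<longrightarrow> compact (closure (blinfun_apply L ` S)))"


section \<open>Fractional integrals and solution operators\<close>

text \<open>Throughout, \<open>\<psi>'\<close> is the derivative of \<open>\<psi>\<close> on \<open>[a,b]\<close>; it is passed as
  a separate argument. Note \<open>0 powr 0 = 0\<close> in this library: the powers below are
  relevant only at positive arguments, zero being attained at most at an end point
  of the range of integration.\<close>

definition hilfer_gamma :: "real \<Rightarrow> real \<Rightarrow> real" where
  "hilfer_gamma \<alpha> \<beta> = \<alpha> + \<beta> * (1 - \<alpha>)"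

definition psi_integral ::
  "(real \<Rightarrow> real) \<Rightarrow> (real \<Rightarrow> real) \<Rightarrow> real \<Rightarrow> real \<Rightarrow> (real \<Rightarrow> 'a::{banach, second_countable_topology}) \<Rightarrow> real \<Rightarrow> 'a" where
  "psi_integral \<psi> \<psi>' a \<delta> f t =
     (if \<delta> = 0 then f t
      else (1 / Gamma \<delta>) *\<^sub>R
        integral\<^sup>L (lebesgue_on {a..t}) (\<lambda>s. (\<psi>' s * (\<psi> t - \<psi> s) powr (\<delta> - 1)) *\<^sub>R f s))"

text \<open>The Wright (Mainardi) function, with the summation index shifted to start at 0.
  \<open>rGamma\<close> is the reciprocal Gamma function, which vanishes at the poles of \<open>Gamma\<close>.\<close>

definition mainardi :: "real \<Rightarrow> real \<Rightarrow> real" where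
  "mainardi \<alpha> \<theta> = (\<Sum>n. (- \<theta>) ^ n / fact n * rGamma (1 - \<alpha> * real (Suc n)))"

text \<open>The operator-valued integrals are taken strongly, that is, after application to
  a vector \<open>x\<close>.\<close>

definition P_op :: "(real \<Rightarrow> 'a::banach \<Rightarrow>\<^sub>L 'a) \<Rightarrow> real \<Rightarrow> real \<Rightarrow> 'a \<Rightarrow> 'a" where
  "P_op T \<alpha> t x =
     (if \<alpha> = 1 then blinfun_apply (T t) x
      else bochner_integral (lebesgue_on {0..}) (\<lambda>\<theta>.
              (\<alpha> * \<theta> * mainardi \<alpha> \<theta>) *\<^sub>R blinfun_apply (T (t powr \<alpha> * \<theta>)) x))"

definition K_op :: "(real \<Rightarrow> 'a::banach \<Rightarrow>\<^sub>L 'a) \<Rightarrow> real \<Rightarrow> real \<Rightarrow> 'a \<Rightarrow> 'a" where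
  "K_op T \<alpha> t x = t powr (\<alpha> - 1) *\<^sub>R P_op T \<alpha> t x"

definition S_op :: "(real \<Rightarrow> 'a::banach \<Rightarrow>\<^sub>L 'a) \<Rightarrow> real \<Rightarrow> real \<Rightarrow> real \<Rightarrow> 'a \<Rightarrow> 'a" where
  "S_op T \<alpha> \<beta> t x =
     (let \<gamma> = hilfer_gamma \<alpha> \<beta> in
      if \<gamma> > \<alpha> then
        (1 / Gamma (\<gamma> - \<alpha>)) *\<^sub>R
          bochner_integral (lebesgue_on {0..t}) (\<lambda>s. (t - s) powr (\<gamma> - \<alpha> - 1) *\<^sub>R K_op T \<alpha> s x)
      else K_op T \<alpha> t x)"


section \<open>Function spaces and mild solutions\<close>

definition L2_functions :: "real \<Rightarrow> real \<Rightarrow> (real \<Rightarrow> 'y::{real_inner, polish_space}) set" where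
  "L2_functions a b =
     {u. u \<in> borel_measurable (lebesgue_on {a..b}) \<and>
         integrable (lebesgue_on {a..b}) (\<lambda>t. (norm (u t))\<^sup>2)}"

text \<open>Elements of this weighted space are functions on \<open>(a,b]\<close>; the value at \<open>a\<close> is
  unconstrained. The limit at \<open>a\<close> says that the weighted function extends continuously
  to \<open>[a,b]\<close>. The argument \<open>\<mu>\<close> is the exponent of the weight.\<close>

definition weighted_C ::
  "(real \<Rightarrow> real) \<Rightarrow> real \<Rightarrow> real \<Rightarrow> real \<Rightarrow> (real \<Rightarrow> 'a::real_normed_vector) set" where
  "weighted_C \<psi> \<mu> a b =
     {q. continuous_on {a<..b} q \<and>
         (\<exists>l. ((\<lambda>t. (\<psi> t - \<psi> a) powr \<mu> *\<^sub>R q t) \<longlongrightarrow> l) (at_right a))}"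

text \<open>The variation-of-constants formula with source \<open>f\<close> and control \<open>u\<close>. Existence of
  the Bochner integral is required explicitly, since \<open>bochner_integral\<close> of a
  non-integrable function is 0.\<close>

definition mild_with_source ::
  "(real \<Rightarrow> real) \<Rightarrow> (real \<Rightarrow> real) \<Rightarrow> real \<Rightarrow> real \<Rightarrow> real \<Rightarrow> real \<Rightarrow>
   (real \<Rightarrow> 'a::banach \<Rightarrow>\<^sub>L 'a) \<Rightarrow> ('y::{real_inner, polish_space} \<Rightarrow>\<^sub>L 'a) \<Rightarrow> 'a \<Rightarrow>
   (real \<Rightarrow> 'a) \<Rightarrow> (real \<Rightarrow> 'y) \<Rightarrow> (real \<Rightarrow> 'a) \<Rightarrow> bool" where
  "mild_with_source \<psi> \<psi>' a b \<alpha> \<beta> T B x0 f u q \<longleftrightarrow>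
     q \<in> weighted_C \<psi> (1 - hilfer_gamma \<alpha> \<beta>) a b \<and>
     (\<forall>t\<in>{a<..b}.
        bochner_integrable (lebesgue_on {a..t})
          (\<lambda>s. \<psi>' s *\<^sub>R K_op T \<alpha> (\<psi> t - \<psi> s) (f s + blinfun_apply B (u s))) \<and>
        q t = S_op T \<alpha> \<beta> (\<psi> t - \<psi> a) x0 +
          bochner_integral (lebesgue_on {a..t}) (\<lambda>s.
             \<psi>' s *\<^sub>R K_op T \<alpha> (\<psi> t - \<psi> s) (f s + blinfun_apply B (u s))))"

definition linear_mild_solution ::
  "(real \<Rightarrow> real) \<Rightarrow> (real \<Rightarrow> real) \<Rightarrow> real \<Rightarrow> real \<Rightarrow> real \<Rightarrow> real \<Rightarrow>
   (real \<Rightarrow> 'a::banach \<Rightarrow>\<^sub>L 'a) \<Rightarrow> ('y::{real_inner, polish_space} \<Rightarrow>\<^sub>L 'a) \<Rightarrow> 'a \<Rightarrow>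
   (real \<Rightarrow> 'y) \<Rightarrow> (real \<Rightarrow> 'a) \<Rightarrow> bool" where
  "linear_mild_solution \<psi> \<psi>' a b \<alpha> \<beta> T B x0 u q \<longleftrightarrow>
     mild_with_source \<psi> \<psi>' a b \<alpha> \<beta> T B x0 (\<lambda>_. 0) u q"

definition inclusion_mild_solution ::
  "(real \<Rightarrow> real) \<Rightarrow> (real \<Rightarrow> real) \<Rightarrow> real \<Rightarrow> real \<Rightarrow> real \<Rightarrow> real \<Rightarrow>
   (real \<Rightarrow> 'a::banach \<Rightarrow>\<^sub>L 'a) \<Rightarrow> ('y::{real_inner, polish_space} \<Rightarrow>\<^sub>L 'a) \<Rightarrow> 'a \<Rightarrow>
   (real \<Rightarrow> 'a \<Rightarrow> 'a set) \<Rightarrow> (real \<Rightarrow> 'y) \<Rightarrow> (real \<Rightarrow> 'a) \<Rightarrow> bool" where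
  "inclusion_mild_solution \<psi> \<psi>' a b \<alpha> \<beta> T B x0 F u q \<longleftrightarrow>
     (\<exists>f. bochner_integrable (lebesgue_on {a..b}) f \<and>
          (AE t in lebesgue_on {a..b}. f t \<in> F t (q t)) \<and>
          mild_with_source \<psi> \<psi>' a b \<alpha> \<beta> T B x0 f u q)"

text \<open>The argument \<open>sol\<close> relates controls to their mild solutions.\<close>

definition approximately_controllable ::
  "real \<Rightarrow> real \<Rightarrow>
   ((real \<Rightarrow> 'y::{real_inner, polish_space}) \<Rightarrow> (real \<Rightarrow> 'a::real_normed_vector) \<Rightarrow> bool) \<Rightarrow>
   bool" where
  "approximately_controllable a b sol \<longleftrightarrow>
     (\<forall>x1. \<forall>\<epsilon>>0. \<exists>u\<in>L2_functions a b. \<exists>q. sol u q \<and> norm (q b - x1) < \<epsilon>)"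


section \<open>Multivalued maps\<close>

definition graph_measurable ::
  "real \<Rightarrow> real \<Rightarrow> (real \<Rightarrow> 'a::topological_space \<Rightarrow> 'a set) \<Rightarrow> bool" where
  "graph_measurable a b F \<longleftrightarrow>
     {(t, x, z). t \<in> {a..b} \<and> z \<in> F t x}
       \<in> sets (lebesgue_on {a..b} \<Otimes>\<^sub>M (borel :: ('a \<times> 'a) measure))"

definition lower_semicontinuous ::
  "('a::topological_space \<Rightarrow> 'b::topological_space set) \<Rightarrow> bool" where
  "lower_semicontinuous G \<longleftrightarrow> (\<forall>V. open V \<longrightarrow> open {x. G x \<inter> V \<noteq> {}})"

end

theory Submission
  imports Defs "HOL-Complex_Analysis.Complex_Analysis"
begin

text \<open>
  Write \<open>L g\<close> for the integral of \<open>K\<^sub>\<alpha> (\<Psi>(b,s)) g(s) \<psi>'(s)\<close> over \<open>[a,b]\<close>. Every mild solution ends at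
  \<open>q(b) = S\<^sub>\<alpha>\<^sub>\<beta> (\<Psi>(b,a)) x\<^sub>0 + L f + L (B u)\<close>, so approximate controllability of the linear system says
  that the vectors \<open>L (B u)\<close> are dense. The selections \<open>f\<close> that can occur are all dominated
  by \<open>m\<close>, and \<open>L\<close> maps the functions dominated by \<open>m\<close> into a relatively compact set, because
  \<open>K\<^sub>\<alpha> \<tau>\<close> is a compact operator depending continuously on \<open>\<tau> > 0\<close> in norm, and its singularity
  \<open>\<tau> powr (\<alpha> - 1)\<close> is uniformly integrable against \<open>m\<close>. Hence the
  vectors \<open>x\<^sub>1 - S\<^sub>\<alpha>\<^sub>\<beta> (\<Psi>(b,a)) x\<^sub>0 - L f\<close>, which the control still has to supply, lie in one
  compact set; finitely many controls come close to all of them, and a partition of unity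
  combines these into a control \<open>u(f)\<close> that depends continuously on \<open>f\<close> and brings \<open>q(b)\<close> within
  \<open>\<epsilon>\<close> of \<open>x\<^sub>1\<close> whatever \<open>f\<close> turns out to be (\<open>control_net\<close>).

  It remains to solve the inclusion with this feedback. Michael's construction, carried out in
  the mean instead of pointwise, yields selections \<open>f(q)\<close> of \<open>t \<mapsto> F(t, q(t))\<close> that depend
  continuously on the path \<open>q\<close> in \<open>L\<^sup>1\<close> (\<open>continuous_selection_in_mean\<close>); convex closed values and
  lower semicontinuity are what it needs, together with measurability of the distance from a
  point to \<open>F(t, q(t))\<close>, which follows from measurability of the graph by projection
  (\<open>measurable_projection\<close>). The paths produced from dominated sources form a relatively compact
  set of continuous functions whose closure is convex (\<open>volterra_paths_compact_convex\<close>), and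
  Schauder's theorem (\<open>Schauder_fixed_point\<close>) gives a path that equals the one produced by its
  own selection and its own control. This is \<open>inclusion_approximately_controllable\<close>.

  Two preparations are needed. The average over the Mainardi function that defines \<open>P\<^sub>\<alpha>\<close> can be
  estimated once this function is known to decay faster than \<open>T\<close> can grow. Its decay at every exponential
  rate (\<open>mainardi_exponential_decay\<close>) comes from its contour integral; compactness and norm
  continuity of \<open>K\<^sub>\<alpha>\<close> are then inherited from \<open>T\<close> (\<open>K_op_compact_family\<close>). Secondly, a space
  carrying a semigroup of compact operators is separable (\<open>compact_semigroup_separable\<close>), so
  the argument may be run in an isometric copy with a countable base, where Bochner
  integrals are the usual integrals of second countable Banach spaces.
\<close>

section \<open>Decay of the Mainardi function\<close>

text \<open>With \<open>\<sigma> = exp z\<close> this is the integrand \<open>exp (\<sigma> - \<theta> \<sigma>\<^sup>\<alpha>) \<sigma>\<^sup>\<alpha>\<^sup>-\<^sup>1 d\<sigma>\<close> of the Hankel contour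
  integral for the Mainardi function. In the logarithmic variable \<open>z\<close> there is no branch cut: the function
  is entire and has a primitive, so that moving a contour amounts to comparing values of the
  primitive.\<close>

definition wright_integrand :: "real \<Rightarrow> real \<Rightarrow> complex \<Rightarrow> complex" where
  "wright_integrand \<alpha> \<theta> z = exp (exp z - of_real \<theta> * exp (of_real \<alpha> * z) + of_real \<alpha> * z)"

lemma norm_wright_integrand:
  "norm (wright_integrand \<alpha> \<theta> (Complex x y)) =
     exp (exp x * cos y - \<theta> * (exp (\<alpha> * x) * cos (\<alpha> * y)) + \<alpha> * x)"
  by (simp add: wright_integrand_def Re_exp)

lemma wright_primitive:
  obtains \<Phi> where "\<And>z. (\<Phi> has_field_derivative wright_integrand \<alpha> \<theta> z) (at z)"
proof -
  have "wright_integrand \<alpha> \<theta> holomorphic_on UNIV"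
    unfolding wright_integrand_def by (intro holomorphic_intros)
  from holomorphic_convex_primitive'[OF convex_UNIV open_UNIV this]
  show ?thesis using that by auto
qed

lemma reflected_rGamma:
  fixes w :: real
  assumes "w > 0"
  shows "rGamma (1 - w) = Gamma w * sin (pi * w) / pi"
proof -
  have 1: "1 - complex_of_real w = complex_of_real (1 - w)" by simp
  have 2: "sin (of_real pi * complex_of_real w) = of_real (sin (pi * w))"
    by (simp only: sin_of_real[symmetric] of_real_mult)
  have "complex_of_real (rGamma w * rGamma (1 - w)) = complex_of_real (sin (pi * w) / pi)"
    using rGamma_reflection_complex[of "of_real w"]
    unfolding 1 2 rGamma_complex_of_real by (simp only: of_real_mult of_real_divide)
  then have "rGamma w * rGamma (1 - w) = sin (pi * w) / pi"
    by (simp only: of_real_eq_iff)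
  moreover have "Gamma w > 0" using assms by (rule Gamma_real_pos)
  ultimately show ?thesis
    by (simp add: Gamma_def field_simps)
qed

text \<open>As \<open>\<alpha> < 1\<close>, the factor \<open>exp (- t)\<close> absorbs \<open>exp (\<theta> t\<^sup>\<alpha>)\<close> with room to spare. This supplies the
  majorant for integrating the exponential series term by term.\<close>

lemma linear_dominates_power:
  fixes \<alpha> \<theta> :: real
  assumes "0 < \<alpha>" "\<alpha> < 1" "0 \<le> \<theta>"
  obtains C where "\<And>t. t \<ge> 0 \<Longrightarrow> \<theta> * t powr \<alpha> \<le> t / 2 + C"
proof -
  \<comment> \<open>beyond \<open>R\<close> the factor \<open>t powr (1 - \<alpha>)\<close> exceeds \<open>2 \<theta>\<close>\<close>
  define R where "R = (2 * \<theta> + 1) powr (1 / (1 - \<alpha>))"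
  have R: "R > 0" unfolding R_def using assms by simp
  show ?thesis
  proof (rule that[of "\<theta> * R powr \<alpha>"])
    fix t :: real assume t: "t \<ge> 0"
    show "\<theta> * t powr \<alpha> \<le> t / 2 + \<theta> * R powr \<alpha>"
    proof (cases "t \<le> R")
      case True
      then have "\<theta> * t powr \<alpha> \<le> \<theta> * R powr \<alpha>"
        using assms t by (intro mult_left_mono powr_mono2) auto
      then show ?thesis using t by simp
    next
      case False
      then have tp: "t > R" "t > 0" using R by auto
      have "2 * \<theta> + 1 = R powr (1 - \<alpha>)"
        unfolding R_def using assms by (simp add: powr_powr)
      also have "\<dots> \<le> t powr (1 - \<alpha>)"
        using tp R assms by (intro powr_mono2) auto
      finally have "2 * \<theta> \<le> t powr (1 - \<alpha>)" by simp
      then have "2 * \<theta> * t powr \<alpha> \<le> t powr (1 - \<alpha>) * t powr \<alpha>"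
        by (intro mult_right_mono) auto
      also have "\<dots> = t" using tp by (simp flip: powr_add)
      finally have "\<theta> * t powr \<alpha> \<le> t / 2" by simp
      moreover have "0 \<le> \<theta> * R powr \<alpha>" using assms by simp
      ultimately show ?thesis by linarith
    qed
  qed
qed

lemma set_integrable_Gamma_kernel:
  fixes w c :: real
  assumes "w > 0" "c > 0"
  shows "set_integrable lborel {0<..} (\<lambda>t. t powr (w - 1) * exp (- (c * t)))"
proof -
  have "(\<lambda>t. complex_of_real t powr (of_real w - 1) / of_real (exp (c * t))) absolutely_integrable_on {0<..}"
    using absolutely_integrable_Gamma_integral[of "of_real w" c] assms by simp
  from set_integrable_norm[OF this]
  have "(\<lambda>t. t powr (w - 1) * exp (- (c * t))) absolutely_integrable_on {0<..}"
    by (rule set_integrable_cong[THEN iffD1, rotated -1])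
       (auto simp: norm_divide norm_powr_real_powr exp_minus field_simps)
  then show ?thesis
    unfolding set_integrable_def
    by (rule integrable_completion[THEN iffD1, rotated])
       (auto intro!: borel_measurable_continuous_on_indicator continuous_intros)
qed

lemma Gamma_set_lebesgue_integral:
  fixes w :: real
  assumes "w > 0"
  shows "(LINT t:{0<..}|lborel. t powr (w - 1) * exp (- t)) = Gamma w"
proof -
  have i: "set_integrable lborel {0<..} (\<lambda>t. t powr (w - 1) * exp (- t))"
    using set_integrable_Gamma_kernel[OF assms, of 1] by simp
  have "((\<lambda>t. t powr (w - 1) / exp t) has_integral Gamma w) {0..}"
    using Gamma_integral_real[OF assms] .
  then have "((\<lambda>t. t powr (w - 1) * exp (- t)) has_integral Gamma w) {0..}"
    by (simp add: exp_minus field_simps)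
  then have "((\<lambda>t. t powr (w - 1) * exp (- t)) has_integral Gamma w) {0<..}"
    by (rule has_integral_spike_set_eq[THEN iffD1, rotated -1])
       (auto intro: negligible_subset[of "{0}"])
  then show ?thesis
    using set_borel_integral_eq_integral(2)[OF i] by (simp add: integral_unique)
qed

text \<open>The form \<open>wright_integrand dz\<close> on the line \<open>Im z = \<pi>\<close>, in the variable \<open>t = exp (Re z)\<close>: the upper
  edge of the cut along the negative half axis of \<open>\<sigma>\<close>.\<close>

definition wright_ray :: "real \<Rightarrow> real \<Rightarrow> real \<Rightarrow> complex" where
  "wright_ray \<alpha> \<theta> t = wright_integrand \<alpha> \<theta> (Complex (ln t) pi) / of_real t"

lemma wright_ray_eq:
  assumes "t > 0"
  shows "wright_ray \<alpha> \<theta> t =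
    of_real (t powr (\<alpha> - 1) * exp (- t)) * cis (\<alpha> * pi) * exp (of_real (- \<theta> * t powr \<alpha>) * cis (\<alpha> * pi))"
proof -
  have z: "Complex (ln t) pi = of_real (ln t) + \<i> * of_real pi"
    by (simp add: complex_eq_iff)
  have 1: "exp (Complex (ln t) pi) = - of_real t"
    using assms by (simp add: z exp_add flip: exp_of_real) (simp add: exp_of_real)
  have 2: "exp (of_real \<alpha> * Complex (ln t) pi) = of_real (t powr \<alpha>) * cis (\<alpha> * pi)"
    using assms
    by (simp add: z powr_def cis_conv_exp ring_distribs exp_add mult_ac flip: exp_of_real)
  have 3: "t powr (\<alpha> - 1) = t powr \<alpha> / t"
    using assms by (simp add: powr_diff)
  show ?thesis
    unfolding wright_ray_def wright_integrand_def exp_add exp_diff 1 2 3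
    using assms by (simp add: exp_minus exp_of_real field_simps)
qed

text \<open>By the reflection formula the coefficients of the Mainardi series are Gamma values times sines.
  The sines are the imaginary parts of the powers of \<open>cis (\<alpha> \<pi>)\<close> that occur when
  the second exponential is expanded on the edge of the cut.\<close>

lemma wright_ray_series:
  assumes "t > 0"
  shows "(\<lambda>n. (- \<theta>) ^ n / fact n * (t powr (\<alpha> * real (Suc n) - 1) * exp (- t)) * sin (pi * (\<alpha> * real (Suc n))))
           sums Im (wright_ray \<alpha> \<theta> t)"
proof -
  let ?c = "of_real (t powr (\<alpha> - 1) * exp (- t)) * cis (\<alpha> * pi)"
  let ?x = "of_real (- \<theta> * t powr \<alpha>) * cis (\<alpha> * pi)"
  have "(\<lambda>n. ?c * (?x ^ n /\<^sub>R fact n)) sums (?c * exp ?x)"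
    by (intro sums_mult exp_converges)
  then have "(\<lambda>n. Im (?c * (?x ^ n /\<^sub>R fact n))) sums Im (wright_ray \<alpha> \<theta> t)"
    unfolding wright_ray_eq[OF assms] by (rule sums_Im)
  moreover have "Im (?c * (?x ^ n /\<^sub>R fact n)) =
      (- \<theta>) ^ n / fact n * (t powr (\<alpha> * real (Suc n) - 1) * exp (- t)) * sin (pi * (\<alpha> * real (Suc n)))" for n
  proof -
    have "?c * (?x ^ n /\<^sub>R fact n) =
      of_real ((- \<theta>) ^ n / fact n * (t powr (\<alpha> - 1) * (t powr \<alpha>) ^ n * exp (- t))) * (cis (\<alpha> * pi)) ^ Suc n"
      by (simp add: power_mult_distrib scaleR_conv_of_real field_simps power_minus[of "_ * _"] power_minus[of "of_real \<theta>"])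
    also have "(t powr \<alpha>) ^ n = t powr (\<alpha> * n)"
      using assms by (simp add: powr_powr flip: powr_realpow)
    also have "t powr (\<alpha> - 1) * t powr (\<alpha> * n) = t powr (\<alpha> * real (Suc n) - 1)"
      by (simp add: algebra_simps flip: powr_add)
    also have "cis (\<alpha> * pi) ^ Suc n = cis (pi * (\<alpha> * real (Suc n)))"
      by (simp only: Complex.DeMoivre mult_ac)
    finally have e: "?c * (?x ^ n /\<^sub>R fact n) = of_real ((- \<theta>) ^ n / fact n * (t powr (\<alpha> * real (Suc n) - 1) * exp (- t))) * cis (pi * (\<alpha> * real (Suc n)))" .
    have im: "Im (of_real r * cis x) = r * sin x" for r x by simp
    show ?thesis unfolding e im ..
  qed
  ultimately show ?thesis by simp
qed

text \<open>Integrating the previous series termwise turns each power of \<open>t\<close> into a Gamma value, and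
  the reflection formula turns that into a term of the Mainardi series.\<close>

lemma mainardi_integral_representation:
  assumes "0 < \<alpha>" "\<alpha> < 1" "0 \<le> \<theta>"
  shows "set_integrable lborel {0<..} (\<lambda>t. Im (wright_ray \<alpha> \<theta> t))" (is ?int)
    and "(\<lambda>n. (- \<theta>) ^ n / fact n * rGamma (1 - \<alpha> * real (Suc n))) sums
           ((LINT t:{0<..}|lborel. Im (wright_ray \<alpha> \<theta> t)) / pi)" (is ?sums)
    and "set_integrable lborel {0<..} (wright_ray \<alpha> \<theta>)" (is ?cint)
proof -
  from linear_dominates_power[OF assms] obtain C where C: "\<And>t. t \<ge> 0 \<Longrightarrow> \<theta> * t powr \<alpha> \<le> t / 2 + C"
    by blast
  define T where "T n t = (- \<theta>) ^ n / fact n * (t powr (\<alpha> * real (Suc n) - 1) * exp (- t)) * sin (pi * (\<alpha> * real (Suc n)))" for n t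
  define w where "w t = exp C * (t powr (\<alpha> - 1) * exp (- (1/2 * t)))" for t :: real
  have wint: "set_integrable lborel {0<..} w"
    unfolding w_def using assms by (intro set_integrable_mult_right set_integrable_Gamma_kernel) auto
  have Tint: "set_integrable lborel {0<..} (T n)" for n
  proof -
    have "set_integrable lborel {0<..} (\<lambda>t. t powr (\<alpha> * real (Suc n) - 1) * exp (- (1 * t)))"
      using assms by (intro set_integrable_Gamma_kernel) auto
    then have "set_integrable lborel {0<..} (\<lambda>t. ((- \<theta>) ^ n / fact n * sin (pi * (\<alpha> * real (Suc n)))) *
        (t powr (\<alpha> * real (Suc n) - 1) * exp (- (1 * t))))"
      by (intro set_integrable_mult_right)
    then show ?thesis unfolding T_def by (simp add: mult_ac)
  qed
  have Tval: "(LINT t:{0<..}|lborel. T n t) = pi * ((- \<theta>) ^ n / fact n * rGamma (1 - \<alpha> * real (Suc n)))" for n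
  proof -
    have "(LINT t:{0<..}|lborel. T n t) = (LINT t:{0<..}|lborel. ((- \<theta>) ^ n / fact n * sin (pi * (\<alpha> * real (Suc n)))) *
        (t powr (\<alpha> * real (Suc n) - 1) * exp (- t)))"
      unfolding T_def by (simp add: mult_ac)
    also have "\<dots> = ((- \<theta>) ^ n / fact n * sin (pi * (\<alpha> * real (Suc n)))) * Gamma (\<alpha> * real (Suc n))"
      using assms by (subst set_integral_mult_right) (subst Gamma_set_lebesgue_integral, auto)
    also have "\<dots> = pi * ((- \<theta>) ^ n / fact n * rGamma (1 - \<alpha> * real (Suc n)))"
      using assms by (subst reflected_rGamma) (auto simp del: of_nat_Suc)
    finally show ?thesis .
  qed
  have psum: "(LINT t:{0<..}|lborel. (\<Sum>n<N. T n t)) = (\<Sum>n<N. (LINT t:{0<..}|lborel. T n t))" for N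
    using Tint unfolding set_lebesgue_integral_def set_integrable_def
    unfolding scaleR_sum_right by (intro Bochner_Integration.integral_sum) auto
  have kernel_le: "t powr (\<alpha> - 1) * exp (- t) * exp (\<theta> * t powr \<alpha>) \<le> w t" if "t > 0" for t
  proof -
    have "exp (- t) * exp (\<theta> * t powr \<alpha>) \<le> exp C * exp (- (1/2 * t))"
      using C[of t] that by (simp flip: exp_add)
    then have "t powr (\<alpha> - 1) * (exp (- t) * exp (\<theta> * t powr \<alpha>)) \<le> t powr (\<alpha> - 1) * (exp C * exp (- (1/2 * t)))"
      by (intro mult_left_mono) auto
    then show ?thesis by (simp add: w_def mult_ac)
  qed
  have bound: "norm (\<Sum>n<N. T n t) \<le> w t" if t: "t > 0" for N t
  proof -
    have "norm (\<Sum>n<N. T n t) \<le> (\<Sum>n<N. t powr (\<alpha> - 1) * exp (- t) * ((\<theta> * t powr \<alpha>) ^ n /\<^sub>R fact n))"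
    proof (rule sum_norm_le)
      fix n
      have e: "t powr (\<alpha> * real (Suc n) - 1) = t powr (\<alpha> - 1) * (t powr \<alpha>) ^ n"
        using t by (simp add: powr_powr algebra_simps flip: powr_realpow powr_add)
      have "norm (T n t) = \<theta> ^ n / fact n * (t powr (\<alpha> * real (Suc n) - 1) * exp (- t)) * \<bar>sin (pi * (\<alpha> * real (Suc n)))\<bar>"
        using assms unfolding T_def real_norm_def abs_mult by (simp add: power_abs)
      also have "\<dots> \<le> \<theta> ^ n / fact n * (t powr (\<alpha> * real (Suc n) - 1) * exp (- t)) * 1"
        using assms by (intro mult_left_mono) auto
      also have "\<dots> = t powr (\<alpha> - 1) * exp (- t) * ((\<theta> * t powr \<alpha>) ^ n /\<^sub>R fact n)"
        unfolding e by (simp add: power_mult_distrib field_simps)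
      finally show "norm (T n t) \<le> t powr (\<alpha> - 1) * exp (- t) * ((\<theta> * t powr \<alpha>) ^ n /\<^sub>R fact n)" .
    qed
    also have "\<dots> = t powr (\<alpha> - 1) * exp (- t) * (\<Sum>n<N. (\<theta> * t powr \<alpha>) ^ n /\<^sub>R fact n)"
      by (simp only: sum_distrib_left)
    also have "\<dots> \<le> t powr (\<alpha> - 1) * exp (- t) * exp (\<theta> * t powr \<alpha>)"
    proof (intro mult_left_mono)
      show "(\<Sum>n<N. (\<theta> * t powr \<alpha>) ^ n /\<^sub>R fact n) \<le> exp (\<theta> * t powr \<alpha>)"
        unfolding exp_def using assms by (intro sum_le_suminf summable_exp_generic) auto
    qed auto
    also have "\<dots> \<le> w t" by (rule kernel_le[OF t])
    finally show ?thesis .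
  qed
  have lim: "(\<lambda>N. \<Sum>n<N. T n t) \<longlonglongrightarrow> Im (wright_ray \<alpha> \<theta> t)" if "t > 0" for t
    using wright_ray_series[OF that] unfolding T_def sums_def .
  have meas: "set_borel_measurable lborel {0<..} (wright_ray \<alpha> \<theta>)"
  proof -
    have "continuous_on {0<..} (wright_ray \<alpha> \<theta>)"
      unfolding wright_ray_def wright_integrand_def Complex_eq by (intro continuous_intros) auto
    then show ?thesis
      unfolding set_borel_measurable_def by (auto intro!: borel_measurable_continuous_on_indicator)
  qed
  show ?cint
  proof (rule set_integrable_bound[OF wint meas])
    have "norm (wright_ray \<alpha> \<theta> t) \<le> norm (w t)" if t: "t > 0" for t
    proof -
      have "norm (wright_ray \<alpha> \<theta> t) = t powr (\<alpha> - 1) * exp (- t) * exp (- \<theta> * t powr \<alpha> * cos (\<alpha> * pi))"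
        unfolding wright_ray_eq[OF t] by (simp add: norm_mult)
      also have "\<dots> \<le> t powr (\<alpha> - 1) * exp (- t) * exp (\<theta> * t powr \<alpha>)"
      proof -
        have "(\<theta> * t powr \<alpha>) * - cos (\<alpha> * pi) \<le> (\<theta> * t powr \<alpha>) * 1"
          using assms by (intro mult_left_mono) (auto simp: minus_le_iff)
        then show ?thesis by (intro mult_left_mono) auto
      qed
      also have "\<dots> \<le> w t" by (rule kernel_le[OF t])
      finally show ?thesis by simp
    qed
    then show "AE x in lborel. x \<in> {0<..} \<longrightarrow> norm (wright_ray \<alpha> \<theta> x) \<le> norm (w x)" by auto
  qed
  then show ?int
    unfolding set_integrable_def
    by (drule_tac integrable_Im) simp
  have "(\<lambda>N. LINT t|lborel. indicator {0<..} t *\<^sub>R (\<Sum>n<N. T n t)) \<longlonglongrightarrow>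
      (LINT t|lborel. indicator {0<..} t *\<^sub>R Im (wright_ray \<alpha> \<theta> t))"
  proof (rule integral_dominated_convergence[where w = "\<lambda>t. indicator {0<..} t *\<^sub>R w t"])
    show "(\<lambda>t. indicator {0<..} t *\<^sub>R Im (wright_ray \<alpha> \<theta> t)) \<in> borel_measurable lborel"
      using \<open>?int\<close> unfolding set_integrable_def by (rule borel_measurable_integrable)
    show "(\<lambda>t. indicator {0<..} t *\<^sub>R (\<Sum>n<N. T n t)) \<in> borel_measurable lborel" for N
      using Tint unfolding set_integrable_def scaleR_sum_right
      by (intro borel_measurable_sum borel_measurable_integrable)
    show "integrable lborel (\<lambda>t. indicator {0<..} t *\<^sub>R w t)"
      using wint unfolding set_integrable_def .
    show "AE x in lborel. (\<lambda>N. indicator {0<..} x *\<^sub>R (\<Sum>n<N. T n x)) \<longlonglongrightarrow> indicator {0<..} x *\<^sub>R Im (wright_ray \<alpha> \<theta> x)"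
      using lim by (auto intro!: AE_I2 simp: indicator_def)
    show "AE x in lborel. norm (indicator {0<..} x *\<^sub>R (\<Sum>n<N. T n x)) \<le> indicator {0<..} x *\<^sub>R w x" for N
      using bound by (auto intro!: AE_I2 simp: indicator_def)
  qed
  then have "(\<lambda>n. LINT t:{0<..}|lborel. T n t) sums (LINT t:{0<..}|lborel. Im (wright_ray \<alpha> \<theta> t))"
    unfolding sums_def psum[symmetric] unfolding set_lebesgue_integral_def .
  then have "(\<lambda>n. (pi * ((- \<theta>) ^ n / fact n * rGamma (1 - \<alpha> * real (Suc n)))) / pi) sums
      ((LINT t:{0<..}|lborel. Im (wright_ray \<alpha> \<theta> t)) / pi)"
    unfolding Tval by (rule sums_divide)
  then show ?sums by simp
qed

lemma mainardi_continuous: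
  assumes "0 < \<alpha>" "\<alpha> < 1"
  shows "continuous_on UNIV (mainardi \<alpha>)"
proof -
  define c where "c n = rGamma (1 - \<alpha> * real (Suc n)) / fact n" for n
  have "summable (\<lambda>n. c n * x ^ n)" for x
  proof (rule powser_inside)
    show "summable (\<lambda>n. c n * (- (\<bar>x\<bar> + 1)) ^ n)"
      using sums_summable[OF mainardi_integral_representation(2)[OF assms, of "\<bar>x\<bar> + 1"]]
      by (simp add: c_def mult_ac)
  qed auto
  then have "isCont (\<lambda>x. \<Sum>n. c n * x ^ n) x" for x
    by (rule isCont_powser_converges_everywhere)
  then have "continuous_on UNIV (\<lambda>x. \<Sum>n. c n * x ^ n)"
    by (simp add: continuous_at_imp_continuous_on)
  then have "continuous_on UNIV (\<lambda>x. \<Sum>n. c n * (- x) ^ n)"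
    by (rule continuous_on_compose2[where f = uminus]) (auto intro: continuous_intros)
  then show ?thesis
    unfolding mainardi_def c_def by (simp add: mult_ac cong: continuous_on_cong)
qed

text \<open>The integral over the edge of the cut, expressed through a primitive. Only
  differences of a primitive occur from here on, so the path may be chosen freely.\<close>

lemma mainardi_eq_limit:
  assumes "0 < \<alpha>" "\<alpha> < 1" "0 \<le> \<theta>"
    and \<Phi>: "\<And>z. (\<Phi> has_field_derivative wright_integrand \<alpha> \<theta> z) (at z)"
  shows "(\<lambda>N. Im (\<Phi> (Complex (real N) pi) - \<Phi> (Complex (- real N) pi))) \<longlonglongrightarrow> pi * mainardi \<alpha> \<theta>"
proof -
  note A = mainardi_integral_representation[OF assms(1-3)]
  let ?S = "\<lambda>N. {exp (- real N)..exp (real N)}"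
  have val: "(LINT t:?S N|lborel. wright_ray \<alpha> \<theta> t) = \<Phi> (Complex (real N) pi) - \<Phi> (Complex (- real N) pi)" for N
  proof -
    have sub: "?S N \<subseteq> {0<..}" by (auto intro: less_le_trans[OF exp_gt_zero])
    have i: "set_integrable lborel (?S N) (wright_ray \<alpha> \<theta>)"
      by (rule set_integrable_subset[OF A(3) _ sub]) auto
    have "(wright_ray \<alpha> \<theta> has_integral
        \<Phi> (Complex (ln (exp (real N))) pi) - \<Phi> (Complex (ln (exp (- real N))) pi)) (?S N)"
    proof (rule fundamental_theorem_of_calculus)
      fix t assume t: "t \<in> ?S N"
      then have t0: "t > 0" using sub by auto
      have "((\<lambda>t. of_real (ln t) + \<i> * of_real pi) has_vector_derivative of_real (1 / t)) (at t within ?S N)"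
        using t0 by (auto intro!: derivative_eq_intros)
      then have "((\<Phi> \<circ> (\<lambda>t. of_real (ln t) + \<i> * of_real pi)) has_vector_derivative
          of_real (1 / t) * wright_integrand \<alpha> \<theta> (of_real (ln t) + \<i> * of_real pi)) (at t within ?S N)"
        by (rule field_vector_diff_chain_within)
          (rule has_field_derivative_at_within[OF \<Phi>])
      then show "((\<lambda>t. \<Phi> (Complex (ln t) pi)) has_vector_derivative wright_ray \<alpha> \<theta> t) (at t within ?S N)"
        by (simp add: o_def Complex_eq wright_ray_def mult_ac)
    qed simp
    then have "integral (?S N) (wright_ray \<alpha> \<theta>) = \<Phi> (Complex (real N) pi) - \<Phi> (Complex (- real N) pi)"
      by (simp add: integral_unique)
    then show ?thesis using set_borel_integral_eq_integral(2)[OF i] by simp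
  qed
  have un: "(\<Union>N. ?S N) = {0<..}"
  proof (safe)
    fix t N assume "t \<in> ?S N" then show "0 < t" by (auto intro: less_le_trans[OF exp_gt_zero])
  next
    fix t :: real assume t: "0 < t"
    obtain N where "\<bar>ln t\<bar> \<le> real N" using real_arch_simple by blast
    then have "- real N \<le> ln t" "ln t \<le> real N" by auto
    then have "exp (- real N) \<le> exp (ln t)" "exp (ln t) \<le> exp (real N)" by simp_all
    then have "t \<in> ?S N" using t by simp
    then show "t \<in> (\<Union>N. ?S N)" by blast
  qed
  have "(\<lambda>N. LINT t:?S N|lborel. wright_ray \<alpha> \<theta> t) \<longlonglongrightarrow> (LINT t:(\<Union>N. ?S N)|lborel. wright_ray \<alpha> \<theta> t)"
  proof (rule set_integral_cont_up)
    show "incseq ?S"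
      unfolding incseq_def by (auto intro: order_trans[rotated])
    show "set_integrable lborel (\<Union>N. ?S N) (wright_ray \<alpha> \<theta>)" unfolding un by (rule A(3))
  qed auto
  then have "(\<lambda>N. Im (LINT t:?S N|lborel. wright_ray \<alpha> \<theta> t)) \<longlonglongrightarrow> Im (LINT t:{0<..}|lborel. wright_ray \<alpha> \<theta> t)"
    unfolding un by (rule tendsto_Im)
  moreover have "Im (LINT t:{0<..}|lborel. wright_ray \<alpha> \<theta> t) = pi * mainardi \<alpha> \<theta>"
  proof -
    have "Im (LINT t:{0<..}|lborel. wright_ray \<alpha> \<theta> t) = (LINT t:{0<..}|lborel. Im (wright_ray \<alpha> \<theta> t))"
      using A(3) unfolding set_lebesgue_integral_def set_integrable_def
      by (subst integral_Im[symmetric]) auto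
    then show ?thesis using sums_unique[OF A(2)] unfolding mainardi_def by (simp add: field_simps)
  qed
  ultimately show ?thesis unfolding val by simp
qed

lemma primitive_vertical_bound:
  assumes \<Phi>: "\<And>z. (\<Phi> has_field_derivative wright_integrand \<alpha> \<theta> z) (at z)"
    and B: "\<And>y. y \<in> {c..d} \<Longrightarrow> norm (wright_integrand \<alpha> \<theta> (Complex x y)) \<le> B" and "c \<le> d"
  shows "norm (\<Phi> (Complex x d) - \<Phi> (Complex x c)) \<le> B * (d - c)"
proof -
  have "norm (\<Phi> (Complex x d) - \<Phi> (Complex x c)) \<le> B * norm (Complex x d - Complex x c)"
  proof (rule field_differentiable_bound[where S = "closed_segment (Complex x c) (Complex x d)"])
    fix z assume "z \<in> closed_segment (Complex x c) (Complex x d)"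
    then obtain u where u: "0 \<le> u" "u \<le> 1" "z = (1 - u) *\<^sub>R Complex x c + u *\<^sub>R Complex x d"
      by (auto simp: closed_segment_def)
    then have z: "z = Complex x (c + u * (d - c))"
      by (simp add: complex_eq_iff algebra_simps)
    have "u * (d - c) \<le> 1 * (d - c)" using u assms(3) by (intro mult_right_mono) auto
    then show "norm (wright_integrand \<alpha> \<theta> z) \<le> B"
      unfolding z using u assms(3) by (intro B) auto
  qed (auto intro: has_field_derivative_at_within[OF \<Phi>])
  also have "norm (Complex x d - Complex x c) = d - c"
    using assms(3) by (simp add: cmod_def)
  finally show ?thesis .
qed

lemma primitive_left_edge:
  assumes "0 < \<alpha>" "0 \<le> \<theta>"
    and \<Phi>: "\<And>z. (\<Phi> has_field_derivative wright_integrand \<alpha> \<theta> z) (at z)"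
  shows "(\<lambda>N. \<Phi> (Complex (- real N) pi) - \<Phi> (Complex (- real N) 0)) \<longlonglongrightarrow> 0"
proof (rule Lim_null_comparison)
  show "eventually (\<lambda>N. norm (\<Phi> (Complex (- real N) pi) - \<Phi> (Complex (- real N) 0)) \<le>
      exp (1 + \<theta> - \<alpha> * real N) * (pi - 0)) sequentially"
  proof (intro always_eventually allI primitive_vertical_bound[OF \<Phi>])
    fix N y
    have "exp (- real N) * cos y \<le> exp (- real N) * 1" by (intro mult_left_mono) auto
    also have "\<dots> \<le> 1" by simp
    finally have 1: "exp (- real N) * cos y \<le> 1" .
    have "exp (\<alpha> * - real N) * - cos (\<alpha> * y) \<le> exp (\<alpha> * - real N) * 1"
      by (intro mult_left_mono) (auto simp: minus_le_iff)
    moreover have "exp (\<alpha> * - real N) \<le> 1" using assms by simp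
    ultimately have "exp (\<alpha> * - real N) * - cos (\<alpha> * y) \<le> 1" by linarith
    then have "\<theta> * (exp (\<alpha> * - real N) * - cos (\<alpha> * y)) \<le> \<theta> * 1"
      using assms by (intro mult_left_mono) auto
    with 1 show "norm (wright_integrand \<alpha> \<theta> (Complex (- real N) y)) \<le> exp (1 + \<theta> - \<alpha> * real N)"
      unfolding norm_wright_integrand by (simp add: algebra_simps)
  qed auto
  show "(\<lambda>N. exp (1 + \<theta> - \<alpha> * real N) * (pi - 0)) \<longlonglongrightarrow> 0"
    using assms by real_asymp
qed

text \<open>On this segment far to the right the integrand is small for two different reasons. Up to a height
  strictly between \<open>\<pi>/2\<close> and \<open>\<pi>/(2\<alpha>)\<close>, which exists as \<open>\<alpha> < 1\<close>, the factor \<open>cos y \<le> 0\<close> does no harm and \<open>cos (\<alpha> y)\<close>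
  is bounded below by a positive constant. Above that height \<open>cos y\<close> is bounded above by a negative constant, and
  \<open>exp x\<close> outweighs \<open>\<theta> exp (\<alpha> x)\<close>.\<close>

lemma primitive_right_edge:
  assumes "1/2 < \<alpha>" "\<alpha> < 1" "0 < \<theta>"
    and \<Phi>: "\<And>z. (\<Phi> has_field_derivative wright_integrand \<alpha> \<theta> z) (at z)"
  shows "(\<lambda>N. \<Phi> (Complex (real N) pi) - \<Phi> (Complex (real N) (pi/2))) \<longlonglongrightarrow> 0"
proof -
  have "pi / 2 < pi / (2 * \<alpha>)" using assms by (simp add: field_simps)
  from dense[OF this] obtain y2 where y2: "pi / 2 < y2" "y2 < pi / (2 * \<alpha>)" by blast
  have "pi / (2 * \<alpha>) < pi" using assms by (simp add: field_simps)
  then have y2pi: "y2 < pi" using y2 by linarith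
  define c2 where "c2 = cos (\<alpha> * y2)"
  define c3 where "c3 = - cos y2"
  have small: "\<alpha> * y2 < pi / 2" using y2 assms by (simp add: field_simps)
  have "0 < \<alpha> * y2" using assms y2 pi_gt_zero by (intro mult_pos_pos) linarith+
  with small have c2: "c2 > 0" unfolding c2_def using pi_gt_zero
    by (intro cos_gt_zero_pi) linarith+
  have c3: "c3 > 0" unfolding c3_def using y2 y2pi cos_monotone_0_pi[of "pi/2" y2] by simp
  let ?B = "\<lambda>N::nat. exp (\<alpha> * real N - \<theta> * (c2 * exp (\<alpha> * real N))) + exp (\<alpha> * real N - c3 * exp (real N) + \<theta> * exp (\<alpha> * real N))"
  show ?thesis
  proof (rule Lim_null_comparison)
    show "eventually (\<lambda>N. norm (\<Phi> (Complex (real N) pi) - \<Phi> (Complex (real N) (pi/2))) \<le> ?B N * (pi - pi/2)) sequentially"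
    proof (intro always_eventually allI primitive_vertical_bound[OF \<Phi>])
      fix N y assume y: "y \<in> {pi/2..pi}"
      show "norm (wright_integrand \<alpha> \<theta> (Complex (real N) y)) \<le> ?B N"
      proof (cases "y \<le> y2")
        case True
        have "cos y \<le> 0"
          using y cos_monotone_0_pi_le[of "pi/2" y] by simp
        then have "exp (real N) * cos y \<le> 0" by (simp add: mult_nonneg_nonpos)
        moreover have "c2 \<le> cos (\<alpha> * y)"
          unfolding c2_def using True y assms y2 small
          by (intro cos_monotone_0_pi_le mult_left_mono) auto
        then have "\<theta> * (exp (\<alpha> * real N) * c2) \<le> \<theta> * (exp (\<alpha> * real N) * cos (\<alpha> * y))"
          using assms by (intro mult_left_mono) auto
        ultimately have "norm (wright_integrand \<alpha> \<theta> (Complex (real N) y)) \<le> exp (\<alpha> * real N - \<theta> * (c2 * exp (\<alpha> * real N)))"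
          unfolding norm_wright_integrand by (simp add: mult_ac)
        then show ?thesis by (rule order_trans) simp
      next
        case False
        have "cos y \<le> - c3"
          unfolding c3_def using False y y2 cos_monotone_0_pi_le[of y2 y] by simp
        then have "exp (real N) * cos y \<le> exp (real N) * (- c3)" by (intro mult_left_mono) auto
        moreover have "\<theta> * (exp (\<alpha> * real N) * - cos (\<alpha> * y)) \<le> \<theta> * (exp (\<alpha> * real N) * 1)"
          using assms by (intro mult_left_mono) (auto simp: minus_le_iff)
        ultimately have "norm (wright_integrand \<alpha> \<theta> (Complex (real N) y)) \<le> exp (\<alpha> * real N - c3 * exp (real N) + \<theta> * exp (\<alpha> * real N))"
          unfolding norm_wright_integrand by (simp add: mult_ac)
        then show ?thesis by (rule order_trans) simp
      qed
    qed auto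
    show "(\<lambda>N. ?B N * (pi - pi/2)) \<longlonglongrightarrow> 0"
      using assms(1-3) c2 c3 by real_asymp
  qed
qed

text \<open>The path runs along the real axis to \<open>L\<close>, up to height \<open>\<pi>/2\<close>, and to the right at that height.
  On the real axis the integrand is real and contributes nothing to the imaginary part; the
  other two pieces both carry the factor \<open>exp (- \<theta> c exp (\<alpha> L))\<close>. The abscissa \<open>L\<close> is at our disposal.\<close>

lemma mainardi_bound_by_shift:
  assumes "1/2 < \<alpha>" "\<alpha> < 1" "0 < \<theta>" and "0 \<le> L"
  defines "c \<equiv> cos (\<alpha> * (pi / 2))"
  shows "\<bar>mainardi \<alpha> \<theta>\<bar> \<le> (exp (exp L + \<alpha> * L) * pi / 2 + 1 / (\<theta> * c * \<alpha>)) * exp (- \<theta> * c * exp (\<alpha> * L)) / pi"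
proof -
  have "\<alpha> * (pi / 2) < 1 * (pi / 2)" using assms by (intro mult_strict_right_mono) auto
  then have c: "c > 0" unfolding c_def using assms pi_gt_zero
    by (intro cos_gt_zero_pi) (auto intro: less_trans[of _ 0])
  obtain \<Phi> where \<Phi>: "\<And>z. (\<Phi> has_field_derivative wright_integrand \<alpha> \<theta> z) (at z)"
    using wright_primitive by blast
  let ?h = "pi / 2"
  let ?E = "exp (- \<theta> * c * exp (\<alpha> * L))"
  have vert: "norm (\<Phi> (Complex L ?h) - \<Phi> (Complex L 0)) \<le> exp (exp L + \<alpha> * L) * ?E * (?h - 0)"
  proof (rule primitive_vertical_bound[OF \<Phi>])
    fix y assume y: "y \<in> {0..?h}"
    have "c \<le> cos (\<alpha> * y)"
      unfolding c_def using y assms \<open>\<alpha> * (pi / 2) < 1 * (pi / 2)\<close>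
      by (intro cos_monotone_0_pi_le mult_left_mono) auto
    then have "\<theta> * (exp (\<alpha> * L) * c) \<le> \<theta> * (exp (\<alpha> * L) * cos (\<alpha> * y))"
      using assms by (intro mult_left_mono) auto
    moreover have "exp L * cos y \<le> exp L * 1" by (intro mult_left_mono) auto
    ultimately have "exp L * cos y - \<theta> * (exp (\<alpha> * L) * cos (\<alpha> * y)) + \<alpha> * L \<le>
        exp L + \<alpha> * L + (- \<theta> * c * exp (\<alpha> * L))"
      by argo
    then show "norm (wright_integrand \<alpha> \<theta> (Complex L y)) \<le> exp (exp L + \<alpha> * L) * ?E"
      unfolding norm_wright_integrand exp_add[symmetric] by simp
  qed simp
  have horiz: "norm (\<Phi> (Complex N ?h) - \<Phi> (Complex L ?h)) \<le> 1 / (\<theta> * c * \<alpha>) * ?E" if "L \<le> N" for N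
  proof -
    define p where "p x = - exp (- \<theta> * c * exp (\<alpha> * x)) / (\<theta> * c * \<alpha>)" for x
    have 1: "((\<lambda>x. wright_integrand \<alpha> \<theta> (Complex x ?h)) has_integral \<Phi> (Complex N ?h) - \<Phi> (Complex L ?h)) {L..N}"
    proof (rule fundamental_theorem_of_calculus[OF that])
      fix x assume "x \<in> {L..N}"
      have "((\<lambda>t. of_real t + \<i> * of_real ?h) has_vector_derivative 1) (at x within {L..N})"
        by (auto intro!: derivative_eq_intros)
      then have "((\<Phi> \<circ> (\<lambda>t. of_real t + \<i> * of_real ?h)) has_vector_derivative
          1 * wright_integrand \<alpha> \<theta> (of_real x + \<i> * of_real ?h)) (at x within {L..N})"
        by (rule field_vector_diff_chain_within) (rule has_field_derivative_at_within[OF \<Phi>])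
      then show "((\<lambda>x. \<Phi> (Complex x ?h)) has_vector_derivative wright_integrand \<alpha> \<theta> (Complex x ?h)) (at x within {L..N})"
        by (simp add: o_def Complex_eq)
    qed
    have 2: "((\<lambda>x. exp (- \<theta> * c * exp (\<alpha> * x)) * exp (\<alpha> * x)) has_integral p N - p L) {L..N}"
      unfolding p_def using assms c
      by (intro fundamental_theorem_of_calculus that)
         (auto intro!: derivative_eq_intros simp flip: has_real_derivative_iff_has_vector_derivative)
    have "norm (\<Phi> (Complex N ?h) - \<Phi> (Complex L ?h)) \<le> p N - p L"
      unfolding integral_unique[OF 1, symmetric] integral_unique[OF 2, symmetric]
    proof (rule integral_norm_bound_integral)
      fix x
      show "norm (wright_integrand \<alpha> \<theta> (Complex x ?h)) \<le> exp (- \<theta> * c * exp (\<alpha> * x)) * exp (\<alpha> * x)"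
        unfolding norm_wright_integrand c_def by (simp add: mult_ac flip: exp_add)
    qed (use 1 2 in auto)
    also have "\<dots> \<le> - p L" unfolding p_def using assms c by simp
    finally show ?thesis unfolding p_def by simp
  qed
  have real_axis: "Im (\<Phi> (Complex L 0) - \<Phi> (Complex (- real N) 0)) = 0" for N
  proof -
    have le: "- real N \<le> L" using assms by simp
    have 1: "((\<lambda>x. wright_integrand \<alpha> \<theta> (Complex x 0)) has_integral \<Phi> (Complex L 0) - \<Phi> (Complex (- real N) 0)) {- real N..L}"
    proof (rule fundamental_theorem_of_calculus[OF le])
      fix x assume "x \<in> {- real N..L}"
      have "(of_real has_vector_derivative (1::complex)) (at x within {- real N..L})"
        by (auto intro!: derivative_eq_intros)
      then have "((\<Phi> \<circ> of_real) has_vector_derivative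
          1 * wright_integrand \<alpha> \<theta> (of_real x)) (at x within {- real N..L})"
        by (rule field_vector_diff_chain_within) (rule has_field_derivative_at_within[OF \<Phi>])
      then show "((\<lambda>x. \<Phi> (Complex x 0)) has_vector_derivative wright_integrand \<alpha> \<theta> (Complex x 0)) (at x within {- real N..L})"
        by (simp add: o_def Complex_eq)
    qed
    have "((\<lambda>x. Im (wright_integrand \<alpha> \<theta> (Complex x 0))) has_integral Im (\<Phi> (Complex L 0) - \<Phi> (Complex (- real N) 0))) {- real N..L}"
      by (rule has_integral_Im[OF 1])
    moreover have "Im (wright_integrand \<alpha> \<theta> (Complex x 0)) = 0" for x
      by (simp add: wright_integrand_def Complex_eq Im_exp)
    ultimately show ?thesis by (metis (no_types, lifting) has_integral_0 has_integral_unique ext)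
  qed
  let ?M = "(exp (exp L + \<alpha> * L) * pi / 2 + 1 / (\<theta> * c * \<alpha>)) * ?E"
  let ?r = "\<lambda>N. \<Phi> (Complex (real N) pi) - \<Phi> (Complex (real N) ?h)"
  let ?l = "\<lambda>N. \<Phi> (Complex (- real N) pi) - \<Phi> (Complex (- real N) 0)"
  have "(\<lambda>N. \<bar>Im (\<Phi> (Complex (real N) pi) - \<Phi> (Complex (- real N) pi))\<bar>) \<longlonglongrightarrow> \<bar>pi * mainardi \<alpha> \<theta>\<bar>"
    using assms by (intro tendsto_rabs mainardi_eq_limit \<Phi>) auto
  moreover have "(\<lambda>N. norm (?r N) + norm (?l N) + ?M) \<longlonglongrightarrow> 0 + 0 + ?M"
    using assms by (intro tendsto_add tendsto_norm_zero primitive_right_edge[OF _ _ _ \<Phi>] primitive_left_edge[OF _ _ \<Phi>] tendsto_const) auto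
  moreover have "eventually (\<lambda>N. \<bar>Im (\<Phi> (Complex (real N) pi) - \<Phi> (Complex (- real N) pi))\<bar> \<le>
      norm (?r N) + norm (?l N) + ?M) sequentially"
  proof -
    obtain N0 where N0: "L \<le> real N0" using real_arch_simple by blast
    have "\<bar>Im (\<Phi> (Complex (real N) pi) - \<Phi> (Complex (- real N) pi))\<bar> \<le> norm (?r N) + norm (?l N) + ?M" if "N \<ge> N0" for N
    proof -
      have LN: "L \<le> real N" using N0 that by linarith
      let ?s = "?r N - ?l N + (\<Phi> (Complex (real N) ?h) - \<Phi> (Complex L ?h)) + (\<Phi> (Complex L ?h) - \<Phi> (Complex L 0))"
      have "Im (\<Phi> (Complex (real N) pi) - \<Phi> (Complex (- real N) pi)) = Im ?s"
        using real_axis[of N] by simp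
      then have "\<bar>Im (\<Phi> (Complex (real N) pi) - \<Phi> (Complex (- real N) pi))\<bar> \<le> norm ?s"
        using abs_Im_le_cmod by metis
      also have "\<dots> \<le> norm (?r N) + norm (?l N) + norm (\<Phi> (Complex (real N) ?h) - \<Phi> (Complex L ?h))
          + norm (\<Phi> (Complex L ?h) - \<Phi> (Complex L 0))"
        by (intro norm_triangle_le norm_triangle_le_diff add_mono order_refl)
      also have "\<dots> \<le> norm (?r N) + norm (?l N) + ?M"
        using vert horiz[OF LN] by (simp add: algebra_simps)
      finally show ?thesis .
    qed
    then show ?thesis unfolding eventually_sequentially by blast
  qed
  ultimately have "\<bar>pi * mainardi \<alpha> \<theta>\<bar> \<le> 0 + 0 + ?M"
    by (intro tendsto_le[OF sequentially_bot])
  then show ?thesis by (simp add: abs_mult field_simps)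
qed

text \<open>The rate \<open>R\<close> has to be arbitrary since it must exceed the growth rate of a
  semigroup. It is reached by taking \<open>L\<close> large in the previous bound; for \<open>\<theta> \<le> 1\<close>, where that bound
  degenerates, continuity suffices.\<close>

lemma mainardi_exponential_decay:
  assumes "1/2 < \<alpha>" "\<alpha> < 1" and "0 \<le> R"
  obtains C where "0 \<le> C" "\<And>\<theta>. 0 \<le> \<theta> \<Longrightarrow> \<bar>mainardi \<alpha> \<theta>\<bar> \<le> C * exp (- R * \<theta>)"
proof -
  define c where "c = cos (\<alpha> * (pi / 2))"
  have "\<alpha> * (pi / 2) < 1 * (pi / 2)" using assms by (intro mult_strict_right_mono) auto
  then have c: "c > 0" unfolding c_def using assms pi_gt_zero
    by (intro cos_gt_zero_pi) (auto intro: less_trans[of _ 0])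
  define L where "L = ln (max 1 (R / c)) / \<alpha>"
  have L: "0 \<le> L" "R \<le> c * exp (\<alpha> * L)"
    unfolding L_def using assms c by (auto simp: field_simps max_def)
  define C1 where "C1 = (exp (exp L + \<alpha> * L) * pi / 2 + 1 / (c * \<alpha>)) / pi"
  have C1: "C1 \<ge> 0" unfolding C1_def using c assms by auto
  have large: "\<bar>mainardi \<alpha> \<theta>\<bar> \<le> C1 * exp (- R * \<theta>)" if "\<theta> \<ge> 1" for \<theta>
  proof -
    have "\<bar>mainardi \<alpha> \<theta>\<bar> \<le> (exp (exp L + \<alpha> * L) * pi / 2 + 1 / (\<theta> * c * \<alpha>)) * exp (- \<theta> * c * exp (\<alpha> * L)) / pi"
      using mainardi_bound_by_shift[OF assms(1,2) _ L(1), of \<theta>] that unfolding c_def by simp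
    also have "\<dots> \<le> (exp (exp L + \<alpha> * L) * pi / 2 + 1 / (c * \<alpha>)) * exp (- R * \<theta>) / pi"
    proof (intro divide_right_mono mult_mono add_left_mono)
      have "1 * (c * \<alpha>) \<le> \<theta> * (c * \<alpha>)" using that c assms by (intro mult_right_mono) auto
      then show "1 / (\<theta> * c * \<alpha>) \<le> 1 / (c * \<alpha>)"
        using c assms by (intro divide_left_mono) auto
      have "R * \<theta> \<le> (c * exp (\<alpha> * L)) * \<theta>" using L that by (intro mult_right_mono) auto
      then show "exp (- \<theta> * c * exp (\<alpha> * L)) \<le> exp (- R * \<theta>)" by (simp add: mult_ac)
    qed (use c assms in auto)
    finally show ?thesis by (simp add: C1_def)
  qed
  have "compact (mainardi \<alpha> ` {0..1})"
    using assms by (intro compact_continuous_image continuous_on_subset[OF mainardi_continuous]) auto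
  then obtain B where B: "\<And>\<theta>. \<theta> \<in> {0..1} \<Longrightarrow> \<bar>mainardi \<alpha> \<theta>\<bar> \<le> B"
    using compact_imp_bounded bounded_iff by (metis imageI real_norm_def)
  have B0: "B \<ge> 0" using B[of 0] by force
  show ?thesis
  proof (rule that[of "C1 + B * exp R"])
    fix \<theta> :: real assume \<theta>: "0 \<le> \<theta>"
    show "\<bar>mainardi \<alpha> \<theta>\<bar> \<le> (C1 + B * exp R) * exp (- R * \<theta>)"
    proof (cases "\<theta> \<ge> 1")
      case True
      have "0 \<le> B * exp R * exp (- R * \<theta>)" using B0 by simp
      then show ?thesis using large[OF True] by (simp add: algebra_simps)
    next
      case False
      have "R * \<theta> \<le> R * 1" using False assms by (intro mult_left_mono) auto
      then have "B * 1 \<le> B * exp (R - R * \<theta>)" using B0 by (intro mult_left_mono) auto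
      moreover have "exp (R - R * \<theta>) = exp R * exp (- R * \<theta>)" by (simp flip: exp_add)
      moreover have "\<bar>mainardi \<alpha> \<theta>\<bar> \<le> B" using B[of \<theta>] False \<theta> by simp
      ultimately have "\<bar>mainardi \<alpha> \<theta>\<bar> \<le> B * exp R * exp (- R * \<theta>)" by (simp add: mult.assoc)
      moreover have "0 \<le> C1 * exp (- R * \<theta>)" using C1 by simp
      ultimately show ?thesis by (simp add: algebra_simps)
    qed
  qed (use C1 B0 in auto)
qed

section \<open>Operator families generated by a compact semigroup\<close>

text \<open>One of \<open>L (x + u)\<close> and \<open>L (x - u)\<close> is at least as long as \<open>L u\<close>, so that large
  values are met in a ball around any centre. The factor 2/3 leaves room for a supremum that is not
  attained.\<close>

lemma blinfun_large_value_in_ball: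
  fixes L :: "'a::real_normed_vector \<Rightarrow>\<^sub>L 'b::real_normed_vector"
  assumes r: "0 < r"
  obtains y where "norm (y - x) \<le> r" "norm (L y) \<ge> 2 / 3 * r * norm L"
proof (cases "norm L = 0")
  case True
  then show ?thesis using that[of x] r by simp
next
  case False
  then have n: "norm L > 0" by simp
  have "\<exists>z. norm (L z) > 2 / 3 * norm L * norm z"
  proof (rule ccontr)
    assume "\<not> ?thesis"
    then have "norm (L z) \<le> 2 / 3 * norm L * norm z" for z by (simp add: not_less)
    then have "norm L \<le> 2 / 3 * norm L" by (intro norm_blinfun_bound) auto
    then show False using n by simp
  qed
  then obtain z where z: "norm (L z) > 2 / 3 * norm L * norm z" by blast
  then have z0: "z \<noteq> 0" by auto
  define u where "u = (r / norm z) *\<^sub>R z"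
  have nu: "norm u = r" using z0 r by (simp add: u_def)
  have "norm (L u) = r / norm z * norm (L z)" using z0 r by (simp add: u_def blinfun.scaleR_right)
  also have "\<dots> \<ge> r / norm z * (2 / 3 * norm L * norm z)" using z z0 r by (intro mult_left_mono) auto
  finally have Lu: "norm (L u) \<ge> 2 / 3 * r * norm L" using z0 by (simp add: field_simps)
  have "2 *\<^sub>R L u = L (x + u) - L (x - u)" by (simp add: blinfun.add_right blinfun.diff_right scaleR_2)
  then have "2 * norm (L u) \<le> norm (L (x + u)) + norm (L (x - u))"
    by (metis norm_scaleR abs_numeral norm_triangle_ineq4)
  then have "norm (L (x + u)) \<ge> norm (L u) \<or> norm (L (x - u)) \<ge> norm (L u)" by linarith
  then show ?thesis
  proof
    assume "norm (L (x + u)) \<ge> norm (L u)"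
    then show ?thesis using that[of "x + u"] Lu nu by simp
  next
    assume "norm (L (x - u)) \<ge> norm (L u)"
    then show ?thesis using that[of "x - u"] Lu nu by simp
  qed
qed

text \<open>Sokal's form of the gliding hump. If the norms were unbounded, successive corrections of length
  at most \<open>3\<^sup>-\<^sup>n\<close> could each make a value of size \<open>(4/3)\<^sup>n\<close> up to a constant, and all later
  corrections together, of length at most half of \<open>3\<^sup>-\<^sup>n\<close>, would not destroy it.\<close>

theorem uniform_boundedness_sequence:
  fixes L :: "nat \<Rightarrow> 'a::banach \<Rightarrow>\<^sub>L 'b::real_normed_vector"
  assumes bnd: "\<And>x. bounded (range (\<lambda>n. L n x))"
  obtains B where "\<And>n. norm (L n) \<le> B"
proof (rule ccontr)
  assume neg: "\<not> thesis"
  have "\<exists>k. norm (L k) \<ge> 4 ^ n" for n :: nat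
    using neg that[of "4 ^ n"] by (meson not_le order.strict_implies_order)
  then obtain k where k: "\<And>n::nat. norm (L (k n)) \<ge> 4 ^ n" by metis
  have "\<exists>X. \<forall>n. True \<and> norm (X (Suc n) - X n) \<le> (1/3) ^ n \<and> norm (L (k n) (X (Suc n))) \<ge> 2 / 3 * (1/3) ^ n * norm (L (k n))"
  proof (rule dependent_nat_choice)
    fix x :: 'a and n :: nat
    obtain y where "norm (y - x) \<le> (1/3) ^ n" "norm (L (k n) y) \<ge> 2 / 3 * (1/3) ^ n * norm (L (k n))"
      by (rule blinfun_large_value_in_ball[of "(1/3) ^ n" x "L (k n)"]) auto
    then show "\<exists>y. True \<and> norm (y - x) \<le> (1/3) ^ n \<and> norm (L (k n) y) \<ge> 2 / 3 * (1/3) ^ n * norm (L (k n))" by blast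
  qed simp
  then obtain X :: "nat \<Rightarrow> 'a" where step: "\<And>n. norm (X (Suc n) - X n) \<le> (1/3) ^ n"
    and big: "\<And>n. norm (L (k n) (X (Suc n))) \<ge> 2 / 3 * (1/3) ^ n * norm (L (k n))" by blast
  have sm: "summable (\<lambda>n. X (Suc n) - X n)"
    by (rule summable_comparison_test[of _ "\<lambda>n. (1/3) ^ n"]) (use step in \<open>auto intro: summable_geometric\<close>)
  define x where "x = X 0 + (\<Sum>n. X (Suc n) - X n)"
  have close: "norm (x - X (Suc n)) \<le> (1/3) ^ n / 2" for n
  proof -
    have "(\<Sum>i. X (Suc i) - X i) = (\<Sum>i. X (Suc (i + Suc n)) - X (i + Suc n)) + (\<Sum>i<Suc n. X (Suc i) - X i)"
      by (rule suminf_split_initial_segment[OF sm])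
    then have "x - X (Suc n) = (\<Sum>i. X (Suc (i + Suc n)) - X (i + Suc n))"
      unfolding x_def by (simp only: sum_lessThan_telescope[of X]) simp
    also have "norm \<dots> \<le> (\<Sum>i. (1/3) ^ (i + Suc n))"
      by (rule norm_suminf_le, rule step, rule summable_ignore_initial_segment, rule summable_geometric) simp
    also have "\<dots> = (1/3) ^ Suc n * (\<Sum>i. (1/3) ^ i)"
      unfolding power_add by (subst suminf_mult[symmetric]) (auto simp: mult.commute)
    also have "\<dots> = (1/3) ^ n / 2" by (simp add: suminf_geometric)
    finally show ?thesis .
  qed
  obtain B where B: "\<And>n. norm (L n x) \<le> B" using bnd[of x] unfolding bounded_iff by blast
  have "(4/3) ^ n / 6 \<le> B" for n :: nat
  proof -
    have "norm (L (k n) (X (Suc n))) \<le> norm (L (k n) x) + norm (L (k n) (x - X (Suc n)))"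
      by (metis blinfun.diff_right norm_minus_commute norm_triangle_sub)
    also have "\<dots> \<le> B + norm (L (k n)) * ((1/3) ^ n / 2)"
      using close[of n] by (intro add_mono B order_trans[OF norm_blinfun] mult_left_mono) auto
    finally have "norm (L (k n)) * ((1/3) ^ n / 6) \<le> B" using big[of n] by (simp add: algebra_simps)
    moreover have "4 ^ n * ((1/3) ^ n / 6) \<le> norm (L (k n)) * ((1/3) ^ n / 6)"
      using k[of n] by (intro mult_right_mono) auto
    ultimately show ?thesis by (simp add: power_divide)
  qed
  moreover obtain n :: nat where "6 * B < (4/3) ^ n" using real_arch_pow[of "4/3" "6 * B"] by auto
  ultimately show False by (metis divide_le_eq_numeral1(1) mult.commute not_less)
qed

context
  fixes T :: "real \<Rightarrow> 'a::banach \<Rightarrow>\<^sub>L 'a"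
  assumes T: "C0_semigroup T"
begin

lemma semigroup_zero: "T 0 = id_blinfun"
  and semigroup_add: "0 \<le> s \<Longrightarrow> 0 \<le> t \<Longrightarrow> T (s + t) = T s o\<^sub>L T t"
  and semigroup_limit: "((\<lambda>t. blinfun_apply (T t) x) \<longlongrightarrow> x) (at_right 0)"
  using T unfolding C0_semigroup_def by auto

lemma semigroup_near_zero:
  assumes "e > 0"
  obtains d where "d > 0" "\<And>t. 0 \<le> t \<Longrightarrow> t < d \<Longrightarrow> norm (T t x - x) < e"
proof -
  have "eventually (\<lambda>t. dist (T t x) x < e) (at_right 0)"
    by (rule tendstoD[OF semigroup_limit assms])
  then obtain d where d: "d > 0" "\<And>t. t > 0 \<Longrightarrow> t < d \<Longrightarrow> dist (T t x) x < e"
    unfolding eventually_at_right_field by auto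
  show ?thesis
  proof (rule that[OF d(1)])
    fix t :: real assume "0 \<le> t" "t < d"
    then show "norm (T t x - x) < e"
      using d(2)[of t] assms by (cases "t = 0") (auto simp: semigroup_zero dist_norm)
  qed
qed

text \<open>Otherwise there would be times tending to 0 at which the norms are unbounded, although at those times
  \<open>T t x\<close> converges for each \<open>x\<close>.\<close>

lemma semigroup_locally_bounded:
  obtains d B where "d > 0" "1 \<le> B" "\<And>t. 0 \<le> t \<Longrightarrow> t \<le> d \<Longrightarrow> norm (T t) \<le> B"
proof (rule ccontr)
  assume neg: "\<not> thesis"
  have "\<exists>t. 0 \<le> t \<and> t \<le> inverse (real (Suc n)) \<and> norm (T t) > real n + 1" for n
    using neg that[of "inverse (real (Suc n))" "real n + 1"] by (force simp: not_le)
  then obtain t where t: "\<And>n. 0 \<le> t n" "\<And>n. t n \<le> inverse (real (Suc n))" "\<And>n. norm (T (t n)) > real n + 1"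
    by metis
  have bdd: "bounded (range (\<lambda>n. T (t n) x))" for x
  proof (rule convergent_imp_bounded)
    show "(\<lambda>n. T (t n) x) \<longlonglongrightarrow> x"
    proof (rule LIMSEQ_I)
      fix r :: real assume "r > 0"
      then obtain d where d: "d > 0" "\<And>t. 0 \<le> t \<Longrightarrow> t < d \<Longrightarrow> norm (T t x - x) < r"
        using semigroup_near_zero by blast
      obtain n0 where n0: "inverse (real (Suc n0)) < d" using reals_Archimedean[OF d(1)] by blast
      have "norm (T (t n) x - x) < r" if "n \<ge> n0" for n
      proof -
        have "inverse (real (Suc n)) \<le> inverse (real (Suc n0))" using that by (simp add: le_imp_inverse_le)
        then have "t n < d" using t(2)[of n] n0 by linarith
        then show ?thesis using t(1) by (intro d(2))
      qed
      then show "\<exists>n0. \<forall>n\<ge>n0. norm (T (t n) x - x) < r" by blast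
    qed
  qed
  obtain B where B: "\<And>n. norm (T (t n)) \<le> B" by (rule uniform_boundedness_sequence[of "\<lambda>n. T (t n)"], rule bdd, rule that)
  obtain n :: nat where "B \<le> real n" using real_arch_simple by blast
  then show False using B[of n] t(3)[of n] by linarith
qed

lemma semigroup_exponential_bound:
  obtains C \<omega> where "1 \<le> C" "0 \<le> \<omega>" "\<And>t. 0 \<le> t \<Longrightarrow> norm (T t) \<le> C * exp (\<omega> * t)"
proof -
  obtain d B where d: "d > 0" and B: "1 \<le> B" "\<And>t. 0 \<le> t \<Longrightarrow> t \<le> d \<Longrightarrow> norm (T t) \<le> B"
    by (rule semigroup_locally_bounded, rule that)
  have pow: "norm (T t) \<le> B ^ Suc n" if "0 \<le> t" "t \<le> real (Suc n) * d" for t n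
    using that
  proof (induction n arbitrary: t)
    case 0
    then show ?case using B(2)[of t] by simp
  next
    case (Suc n)
    show ?case
    proof (cases "t \<le> d")
      case True
      have "norm (T t) \<le> B ^ 1" using B(2) True Suc.prems by simp
      also have "\<dots> \<le> B ^ Suc (Suc n)" using B(1) by (intro power_increasing) auto
      finally show ?thesis .
    next
      case False
      have "T (d + (t - d)) = T d o\<^sub>L T (t - d)" using d False by (intro semigroup_add) auto
      then have "norm (T t) \<le> norm (T d) * norm (T (t - d))" by (simp add: norm_blinfun_compose)
      also have "\<dots> \<le> B * B ^ Suc n"
        using Suc.prems False d B by (intro mult_mono Suc.IH B(2)) (auto simp: algebra_simps)
      finally show ?thesis by simp
    qed
  qed
  define \<omega> where "\<omega> = ln B / d"
  show ?thesis
  proof (rule that[of B \<omega>])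
    show "0 \<le> \<omega>" using B d by (simp add: \<omega>_def)
    fix t :: real assume t: "0 \<le> t"
    define n where "n = nat \<lfloor>t / d\<rfloor>"
    have fl: "real n \<le> t / d" "t / d \<le> real n + 1" unfolding n_def using t d by (auto simp: of_nat_nat)
    have "norm (T t) \<le> B ^ Suc n" using fl d t by (intro pow) (auto simp: field_simps)
    also have "B ^ Suc n = B * exp (real n * ln B)" using B by (simp add: exp_of_nat_mult)
    also have "\<dots> \<le> B * exp (\<omega> * t)"
    proof -
      have "real n * ln B \<le> t / d * ln B" using fl B by (intro mult_right_mono) auto
      then show ?thesis using B by (simp add: \<omega>_def mult.commute)
    qed
    finally show "norm (T t) \<le> B * exp (\<omega> * t)" .
  qed (rule B(1))
qed

lemma semigroup_continuous: "continuous_on {0..} (\<lambda>t. T t x)"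
  unfolding continuous_on_iff
proof (intro ballI allI impI)
  fix t e :: real assume t: "t \<in> {0..}" and e: "e > 0"
  obtain C \<omega> where C: "1 \<le> C" "0 \<le> \<omega>" "\<And>t. 0 \<le> t \<Longrightarrow> norm (T t) \<le> C * exp (\<omega> * t)"
    by (rule semigroup_exponential_bound, rule that)
  define B where "B = C * exp (\<omega> * (t + 1))"
  have B: "B > 0" using C by (simp add: B_def)
  have TB: "norm (T s) \<le> B" if "0 \<le> s" "s \<le> t + 1" for s
  proof -
    have "norm (T s) \<le> C * exp (\<omega> * s)" using C that by simp
    also have "\<dots> \<le> B" unfolding B_def using that C by (intro mult_left_mono) (auto intro: mult_left_mono)
    finally show ?thesis .
  qed
  obtain d where d: "d > 0" "\<And>t. 0 \<le> t \<Longrightarrow> t < d \<Longrightarrow> norm (T t x - x) < e / B"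
    using semigroup_near_zero[of "e / B" x] e B by auto
  have key: "dist (T (s + h) x) (T s x) < e" if "0 \<le> s" "s \<le> t + 1" "0 \<le> h" "h < d" for s h
  proof -
    have "T (s + h) x - T s x = T s (T h x - x)"
      using semigroup_add[OF that(1,3)] by (simp add: blinfun.diff_right)
    then have "dist (T (s + h) x) (T s x) \<le> norm (T s) * norm (T h x - x)"
      unfolding dist_norm by (simp add: norm_blinfun)
    also have "\<dots> \<le> B * norm (T h x - x)" using TB that by (intro mult_right_mono) auto
    also have "\<dots> < B * (e / B)" using d(2) that B by (intro mult_strict_left_mono) auto
    finally show ?thesis using B by simp
  qed
  show "\<exists>d>0. \<forall>s\<in>{0..}. dist s t < d \<longrightarrow> dist (T s x) (T t x) < e"
  proof (intro exI conjI ballI impI)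
    show "min d 1 > 0" using d by simp
    fix s assume s: "s \<in> {0..}" "dist s t < min d 1"
    show "dist (T s x) (T t x) < e"
    proof (cases "t \<le> s")
      case True
      then show ?thesis using key[of t "s - t"] s t by (simp add: dist_real_def)
    next
      case False
      then show ?thesis using key[of s "t - s"] s t by (simp add: dist_real_def dist_commute)
    qed
  qed
qed

text \<open>In \<open>T t = T (t - c) T c\<close> the right factor sends the unit ball into a compact set, on which the strong
  continuity of the left factor is uniform.\<close>

lemma compact_semigroup_norm_continuous:
  assumes compact: "\<And>t. t > 0 \<Longrightarrow> compact_operator (T t)"
  shows "continuous_on {0<..} T"
  unfolding continuous_on_iff
proof (intro ballI allI impI)
  fix t e :: real assume t: "t \<in> {0<..}" and e: "e > 0"
  obtain C \<omega> where C: "1 \<le> C" "0 \<le> \<omega>" "\<And>t. 0 \<le> t \<Longrightarrow> norm (T t) \<le> C * exp (\<omega> * t)"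
    by (rule semigroup_exponential_bound, rule that)
  define B where "B = C * exp (\<omega> * t)"
  have B: "B > 0" using C by (simp add: B_def)
  have TB: "norm (T s) \<le> B" if "0 \<le> s" "s \<le> t" for s
  proof -
    have "norm (T s) \<le> C * exp (\<omega> * s)" using C that by simp
    also have "\<dots> \<le> B" unfolding B_def using that C by (intro mult_left_mono) (auto intro: mult_left_mono)
    finally show ?thesis .
  qed
  define c where "c = t / 2"
  have c: "c > 0" "c < t" using t by (auto simp: c_def)
  let ?K = "closure (T c ` cball 0 1)"
  have K: "compact ?K" using compact[OF c(1)] unfolding compact_operator_def by auto
  have "?K \<subseteq> (\<Union>y\<in>?K. ball y (e / (8 * B)))" using e B by auto
  then obtain N where N: "N \<subseteq> ?K" "finite N" "?K \<subseteq> (\<Union>y\<in>N. ball y (e / (8 * B)))"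
    by (rule compactE_image[OF K, of ?K "\<lambda>y. ball y (e / (8 * B))", rotated]) auto
  have "eventually (\<lambda>s. \<forall>y\<in>N. dist (T s y) (T (t - c) y) < e / 4) (at (t - c))"
  proof (rule eventually_ball_finite[OF N(2)], intro ballI tendstoD)
    fix y
    have "continuous_on {0<..} (\<lambda>t. T t y)" by (rule continuous_on_subset[OF semigroup_continuous]) auto
    then have "isCont (\<lambda>t. T t y) (t - c)" using c by (subst (asm) continuous_on_eq_continuous_at) auto
    then show "((\<lambda>s. T s y) \<longlongrightarrow> T (t - c) y) (at (t - c))" by (simp add: isCont_def)
  qed (use e in auto)
  then obtain d where d: "d > 0" "\<And>s y. s \<noteq> t - c \<Longrightarrow> dist s (t - c) < d \<Longrightarrow> y \<in> N \<Longrightarrow> dist (T s y) (T (t - c) y) < e / 4"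
    unfolding eventually_at by blast
  show "\<exists>d>0. \<forall>s\<in>{0<..}. dist s t < d \<longrightarrow> dist (T s) (T t) < e"
  proof (intro exI conjI ballI impI)
    show "min d c > 0" using d c by simp
    fix s assume s: "s \<in> {0<..}" "dist s t < min d c"
    have "\<bar>s - t\<bar> < c" using s(2) by (simp add: dist_real_def)
    then have sc: "0 \<le> s - c" "s - c \<le> t" unfolding c_def abs_less_iff by linarith+
    have B': "norm (T (s - c)) \<le> B" "norm (T (t - c)) \<le> B" using TB sc c by auto
    have "norm (T s - T t) \<le> e / 2"
    proof (rule norm_blinfun_bound)
      fix x
      have unit: "norm ((T s - T t) x) \<le> e / 2" if x: "norm x \<le> 1" for x
      proof -
        have Ts: "T s x = T (s - c) (T c x)" using semigroup_add[of "s - c" c] sc c by simp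
        have Tt: "T t x = T (t - c) (T c x)" using semigroup_add[of "t - c" c] c by simp
        have "T c x \<in> ?K" using x by (intro subsetD[OF closure_subset]) auto
        then obtain y where y: "y \<in> N" "dist y (T c x) < e / (8 * B)" using N(3) by (auto simp: dist_commute)
        have yn: "norm (T c x - y) \<le> e / (8 * B)" using y(2) by (simp add: dist_norm norm_minus_commute)
        have 1: "norm (T u (T c x - y)) \<le> e / 8" if "norm (T u) \<le> B" for u
        proof -
          have "norm (T u (T c x - y)) \<le> norm (T u) * norm (T c x - y)" by (rule norm_blinfun)
          also have "\<dots> \<le> B * (e / (8 * B))" using that yn B by (intro mult_mono) auto
          finally show ?thesis using B by simp
        qed
        have 2: "norm (T (s - c) y - T (t - c) y) \<le> e / 4"
        proof (cases "s = t")
          case False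
          then show ?thesis using d(2)[of "s - c" y] y s by (auto simp: dist_norm dist_real_def intro: less_imp_le)
        qed (use e in auto)
        have "(T s - T t) x = T (s - c) (T c x - y) + (T (s - c) y - T (t - c) y) - T (t - c) (T c x - y)"
          by (simp add: Ts Tt blinfun.diff_left blinfun.diff_right)
        also have "norm \<dots> \<le> norm (T (s - c) (T c x - y)) + norm (T (s - c) y - T (t - c) y) + norm (T (t - c) (T c x - y))"
          by (intro order_trans[OF norm_triangle_ineq4] add_mono norm_triangle_ineq order_refl)
        also have "\<dots> \<le> e / 8 + e / 4 + e / 8" by (intro add_mono 1 2 B')
        finally show ?thesis by simp
      qed
      show "norm ((T s - T t) x) \<le> e / 2 * norm x"
      proof (cases "x = 0")
        case False
        have "norm ((T s - T t) (x /\<^sub>R norm x)) \<le> e / 2" by (rule unit) (use False in simp)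
        then show ?thesis using False by (simp add: blinfun.scaleR_right field_simps)
      qed simp
    qed (use e in simp)
    then show "dist (T s) (T t) < e" unfolding dist_norm using e by linarith
  qed
qed

end

lemma precompact_iff_totally_bounded:
  fixes X :: "'b::complete_space set"
  shows "compact (closure X) \<longleftrightarrow> (\<forall>e>0. \<exists>N. finite N \<and> X \<subseteq> (\<Union>y\<in>N. ball y e))"
proof
  assume "compact (closure X)"
  then show "\<forall>e>0. \<exists>N. finite N \<and> X \<subseteq> (\<Union>y\<in>N. ball y e)"
    unfolding compact_eq_totally_bounded using closure_subset[of X] by (meson subset_trans)
next
  assume *: "\<forall>e>0. \<exists>N. finite N \<and> X \<subseteq> (\<Union>y\<in>N. ball y e)"
  have "\<exists>N. finite N \<and> closure X \<subseteq> (\<Union>y\<in>N. ball y e)" if e: "e > 0" for e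
  proof -
    obtain N where N: "finite N" "X \<subseteq> (\<Union>y\<in>N. ball y (e / 2))" using * e half_gt_zero by blast
    have "X \<subseteq> (\<Union>y\<in>N. cball y (e / 2))" 
      by (rule order_trans[OF N(2)]) (intro UN_mono order_refl ball_subset_cball)
    moreover have "closed (\<Union>y\<in>N. cball y (e / 2))" using N(1) by (intro closed_UN) auto
    ultimately have "closure X \<subseteq> (\<Union>y\<in>N. cball y (e / 2))" by (rule closure_minimal)
    also have "\<dots> \<subseteq> (\<Union>y\<in>N. ball y e)" using e by auto
    finally show ?thesis using N(1) by blast
  qed
  then show "compact (closure X)"
    unfolding compact_eq_totally_bounded by (auto simp: complete_eq_closed)
qed

lemma precompact_approximation:
  fixes X :: "'b::complete_space set"
  assumes "\<And>e. e > 0 \<Longrightarrow> \<exists>Y. compact (closure Y) \<and> (\<forall>x\<in>X. \<exists>y\<in>Y. dist x y \<le> e)"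
  shows "compact (closure X)"
  unfolding precompact_iff_totally_bounded
proof (intro allI impI)
  fix e :: real assume e: "e > 0"
  then obtain Y where Y: "compact (closure Y)" "\<And>x. x \<in> X \<Longrightarrow> \<exists>y\<in>Y. dist x y \<le> e / 2"
    using assms[of "e / 2"] by auto
  obtain N where N: "finite N" "Y \<subseteq> (\<Union>y\<in>N. ball y (e / 2))"
    using Y(1) e unfolding precompact_iff_totally_bounded by (meson half_gt_zero)
  have "X \<subseteq> (\<Union>y\<in>N. ball y e)"
  proof
    fix x assume "x \<in> X"
    then obtain y where y: "y \<in> Y" "dist x y \<le> e / 2" using Y(2) by blast
    then obtain z where z: "z \<in> N" "dist z y < e / 2" using N(2) by auto
    have "dist z x < e" using dist_triangle2[of z x y] y(2) z(2) by linarith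
    then show "x \<in> (\<Union>y\<in>N. ball y e)" using z(1) by auto
  qed
  then show "\<exists>N. finite N \<and> X \<subseteq> (\<Union>y\<in>N. ball y e)" using N(1) by blast
qed

lemma precompact_subset:
  fixes X Y :: "'b::metric_space set"
  assumes "compact (closure Y)" "X \<subseteq> Y"
  shows "compact (closure X)"
  using assms by (metis closure_mono compact_Int_closed closed_closure inf.absorb2)

lemma precompact_sums:
  fixes X Y :: "'b::real_normed_vector set"
  assumes "compact (closure X)" "compact (closure Y)"
  shows "compact (closure {x + y |x y. x \<in> X \<and> y \<in> Y})"
proof (rule precompact_subset)
  have c: "compact {x + y |x y. x \<in> closure X \<and> y \<in> closure Y}" by (rule compact_sums[OF assms])
  then show "compact (closure {x + y |x y. x \<in> closure X \<and> y \<in> closure Y})"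
    by (simp add: compact_imp_closed closure_closed)
  show "{x + y |x y. x \<in> X \<and> y \<in> Y} \<subseteq> {x + y |x y. x \<in> closure X \<and> y \<in> closure Y}"
    using closure_subset by blast
qed

lemma compact_operator_comp:
  fixes L :: "'b::real_normed_vector \<Rightarrow>\<^sub>L 'c::real_normed_vector" and R :: "'a::real_normed_vector \<Rightarrow>\<^sub>L 'b"
  assumes "compact_operator L"
  shows "compact_operator (L o\<^sub>L R)"
  unfolding compact_operator_def
proof (intro allI impI)
  fix S :: "'a set" assume "bounded S"
  then have "bounded (blinfun_apply R ` S)" by (rule bounded_linear_image) (rule blinfun.bounded_linear_right)
  then have "compact (closure (L ` R ` S))" using assms unfolding compact_operator_def by blast
  then show "compact (closure ((L o\<^sub>L R) ` S))" by (simp add: image_image)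
qed

lemma compact_operator_scaleR:
  fixes L :: "'a::real_normed_vector \<Rightarrow>\<^sub>L 'b::real_normed_vector"
  assumes "compact_operator L"
  shows "compact_operator (c *\<^sub>R L)"
  unfolding compact_operator_def
proof (intro allI impI)
  fix S :: "'a set" assume "bounded S"
  then have "compact (closure (L ` S))" using assms unfolding compact_operator_def by blast
  then have c: "compact ((*\<^sub>R) c ` closure (L ` S))" by (rule compact_scaling)
  show "compact (closure ((c *\<^sub>R L) ` S))"
  proof (rule precompact_subset)
    show "compact (closure ((*\<^sub>R) c ` closure (L ` S)))" using c by (simp add: compact_imp_closed closure_closed)
    show "(c *\<^sub>R L) ` S \<subseteq> (*\<^sub>R) c ` closure (L ` S)"
      using closure_subset[of "L ` S"] by (auto simp: blinfun.scaleR_left)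
  qed
qed

text \<open>The images of a bounded set under \<open>P\<close> and under a close \<open>Q\<close> are uniformly close, and a set that can be
  approximated uniformly by relatively compact sets is relatively compact.\<close>

lemma compact_operator_limit:
  fixes P :: "'a::real_normed_vector \<Rightarrow>\<^sub>L 'b::banach"
  assumes "\<And>e. e > 0 \<Longrightarrow> \<exists>Q. compact_operator Q \<and> norm (P - Q) \<le> e"
  shows "compact_operator P"
  unfolding compact_operator_def
proof (intro allI impI)
  fix S :: "'a set" assume S: "bounded S"
  then obtain b where b: "b > 0" "\<And>x. x \<in> S \<Longrightarrow> norm x \<le> b" unfolding bounded_pos by blast
  show "compact (closure (P ` S))"
  proof (rule precompact_approximation)
    fix e :: real assume e: "e > 0"
    then obtain Q where Q: "compact_operator Q" "norm (P - Q) \<le> e / b" using assms[of "e / b"] b by auto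
    have "dist (P x) (Q x) \<le> e" if "x \<in> S" for x
    proof -
      have "dist (P x) (Q x) \<le> norm (P - Q) * norm x"
        unfolding dist_norm blinfun.diff_left[symmetric] by (rule norm_blinfun)
      also have "\<dots> \<le> e / b * b" using Q(2) b(2)[OF that] e b(1) by (intro mult_mono) auto
      finally show ?thesis using b by simp
    qed
    then show "\<exists>Y. compact (closure Y) \<and> (\<forall>x\<in>P ` S. \<exists>y\<in>Y. dist x y \<le> e)"
      using Q(1) S unfolding compact_operator_def by (intro exI[of _ "Q ` S"]) blast
  qed
qed

lemma borel_imp_lebesgue_on_measurable:
  "f \<in> borel_measurable borel \<Longrightarrow> f \<in> borel_measurable (lebesgue_on S)"
  by (intro measurable_restrict_space1 measurable_completion) (simp add: measurable_lborel1)

text \<open>Operator-valued functions need not be measurable into the operator norm, whose space is not separable;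
  the integral is therefore formed pointwise and reassembled into an operator.\<close>

lemma strong_operator_integral:
  fixes U :: "'w \<Rightarrow> 'a::real_normed_vector \<Rightarrow>\<^sub>L 'b::{banach, second_countable_topology}"
  assumes meas: "\<And>x. (\<lambda>w. U w x) \<in> borel_measurable N"
    and bnd: "\<And>w. w \<in> space N \<Longrightarrow> norm (U w) \<le> u w" and u: "integrable N u"
  obtains Q where "\<And>x. integrable N (\<lambda>w. U w x)" "\<And>x. blinfun_apply Q x = (LINT w|N. U w x)"
    "norm Q \<le> (LINT w|N. u w)"
proof -
  have le: "norm (U w x) \<le> norm x * u w" if "w \<in> space N" for w x
    using norm_blinfun[of "U w" x] mult_right_mono[OF bnd[OF that], of "norm x"] by (simp add: mult.commute)
  have int: "integrable N (\<lambda>w. U w x)" for x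
    by (rule Bochner_Integration.integrable_bound[where f = "\<lambda>w. norm x * u w"])
       (use u meas le in \<open>auto intro!: AE_I2 intro: order_trans[OF _ abs_ge_self]\<close>)
  have nb: "norm (LINT w|N. U w x) \<le> norm x * (LINT w|N. u w)" for x
  proof -
    have "norm (LINT w|N. U w x) \<le> (LINT w|N. norm (U w x))" by (rule integral_norm_bound)
    also have "\<dots> \<le> (LINT w|N. norm x * u w)" using le int u by (intro integral_mono) auto
    finally show ?thesis by simp
  qed
  have "bounded_linear (\<lambda>x. LINT w|N. U w x)"
    by (rule bounded_linear_intro[OF _ _ nb])
       (simp_all add: blinfun.add_right blinfun.scaleR_right int)
  then have app: "blinfun_apply (Blinfun (\<lambda>x. LINT w|N. U w x)) x = (LINT w|N. U w x)" for x
    by (simp add: bounded_linear_Blinfun_apply)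
  show ?thesis
  proof (rule that[OF int app])
    have "0 \<le> (LINT w|N. u w)" using bnd by (intro integral_nonneg_AE AE_I2) (auto intro: order_trans[OF norm_ge_zero])
    then show "norm (Blinfun (\<lambda>x. LINT w|N. U w x)) \<le> (LINT w|N. u w)"
      using nb by (intro norm_blinfun_bound) (auto simp: app mult.commute)
  qed
qed

text \<open>Existential form, so that one operator can be chosen for each value of a parameter.\<close>

lemma strong_operator_integral_ex:
  fixes U :: "'w \<Rightarrow> 'a::real_normed_vector \<Rightarrow>\<^sub>L 'b::{banach, second_countable_topology}"
  assumes meas: "\<And>x. (\<lambda>w. U w x) \<in> borel_measurable N"
    and bnd: "\<And>w. w \<in> space N \<Longrightarrow> norm (U w) \<le> u w" and u: "integrable N u"
  shows "\<exists>Q. (\<forall>x. integrable N (\<lambda>w. U w x)) \<and> (\<forall>x. blinfun_apply Q x = (LINT w|N. U w x)) \<and>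
    norm Q \<le> (LINT w|N. u w)"
  by (rule strong_operator_integral[of U N u, OF assms]) blast+

lemma integrable_linear_exponential:
  "integrable (lebesgue_on {0..}) (\<lambda>\<theta>::real. \<theta> * exp (- \<theta>))"
proof -
  have "set_integrable lborel {0<..} (\<lambda>t::real. t powr (2 - 1) * exp (- (1 * t)))"
    by (rule set_integrable_Gamma_kernel) auto
  then have "integrable lborel (\<lambda>t::real. indicator {0..} t *\<^sub>R (t * exp (- t)))"
    unfolding set_integrable_def
    by (rule Bochner_Integration.integrable_cong[THEN iffD1, rotated -1]) (auto simp: indicator_def)
  then have "integrable lebesgue (\<lambda>t::real. indicator {0..} t *\<^sub>R (t * exp (- t)))"
    by (subst integrable_completion) auto
  then show ?thesis by (subst integrable_restrict_space) auto
qed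

text \<open>The decay of the Mainardi function gives a majorant \<open>u\<close> of the operator norms that is independent of
  \<open>\<tau>\<close>. Continuity in norm follows from dominated convergence. For compactness, the part of the integral over
  \<open>\<theta> \<ge> \<eta>\<close> factors through the compact operator \<open>T (\<tau>\<^sup>\<alpha> \<eta>)\<close>, and the
  rest tends to 0 in norm with \<open>\<eta>\<close>.\<close>

lemma Mainardi_average_compact_semigroup:
  fixes T :: "real \<Rightarrow> 'a::{banach, second_countable_topology} \<Rightarrow>\<^sub>L 'a"
  assumes T: "C0_semigroup T" and compact: "\<And>t. t > 0 \<Longrightarrow> compact_operator (T t)"
    and \<alpha>: "1/2 < \<alpha>" "\<alpha> < 1" and \<tau>m: "\<tau>m > 0"
  obtains P C where "0 \<le> C" "\<And>\<tau>. 0 < \<tau> \<Longrightarrow> \<tau> \<le> \<tau>m \<Longrightarrow> norm (P \<tau>) \<le> C"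
    "\<And>\<tau> x. 0 < \<tau> \<Longrightarrow> \<tau> \<le> \<tau>m \<Longrightarrow> P_op T \<alpha> \<tau> x = blinfun_apply (P \<tau>) x"
    "continuous_on {0<..\<tau>m} P" "\<And>\<tau>. 0 < \<tau> \<Longrightarrow> \<tau> \<le> \<tau>m \<Longrightarrow> compact_operator (P \<tau>)"
proof -
  let ?N = "lebesgue_on {0::real..}"
  obtain C1 \<omega> where C1: "1 \<le> C1" "0 \<le> \<omega>" "\<And>t. 0 \<le> t \<Longrightarrow> norm (T t) \<le> C1 * exp (\<omega> * t)"
    by (rule semigroup_exponential_bound[OF T], rule that)
  \<comment> \<open>the rate that beats the growth of \<open>T (\<tau>\<^sup>\<alpha> \<theta>)\<close> for all \<open>\<tau> \<le> \<tau>m\<close> and leaves \<open>exp (- \<theta>)\<close>\<close>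
  define R where "R = \<omega> * \<tau>m powr \<alpha> + 1"
  have R0: "0 \<le> R" using C1 by (simp add: R_def)
  obtain C2 where C2: "0 \<le> C2" "\<And>\<theta>. 0 \<le> \<theta> \<Longrightarrow> \<bar>mainardi \<alpha> \<theta>\<bar> \<le> C2 * exp (- R * \<theta>)"
    by (rule mainardi_exponential_decay[OF \<alpha> R0], rule that)
  define k where "k \<theta> = \<alpha> * \<theta> * mainardi \<alpha> \<theta>" for \<theta>
  have kc: "continuous_on UNIV k"
    unfolding k_def using mainardi_continuous[of \<alpha>] \<alpha> by (intro continuous_intros) auto
  define A where "A = \<alpha> * C1 * C2"
  have A0: "0 \<le> A" using \<alpha> C1 C2 by (simp add: A_def)
  define u where "u \<theta> = A * (\<theta> * exp (- \<theta>))" for \<theta> :: real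
  have u0: "0 \<le> u \<theta>" if "0 \<le> \<theta>" for \<theta> using that A0 by (simp add: u_def)
  have ui: "integrable ?N u" unfolding u_def using integrable_linear_exponential by simp
  have bound: "norm (k \<theta> *\<^sub>R T s) \<le> u \<theta>" if "0 \<le> \<theta>" "0 \<le> s" "s \<le> \<tau>m powr \<alpha> * \<theta>" for \<theta> s
  proof -
    have "norm (k \<theta> *\<^sub>R T s) = \<alpha> * \<theta> * \<bar>mainardi \<alpha> \<theta>\<bar> * norm (T s)" using that \<alpha> by (simp add: k_def abs_mult)
    also have "\<dots> \<le> \<alpha> * \<theta> * (C2 * exp (- R * \<theta>)) * (C1 * exp (\<omega> * s))"
      using that \<alpha> C1 C2 by (intro mult_mono) auto
    also have "\<dots> = \<alpha> * C1 * C2 * \<theta> * exp (\<omega> * s - R * \<theta>)"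
      by (simp add: exp_diff exp_minus field_simps)
    also have "\<dots> \<le> \<alpha> * C1 * C2 * \<theta> * exp (- \<theta>)"
    proof -
      have "\<omega> * s \<le> \<omega> * (\<tau>m powr \<alpha> * \<theta>)" using that C1 by (intro mult_left_mono) auto
      then have "\<omega> * s - R * \<theta> \<le> - \<theta>" by (simp add: R_def algebra_simps)
      then show ?thesis using that \<alpha> C1 C2 by (intro mult_left_mono) auto
    qed
    finally show ?thesis by (simp add: u_def A_def)
  qed
  have arg_le: "\<tau> powr \<alpha> * \<theta> \<le> \<tau>m powr \<alpha> * \<theta>" if "0 < \<tau>" "\<tau> \<le> \<tau>m" "0 \<le> \<theta>" for \<tau> \<theta>
    using that \<alpha> by (intro mult_right_mono powr_mono2) auto
  have meas: "(\<lambda>\<theta>. (k \<theta> *\<^sub>R T (c * \<theta>)) x) \<in> borel_measurable ?N" if "0 \<le> c" for c x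
  proof (rule continuous_imp_measurable_on_sets_lebesgue)
    show "continuous_on {0..} (\<lambda>\<theta>. (k \<theta> *\<^sub>R T (c * \<theta>)) x)"
      unfolding blinfun.scaleR_left
      using that by (intro continuous_intros continuous_on_subset[OF kc] continuous_on_compose2[OF semigroup_continuous[OF T]]) auto
  qed auto
  define good where "good \<tau> Q \<longleftrightarrow> (\<forall>x. integrable ?N (\<lambda>\<theta>. (k \<theta> *\<^sub>R T (\<tau> powr \<alpha> * \<theta>)) x)) \<and>
      (\<forall>x. blinfun_apply Q x = (LINT \<theta>|?N. (k \<theta> *\<^sub>R T (\<tau> powr \<alpha> * \<theta>)) x)) \<and>
      norm Q \<le> (LINT \<theta>|?N. u \<theta>)" for \<tau> Q
  have "\<forall>\<tau>\<in>{0<..\<tau>m}. \<exists>Q. good \<tau> Q"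
  proof
    fix \<tau> assume "\<tau> \<in> {0<..\<tau>m}"
    then have \<tau>: "0 < \<tau>" "\<tau> \<le> \<tau>m" by auto
    show "\<exists>Q. good \<tau> Q"
      unfolding good_def
    proof (rule strong_operator_integral_ex[OF meas _ ui])
      show "norm (k \<theta> *\<^sub>R T (\<tau> powr \<alpha> * \<theta>)) \<le> u \<theta>" if "\<theta> \<in> space ?N" for \<theta>
        using that \<tau> by (intro bound arg_le) auto
    qed simp
  qed
  from bchoice[OF this] obtain P where good: "\<forall>\<tau>\<in>{0<..\<tau>m}. good \<tau> (P \<tau>)" ..
  have Pi: "integrable ?N (\<lambda>\<theta>. (k \<theta> *\<^sub>R T (\<tau> powr \<alpha> * \<theta>)) x)"
    and P: "blinfun_apply (P \<tau>) x = (LINT \<theta>|?N. (k \<theta> *\<^sub>R T (\<tau> powr \<alpha> * \<theta>)) x)"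
    and Pn: "norm (P \<tau>) \<le> (LINT \<theta>|?N. u \<theta>)" if "0 < \<tau>" "\<tau> \<le> \<tau>m" for \<tau> x
    using good that unfolding good_def by auto
  show ?thesis
  proof (rule that[of "LINT \<theta>|?N. u \<theta>" P])
    show "0 \<le> (LINT \<theta>|?N. u \<theta>)" using u0 by (intro integral_nonneg_AE AE_I2) auto
    show "norm (P \<tau>) \<le> (LINT \<theta>|?N. u \<theta>)" if "0 < \<tau>" "\<tau> \<le> \<tau>m" for \<tau> by (rule Pn[OF that])
    show "P_op T \<alpha> \<tau> x = blinfun_apply (P \<tau>) x" if "0 < \<tau>" "\<tau> \<le> \<tau>m" for \<tau> x
      using P[OF that] \<alpha> by (simp add: P_op_def bochner_integral_eq_library k_def blinfun.scaleR_left)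
    show "continuous_on {0<..\<tau>m} P"
      unfolding continuous_on_sequentially
    proof (intro allI ballI impI, elim conjE)
      fix X \<tau> assume \<tau>: "\<tau> \<in> {0<..\<tau>m}" and X: "\<forall>n. X n \<in> {0<..\<tau>m}" and lim: "X \<longlonglongrightarrow> \<tau>"
      define v where "v n \<theta> = norm (k \<theta> *\<^sub>R T (X n powr \<alpha> * \<theta>) - k \<theta> *\<^sub>R T (\<tau> powr \<alpha> * \<theta>))" for n \<theta>
      have vc: "continuous_on {0<..} (v n)" for n
        unfolding v_def using X[rule_format, of n] \<tau>
        by (intro continuous_intros continuous_on_subset[OF kc] continuous_on_compose2[OF compact_semigroup_norm_continuous[OF T compact]]) auto
      have vm: "v n \<in> borel_measurable ?N" for n
      proof -
        have "(\<lambda>\<theta>. indicator {0<..} \<theta> *\<^sub>R v n \<theta>) \<in> borel_measurable borel"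
          by (intro borel_measurable_continuous_on_indicator vc) auto
        then have "(\<lambda>\<theta>. indicator {0<..} \<theta> *\<^sub>R v n \<theta>) \<in> borel_measurable ?N"
          by (rule borel_imp_lebesgue_on_measurable)
        then show ?thesis
          by (rule measurable_cong[THEN iffD1, rotated]) (auto simp: v_def k_def indicator_def)
      qed
      have vb: "v n \<theta> \<le> 2 * u \<theta>" if "0 \<le> \<theta>" for n \<theta>
      proof -
        have "v n \<theta> \<le> norm (k \<theta> *\<^sub>R T (X n powr \<alpha> * \<theta>)) + norm (k \<theta> *\<^sub>R T (\<tau> powr \<alpha> * \<theta>))"
          unfolding v_def by (rule norm_triangle_ineq4)
        also have "\<dots> \<le> u \<theta> + u \<theta>"
          using X \<tau> that by (intro add_mono bound arg_le) auto
        finally show ?thesis by simp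
      qed
      have v0: "0 \<le> v n \<theta>" for n \<theta> by (simp add: v_def)
      have vi: "integrable ?N (v n)" for n
        by (rule Bochner_Integration.integrable_bound[where f = "\<lambda>\<theta>. 2 * u \<theta>"])
           (use ui vm vb v0 u0 in \<open>auto intro!: AE_I2\<close>)
      have "(\<lambda>n. LINT \<theta>|?N. v n \<theta>) \<longlonglongrightarrow> (LINT \<theta>|?N. 0)"
      proof (rule integral_dominated_convergence[where w = "\<lambda>\<theta>. 2 * u \<theta>"])
        show "AE \<theta> in ?N. (\<lambda>n. v n \<theta>) \<longlonglongrightarrow> 0"
        proof (rule AE_I2)
          fix \<theta> :: real assume "\<theta> \<in> space ?N"
          then have \<theta>: "0 \<le> \<theta>" by simp
          show "(\<lambda>n. v n \<theta>) \<longlonglongrightarrow> 0"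
          proof (cases "\<theta> = 0")
            case True
            then show ?thesis by (simp add: v_def k_def)
          next
            case False
            have "(\<lambda>n. X n powr \<alpha> * \<theta>) \<longlonglongrightarrow> \<tau> powr \<alpha> * \<theta>"
              using \<tau> by (intro tendsto_intros lim) auto
            then have "(\<lambda>n. T (X n powr \<alpha> * \<theta>)) \<longlonglongrightarrow> T (\<tau> powr \<alpha> * \<theta>)"
              using X[THEN spec, THEN greaterThanAtMost_iff[THEN iffD1], THEN conjunct1] \<tau> False \<theta>
              by (intro continuous_on_tendsto_compose[OF compact_semigroup_norm_continuous[OF T compact]])
                 (auto intro!: always_eventually mult_pos_pos simp: less_imp_neq[symmetric])
            then have "(\<lambda>n. v n \<theta>) \<longlonglongrightarrow> norm (k \<theta> *\<^sub>R T (\<tau> powr \<alpha> * \<theta>) - k \<theta> *\<^sub>R T (\<tau> powr \<alpha> * \<theta>))"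
              unfolding v_def by (intro tendsto_intros)
            then show ?thesis by simp
          qed
        qed
      qed (use ui vm vb v0 in auto)
      then have vlim: "(\<lambda>n. LINT \<theta>|?N. v n \<theta>) \<longlonglongrightarrow> 0" by simp
      have "norm (P (X n) - P \<tau>) \<le> (LINT \<theta>|?N. v n \<theta>)" for n
      proof (rule norm_blinfun_bound)
        have Xn: "0 < X n" "X n \<le> \<tau>m" using X by auto
        have \<tau>': "0 < \<tau>" "\<tau> \<le> \<tau>m" using \<tau> by auto
        show "0 \<le> (LINT \<theta>|?N. v n \<theta>)" using v0 by (intro integral_nonneg_AE AE_I2)
        fix x
        have "(P (X n) - P \<tau>) x = (LINT \<theta>|?N. (k \<theta> *\<^sub>R T (X n powr \<alpha> * \<theta>)) x - (k \<theta> *\<^sub>R T (\<tau> powr \<alpha> * \<theta>)) x)"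
          unfolding blinfun.diff_left P[OF Xn] P[OF \<tau>']
          by (rule Bochner_Integration.integral_diff[symmetric, OF Pi[OF Xn] Pi[OF \<tau>']])
        also have "norm \<dots> \<le> (LINT \<theta>|?N. norm ((k \<theta> *\<^sub>R T (X n powr \<alpha> * \<theta>)) x - (k \<theta> *\<^sub>R T (\<tau> powr \<alpha> * \<theta>)) x))"
          by (rule integral_norm_bound)
        also have "\<dots> \<le> (LINT \<theta>|?N. v n \<theta> * norm x)"
        proof (rule integral_mono)
          show "integrable ?N (\<lambda>\<theta>. norm ((k \<theta> *\<^sub>R T (X n powr \<alpha> * \<theta>)) x - (k \<theta> *\<^sub>R T (\<tau> powr \<alpha> * \<theta>)) x))"
            by (intro integrable_norm Bochner_Integration.integrable_diff Pi[OF Xn] Pi[OF \<tau>'])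
          show "integrable ?N (\<lambda>\<theta>. v n \<theta> * norm x)" using vi by simp
          show "norm ((k \<theta> *\<^sub>R T (X n powr \<alpha> * \<theta>)) x - (k \<theta> *\<^sub>R T (\<tau> powr \<alpha> * \<theta>)) x) \<le> v n \<theta> * norm x" for \<theta>
            unfolding v_def blinfun.diff_left[symmetric] by (rule norm_blinfun)
        qed
        finally show "norm ((P (X n) - P \<tau>) x) \<le> (LINT \<theta>|?N. v n \<theta>) * norm x" by simp
      qed
      then have "(\<lambda>n. P (X n) - P \<tau>) \<longlonglongrightarrow> 0"
        by (intro Lim_null_comparison[OF _ vlim] always_eventually) auto
      then show "(P \<circ> X) \<longlonglongrightarrow> P \<tau>" unfolding o_def by (rule Lim_null[THEN iffD2])
    qed
    show "compact_operator (P \<tau>)" if \<tau>: "0 < \<tau>" "\<tau> \<le> \<tau>m" for \<tau>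
    proof (rule compact_operator_limit)
      fix e :: real assume e: "e > 0"
      have "(\<lambda>n. LINT \<theta>|?N. indicator {0..<inverse (real (Suc n))} \<theta> * u \<theta>) \<longlonglongrightarrow> (LINT \<theta>|?N. 0)"
      proof (rule integral_dominated_convergence[where w = u])
        show "AE \<theta> in ?N. (\<lambda>n. indicator {0..<inverse (real (Suc n))} \<theta> * u \<theta>) \<longlonglongrightarrow> 0"
        proof (rule AE_I2)
          fix \<theta> :: real assume "\<theta> \<in> space ?N"
          then have \<theta>: "0 \<le> \<theta>" by simp
          show "(\<lambda>n. indicator {0..<inverse (real (Suc n))} \<theta> * u \<theta>) \<longlonglongrightarrow> 0"
          proof (cases "\<theta> = 0")
            case False
            then obtain n0 where n0: "inverse (real (Suc n0)) < \<theta>" using reals_Archimedean[of \<theta>] \<theta> by auto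
            have "indicator {0..<inverse (real (Suc n))} \<theta> * u \<theta> = 0" if "n \<ge> n0" for n
            proof -
              have "inverse (real (Suc n)) \<le> inverse (real (Suc n0))" using that by (simp add: le_imp_inverse_le)
              then have "inverse (real (Suc n)) < \<theta>" using n0 by linarith
              then show ?thesis by (auto simp: indicator_def simp del: of_nat_Suc)
            qed
            then show ?thesis by (intro tendsto_eventually) (auto simp: eventually_sequentially)
          qed (simp add: u_def)
        qed
        show "(\<lambda>\<theta>. indicator {0..<inverse (real (Suc n))} \<theta> * u \<theta>) \<in> borel_measurable ?N" for n
          by (intro borel_measurable_times borel_measurable_indicator') (auto simp: sets_restrict_space intro: borel_measurable_integrable[OF ui])
        show "AE \<theta> in ?N. norm (indicator {0..<inverse (real (Suc n))} \<theta> * u \<theta>) \<le> u \<theta>" for n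
        proof (rule AE_I2)
          fix \<theta> :: real assume "\<theta> \<in> space ?N"
          then have "0 \<le> u \<theta>" using u0 by simp
          then show "norm (indicator {0..<inverse (real (Suc n))} \<theta> * u \<theta>) \<le> u \<theta>"
            by (cases "\<theta> \<in> {0..<inverse (real (Suc n))}") (simp_all only: indicator_simps, simp_all)
        qed
      qed (simp_all add: ui)
      then have "eventually (\<lambda>n. (LINT \<theta>|?N. indicator {0..<inverse (real (Suc n))} \<theta> * u \<theta>) < e) sequentially"
        using e by (intro order_tendstoD(2)) auto
      then obtain n where n: "(LINT \<theta>|?N. indicator {0..<inverse (real (Suc n))} \<theta> * u \<theta>) < e"
        by (auto simp: eventually_sequentially)
      define \<eta> where "\<eta> = inverse (real (Suc n))"
      have \<eta>: "\<eta> > 0" by (simp add: \<eta>_def)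
      define c where "c = \<tau> powr \<alpha>"
      have c: "c > 0" using \<tau> by (simp add: c_def)
      \<comment> \<open>\<open>S1\<close> is the part over \<open>\<theta> \<ge> \<eta>\<close> with the factor \<open>T (c \<eta>)\<close> split off, \<open>S2\<close> the remaining part\<close>
      define S1 where "S1 \<theta> = (indicator {\<eta>..} \<theta> :: real) *\<^sub>R (k \<theta> *\<^sub>R T (c * \<theta> - c * \<eta>))" for \<theta>
      define S2 where "S2 \<theta> = (indicator {0..<\<eta>} \<theta> :: real) *\<^sub>R (k \<theta> *\<^sub>R T (c * \<theta>))" for \<theta>
      have ind1: "(indicator {\<eta>..} :: real \<Rightarrow> real) \<in> borel_measurable ?N"
        and ind2: "(indicator {0..<\<eta>} :: real \<Rightarrow> real) \<in> borel_measurable ?N"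
        by (auto intro!: borel_imp_lebesgue_on_measurable)
      have "\<exists>Q. (\<forall>x. integrable ?N (\<lambda>\<theta>. S1 \<theta> x)) \<and> (\<forall>x. blinfun_apply Q x = (LINT \<theta>|?N. S1 \<theta> x)) \<and>
        norm Q \<le> (LINT \<theta>|?N. u \<theta>)"
      proof (rule strong_operator_integral_ex)
        fix x
        have "(\<lambda>\<theta>. k \<theta> *\<^sub>R T (max 0 (c * \<theta> - c * \<eta>)) x) \<in> borel_measurable ?N"
          by (intro continuous_imp_measurable_on_sets_lebesgue continuous_intros continuous_on_subset[OF kc]
              continuous_on_compose2[OF semigroup_continuous[OF T]]) auto
        then have "(\<lambda>\<theta>. indicator {\<eta>..} \<theta> *\<^sub>R (k \<theta> *\<^sub>R T (max 0 (c * \<theta> - c * \<eta>)) x)) \<in> borel_measurable ?N"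
          by (rule borel_measurable_scaleR[OF ind1])
        moreover have "max 0 (c * \<theta> - c * \<eta>) = c * \<theta> - c * \<eta>" if "\<eta> \<le> \<theta>" for \<theta> using that c by simp
        ultimately show "(\<lambda>\<theta>. S1 \<theta> x) \<in> borel_measurable ?N"
          by (elim measurable_cong[THEN iffD1, rotated]) (auto simp: S1_def blinfun.scaleR_left indicator_def)
      next
        fix \<theta> assume "\<theta> \<in> space ?N"
        then have \<theta>: "0 \<le> \<theta>" by simp
        show "norm (S1 \<theta>) \<le> u \<theta>"
        proof (cases "\<eta> \<le> \<theta>")
          case True
          have "norm (k \<theta> *\<^sub>R T (c * \<theta> - c * \<eta>)) \<le> u \<theta>"
          proof (rule bound[OF \<theta>])
            show "0 \<le> c * \<theta> - c * \<eta>" using True c by simp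
            have "c * \<theta> - c * \<eta> \<le> c * \<theta>" using c \<eta> by simp
            then show "c * \<theta> - c * \<eta> \<le> \<tau>m powr \<alpha> * \<theta>" using arg_le[OF \<tau> \<theta>] unfolding c_def by linarith
          qed
          then show ?thesis using True by (simp add: S1_def)
        qed (use u0[OF \<theta>] in \<open>simp add: S1_def\<close>)
      qed (rule ui)
      then obtain Q1 where Q1: "\<And>x. integrable ?N (\<lambda>\<theta>. S1 \<theta> x)" "\<And>x. blinfun_apply Q1 x = (LINT \<theta>|?N. S1 \<theta> x)"
        by blast
      have "\<exists>Q. (\<forall>x. integrable ?N (\<lambda>\<theta>. S2 \<theta> x)) \<and> (\<forall>x. blinfun_apply Q x = (LINT \<theta>|?N. S2 \<theta> x)) \<and>
        norm Q \<le> (LINT \<theta>|?N. indicator {0..<\<eta>} \<theta> * u \<theta>)"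
      proof (rule strong_operator_integral_ex)
        show "(\<lambda>\<theta>. S2 \<theta> x) \<in> borel_measurable ?N" for x
          using borel_measurable_scaleR[OF ind2 meas[of c x]] c by (simp add: S2_def blinfun.scaleR_left)
        show "norm (S2 \<theta>) \<le> indicator {0..<\<eta>} \<theta> * u \<theta>" if "\<theta> \<in> space ?N" for \<theta>
          using bound[of \<theta> "c * \<theta>"] arg_le[OF \<tau>, of \<theta>] c that by (auto simp: S2_def c_def indicator_def)
        show "integrable ?N (\<lambda>\<theta>. indicator {0..<\<eta>} \<theta> * u \<theta>)"
        proof (rule Bochner_Integration.integrable_bound[OF ui])
          show "(\<lambda>\<theta>. indicator {0..<\<eta>} \<theta> * u \<theta>) \<in> borel_measurable ?N"
            by (rule borel_measurable_times[OF ind2 borel_measurable_integrable[OF ui]])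
          show "AE \<theta> in ?N. norm (indicator {0..<\<eta>} \<theta> * u \<theta>) \<le> norm (u \<theta>)"
            by (rule AE_I2) (simp add: abs_mult mult_left_le_one_le)
        qed
      qed
      then obtain Q2 where Q2: "\<And>x. integrable ?N (\<lambda>\<theta>. S2 \<theta> x)" "\<And>x. blinfun_apply Q2 x = (LINT \<theta>|?N. S2 \<theta> x)"
        "norm Q2 \<le> (LINT \<theta>|?N. indicator {0..<\<eta>} \<theta> * u \<theta>)" by blast
      have "P \<tau> x - (T (c * \<eta>) o\<^sub>L Q1) x = Q2 x" for x
      proof -
        have "(T (c * \<eta>) o\<^sub>L Q1) x = (LINT \<theta>|?N. T (c * \<eta>) (S1 \<theta> x))"
          using Q1 by (simp add: integral_bounded_linear[OF blinfun.bounded_linear_right])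
        moreover have "P \<tau> x = (LINT \<theta>|?N. (k \<theta> *\<^sub>R T (c * \<theta>)) x)"
          and ic: "integrable ?N (\<lambda>\<theta>. (k \<theta> *\<^sub>R T (c * \<theta>)) x)"
          unfolding c_def by (rule P[OF \<tau>] Pi[OF \<tau>])+
        ultimately have "P \<tau> x - (T (c * \<eta>) o\<^sub>L Q1) x = (LINT \<theta>|?N. (k \<theta> *\<^sub>R T (c * \<theta>)) x - T (c * \<eta>) (S1 \<theta> x))"
          by (simp only: Bochner_Integration.integral_diff[OF ic integrable_bounded_linear[OF blinfun.bounded_linear_right Q1(1)]])
        also have "\<dots> = (LINT \<theta>|?N. S2 \<theta> x)"
        proof (rule Bochner_Integration.integral_cong[OF refl])
          fix \<theta> assume "\<theta> \<in> space ?N"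
          then have \<theta>: "0 \<le> \<theta>" by simp
          show "(k \<theta> *\<^sub>R T (c * \<theta>)) x - T (c * \<eta>) (S1 \<theta> x) = S2 \<theta> x"
          proof (cases "\<eta> \<le> \<theta>")
            case True
            have "T (c * \<theta>) = T (c * \<eta>) o\<^sub>L T (c * \<theta> - c * \<eta>)"
              using semigroup_add[OF T, of "c * \<eta>" "c * \<theta> - c * \<eta>"] True c \<eta> by simp
            then show ?thesis using True by (simp add: S1_def S2_def blinfun.scaleR_left blinfun.scaleR_right)
          next
            case False
            then show ?thesis using \<theta> by (simp add: S1_def S2_def)
          qed
        qed
        finally show ?thesis using Q2 by simp
      qed
      then have "P \<tau> - (T (c * \<eta>) o\<^sub>L Q1) = Q2" by (intro blinfun_eqI) (simp add: blinfun.diff_left)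
      then have "norm (P \<tau> - (T (c * \<eta>) o\<^sub>L Q1)) \<le> e" using Q2(3) n by (simp add: \<eta>_def)
      moreover have "compact_operator (T (c * \<eta>) o\<^sub>L Q1)"
        using c \<eta> by (intro compact_operator_comp compact) auto
      ultimately show "\<exists>Q. compact_operator Q \<and> norm (P \<tau> - Q) \<le> e" by blast
    qed
  qed
qed

text \<open>What the integral terms of a mild solution depend on: an
  integrable singularity at 0, continuity in norm, and compactness.\<close>

theorem K_op_compact_family:
  fixes T :: "real \<Rightarrow> 'a::{banach, second_countable_topology} \<Rightarrow>\<^sub>L 'a"
  assumes T: "C0_semigroup T" and compact: "\<And>t. t > 0 \<Longrightarrow> compact_operator (T t)"
    and \<alpha>: "1/2 < \<alpha>" "\<alpha> \<le> 1" and \<tau>m: "\<tau>m > 0"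
  obtains K C where "0 \<le> C" "\<And>\<tau>. 0 < \<tau> \<Longrightarrow> \<tau> \<le> \<tau>m \<Longrightarrow> norm (K \<tau>) \<le> C * \<tau> powr (\<alpha> - 1)"
    "\<And>\<tau> x. 0 < \<tau> \<Longrightarrow> \<tau> \<le> \<tau>m \<Longrightarrow> K_op T \<alpha> \<tau> x = blinfun_apply (K \<tau>) x"
    "continuous_on {0<..\<tau>m} K" "\<And>\<tau>. 0 < \<tau> \<Longrightarrow> \<tau> \<le> \<tau>m \<Longrightarrow> compact_operator (K \<tau>)"
proof -
  have "\<exists>P C. 0 \<le> C \<and> (\<forall>\<tau>. 0 < \<tau> \<longrightarrow> \<tau> \<le> \<tau>m \<longrightarrow> norm (P \<tau>) \<le> C \<and> compact_operator (P \<tau>) \<and>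
      (\<forall>x. P_op T \<alpha> \<tau> x = blinfun_apply (P \<tau>) x)) \<and> continuous_on {0<..\<tau>m} P"
  proof (cases "\<alpha> = 1")
    case True
    obtain C1 \<omega> where C1: "1 \<le> C1" "0 \<le> \<omega>" "\<And>t. 0 \<le> t \<Longrightarrow> norm (T t) \<le> C1 * exp (\<omega> * t)"
      by (rule semigroup_exponential_bound[OF T], rule that)
    have "norm (T \<tau>) \<le> C1 * exp (\<omega> * \<tau>m)" if "0 < \<tau>" "\<tau> \<le> \<tau>m" for \<tau>
    proof -
      have "norm (T \<tau>) \<le> C1 * exp (\<omega> * \<tau>)" using C1 that by simp
      also have "\<dots> \<le> C1 * exp (\<omega> * \<tau>m)" using that C1 by (intro mult_left_mono) (auto intro: mult_left_mono)
      finally show ?thesis .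
    qed
    moreover have "continuous_on {0<..\<tau>m} T"
      by (rule continuous_on_subset[OF compact_semigroup_norm_continuous[OF T compact]]) auto
    ultimately show ?thesis
      using True compact C1 by (intro exI[of _ T] exI[of _ "C1 * exp (\<omega> * \<tau>m)"]) (auto simp: P_op_def)
  next
    case False
    then have "\<alpha> < 1" using \<alpha> by simp
    show ?thesis
      by (rule Mainardi_average_compact_semigroup[OF T compact \<alpha>(1) \<open>\<alpha> < 1\<close> \<tau>m]) blast+
  qed
  then obtain P C where C: "0 \<le> C" and PC: "\<forall>\<tau>. 0 < \<tau> \<longrightarrow> \<tau> \<le> \<tau>m \<longrightarrow> norm (P \<tau>) \<le> C \<and> compact_operator (P \<tau>) \<and>
      (\<forall>x. P_op T \<alpha> \<tau> x = blinfun_apply (P \<tau>) x)" and Pcont: "continuous_on {0<..\<tau>m} P"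
    by (elim exE conjE)
  have Pn: "norm (P \<tau>) \<le> C" and Pc: "compact_operator (P \<tau>)" and Pa: "P_op T \<alpha> \<tau> x = blinfun_apply (P \<tau>) x"
    if "0 < \<tau>" "\<tau> \<le> \<tau>m" for \<tau> x
    using PC that by blast+
  show ?thesis
  proof (rule that[of C "\<lambda>\<tau>. \<tau> powr (\<alpha> - 1) *\<^sub>R P \<tau>"])
    show "norm (\<tau> powr (\<alpha> - 1) *\<^sub>R P \<tau>) \<le> C * \<tau> powr (\<alpha> - 1)" if "0 < \<tau>" "\<tau> \<le> \<tau>m" for \<tau>
      using Pn[OF that] by (simp add: mult.commute mult_right_mono)
    show "continuous_on {0<..\<tau>m} (\<lambda>\<tau>. \<tau> powr (\<alpha> - 1) *\<^sub>R P \<tau>)"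
      by (intro continuous_intros Pcont) auto
  qed (use C Pc Pa in \<open>auto simp: K_op_def blinfun.scaleR_left intro: compact_operator_scaleR\<close>)
qed

section \<open>Volterra operators with weakly singular kernel\<close>

text \<open>The kernel is controlled only strictly below the diagonal, where it may blow up like
  \<open>(t - s) powr (\<alpha> - 1)\<close>. Compactness of its values is what makes the Volterra operator compact in
  infinite dimension.\<close>

locale weakly_singular_kernel =
  fixes a b \<alpha> C :: real
    and \<kappa> :: "real \<Rightarrow> real \<Rightarrow> 'a::{banach, second_countable_topology} \<Rightarrow>\<^sub>L 'a"
  assumes ab: "a < b" and \<alpha>_pos: "0 < \<alpha>" and \<alpha>_le: "\<alpha> \<le> 1" and C_pos: "0 < C"
    and \<kappa>_bound: "a \<le> s \<Longrightarrow> s < t \<Longrightarrow> t \<le> b \<Longrightarrow> norm (\<kappa> t s) \<le> C * (t - s) powr (\<alpha> - 1)"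
    and \<kappa>_continuous: "continuous_on {(t, s). a \<le> s \<and> s < t \<and> t \<le> b} (\<lambda>(t, s). \<kappa> t s)"
    and \<kappa>_compact: "a \<le> s \<Longrightarrow> s < t \<Longrightarrow> t \<le> b \<Longrightarrow> compact_operator (\<kappa> t s)"
begin

abbreviation M :: "real measure" where "M \<equiv> lebesgue_on {a..b}"

definition integrand :: "(real \<Rightarrow> 'a) \<Rightarrow> real \<Rightarrow> real \<Rightarrow> 'a" where
  "integrand h t s = indicator {..<t} s *\<^sub>R \<kappa> t s (h s)"

definition volterra :: "(real \<Rightarrow> 'a) \<Rightarrow> real \<Rightarrow> 'a" where
  "volterra h t = (LINT s|M. integrand h t s)"

text \<open>The singular factor of the kernel cut down to a window of length \<open>\<delta>\<close> before \<open>t\<close>.\<close>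

definition near :: "real \<Rightarrow> real \<Rightarrow> real \<Rightarrow> real" where
  "near \<delta> t s = indicator {t - \<delta><..<t} s * (t - s) powr (\<alpha> - 1)"

text \<open>Dominating functions for which the singular part of the Volterra integral is small uniformly in
  \<open>t\<close>. Unlike membership in one fixed \<open>L\<^sup>p\<close>, the condition is stable under sums of functions with different
  exponents: the bound \<open>m\<close> on the nonlinearity comes with its own exponent \<open>1/r\<close>, and controls are
  square integrable.\<close>

definition admissible :: "(real \<Rightarrow> real) \<Rightarrow> bool" where
  "admissible m \<longleftrightarrow> integrable M m \<and> (\<forall>s\<in>{a..b}. 0 \<le> m s) \<and>
     (\<forall>\<epsilon>>0. \<exists>\<delta>>0. \<forall>t\<in>{a..b}. integrable M (\<lambda>s. near \<delta> t s * m s) \<and> (LINT s|M. near \<delta> t s * m s) \<le> \<epsilon>)"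

definition dominated :: "(real \<Rightarrow> 'a) \<Rightarrow> (real \<Rightarrow> real) \<Rightarrow> bool" where
  "dominated h m \<longleftrightarrow> h \<in> borel_measurable M \<and> (\<forall>s\<in>{a..b}. norm (h s) \<le> m s)"

lemma near_nonneg [simp]: "0 \<le> near \<delta> t s"
  by (simp add: near_def)

lemma near_mono: "\<delta> \<le> \<delta>' \<Longrightarrow> near \<delta> t s \<le> near \<delta>' t s"
  by (auto simp: near_def indicator_def)

lemma near_measurable [measurable]: "near \<delta> t \<in> borel_measurable M"
proof -
  have "near \<delta> t \<in> borel_measurable borel" unfolding near_def by measurable
  then show ?thesis by (rule borel_imp_lebesgue_on_measurable)
qed

lemma admissible_smaller_radius:
  assumes m: "m \<in> borel_measurable M" "\<And>s. s \<in> {a..b} \<Longrightarrow> 0 \<le> m s"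
    and \<delta>: "\<delta> \<le> \<delta>'" and i: "integrable M (\<lambda>s. near \<delta>' t s * m s)"
  shows "integrable M (\<lambda>s. near \<delta> t s * m s)" "(LINT s|M. near \<delta> t s * m s) \<le> (LINT s|M. near \<delta>' t s * m s)"
proof -
  have le: "near \<delta> t s * m s \<le> near \<delta>' t s * m s" "0 \<le> near \<delta> t s * m s" if "s \<in> {a..b}" for s
    using m(2)[OF that] near_mono[OF \<delta>] by (auto intro: mult_right_mono)
  show 1: "integrable M (\<lambda>s. near \<delta> t s * m s)"
  proof (rule Bochner_Integration.integrable_bound[OF i])
    show "(\<lambda>s. near \<delta> t s * m s) \<in> borel_measurable M" using m(1) by measurable
    show "AE s in M. norm (near \<delta> t s * m s) \<le> norm (near \<delta>' t s * m s)"
      using le by (intro AE_I2) (force simp: abs_of_nonneg)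
  qed
  show "(LINT s|M. near \<delta> t s * m s) \<le> (LINT s|M. near \<delta>' t s * m s)"
    using le by (intro integral_mono 1 i) auto
qed

lemma admissibleD:
  assumes "admissible m"
  shows "integrable M m" "s \<in> {a..b} \<Longrightarrow> 0 \<le> m s"
    "\<epsilon> > 0 \<Longrightarrow> \<exists>\<delta>>0. \<forall>t\<in>{a..b}. integrable M (\<lambda>s. near \<delta> t s * m s) \<and> (LINT s|M. near \<delta> t s * m s) \<le> \<epsilon>"
  using assms unfolding admissible_def by auto

lemma admissible_add:
  assumes "admissible m" "admissible m'"
  shows "admissible (\<lambda>s. m s + m' s)"
  unfolding admissible_def
proof (intro conjI allI impI)
  note m = admissibleD[OF assms(1)] and m' = admissibleD[OF assms(2)]
  show "integrable M (\<lambda>s. m s + m' s)" using m m' by auto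
  show "\<forall>s\<in>{a..b}. 0 \<le> m s + m' s" using m(2) m'(2) by auto
  fix \<epsilon> :: real assume "\<epsilon> > 0"
  then have e2: "\<epsilon> / 2 > 0" by simp
  obtain d where d: "d > 0" "\<And>t. t \<in> {a..b} \<Longrightarrow> integrable M (\<lambda>s. near d t s * m s)"
    "\<And>t. t \<in> {a..b} \<Longrightarrow> (LINT s|M. near d t s * m s) \<le> \<epsilon> / 2" using m(3)[OF e2] by blast
  obtain d' where d': "d' > 0" "\<And>t. t \<in> {a..b} \<Longrightarrow> integrable M (\<lambda>s. near d' t s * m' s)"
    "\<And>t. t \<in> {a..b} \<Longrightarrow> (LINT s|M. near d' t s * m' s) \<le> \<epsilon> / 2" using m'(3)[OF e2] by blast
  let ?d = "min d d'"
  have "integrable M (\<lambda>s. near ?d t s * (m s + m' s)) \<and> (LINT s|M. near ?d t s * (m s + m' s)) \<le> \<epsilon>"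
    if t: "t \<in> {a..b}" for t
  proof -
    have mm: "m \<in> borel_measurable M" "m' \<in> borel_measurable M" using m(1) m'(1) by auto
    note 1 = admissible_smaller_radius[OF mm(1) m(2) min.cobounded1 d(2)[OF t], of d']
      and 2 = admissible_smaller_radius[OF mm(2) m'(2) min.cobounded2 d'(2)[OF t], of d]
    have "(LINT s|M. near ?d t s * (m s + m' s)) = (LINT s|M. near ?d t s * m s) + (LINT s|M. near ?d t s * m' s)"
      using 1(1) 2(1) by (simp add: distrib_left)
    then show ?thesis using 1 2 d(3)[OF t] d'(3)[OF t] by (simp add: distrib_left)
  qed
  then show "\<exists>\<delta>>0. \<forall>t\<in>{a..b}. integrable M (\<lambda>s. near \<delta> t s * (m s + m' s)) \<and>
      (LINT s|M. near \<delta> t s * (m s + m' s)) \<le> \<epsilon>"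
    using d(1) d'(1) by (intro exI[of _ ?d]) auto
qed

lemma admissible_scale:
  assumes "admissible m" "0 \<le> c"
  shows "admissible (\<lambda>s. c * m s)"
  unfolding admissible_def
proof (intro conjI allI impI)
  note m = admissibleD[OF assms(1)]
  show "integrable M (\<lambda>s. c * m s)" using m by auto
  show "\<forall>s\<in>{a..b}. 0 \<le> c * m s" using m(2) assms(2) by auto
  fix \<epsilon> :: real assume "\<epsilon> > 0"
  then have "\<epsilon> / (c + 1) > 0" using assms(2) by simp
  from m(3)[OF this] obtain d where d: "d > 0" "\<And>t. t \<in> {a..b} \<Longrightarrow> integrable M (\<lambda>s. near d t s * m s)"
    "\<And>t. t \<in> {a..b} \<Longrightarrow> (LINT s|M. near d t s * m s) \<le> \<epsilon> / (c + 1)" by blast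
  have "integrable M (\<lambda>s. near d t s * (c * m s)) \<and> (LINT s|M. near d t s * (c * m s)) \<le> \<epsilon>"
    if t: "t \<in> {a..b}" for t
  proof -
    have e: "near d t s * (c * m s) = c * (near d t s * m s)" for s by simp
    have "c * (LINT s|M. near d t s * m s) \<le> c * (\<epsilon> / (c + 1))"
      using d(3)[OF t] assms(2) by (intro mult_left_mono) auto
    also have "\<dots> \<le> \<epsilon>" using assms(2) \<open>\<epsilon> > 0\<close> by (simp add: field_simps)
    finally show ?thesis unfolding e using d(2)[OF t] by simp
  qed
  then show "\<exists>\<delta>>0. \<forall>t\<in>{a..b}. integrable M (\<lambda>s. near \<delta> t s * (c * m s)) \<and>
      (LINT s|M. near \<delta> t s * (c * m s)) \<le> \<epsilon>"
    using d(1) by (intro exI[of _ d]) auto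
qed

lemma admissible_zero: "admissible (\<lambda>_. 0)"
  unfolding admissible_def by (auto intro: exI[of _ 1])

lemma admissible_sum:
  "finite N \<Longrightarrow> (\<And>i. i \<in> N \<Longrightarrow> admissible (m i)) \<Longrightarrow> admissible (\<lambda>s. \<Sum>i\<in>N. m i s)"
  by (induction N rule: finite_induct) (auto simp: admissible_zero intro: admissible_add)

lemma nn_integral_singular_power:
  assumes c: "-1 < c" and \<delta>: "0 < \<delta>"
  shows "(\<integral>\<^sup>+s. ennreal (indicator {t - \<delta><..<t} s * (t - s) powr c) \<partial>M) \<le> ennreal (\<delta> powr (c + 1) / (c + 1))"
proof -
  define F where "F s = - ((t - s) powr (c + 1) / (c + 1))" for s
  have "((\<lambda>s. (t - s) powr c) has_integral F t - F (t - \<delta>)) {t - \<delta>..t}"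
  proof (rule fundamental_theorem_of_calculus_interior)
    show "continuous_on {t - \<delta>..t} F"
      unfolding F_def using c by (intro continuous_intros continuous_on_powr') auto
    fix s assume s: "s \<in> {t - \<delta><..<t}"
    have "((\<lambda>s. (t - s) powr (c + 1)) has_real_derivative - ((c + 1) * (t - s) powr c)) (at s)"
      using s by (auto intro!: derivative_eq_intros)
    from DERIV_minus[OF DERIV_cdivide[OF this, of "c + 1"]]
    have "(F has_real_derivative (t - s) powr c) (at s)"
      unfolding F_def using c by simp
    then show "(F has_vector_derivative (t - s) powr c) (at s)"
      by (simp add: has_real_derivative_iff_has_vector_derivative)
  qed (use \<delta> in auto)
  moreover have "F t - F (t - \<delta>) = \<delta> powr (c + 1) / (c + 1)" using c by (simp add: F_def)
  ultimately have I: "((\<lambda>s. (t - s) powr c) has_integral \<delta> powr (c + 1) / (c + 1)) {t - \<delta>..t}" by simp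
  have m1: "(\<lambda>s. ennreal (indicator {t - \<delta><..<t} s * (t - s) powr c)) \<in> borel_measurable borel" by measurable
  have "(\<integral>\<^sup>+s. ennreal (indicator {t - \<delta><..<t} s * (t - s) powr c) \<partial>M) \<le>
      (\<integral>\<^sup>+s. ennreal (indicator {t - \<delta><..<t} s * (t - s) powr c) \<partial>lebesgue)"
    by (subst nn_integral_restrict_space) (auto intro!: nn_integral_mono simp: indicator_def)
  also have "\<dots> = (\<integral>\<^sup>+s. ennreal (indicator {t - \<delta><..<t} s * (t - s) powr c) \<partial>lborel)"
    using m1 by (intro nn_integral_completion)
  also have "\<dots> \<le> (\<integral>\<^sup>+s. ennreal (indicator {t - \<delta>..t} s * (t - s) powr c) \<partial>lborel)"
    by (intro nn_integral_mono ennreal_leI) (auto simp: indicator_def)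
  also have "\<dots> = ennreal (\<delta> powr (c + 1) / (c + 1))"
    using nn_integral_has_integral_lebesgue[OF _ I] by simp
  finally show ?thesis .
qed

text \<open>Young's inequality with a weight: for a conjugate exponent \<open>q\<close>, the product is at most
  \<open>L\<^sup>q (t - s)\<^sup>(\<^sup>\<alpha>\<^sup>-\<^sup>1\<^sup>)\<^sup>q + m\<^sup>p / L\<^sup>p\<close>. A large \<open>L\<close> makes the integral of the second term small, and then a
  small \<open>\<delta>\<close> makes that of the first term small. The power is integrable, \<open>(\<alpha> - 1) q > -1\<close>, exactly when
  \<open>\<alpha> p > 1\<close>.\<close>

lemma admissible_Lp:
  assumes p: "1 < p" "1 < \<alpha> * p"
    and m: "m \<in> borel_measurable M" "\<And>s. s \<in> {a..b} \<Longrightarrow> 0 \<le> m s" "integrable M (\<lambda>s. m s powr p)"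
  shows "admissible m"
  unfolding admissible_def
proof (intro conjI allI impI)
  define q where "q = p / (p - 1)"
  have q: "1 < q" "1 / p + 1 / q = 1" using p by (auto simp: q_def field_simps)
  define c where "c = (\<alpha> - 1) * q"
  have c: "-1 < c" using p by (simp add: c_def q_def field_simps)
  have fin: "emeasure M (space M) < \<infinity>" by (simp add: emeasure_restrict_space emeasure_lborel_Icc_eq)
  interpret finite_measure M by (rule finite_measureI) (use fin in auto)
  show mi: "integrable M m"
  proof (rule Bochner_Integration.integrable_bound[where f = "\<lambda>s. m s powr p + 1"])
    show "integrable M (\<lambda>s. m s powr p + 1)" using m(3) by auto
    have "m s \<le> m s powr p + 1" if "0 \<le> m s" for s
    proof (cases "m s \<le> 1")
      case True then show ?thesis using powr_ge_zero[of "m s" p] by linarith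
    next
      case False
      then have "m s powr 1 \<le> m s powr p" using p by (intro powr_mono) auto
      then show ?thesis using False by simp
    qed
    then show "AE s in M. norm (m s) \<le> norm (m s powr p + 1)" using m(2) by (intro AE_I2) (simp add: abs_of_nonneg add_nonneg_nonneg)
  qed (rule m(1))
  show "\<forall>s\<in>{a..b}. 0 \<le> m s" using m(2) by blast
  fix \<epsilon> :: real assume \<epsilon>: "\<epsilon> > 0"
  define I where "I = (LINT s|M. m s powr p)"
  have I: "0 \<le> I" unfolding I_def by (intro integral_nonneg_AE AE_I2) simp
  define L where "L = (2 * (I + 1) / \<epsilon>) powr (1 / p)"
  have L: "L > 0" using \<epsilon> I by (simp add: L_def)
  have Lp: "L powr p = 2 * (I + 1) / \<epsilon>" using p I \<epsilon> by (simp add: L_def powr_powr)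
  define X where "X = \<epsilon> * (c + 1) / (2 * L powr q)"
  have X: "X > 0" using \<epsilon> c L by (simp add: X_def)
  define \<delta> where "\<delta> = X powr (1 / (c + 1))"
  have \<delta>: "\<delta> > 0" using X by (simp add: \<delta>_def)
  have "\<delta> powr (c + 1) = X" using X c by (simp add: \<delta>_def powr_powr)
  moreover have "L powr q * (X / (c + 1)) = \<epsilon> / 2"
  proof -
    have "L powr q > 0" "c + 1 > 0" using L c by auto
    then show ?thesis by (simp add: X_def)
  qed
  ultimately have \<delta>p: "L powr q * (\<delta> powr (c + 1) / (c + 1)) = \<epsilon> / 2" by simp
  have young: "near \<delta> t s * m s \<le> L powr q * (indicator {t - \<delta><..<t} s * (t - s) powr c) + m s powr p / L powr p"
    if s: "s \<in> {a..b}" for t s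
  proof (cases "s \<in> {t - \<delta><..<t}")
    case True
    have "near \<delta> t s * m s = (L * (t - s) powr (\<alpha> - 1)) * (m s / L)" using True L by (simp add: near_def)
    also have "\<dots> \<le> (L * (t - s) powr (\<alpha> - 1)) powr q / q + (m s / L) powr p / p"
      using p q L m(2)[OF s] by (intro Youngs_inequality) auto
    also have "\<dots> \<le> (L * (t - s) powr (\<alpha> - 1)) powr q / 1 + (m s / L) powr p / 1"
      using p q by (intro add_mono divide_left_mono) auto
    also have "\<dots> = L powr q * (t - s) powr c + m s powr p / L powr p"
      using L m(2)[OF s] True by (simp add: powr_mult powr_powr c_def powr_divide)
    finally show ?thesis using True by simp
  qed (simp add: near_def)
  have "integrable M (\<lambda>s. near \<delta> t s * m s) \<and> (LINT s|M. near \<delta> t s * m s) \<le> \<epsilon>" for t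
  proof -
    have meas: "(\<lambda>s. near \<delta> t s * m s) \<in> borel_measurable M" using m(1) by measurable
    have nonneg: "AE s in M. 0 \<le> near \<delta> t s * m s" using m(2) by (intro AE_I2) auto
    have m1: "(\<lambda>s. indicator {t - \<delta><..<t} s * (t - s) powr c :: real) \<in> borel_measurable M"
    proof -
      have "(\<lambda>s. indicator {t - \<delta><..<t} s * (t - s) powr c :: real) \<in> borel_measurable borel" by measurable
      then show ?thesis by (rule borel_imp_lebesgue_on_measurable)
    qed
    have "(\<integral>\<^sup>+s. ennreal (near \<delta> t s * m s) \<partial>M) \<le>
      (\<integral>\<^sup>+s. ennreal (L powr q) * ennreal (indicator {t - \<delta><..<t} s * (t - s) powr c) + ennreal (m s powr p / L powr p) \<partial>M)"
      using young by (intro nn_integral_mono) (auto simp flip: ennreal_mult ennreal_plus intro!: ennreal_leI)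
    also have "\<dots> = ennreal (L powr q) * (\<integral>\<^sup>+s. ennreal (indicator {t - \<delta><..<t} s * (t - s) powr c) \<partial>M) +
        (\<integral>\<^sup>+s. ennreal (m s powr p / L powr p) \<partial>M)"
      using m(1) m1 by (subst nn_integral_add) (auto simp: nn_integral_cmult)
    also have "(\<integral>\<^sup>+s. ennreal (m s powr p / L powr p) \<partial>M) = ennreal (I / L powr p)"
      using m(3) by (subst nn_integral_eq_integral) (auto simp: I_def)
    also have "ennreal (L powr q) * (\<integral>\<^sup>+s. ennreal (indicator {t - \<delta><..<t} s * (t - s) powr c) \<partial>M)
        \<le> ennreal (L powr q) * ennreal (\<delta> powr (c + 1) / (c + 1))"
      by (intro mult_left_mono nn_integral_singular_power[OF c \<delta>]) auto
    also have "\<dots> = ennreal (\<epsilon> / 2)" unfolding \<delta>p[symmetric] by (rule ennreal_mult'[symmetric]) simp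
    also have "I / L powr p \<le> \<epsilon> / 2"
      unfolding Lp using I \<epsilon> by (simp add: field_simps)
    finally have "(\<integral>\<^sup>+s. ennreal (near \<delta> t s * m s) \<partial>M) \<le> ennreal (\<epsilon> / 2) + ennreal (\<epsilon> / 2)"
      by (simp add: add_left_mono ennreal_leI)
    also have "\<dots> = ennreal \<epsilon>" using \<epsilon> by (simp flip: ennreal_plus)
    finally have nn: "(\<integral>\<^sup>+s. ennreal (near \<delta> t s * m s) \<partial>M) \<le> ennreal \<epsilon>" .
    have i: "integrable M (\<lambda>s. near \<delta> t s * m s)"
      by (rule integrableI_nonneg[OF meas nonneg]) (use nn in \<open>auto intro: le_less_trans\<close>)
    moreover have "ennreal (LINT s|M. near \<delta> t s * m s) \<le> ennreal \<epsilon>"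
      using nn by (subst nn_integral_eq_integral[OF i nonneg, symmetric])
    ultimately show ?thesis using \<epsilon> by (simp add: ennreal_le_iff)
  qed
  then show "\<exists>\<delta>>0. \<forall>t\<in>{a..b}. integrable M (\<lambda>s. near \<delta> t s * m s) \<and> (LINT s|M. near \<delta> t s * m s) \<le> \<epsilon>"
    using \<delta> by blast
qed

lemma integrand_measurable:
  assumes h: "h \<in> borel_measurable M" and t: "t \<le> b"
  shows "integrand h t \<in> borel_measurable M"
proof -
  let ?D = "{a..<t} \<times> (UNIV :: 'a set)"
  have "continuous_on ?D (\<lambda>p. \<kappa> t (fst p) (snd p))"
    by (intro continuous_intros continuous_on_compose2[OF \<kappa>_continuous, of ?D "\<lambda>p. (t, fst p)", simplified]) (use t in auto)
  moreover have "?D \<in> sets borel" by (simp add: borel_prod[symmetric])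
  ultimately have "(\<lambda>p. indicator ?D p *\<^sub>R \<kappa> t (fst p) (snd p)) \<in> borel_measurable borel"
    by (intro borel_measurable_continuous_on_indicator) auto
  moreover have "(\<lambda>s. (s, h s)) \<in> measurable M borel"
    unfolding borel_prod[symmetric]
    by (rule measurable_Pair[OF borel_imp_lebesgue_on_measurable h]) simp
  ultimately have "(\<lambda>s. indicator ?D (s, h s) *\<^sub>R \<kappa> t s (h s)) \<in> borel_measurable M"
    by (auto dest: measurable_compose[rotated])
  then show ?thesis
    by (rule measurable_cong[THEN iffD1, rotated]) (auto simp: integrand_def indicator_def)
qed

text \<open>Inside the window the source is estimated by its bound \<open>m\<close>, outside it by its own norm. The second
  alternative is what makes the Volterra operator continuous for convergence in the mean.\<close>

lemma integrand_bound:
  assumes m: "dominated h m" and \<delta>: "\<delta> > 0" and s: "s \<in> {a..b}" and t: "t \<le> b"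
  shows "norm (integrand h t s) \<le> C * (near \<delta> t s * m s) + C * \<delta> powr (\<alpha> - 1) * norm (h s)"
proof (cases "s < t")
  case True
  have hm: "norm (h s) \<le> m s" using m s unfolding dominated_def by blast
  have n: "norm (integrand h t s) \<le> C * (t - s) powr (\<alpha> - 1) * norm (h s)"
  proof -
    have "norm (integrand h t s) \<le> norm (\<kappa> t s) * norm (h s)"
      using True by (simp add: integrand_def norm_blinfun)
    also have "\<dots> \<le> C * (t - s) powr (\<alpha> - 1) * norm (h s)"
      using True s t by (intro mult_right_mono \<kappa>_bound) auto
    finally show ?thesis .
  qed
  show ?thesis
  proof (cases "t - \<delta> < s")
    case True
    have "C * (t - s) powr (\<alpha> - 1) * norm (h s) \<le> C * (t - s) powr (\<alpha> - 1) * m s"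
      using hm C_pos by (intro mult_left_mono) auto
    also have "\<dots> = C * (near \<delta> t s * m s)" using True \<open>s < t\<close> by (simp add: near_def)
    moreover have "0 \<le> C * \<delta> powr (\<alpha> - 1) * norm (h s)" using C_pos by simp
    ultimately show ?thesis using n by linarith
  next
    case False
    have "(t - s) powr (\<alpha> - 1) \<le> \<delta> powr (\<alpha> - 1)"
      using False \<delta> \<alpha>_le by (intro powr_mono2') auto
    then have "C * (t - s) powr (\<alpha> - 1) * norm (h s) \<le> C * \<delta> powr (\<alpha> - 1) * norm (h s)"
      using C_pos by (intro mult_right_mono mult_left_mono) auto
    moreover have "0 \<le> C * (near \<delta> t s * m s)"
      using C_pos hm norm_ge_zero[of "h s"] by (intro mult_nonneg_nonneg) (auto simp del: norm_ge_zero)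
    ultimately show ?thesis using n by linarith
  qed
next
  case False
  have "0 \<le> m s" using m s unfolding dominated_def by (meson norm_ge_zero order_trans)
  then show ?thesis using False C_pos by (simp add: integrand_def)
qed

lemma dominated_integrable:
  assumes "dominated h m" "admissible m"
  shows "integrable M h"
proof (rule Bochner_Integration.integrable_bound[OF admissibleD(1)[OF assms(2)]])
  show "AE s in M. norm (h s) \<le> norm (m s)"
    using assms(1) unfolding dominated_def by (intro AE_I2) (auto intro: order_trans[OF _ abs_ge_self])
qed (use assms(1) in \<open>simp add: dominated_def\<close>)

lemma integrand_integrable:
  assumes h: "dominated h m" and m: "admissible m" and t: "t \<in> {a..b}"
  shows "integrable M (integrand h t)"
proof -
  obtain \<delta> where \<delta>: "\<delta> > 0" "integrable M (\<lambda>s. near \<delta> t s * m s)"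
    using admissibleD(3)[OF m, of 1] t by auto
  show ?thesis
  proof (rule Bochner_Integration.integrable_bound)
    show "integrable M (\<lambda>s. C * (near \<delta> t s * m s) + C * \<delta> powr (\<alpha> - 1) * norm (h s))"
      using \<delta>(2) dominated_integrable[OF h m] by auto
    show "AE s in M. norm (integrand h t s) \<le> norm (C * (near \<delta> t s * m s) + C * \<delta> powr (\<alpha> - 1) * norm (h s))"
      using integrand_bound[OF h \<delta>(1)] t by (intro AE_I2) (auto intro: order_trans[OF _ abs_ge_self])
  qed (use h t in \<open>auto simp: dominated_def intro: integrand_measurable\<close>)
qed

lemma volterra_add:
  assumes "dominated h m" "admissible m" "dominated h' m'" "admissible m'" "t \<in> {a..b}"
  shows "volterra (\<lambda>s. h s + h' s) t = volterra h t + volterra h' t"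
proof -
  have "integrand (\<lambda>s. h s + h' s) t = (\<lambda>s. integrand h t s + integrand h' t s)"
    by (simp add: integrand_def blinfun.add_right scaleR_add_right fun_eq_iff)
  then show ?thesis
    unfolding volterra_def using integrand_integrable[OF assms(1,2,5)] integrand_integrable[OF assms(3,4,5)] by simp
qed

lemma volterra_scaleR: "volterra (\<lambda>s. c *\<^sub>R h s) t = c *\<^sub>R volterra h t"
proof -
  have "integrand (\<lambda>s. c *\<^sub>R h s) t = (\<lambda>s. c *\<^sub>R integrand h t s)"
    by (simp add: integrand_def blinfun.scaleR_right fun_eq_iff)
  then show ?thesis unfolding volterra_def by simp
qed

lemma integral_difference_bound:
  fixes f g :: "real \<Rightarrow> 'a"
  assumes "integrable M f" "integrable M g" "integrable M w" "\<And>s. s \<in> {a..b} \<Longrightarrow> norm (f s - g s) \<le> w s"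
  shows "norm ((LINT s|M. f s) - (LINT s|M. g s)) \<le> (LINT s|M. w s)"
proof -
  have "(LINT s|M. f s) - (LINT s|M. g s) = (LINT s|M. f s - g s)" using assms by simp
  also have "norm \<dots> \<le> (LINT s|M. norm (f s - g s))" by (rule integral_norm_bound)
  also have "\<dots> \<le> (LINT s|M. w s)" using assms by (intro integral_mono) auto
  finally show ?thesis .
qed

lemma volterra_mean_continuous:
  assumes m: "admissible m" and e: "e > 0"
  shows "\<exists>d>0. \<forall>h h'. dominated h m \<longrightarrow> dominated h' m \<longrightarrow> (LINT s|M. norm (h s - h' s)) \<le> d \<longrightarrow>
    (\<forall>t\<in>{a..b}. norm (volterra h t - volterra h' t) \<le> e)"
proof -
  have e4: "e / (4 * C) > 0" using e C_pos by simp
  from admissibleD(3)[OF m e4] obtain \<delta> where \<delta>: "\<delta> > 0"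
    "\<And>t. t \<in> {a..b} \<Longrightarrow> integrable M (\<lambda>s. near \<delta> t s * m s)"
    "\<And>t. t \<in> {a..b} \<Longrightarrow> (LINT s|M. near \<delta> t s * m s) \<le> e / (4 * C)" by blast
  define D where "D = C * \<delta> powr (\<alpha> - 1)"
  have D: "D > 0" using C_pos \<delta>(1) by (simp add: D_def)
  have "norm (volterra h t - volterra h' t) \<le> e"
    if h: "dominated h m" "dominated h' m" and d: "(LINT s|M. norm (h s - h' s)) \<le> e / (2 * D)" and t: "t \<in> {a..b}" for h h' t
  proof -
    have dd: "dominated (\<lambda>s. h s - h' s) (\<lambda>s. 2 * m s)"
      unfolding dominated_def
    proof (intro conjI ballI)
      show "(\<lambda>s. h s - h' s) \<in> borel_measurable M"
        using h unfolding dominated_def by (intro borel_measurable_diff) auto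
      fix s assume "s \<in> {a..b}"
      then have "norm (h s) \<le> m s" "norm (h' s) \<le> m s" using h unfolding dominated_def by auto
      then show "norm (h s - h' s) \<le> 2 * m s" using norm_triangle_ineq4[of "h s" "h' s"] by linarith
    qed
    have i: "integrable M (\<lambda>s. norm (h s - h' s))"
      using dominated_integrable[OF h(1) m] dominated_integrable[OF h(2) m] by auto
    have "norm (volterra h t - volterra h' t) \<le> (LINT s|M. 2 * C * (near \<delta> t s * m s) + D * norm (h s - h' s))"
      unfolding volterra_def
    proof (rule integral_difference_bound)
      show "integrable M (\<lambda>s. 2 * C * (near \<delta> t s * m s) + D * norm (h s - h' s))"
        using \<delta>(2)[OF t] i by auto
      fix s assume s: "s \<in> {a..b}"
      have "integrand h t s - integrand h' t s = integrand (\<lambda>s. h s - h' s) t s"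
        by (simp add: integrand_def blinfun.diff_right scaleR_diff_right)
      then show "norm (integrand h t s - integrand h' t s) \<le> 2 * C * (near \<delta> t s * m s) + D * norm (h s - h' s)"
        using integrand_bound[OF dd \<delta>(1) s] t by (simp add: D_def mult_ac)
    qed (rule integrand_integrable[OF h(1) m t] integrand_integrable[OF h(2) m t])+
    also have "\<dots> = 2 * C * (LINT s|M. near \<delta> t s * m s) + D * (LINT s|M. norm (h s - h' s))"
      using \<delta>(2)[OF t] i by simp
    also have "\<dots> \<le> 2 * C * (e / (4 * C)) + D * (e / (2 * D))"
      using \<delta>(3)[OF t] d C_pos D by (intro add_mono mult_left_mono) auto
    also have "\<dots> = e" using C_pos D by (simp add: field_simps)
    finally show ?thesis .
  qed
  then show ?thesis using e D by (intro exI[of _ "e / (2 * D)"]) auto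
qed

lemma diagonal_strip_compact: "compact {(t, s). a \<le> s \<and> s \<le> t - \<delta> \<and> t \<le> b}"
proof -
  have "{(t, s). a \<le> s \<and> s \<le> t - \<delta> \<and> t \<le> b} = ({a - \<bar>\<delta>\<bar>..b} \<times> {a..b + \<bar>\<delta>\<bar>}) \<inter> {p. a \<le> snd p \<and> snd p \<le> fst p - \<delta> \<and> fst p \<le> b}"
    by auto
  moreover have "closed {p :: real \<times> real. a \<le> snd p \<and> snd p \<le> fst p - \<delta> \<and> fst p \<le> b}"
    by (intro closed_Collect_conj closed_Collect_le continuous_intros)
  ultimately show ?thesis by (simp add: compact_Int_closed compact_Times)
qed

lemma kernel_uniformly_continuous:
  assumes "\<delta> > 0" "e > 0"
  shows "\<exists>d>0. \<forall>t t' s s'. a \<le> s \<longrightarrow> s \<le> t - \<delta> \<longrightarrow> t \<le> b \<longrightarrow> a \<le> s' \<longrightarrow> s' \<le> t' - \<delta> \<longrightarrow> t' \<le> b \<longrightarrow>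
    \<bar>t - t'\<bar> < d \<longrightarrow> \<bar>s - s'\<bar> < d \<longrightarrow> norm (\<kappa> t s - \<kappa> t' s') \<le> e"
proof -
  let ?Z = "{(t, s). a \<le> s \<and> s \<le> t - \<delta> \<and> t \<le> b}"
  have "continuous_on ?Z (\<lambda>(t, s). \<kappa> t s)"
    by (rule continuous_on_subset[OF \<kappa>_continuous]) (use assms(1) in auto)
  then have "uniformly_continuous_on ?Z (\<lambda>(t, s). \<kappa> t s)"
    by (rule compact_uniformly_continuous[OF _ diagonal_strip_compact])
  then obtain d where d: "d > 0" "\<And>p p'. p \<in> ?Z \<Longrightarrow> p' \<in> ?Z \<Longrightarrow> dist p' p < d \<Longrightarrow>
      dist ((\<lambda>(t, s). \<kappa> t s) p') ((\<lambda>(t, s). \<kappa> t s) p) < e"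
    unfolding uniformly_continuous_on_def using assms(2) by meson
  have "norm (\<kappa> t s - \<kappa> t' s') \<le> e"
    if "a \<le> s" "s \<le> t - \<delta>" "t \<le> b" "a \<le> s'" "s' \<le> t' - \<delta>" "t' \<le> b" "\<bar>t - t'\<bar> < d / 2" "\<bar>s - s'\<bar> < d / 2" for t t' s s'
  proof -
    have "dist (t, s) (t', s') \<le> \<bar>t - t'\<bar> + \<bar>s - s'\<bar>"
      unfolding dist_Pair_Pair dist_real_def by (rule sqrt_sum_squares_le_sum_abs[THEN order_trans]) auto
    then have "dist (t, s) (t', s') < d" using that by linarith
    from d(2)[OF _ _ this] show ?thesis using that by (simp add: dist_norm)
  qed
  then show ?thesis using d(1) by (intro exI[of _ "d / 2"]) auto
qed

text \<open>For \<open>t \<le> t'\<close> close together, the windows of length \<open>\<delta>\<close> before both points cover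
  everything between \<open>t - \<delta>/2\<close> and \<open>t'\<close>; before that the kernel is uniformly continuous.\<close>

lemma volterra_equicontinuous:
  assumes m: "admissible m" and e: "e > 0"
  shows "\<exists>d>0. \<forall>t\<in>{a..b}. \<forall>t'\<in>{a..b}. \<bar>t - t'\<bar> < d \<longrightarrow>
    (\<forall>h. dominated h m \<longrightarrow> norm (volterra h t - volterra h t') \<le> e)"
proof -
  have e3: "e / (3 * C) > 0" using e C_pos by simp
  from admissibleD(3)[OF m e3] obtain \<delta> where \<delta>: "\<delta> > 0"
    "\<And>t. t \<in> {a..b} \<Longrightarrow> integrable M (\<lambda>s. near \<delta> t s * m s)"
    "\<And>t. t \<in> {a..b} \<Longrightarrow> (LINT s|M. near \<delta> t s * m s) \<le> e / (3 * C)" by blast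
  define I where "I = (LINT s|M. m s)"
  have I: "0 \<le> I" unfolding I_def using admissibleD(2)[OF m] by (intro integral_nonneg_AE AE_I2) auto
  define \<epsilon> where "\<epsilon> = e / (3 * (I + 1))"
  have \<epsilon>: "\<epsilon> > 0" using e I by (simp add: \<epsilon>_def)
  have "\<epsilon> * I \<le> \<epsilon> * (I + 1)" using \<epsilon> by simp
  also have "\<dots> = e / 3" using I by (simp add: \<epsilon>_def field_simps)
  finally have \<epsilon>I: "\<epsilon> * I \<le> e / 3" .
  have "\<delta> / 2 > 0" using \<delta> by simp
  from kernel_uniformly_continuous[OF this \<epsilon>] obtain d where d: "d > 0"
    and uc: "\<And>t t' s s'. a \<le> s \<Longrightarrow> s \<le> t - \<delta> / 2 \<Longrightarrow> t \<le> b \<Longrightarrow> a \<le> s' \<Longrightarrow> s' \<le> t' - \<delta> / 2 \<Longrightarrow> t' \<le> b \<Longrightarrow>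
    \<bar>t - t'\<bar> < d \<Longrightarrow> \<bar>s - s'\<bar> < d \<Longrightarrow> norm (\<kappa> t s - \<kappa> t' s') \<le> \<epsilon>" by blast
  have ordered: "norm (volterra h t - volterra h t') \<le> e"
    if t: "t \<in> {a..b}" and t': "t' \<in> {a..b}" and le: "t \<le> t'" and lt: "t' - t < min d (\<delta> / 2)" and h: "dominated h m" for t t' h
  proof -
    have "norm (volterra h t - volterra h t') \<le> (LINT s|M. C * (near \<delta> t s * m s) + C * (near \<delta> t' s * m s) + \<epsilon> * m s)"
      unfolding volterra_def
    proof (rule integral_difference_bound)
      show "integrable M (\<lambda>s. C * (near \<delta> t s * m s) + C * (near \<delta> t' s * m s) + \<epsilon> * m s)"
        using \<delta>(2)[OF t] \<delta>(2)[OF t'] admissibleD(1)[OF m] by auto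
      fix s assume s: "s \<in> {a..b}"
      have hm: "norm (h s) \<le> m s" using h s unfolding dominated_def by blast
      have m0: "0 \<le> m s" by (rule admissibleD(2)[OF m s])
      have near_part: "norm (integrand h u s) \<le> C * (near \<delta> u s * m s)" if u: "u \<in> {a..b}" "u - \<delta> < s" for u
      proof (cases "s < u")
        case True
        have "norm (integrand h u s) \<le> norm (\<kappa> u s) * norm (h s)" using True by (simp add: integrand_def norm_blinfun)
        also have "\<dots> \<le> C * (u - s) powr (\<alpha> - 1) * m s"
          using True s u hm C_pos by (intro mult_mono \<kappa>_bound) auto
        also have "\<dots> = C * (near \<delta> u s * m s)" using True u by (simp add: near_def)
        finally show ?thesis .
      qed (use C_pos m0 in \<open>simp add: integrand_def\<close>)
      have nn: "0 \<le> C * (near \<delta> t s * m s)" "0 \<le> C * (near \<delta> t' s * m s)" "0 \<le> \<epsilon> * m s"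
        using C_pos m0 \<epsilon> by auto
      show "norm (integrand h t s - integrand h t' s) \<le> C * (near \<delta> t s * m s) + C * (near \<delta> t' s * m s) + \<epsilon> * m s"
      proof (cases "s \<le> t - \<delta> / 2")
        case True
        have "s < t" "s < t'" using True \<delta>(1) le by auto
        then have "integrand h t s - integrand h t' s = (\<kappa> t s - \<kappa> t' s) (h s)"
          by (simp add: integrand_def blinfun.diff_left)
        also have "norm \<dots> \<le> norm (\<kappa> t s - \<kappa> t' s) * norm (h s)" by (rule norm_blinfun)
        also have "\<dots> \<le> \<epsilon> * m s"
          using True s t t' le lt hm \<epsilon> d by (intro mult_mono uc) auto
        finally show ?thesis using nn by linarith
      next
        case False
        have "norm (integrand h t s - integrand h t' s) \<le> norm (integrand h t s) + norm (integrand h t' s)"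
          by (rule norm_triangle_ineq4)
        also have "\<dots> \<le> C * (near \<delta> t s * m s) + C * (near \<delta> t' s * m s)"
          using False lt \<delta>(1) t t' by (intro add_mono near_part) auto
        finally show ?thesis using nn by linarith
      qed
    qed (rule integrand_integrable[OF h m t] integrand_integrable[OF h m t'])+
    also have "\<dots> = C * (LINT s|M. near \<delta> t s * m s) + C * (LINT s|M. near \<delta> t' s * m s) + \<epsilon> * I"
      using \<delta>(2)[OF t] \<delta>(2)[OF t'] admissibleD(1)[OF m] by (simp add: I_def)
    also have "\<dots> \<le> C * (e / (3 * C)) + C * (e / (3 * C)) + e / 3"
      using \<delta>(3)[OF t] \<delta>(3)[OF t'] C_pos \<epsilon>I by (intro add_mono mult_left_mono) auto
    also have "\<dots> = e" using C_pos by (simp add: field_simps)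
    finally show ?thesis .
  qed
  have "norm (volterra h t - volterra h t') \<le> e"
    if "t \<in> {a..b}" "t' \<in> {a..b}" "\<bar>t - t'\<bar> < min d (\<delta> / 2)" "dominated h m" for t t' h
  proof (cases "t \<le> t'")
    case True
    then show ?thesis using that by (intro ordered) auto
  next
    case False
    then have "norm (volterra h t' - volterra h t) \<le> e" using that by (intro ordered) auto
    then show ?thesis by (simp add: norm_minus_commute)
  qed
  then show ?thesis using d \<delta>(1) by (intro exI[of _ "min d (\<delta> / 2)"]) auto
qed

lemma precompact_finite_sums:
  fixes X :: "nat \<Rightarrow> 'a set"
  assumes "\<And>j. compact (closure (X j))"
  shows "compact (closure {\<Sum>j<n. x j |x. \<forall>j. x j \<in> X j})"
proof (induction n)
  case 0
  show ?case by (rule precompact_subset[of "{0}"]) auto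
next
  case (Suc n)
  show ?case
  proof (rule precompact_subset[OF precompact_sums[OF Suc.IH assms[of n]]], safe)
    fix x :: "nat \<Rightarrow> 'a" assume x: "\<forall>j. x j \<in> X j"
    show "\<exists>y z. sum x {..<Suc n} = y + z \<and> y \<in> {\<Sum>j<n. x j |x. \<forall>j. x j \<in> X j} \<and> z \<in> X n"
      using x by (intro exI[of _ "sum x {..<n}"] exI[of _ "x n"]) auto
  qed
qed

text \<open>Away from the diagonal, freezing the second argument of the kernel on small intervals replaces the integral by a
  finite sum of compact operators applied to vectors of norm at most the integral of \<open>m\<close>. The error is small
  uniformly in the source.\<close>

lemma volterra_precompact:
  assumes m: "admissible m" and t: "t \<in> {a..b}"
  shows "compact (closure {volterra h t |h. dominated h m})"
proof (rule precompact_approximation)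
  fix e :: real assume e: "e > 0"
  have e2: "e / (2 * C) > 0" using e C_pos by simp
  from admissibleD(3)[OF m e2] t obtain \<delta> where \<delta>: "\<delta> > 0"
    "integrable M (\<lambda>s. near \<delta> t s * m s)" "(LINT s|M. near \<delta> t s * m s) \<le> e / (2 * C)" by blast
  define I where "I = (LINT s|M. m s)"
  have I: "0 \<le> I" unfolding I_def using admissibleD(2)[OF m] by (intro integral_nonneg_AE AE_I2) auto
  define \<epsilon> where "\<epsilon> = e / (2 * (I + 1))"
  have \<epsilon>: "\<epsilon> > 0" using e I by (simp add: \<epsilon>_def)
  have "\<epsilon> * I \<le> \<epsilon> * (I + 1)" using \<epsilon> by simp
  also have "\<dots> = e / 2" using I by (simp add: \<epsilon>_def field_simps)
  finally have \<epsilon>I: "\<epsilon> * I \<le> e / 2" .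
  obtain d where d: "d > 0"
    and uc: "\<And>t t' s s'. a \<le> s \<Longrightarrow> s \<le> t - \<delta> \<Longrightarrow> t \<le> b \<Longrightarrow> a \<le> s' \<Longrightarrow> s' \<le> t' - \<delta> \<Longrightarrow> t' \<le> b \<Longrightarrow>
    \<bar>t - t'\<bar> < d \<Longrightarrow> \<bar>s - s'\<bar> < d \<Longrightarrow> norm (\<kappa> t s - \<kappa> t' s') \<le> \<epsilon>"
    using kernel_uniformly_continuous[OF \<delta>(1) \<epsilon>] by blast
  \<comment> \<open>the interval \<open>[a,b]\<close> is cut into steps of length \<open>d/2\<close>; \<open>pt (idx s)\<close> is the left end of the step containing \<open>s\<close>\<close>
  define idx where "idx s = nat \<lfloor>(s - a) / (d / 2)\<rfloor>" for s
  define pt where "pt j = a + real j * (d / 2)" for j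
  have pt: "a \<le> pt (idx s)" "pt (idx s) \<le> s" "s - pt (idx s) < d" if "a \<le> s" for s
  proof -
    have r: "real (idx s) = of_int \<lfloor>(s - a) / (d / 2)\<rfloor>" unfolding idx_def using that d by simp
    have "real (idx s) \<le> (s - a) / (d / 2)" "(s - a) / (d / 2) < real (idx s) + 1" unfolding r by linarith+
    then have "real (idx s) * (d / 2) \<le> s - a" "s - a < (real (idx s) + 1) * (d / 2)"
      using d by (simp_all add: field_simps)
    then show "a \<le> pt (idx s)" "pt (idx s) \<le> s" "s - pt (idx s) < d"
      using d by (auto simp: pt_def algebra_simps)
  qed
  define n where "n = Suc (idx b)"
  have idx_n: "idx s < n" if "s \<in> {a..b}" for s
  proof -
    have "(s - a) / (d / 2) \<le> (b - a) / (d / 2)" using that d by (intro divide_right_mono) auto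
    then show ?thesis unfolding n_def idx_def by (simp add: less_Suc_eq_le nat_mono floor_mono)
  qed
  define L where "L j = (if pt j < t then \<kappa> t (pt j) else 0)" for j
  define J where "J j s = (indicator {s. s \<le> t - \<delta> \<and> idx s = j} s :: real)" for j s
  have Jm: "J j \<in> borel_measurable M" for j
  proof -
    have "J j \<in> borel_measurable borel" unfolding J_def idx_def by measurable
    then show ?thesis by (rule borel_imp_lebesgue_on_measurable)
  qed
  have J01: "0 \<le> J j s" "J j s \<le> 1" for j s by (auto simp: J_def indicator_def)
  have pta: "a \<le> pt j" for j using d by (simp add: pt_def)
  have L_compact: "compact_operator (L j)" for j
  proof (cases "pt j < t")
    case True then show ?thesis using pta t by (auto simp: L_def intro: \<kappa>_compact)
  next
    case False
    have "compact (closure (blinfun_apply (0 :: 'a \<Rightarrow>\<^sub>L 'a) ` S))" for S :: "'a set"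
      by (rule precompact_subset[of "{0}"]) auto
    then show ?thesis using False by (simp add: L_def compact_operator_def)
  qed
  define Y where "Y = {\<Sum>j<n. x j |x. \<forall>j. x j \<in> L j ` cball 0 I}"
  have "compact (closure Y)"
    unfolding Y_def by (rule precompact_finite_sums) (use L_compact in \<open>auto simp: compact_operator_def\<close>)
  moreover have "\<exists>y\<in>Y. dist (volterra h t) y \<le> e" if h: "dominated h m" for h
  proof -
    have hi: "integrable M (\<lambda>s. J j s *\<^sub>R h s)" for j
    proof (rule Bochner_Integration.integrable_bound[OF dominated_integrable[OF h m]])
      show "(\<lambda>s. J j s *\<^sub>R h s) \<in> borel_measurable M" using h Jm unfolding dominated_def by auto
      show "AE s in M. norm (J j s *\<^sub>R h s) \<le> norm (h s)"
        using J01 by (intro AE_I2) (simp add: mult_left_le_one_le)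
    qed
    define x where "x j = L j (LINT s|M. J j s *\<^sub>R h s)" for j
    have "norm (LINT s|M. J j s *\<^sub>R h s) \<le> I" for j
    proof -
      have "norm (LINT s|M. J j s *\<^sub>R h s) \<le> (LINT s|M. norm (J j s *\<^sub>R h s))" by (rule integral_norm_bound)
      also have "\<dots> \<le> I" unfolding I_def
      proof (rule integral_mono)
        fix s assume "s \<in> space M"
        then have "norm (h s) \<le> m s" using h unfolding dominated_def by auto
        then show "norm (J j s *\<^sub>R h s) \<le> m s" using J01[of j s] mult_left_le_one_le[of "norm (h s)" "J j s"] by simp
      qed (rule integrable_norm[OF hi] admissibleD(1)[OF m])+
      finally show ?thesis .
    qed
    then have "x j \<in> L j ` cball 0 I" for j unfolding x_def by (intro imageI) simp
    then have "(\<Sum>j<n. x j) \<in> Y" unfolding Y_def by blast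
    moreover have "norm (volterra h t - (\<Sum>j<n. x j)) \<le> e"
    proof -
      have Li: "integrable M (\<lambda>s. L j (J j s *\<^sub>R h s))" for j
        by (intro integrable_bounded_linear[OF blinfun.bounded_linear_right] hi)
      have "(\<Sum>j<n. x j) = (LINT s|M. (\<Sum>j<n. L j (J j s *\<^sub>R h s)))"
        unfolding x_def using hi Li
        by (simp add: integral_bounded_linear[OF blinfun.bounded_linear_right])
      moreover have "norm ((LINT s|M. integrand h t s) - (LINT s|M. (\<Sum>j<n. L j (J j s *\<^sub>R h s)))) \<le>
          (LINT s|M. C * (near \<delta> t s * m s) + \<epsilon> * m s)"
      proof (rule integral_difference_bound)
        show "integrable M (\<lambda>s. C * (near \<delta> t s * m s) + \<epsilon> * m s)" using \<delta>(2) admissibleD(1)[OF m] by auto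
        show "integrable M (\<lambda>s. (\<Sum>j<n. L j (J j s *\<^sub>R h s)))" using Li by auto
        fix s assume s: "s \<in> {a..b}"
        have hm: "norm (h s) \<le> m s" using h s unfolding dominated_def by blast
        have m0: "0 \<le> m s" by (rule admissibleD(2)[OF m s])
        have nn: "0 \<le> C * (near \<delta> t s * m s)" "0 \<le> \<epsilon> * m s" using C_pos m0 \<epsilon> by auto
        show "norm (integrand h t s - (\<Sum>j<n. L j (J j s *\<^sub>R h s))) \<le> C * (near \<delta> t s * m s) + \<epsilon> * m s"
        proof (cases "s \<le> t - \<delta>")
          case True
          have "(\<Sum>j<n. L j (J j s *\<^sub>R h s)) = (\<Sum>j<n. if j = idx s then L j (h s) else 0)"
            using True by (intro sum.cong refl) (auto simp: J_def blinfun.zero_right)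
          also have "\<dots> = L (idx s) (h s)" using idx_n[OF s] by simp
          also have "L (idx s) = \<kappa> t (pt (idx s))" using pt[of s] s True \<delta>(1) by (simp add: L_def)
          finally have "integrand h t s - (\<Sum>j<n. L j (J j s *\<^sub>R h s)) = (\<kappa> t s - \<kappa> t (pt (idx s))) (h s)"
            using True \<delta>(1) by (simp add: integrand_def blinfun.diff_left)
          also have "norm \<dots> \<le> norm (\<kappa> t s - \<kappa> t (pt (idx s))) * norm (h s)" by (rule norm_blinfun)
          also have "\<dots> \<le> \<epsilon> * m s"
            using True s t hm \<epsilon> d pt[of s] by (intro mult_mono uc) auto
          finally show ?thesis using nn by linarith
        next
          case False
          then have "(\<Sum>j<n. L j (J j s *\<^sub>R h s)) = 0"
            by (intro sum.neutral) (auto simp: J_def blinfun.zero_right)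
          moreover have "norm (integrand h t s) \<le> C * (near \<delta> t s * m s)"
          proof (cases "s < t")
            case True
            have "norm (integrand h t s) \<le> norm (\<kappa> t s) * norm (h s)" using True by (simp add: integrand_def norm_blinfun)
            also have "\<dots> \<le> C * (t - s) powr (\<alpha> - 1) * m s"
              using True s t hm C_pos by (intro mult_mono \<kappa>_bound) auto
            also have "\<dots> = C * (near \<delta> t s * m s)" using True False by (simp add: near_def)
            finally show ?thesis .
          qed (use C_pos m0 in \<open>simp add: integrand_def\<close>)
          ultimately show ?thesis using nn by simp
        qed
      qed (rule integrand_integrable[OF h m t])
      moreover have "(LINT s|M. C * (near \<delta> t s * m s) + \<epsilon> * m s) \<le> e"
      proof -
        have "(LINT s|M. C * (near \<delta> t s * m s) + \<epsilon> * m s) = C * (LINT s|M. near \<delta> t s * m s) + \<epsilon> * I"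
          using \<delta>(2) admissibleD(1)[OF m] by (simp add: I_def)
        also have "\<dots> \<le> C * (e / (2 * C)) + e / 2" using \<delta>(3) \<epsilon>I C_pos by (intro add_mono mult_left_mono) auto
        also have "\<dots> = e" using C_pos by (simp add: field_simps)
        finally show ?thesis .
      qed
      ultimately show ?thesis unfolding volterra_def by simp
    qed
    ultimately show ?thesis by (intro bexI[of _ "\<Sum>j<n. x j"]) (auto simp: dist_norm)
  qed
  ultimately show "\<exists>Y. compact (closure Y) \<and> (\<forall>x\<in>{volterra h t |h. dominated h m}. \<exists>y\<in>Y. dist x y \<le> e)"
    by blast
qed

end

section \<open>Relatively compact sets of continuous functions\<close>

text \<open>The Arzela-Ascoli theorem for vector values. A function is classified by the points of finite nets
  to which it is close at the times of a finite grid; two functions of the same class differ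
  little everywhere by equicontinuity. Functions on \<open>[a,b]\<close> are represented by their extensions that are
  constant outside the interval, so that they form a set in a Banach space.\<close>

lemma precompact_bcontfun:
  fixes X :: "(real \<Rightarrow>\<^sub>C 'a::banach) set"
  assumes clamp: "\<And>f t. f \<in> X \<Longrightarrow> apply_bcontfun f t = apply_bcontfun f (max a (min b t))" and ab: "a \<le> b"
    and equi: "\<And>e. e > 0 \<Longrightarrow> \<exists>d>0. \<forall>t\<in>{a..b}. \<forall>t'\<in>{a..b}. \<bar>t - t'\<bar> < d \<longrightarrow>
      (\<forall>f\<in>X. dist (apply_bcontfun f t) (apply_bcontfun f t') \<le> e)"
    and pc: "\<And>t. t \<in> {a..b} \<Longrightarrow> compact (closure ((\<lambda>f. apply_bcontfun f t) ` X))"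
  shows "compact (closure X)"
  unfolding precompact_iff_totally_bounded
proof (intro allI impI)
  fix e :: real assume e: "e > 0"
  then have e8: "e / 8 > 0" by simp
  from equi[OF this] obtain d where d: "d > 0" and eq: "\<And>t t' f. t \<in> {a..b} \<Longrightarrow> t' \<in> {a..b} \<Longrightarrow> \<bar>t - t'\<bar> < d \<Longrightarrow>
      f \<in> X \<Longrightarrow> dist (apply_bcontfun f t) (apply_bcontfun f t') \<le> e / 8" by blast
  have cp: "compact {a..b}" by simp
  obtain G where G: "G \<subseteq> {a..b}" "finite G" "{a..b} \<subseteq> (\<Union>g\<in>G. ball g d)"
    by (rule compactE_image[OF cp, of "{a..b}" "\<lambda>g. ball g d"]) (use d in \<open>auto intro: that\<close>)
  have "\<forall>g\<in>G. \<exists>N. finite N \<and> (\<lambda>f. apply_bcontfun f g) ` X \<subseteq> (\<Union>y\<in>N. ball y (e / 8))"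
    using pc G(1) e8 unfolding precompact_iff_totally_bounded by blast
  from bchoice[OF this] obtain N where "\<forall>g\<in>G. finite (N g) \<and> (\<lambda>f. apply_bcontfun f g) ` X \<subseteq> (\<Union>y\<in>N g. ball y (e / 8))" ..
  then have N: "\<And>g. g \<in> G \<Longrightarrow> finite (N g)" "\<And>g f. g \<in> G \<Longrightarrow> f \<in> X \<Longrightarrow> \<exists>y. y \<in> N g \<and> dist y (apply_bcontfun f g) < e / 8"
    by (auto simp: image_subset_iff)
  define p where "p f = restrict (\<lambda>g. SOME y. y \<in> N g \<and> dist y (apply_bcontfun f g) < e / 8) G" for f
  have p: "p f g \<in> N g" "dist (p f g) (apply_bcontfun f g) < e / 8" if "f \<in> X" "g \<in> G" for f g
    using someI_ex[OF N(2)[OF that(2,1)]] that(2) unfolding p_def by auto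
  have "p ` X \<subseteq> PiE G N" using p(1) by (auto simp: p_def PiE_def extensional_def)
  moreover have "finite (PiE G N)" using G(2) N(1) by (rule finite_PiE)
  ultimately have fin: "finite (p ` X)" by (rule finite_subset)
  define r where "r \<pi> = (SOME f. f \<in> X \<and> p f = \<pi>)" for \<pi>
  have r: "r (p f) \<in> X" "p (r (p f)) = p f" if "f \<in> X" for f
    using someI[of "\<lambda>f'. f' \<in> X \<and> p f' = p f" f] that unfolding r_def by auto
  have "X \<subseteq> (\<Union>y\<in>r ` p ` X. ball y e)"
  proof
    fix f assume f: "f \<in> X"
    have "dist (r (p f)) f \<le> e / 2"
    proof (rule dist_bound)
      fix t
      define c where "c = max a (min b t)"
      have c: "c \<in> {a..b}" using ab by (auto simp: c_def)
      then obtain g where g: "g \<in> G" "\<bar>c - g\<bar> < d" using G(3) by (force simp: dist_real_def)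
      have gab: "g \<in> {a..b}" using g G(1) by blast
      let ?r = "r (p f)"
      have 1: "dist (apply_bcontfun ?r c) (apply_bcontfun ?r g) \<le> e / 8" by (rule eq[OF c gab g(2) r(1)[OF f]])
      have 2: "dist (apply_bcontfun f c) (apply_bcontfun f g) \<le> e / 8" by (rule eq[OF c gab g(2) f])
      have 3: "dist (p f g) (apply_bcontfun f g) < e / 8" by (rule p(2)[OF f g(1)])
      have 4: "dist (p f g) (apply_bcontfun ?r g) < e / 8" using p(2)[OF r(1)[OF f] g(1)] r(2)[OF f] by simp
      have "dist (apply_bcontfun ?r c) (apply_bcontfun f c) \<le>
          dist (apply_bcontfun ?r c) (apply_bcontfun ?r g) + dist (apply_bcontfun ?r g) (apply_bcontfun f c)"
        by (rule dist_triangle)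
      moreover have "dist (apply_bcontfun ?r g) (apply_bcontfun f c) \<le>
          dist (apply_bcontfun ?r g) (apply_bcontfun f g) + dist (apply_bcontfun f c) (apply_bcontfun f g)"
        by (rule dist_triangle2)
      moreover have "dist (apply_bcontfun ?r g) (apply_bcontfun f g) \<le>
          dist (p f g) (apply_bcontfun ?r g) + dist (p f g) (apply_bcontfun f g)"
        by (rule dist_triangle3)
      ultimately have "dist (apply_bcontfun ?r c) (apply_bcontfun f c) \<le> e / 2" using 1 2 3 4 by linarith
      then show "dist (apply_bcontfun ?r t) (apply_bcontfun f t) \<le> e / 2"
        using clamp[OF f, of t] clamp[OF r(1)[OF f], of t] by (simp add: c_def)
    qed
    then have "f \<in> ball (r (p f)) e" using e by simp
    then show "f \<in> (\<Union>y\<in>r ` p ` X. ball y e)" using f by blast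
  qed
  then show "\<exists>N. finite N \<and> X \<subseteq> (\<Union>y\<in>N. ball y e)" using fin by blast
qed

context weakly_singular_kernel
begin

lemma volterra_continuous:
  assumes h: "dominated h m" and m: "admissible m"
  shows "continuous_on {a..b} (volterra h)"
  unfolding continuous_on_iff
proof (intro ballI allI impI)
  fix t e :: real assume t: "t \<in> {a..b}" and e: "e > 0"
  have "e / 2 > 0" using e by simp
  from volterra_equicontinuous[OF m this] obtain d where d: "d > 0" "\<And>t t' h. t \<in> {a..b} \<Longrightarrow> t' \<in> {a..b} \<Longrightarrow> \<bar>t - t'\<bar> < d \<Longrightarrow>
      dominated h m \<Longrightarrow> norm (volterra h t - volterra h t') \<le> e / 2" by blast
  have "dist (volterra h t') (volterra h t) < e" if "t' \<in> {a..b}" "dist t' t < d" for t'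
    using d(2)[OF that(1) t _ h] that(2) e by (simp add: dist_norm dist_real_def)
  then show "\<exists>d>0. \<forall>t'\<in>{a..b}. dist t' t < d \<longrightarrow> dist (volterra h t') (volterra h t) < e"
    using d(1) by blast
qed

definition volterra_path :: "(real \<Rightarrow> 'a) \<Rightarrow> (real \<Rightarrow>\<^sub>C 'a)" where
  "volterra_path h = Bcontfun (\<lambda>t. volterra h (max a (min b t)))"

lemma volterra_path_apply:
  assumes h: "dominated h m" and m: "admissible m"
  shows "apply_bcontfun (volterra_path h) t = volterra h (max a (min b t))"
proof -
  have c: "continuous_on {a..b} (volterra h)" by (rule volterra_continuous[OF h m])
  have "(\<lambda>t. volterra h (max a (min b t))) \<in> bcontfun"
    unfolding bcontfun_def
  proof (intro CollectI conjI)
    show "continuous_on UNIV (\<lambda>t. volterra h (max a (min b t)))"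
      using ab by (intro continuous_on_compose2[OF c] continuous_intros) auto
    have "bounded (volterra h ` {a..b})" by (intro compact_imp_bounded compact_continuous_image[OF c]) simp
    then show "bounded (range (\<lambda>t. volterra h (max a (min b t))))"
      by (rule bounded_subset) (use ab in auto)
  qed
  then show ?thesis unfolding volterra_path_def by (simp add: Bcontfun_inverse)
qed

lemma dominated_convex:
  assumes "dominated h m" "dominated h' m" "0 \<le> c" "0 \<le> d" "c + d = 1"
  shows "dominated (\<lambda>s. c *\<^sub>R h s + d *\<^sub>R h' s) m"
  unfolding dominated_def
proof (intro conjI ballI)
  show "(\<lambda>s. c *\<^sub>R h s + d *\<^sub>R h' s) \<in> borel_measurable M"
    using assms unfolding dominated_def by auto
  fix s assume "s \<in> {a..b}"
  then have n: "norm (h s) \<le> m s" "norm (h' s) \<le> m s" using assms unfolding dominated_def by auto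
  have "norm (c *\<^sub>R h s + d *\<^sub>R h' s) \<le> c * norm (h s) + d * norm (h' s)"
    using assms by (intro norm_triangle_le) simp
  also have "\<dots> \<le> c * m s + d * m s" using n assms by (intro add_mono mult_left_mono) auto
  also have "\<dots> = m s" using assms by (simp flip: distrib_right)
  finally show "norm (c *\<^sub>R h s + d *\<^sub>R h' s) \<le> m s" .
qed

lemma dominated_scaleR: "dominated h m \<Longrightarrow> 0 \<le> c \<Longrightarrow> dominated (\<lambda>s. c *\<^sub>R h s) (\<lambda>s. c * m s)"
  unfolding dominated_def by (auto intro!: mult_left_mono)

text \<open>The fixed point argument takes place in the closure of this set.\<close>

theorem volterra_paths_compact_convex:
  assumes m: "admissible m"
  defines "V \<equiv> {volterra_path h |h. dominated h m}"
  shows "compact (closure V)" "convex (closure V)" "V \<noteq> {}"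
proof -
  show "V \<noteq> {}"
    using admissibleD(2)[OF m] unfolding V_def dominated_def by (auto intro!: exI[of _ "\<lambda>_. 0"])
  show "convex (closure V)"
  proof (rule convex_closure, rule convexI)
    fix x y :: "real \<Rightarrow>\<^sub>C 'a" and c d :: real
    assume xy: "x \<in> V" "y \<in> V" and cd: "0 \<le> c" "0 \<le> d" "c + d = 1"
    then obtain h h' where h: "dominated h m" "x = volterra_path h" "dominated h' m" "y = volterra_path h'"
      unfolding V_def by blast
    have "c *\<^sub>R x + d *\<^sub>R y = volterra_path (\<lambda>s. c *\<^sub>R h s + d *\<^sub>R h' s)"
    proof (rule bcontfun_eqI)
      fix t
      have t: "max a (min b t) \<in> {a..b}" using ab by auto
      have "volterra (\<lambda>s. c *\<^sub>R h s + d *\<^sub>R h' s) (max a (min b t)) =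
          c *\<^sub>R volterra h (max a (min b t)) + d *\<^sub>R volterra h' (max a (min b t))"
        unfolding volterra_scaleR[symmetric]
        by (rule volterra_add[OF dominated_scaleR[OF h(1) cd(1)] admissible_scale[OF m cd(1)]
              dominated_scaleR[OF h(3) cd(2)] admissible_scale[OF m cd(2)] t])
      then show "apply_bcontfun (c *\<^sub>R x + d *\<^sub>R y) t = apply_bcontfun (volterra_path (\<lambda>s. c *\<^sub>R h s + d *\<^sub>R h' s)) t"
        by (simp add: h volterra_path_apply[OF h(1) m] volterra_path_apply[OF h(3) m]
            volterra_path_apply[OF dominated_convex[OF h(1,3) cd] m])
    qed
    then show "c *\<^sub>R x + d *\<^sub>R y \<in> V" unfolding V_def using dominated_convex[OF h(1,3) cd] by blast
  qed
  show "compact (closure V)"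
  proof (rule precompact_bcontfun[of V a b])
    show "apply_bcontfun f t = apply_bcontfun f (max a (min b t))" if f: "f \<in> V" for f t
    proof -
      obtain h where h: "dominated h m" "f = volterra_path h" using f unfolding V_def by blast
      have "max a (min b (max a (min b t))) = max a (min b t)" using ab by auto
      then show ?thesis unfolding h(2) volterra_path_apply[OF h(1) m] by simp
    qed
    show "a \<le> b" using ab by simp
    have ev: "apply_bcontfun (volterra_path h) t = volterra h t" if "t \<in> {a..b}" "dominated h m" for h t
    proof -
      have "max a (min b t) = t" using that(1) by auto
      then show ?thesis using volterra_path_apply[OF that(2) m, of t] by simp
    qed
    show "\<exists>d>0. \<forall>t\<in>{a..b}. \<forall>t'\<in>{a..b}. \<bar>t - t'\<bar> < d \<longrightarrow>
      (\<forall>f\<in>V. dist (apply_bcontfun f t) (apply_bcontfun f t') \<le> e)" if e: "e > 0" for e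
    proof -
      from volterra_equicontinuous[OF m e] obtain d where d: "d > 0" "\<And>t t' h. t \<in> {a..b} \<Longrightarrow> t' \<in> {a..b} \<Longrightarrow> \<bar>t - t'\<bar> < d \<Longrightarrow>
        dominated h m \<Longrightarrow> norm (volterra h t - volterra h t') \<le> e" by blast
      then show ?thesis unfolding V_def by (intro exI[of _ d]) (auto simp: ev dist_norm)
    qed
    show "compact (closure ((\<lambda>f. apply_bcontfun f t) ` V))" if t: "t \<in> {a..b}" for t
      by (rule precompact_subset[OF volterra_precompact[OF m t]]) (auto simp: V_def ev[OF t])
  qed
qed

end

section \<open>Measurable projections\<close>

text \<open>Local constancy on the Baire space. The number of coordinates that matter may depend on \<open>\<sigma>\<close>:
  countable unions are coded by reading the index of the set off \<open>\<sigma> 0\<close>, and no common bound then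
  exists.\<close>

definition finitely_determined :: "((nat \<Rightarrow> nat) \<Rightarrow> 'b) \<Rightarrow> bool" where
  "finitely_determined f \<longleftrightarrow> (\<forall>\<sigma>. \<exists>n. \<forall>\<tau>. (\<forall>i<n. \<tau> i = \<sigma> i) \<longrightarrow> f \<tau> = f \<sigma>)"

lemma finitely_determinedD:
  "finitely_determined f \<Longrightarrow> \<exists>n. \<forall>\<tau>. (\<forall>i<n. \<tau> i = \<sigma> i) \<longrightarrow> f \<tau> = f \<sigma>"
  by (simp add: finitely_determined_def)

lemma finitely_determined_const: "finitely_determined (\<lambda>_. c)"
  by (simp add: finitely_determined_def)

lemma finitely_determined_compose:
  "finitely_determined f \<Longrightarrow> finitely_determined (\<lambda>\<sigma>. h (f \<sigma>))"
  unfolding finitely_determined_def by metis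

lemma finitely_determined_Pair:
  assumes "finitely_determined f" "finitely_determined g"
  shows "finitely_determined (\<lambda>\<sigma>. (f \<sigma>, g \<sigma>))"
  unfolding finitely_determined_def
proof
  fix \<sigma>
  from finitely_determinedD[OF assms(1)]
  obtain m where m: "\<forall>\<tau>. (\<forall>i<m. \<tau> i = \<sigma> i) \<longrightarrow> f \<tau> = f \<sigma>" ..
  from finitely_determinedD[OF assms(2)]
  obtain n where n: "\<forall>\<tau>. (\<forall>i<n. \<tau> i = \<sigma> i) \<longrightarrow> g \<tau> = g \<sigma>" ..
  show "\<exists>n. \<forall>\<tau>. (\<forall>i<n. \<tau> i = \<sigma> i) \<longrightarrow> (f \<tau>, g \<tau>) = (f \<sigma>, g \<sigma>)"
  proof (intro exI allI impI)
    fix \<tau> assume t: "\<forall>i<max m n. \<tau> i = \<sigma> i"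
    have "f \<tau> = f \<sigma>" using t by (intro m[rule_format]) simp
    moreover have "g \<tau> = g \<sigma>" using t by (intro n[rule_format]) simp
    ultimately show "(f \<tau>, g \<tau>) = (f \<sigma>, g \<sigma>)" by simp
  qed
qed

lemma finitely_determined_initial:
  assumes "\<And>k. finitely_determined (f k)"
  shows "finitely_determined (\<lambda>\<sigma>. \<lambda>k::nat. if k < n then f k \<sigma> else c)"
proof (induction n)
  case 0
  show ?case by (simp add: finitely_determined_const)
next
  case (Suc n)
  have "(\<lambda>\<sigma> k. if k < Suc n then f k \<sigma> else c) =
      (\<lambda>\<sigma>. (\<lambda>(u, x). u(n := x)) ((\<lambda>k. if k < n then f k \<sigma> else c), f n \<sigma>))"
    by (auto simp: fun_eq_iff)
  then show ?case
    by (simp only:) (rule finitely_determined_compose[OF finitely_determined_Pair[OF Suc.IH assms]])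
qed

lemma finitely_determined_reindex:
  assumes "finitely_determined f"
  shows "finitely_determined (\<lambda>\<sigma>. f (\<lambda>n. \<sigma> (e n)))"
  unfolding finitely_determined_def
proof
  fix \<sigma>
  from finitely_determinedD[OF assms]
  obtain n where n: "\<forall>\<tau>. (\<forall>i<n. \<tau> i = \<sigma> (e i)) \<longrightarrow> f \<tau> = f (\<lambda>n. \<sigma> (e n))" ..
  have "e i < Suc (Max (e ` {..<n}))" if "i < n" for i
    using that by (simp add: less_Suc_eq_le)
  then show "\<exists>n. \<forall>\<tau>. (\<forall>i<n. \<tau> i = \<sigma> i) \<longrightarrow> f (\<lambda>n. \<tau> (e n)) = f (\<lambda>n. \<sigma> (e n))"
    by (intro exI[of _ "Suc (Max (e ` {..<n}))"] allI impI n[rule_format]) auto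
qed

lemma finitely_determined_head:
  assumes "\<And>i. finitely_determined (f i)"
  shows "finitely_determined (\<lambda>\<sigma>. f (\<sigma> 0) (\<lambda>n. \<sigma> (Suc n)))"
  unfolding finitely_determined_def
proof
  fix \<sigma> :: "nat \<Rightarrow> nat"
  from finitely_determinedD[OF assms]
  obtain n where n: "\<forall>\<tau>. (\<forall>i<n. \<tau> i = \<sigma> (Suc i)) \<longrightarrow> f (\<sigma> 0) \<tau> = f (\<sigma> 0) (\<lambda>n. \<sigma> (Suc n))" ..
  show "\<exists>n. \<forall>\<tau>. (\<forall>i<n. \<tau> i = \<sigma> i) \<longrightarrow> f (\<tau> 0) (\<lambda>n. \<tau> (Suc n)) = f (\<sigma> 0) (\<lambda>n. \<sigma> (Suc n))"
  proof (intro exI allI impI)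
    fix \<tau> :: "nat \<Rightarrow> nat" assume t: "\<forall>i<Suc n. \<tau> i = \<sigma> i"
    then have "\<tau> 0 = \<sigma> 0" by simp
    moreover have "f (\<sigma> 0) (\<lambda>n. \<tau> (Suc n)) = f (\<sigma> 0) (\<lambda>n. \<sigma> (Suc n))"
      using t by (intro n[rule_format]) simp
    ultimately show "f (\<tau> 0) (\<lambda>n. \<tau> (Suc n)) = f (\<sigma> 0) (\<lambda>n. \<sigma> (Suc n))" by simp
  qed
qed

lemma finitely_determined_nth: "finitely_determined (\<lambda>\<sigma>. \<sigma> k)"
  unfolding finitely_determined_def by blast

text \<open>A finite sequence \<open>s\<close> determines the set \<open>B s\<close> of points reached by some \<open>\<sigma>\<close> that extends \<open>s\<close>.
  Let \<open>H s\<close> be a measurable hull of \<open>B s\<close>. Since \<open>B s\<close> is the union of the sets \<open>B (s @ [k])\<close>, its hull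
  exceeds the union of their hulls by a null set only. Outside these countably many null sets, a
  point of the hull of everything can be followed step by step to a full sequence \<open>\<sigma>\<close>, so it
  lies in the Souslin set itself. By completeness the null exceptional set does no harm.\<close>

theorem (in finite_measure) Souslin_operation_measurable:
  assumes complete: "\<And>N B. N \<in> null_sets M \<Longrightarrow> B \<subseteq> N \<Longrightarrow> B \<in> sets M"
    and A: "\<And>(k::nat) \<sigma>. A k \<sigma> \<in> sets M"
    and fd: "\<And>k. finitely_determined (A k)"
  shows "{w \<in> space M. \<exists>\<sigma>. \<forall>k. w \<in> A k \<sigma>} \<in> sets M"
proof -
  define ex where "ex s i = (if i < length s then s ! i else 0)" for s :: "nat list" and i
  \<comment> \<open>\<open>D s\<close> lists the conditions among the first ones that \<open>s\<close> already decides, and \<open>P s\<close> their conjunction\<close>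
  define D where "D s = {k. k < length s \<and> (\<forall>\<tau>. (\<forall>i<length s. \<tau> i = s ! i) \<longrightarrow> A k \<tau> = A k (ex s))}" for s
  define P where "P s = {w \<in> space M. \<forall>k\<in>D s. w \<in> A k (ex s)}" for s
  define B where "B s = {w \<in> space M. \<exists>\<sigma>. (\<forall>i<length s. \<sigma> i = s ! i) \<and> (\<forall>k. w \<in> A k \<sigma>)}" for s
  have P_sets: "P s \<in> sets M" for s
  proof -
    have "finite (D s)" unfolding D_def by simp
    then show ?thesis unfolding P_def using A
      by (intro sets.sets_Collect_finite_All) (auto simp: sets.Int_space_eq2 Collect_conj_eq Int_def[symmetric] intro: sets.sets_Collect_const)
  qed
  have BP: "B s \<subseteq> P s" for s
    unfolding B_def P_def D_def by auto
  have B_step: "B s \<subseteq> (\<Union>k. B (s @ [k]))" for s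
  proof
    fix w assume "w \<in> B s"
    then obtain \<sigma> where s: "w \<in> space M" "\<forall>i<length s. \<sigma> i = s ! i" "\<forall>k. w \<in> A k \<sigma>"
      unfolding B_def by blast
    then have "w \<in> B (s @ [\<sigma> (length s)])"
      unfolding B_def by (auto intro!: exI[of _ \<sigma>] simp: nth_append less_Suc_eq)
    then show "w \<in> (\<Union>k. B (s @ [k]))" by blast
  qed
  have "\<exists>H. H \<in> sets M \<and> B s \<subseteq> H \<and> H \<subseteq> P s \<and> (\<forall>C\<in>sets M. B s \<subseteq> C \<longrightarrow> emeasure M H \<le> emeasure M C)" for s
  proof -
    \<comment> \<open>cutting the hull down to \<open>P s\<close> keeps it a hull and ties its points to the conditions decided by \<open>s\<close>\<close>
    have "B s \<subseteq> space M" unfolding B_def by auto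
    from outer_measure_of_attain[OF this] obtain E where E: "E \<in> sets M" "B s \<subseteq> E"
      "outer_measure_of M (B s) = emeasure M E" by blast
    have "emeasure M (E \<inter> P s) \<le> emeasure M C" if "C \<in> sets M" "B s \<subseteq> C" for C
    proof -
      have "emeasure M (E \<inter> P s) \<le> emeasure M E" using E P_sets by (intro emeasure_mono) auto
      also have "\<dots> \<le> emeasure M C"
        unfolding E(3)[symmetric] outer_measure_of_def using that by (intro INF_lower) auto
      finally show ?thesis .
    qed
    then show ?thesis using E P_sets BP by (intro exI[of _ "E \<inter> P s"]) auto
  qed
  then obtain H where H: "\<And>s. H s \<in> sets M" "\<And>s. B s \<subseteq> H s" "\<And>s. H s \<subseteq> P s"
      "\<And>s C. C \<in> sets M \<Longrightarrow> B s \<subseteq> C \<Longrightarrow> emeasure M (H s) \<le> emeasure M C"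
    by metis
  define N where "N = (\<Union>s. H s - (\<Union>k. H (s @ [k])))"
  have "H s - (\<Union>k. H (s @ [k])) \<in> null_sets M" for s
  proof -
    let ?C = "\<Union>k. H (s @ [k])"
    have C: "?C \<in> sets M" using H by blast
    have "emeasure M (H s) \<le> emeasure M (H s \<inter> ?C)"
    proof (rule H(4))
      show "H s \<inter> ?C \<in> sets M" using C H by blast
      show "B s \<subseteq> H s \<inter> ?C" using B_step[of s] H(2) by blast
    qed
    moreover have "H s - ?C = H s - (H s \<inter> ?C)" by auto
    then have "emeasure M (H s - ?C) = emeasure M (H s) - emeasure M (H s \<inter> ?C)"
      using H C by (simp add: emeasure_Diff)
    ultimately have "emeasure M (H s - ?C) = 0"
      by (simp add: diff_eq_0_iff_ennreal flip: less_top)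
    then show ?thesis using H C by auto
  qed
  then have N: "N \<in> null_sets M" unfolding N_def by (intro null_sets_UN)
  have "H [] - N \<subseteq> B []"
  proof
    fix w assume w: "w \<in> H [] - N"
    have step: "\<exists>k. w \<in> H (s @ [k])" if "w \<in> H s" for s
      using w that unfolding N_def by blast
    define L where "L = rec_nat [] (\<lambda>_ s. s @ [SOME k. w \<in> H (s @ [k])])"
    have L_Suc: "L (Suc n) = L n @ [SOME k. w \<in> H (L n @ [k])]" for n by (simp add: L_def)
    have LH: "w \<in> H (L n)" for n
    proof (induction n)
      case 0 then show ?case using w by (simp add: L_def)
    next
      case (Suc n) then show ?case unfolding L_Suc using someI_ex[OF step] by blast
    qed
    define \<sigma> where "\<sigma> n = (SOME k. w \<in> H (L n @ [k]))" for n
    have L_eq: "L n = map \<sigma> [0..<n]" for n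
    proof (induction n)
      case 0 then show ?case by (simp add: L_def)
    next
      case (Suc n)
      have "L (Suc n) = L n @ [\<sigma> n]" unfolding \<sigma>_def by (rule L_Suc)
      then show ?case using Suc.IH by simp
    qed
    have "w \<in> A k \<sigma>" for k
    proof -
      from finitely_determinedD[OF fd]
      obtain n where n: "\<forall>\<tau>. (\<forall>i<n. \<tau> i = \<sigma> i) \<longrightarrow> A k \<tau> = A k \<sigma>" ..
      let ?n = "max n (Suc k)"
      have e: "A k \<tau> = A k \<sigma>" if "\<forall>i<?n. \<tau> i = L ?n ! i" for \<tau>
        using that by (intro n[rule_format]) (simp add: L_eq)
      have e': "A k (ex (L ?n)) = A k \<sigma>"
        by (rule e) (simp add: ex_def L_eq)
      have len: "length (L ?n) = ?n" by (simp only: L_eq length_map length_upt diff_zero)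
      have "k \<in> D (L ?n)"
        unfolding D_def len
      proof (intro CollectI conjI allI impI)
        fix \<tau> assume "\<forall>i<?n. \<tau> i = L ?n ! i"
        then show "A k \<tau> = A k (ex (L ?n))" unfolding e' by (rule e)
      qed simp
      moreover have "w \<in> P (L ?n)" using LH H(3) by blast
      ultimately show ?thesis unfolding P_def using e' by blast
    qed
    moreover have "w \<in> space M" using w sets.sets_into_space[OF H(1)] by blast
    ultimately show "w \<in> B []" unfolding B_def by auto
  qed
  then have "H [] - B [] \<subseteq> N" by blast
  then have "H [] - B [] \<in> sets M" by (rule complete[OF N])
  moreover have "B [] = H [] - (H [] - B [])" using H(2) by blast
  ultimately have "B [] \<in> sets M" using H(1) by (metis sets.Diff)
  then show ?thesis unfolding B_def by simp
qed

definition Souslin_scheme ::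
  "'w measure \<Rightarrow> (nat \<Rightarrow> (nat \<Rightarrow> nat) \<Rightarrow> 'w set) \<Rightarrow> (nat \<Rightarrow> (nat \<Rightarrow> nat) \<Rightarrow> 'x::topological_space set) \<Rightarrow> bool"
  where "Souslin_scheme M A C \<longleftrightarrow>
     (\<forall>k. finitely_determined (A k)) \<and> (\<forall>k. finitely_determined (C k)) \<and>
     (\<forall>k \<sigma>. A k \<sigma> \<in> sets M) \<and> (\<forall>k \<sigma>. closed (C k \<sigma>))"

definition Souslin_result ::
  "'w measure \<Rightarrow> (nat \<Rightarrow> (nat \<Rightarrow> nat) \<Rightarrow> 'w set) \<Rightarrow> (nat \<Rightarrow> (nat \<Rightarrow> nat) \<Rightarrow> 'x set) \<Rightarrow> ('w \<times> 'x) set"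
  where "Souslin_result M A C = {(w, x). w \<in> space M \<and> (\<exists>\<sigma>. \<forall>k. w \<in> A k \<sigma> \<and> x \<in> C k \<sigma>)}"

text \<open>Souslin sets over the rectangles with a measurable side and a closed side. The two sides are kept
  apart, since in the projection the closed side is tested for emptiness on its own.\<close>

definition Souslin_set :: "'w measure \<Rightarrow> ('w \<times> 'x::topological_space) set \<Rightarrow> bool" where
  "Souslin_set M G \<longleftrightarrow> (\<exists>A C. Souslin_scheme M A C \<and> G = Souslin_result M A C)"

lemma Souslin_set_family:
  assumes "\<And>i. Souslin_set M (G i)"
  obtains A C where "\<And>i (k::nat). finitely_determined (A i k)" "\<And>i (k::nat). finitely_determined (C i k)"
    and "\<And>i k \<sigma>. A i k \<sigma> \<in> sets M" "\<And>i k \<sigma>. closed (C i k \<sigma>)"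
    and "\<And>i. G i = {(w, x). w \<in> space M \<and> (\<exists>\<sigma>. \<forall>k. w \<in> A i k \<sigma> \<and> x \<in> C i k \<sigma>)}"
proof -
  from assms have "\<forall>i. \<exists>A C. Souslin_scheme M A C \<and> G i = Souslin_result M A C"
    unfolding Souslin_set_def by blast
  from choice[OF this] obtain A where "\<forall>i. \<exists>C. Souslin_scheme M (A i) C \<and> G i = Souslin_result M (A i) C" ..
  from choice[OF this] obtain C where AC: "\<forall>i. Souslin_scheme M (A i) (C i) \<and> G i = Souslin_result M (A i) (C i)" ..
  show ?thesis
    by (rule that[of A C])
       (use AC in \<open>simp_all only: Souslin_scheme_def Souslin_result_def simp_thms\<close>)
qed

lemma Souslin_setI:
  assumes "\<And>k::nat. finitely_determined (A k)" "\<And>k::nat. finitely_determined (C k)"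
    and "\<And>k \<sigma>. A k \<sigma> \<in> sets M" "\<And>k \<sigma>. closed (C k \<sigma>)"
    and "G = {(w, x). w \<in> space M \<and> (\<exists>\<sigma>. \<forall>k. w \<in> A k \<sigma> \<and> x \<in> C k \<sigma>)}"
  shows "Souslin_set M G"
  unfolding Souslin_set_def Souslin_scheme_def Souslin_result_def
  using assms by (intro exI[of _ A] exI[of _ C]) simp

lemma Souslin_set_rectangle:
  assumes "A \<in> sets M" "closed C"
  shows "Souslin_set M (A \<times> C)"
proof -
  have "A \<times> C = {(w, x). w \<in> space M \<and> (\<exists>\<sigma>::nat \<Rightarrow> nat. \<forall>k::nat. w \<in> A \<and> x \<in> C)}"
    using sets.sets_into_space[OF assms(1)] by auto
  then show ?thesis
    by (intro Souslin_setI[of "\<lambda>_ _. A" "\<lambda>_ _. C"]) (use assms in \<open>simp_all add: finitely_determined_const\<close>)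
qed

text \<open>One \<open>\<sigma>\<close> codes a whole sequence of them by the pairing function.\<close>

lemma Souslin_set_Inter:
  fixes G :: "nat \<Rightarrow> ('w \<times> 'x::topological_space) set"
  assumes "\<And>i. Souslin_set M (G i)"
  shows "Souslin_set M (\<Inter>i. G i)"
proof -
  obtain A C where fd: "\<And>i (k::nat). finitely_determined (A i k)" "\<And>i (k::nat). finitely_determined (C i k)"
    and sets: "\<And>i k \<sigma>. A i k \<sigma> \<in> sets M" "\<And>i k \<sigma>. closed (C i k \<sigma>)"
    and G: "\<And>i. G i = {(w, x). w \<in> space M \<and> (\<exists>\<sigma>. \<forall>k. w \<in> A i k \<sigma> \<and> x \<in> C i k \<sigma>)}"
    by (rule Souslin_set_family[of M G], rule assms, rule that)
  let ?i = "\<lambda>m. fst (prod_decode m)" and ?k = "\<lambda>m. snd (prod_decode m)"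
  let ?\<sigma> = "\<lambda>m \<sigma> n. \<sigma> (prod_encode (?i m, n))"
  define A' where "A' m \<sigma> = A (?i m) (?k m) (?\<sigma> m \<sigma>)" for m \<sigma>
  define C' where "C' m \<sigma> = C (?i m) (?k m) (?\<sigma> m \<sigma>)" for m \<sigma>
  have "(\<Inter>i. G i) = {(w, x). w \<in> space M \<and> (\<exists>\<sigma>. \<forall>k. w \<in> A' k \<sigma> \<and> x \<in> C' k \<sigma>)}" (is "_ = ?R")
  proof (intro equalityI subsetI)
    fix p assume p: "p \<in> (\<Inter>i. G i)"
    obtain w x where wx: "p = (w, x)" by force
    have "\<forall>i. \<exists>\<sigma>. \<forall>k. w \<in> A i k \<sigma> \<and> x \<in> C i k \<sigma>" using p unfolding wx G by auto
    then obtain s where s: "\<And>i k. w \<in> A i k (s i)" "\<And>i k. x \<in> C i k (s i)" by metis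
    have "\<forall>k. w \<in> A' k (\<lambda>j. s (?i j) (?k j)) \<and> x \<in> C' k (\<lambda>j. s (?i j) (?k j))"
      unfolding A'_def C'_def by (auto intro!: s)
    then show "p \<in> ?R" using p unfolding wx G by blast
  next
    fix p assume "p \<in> ?R"
    then obtain w x \<sigma> where wx: "p = (w, x)" "w \<in> space M"
      and s: "\<And>k. w \<in> A' k \<sigma>" "\<And>k. x \<in> C' k \<sigma>" by auto
    have "w \<in> A i k (\<lambda>n. \<sigma> (prod_encode (i, n))) \<and> x \<in> C i k (\<lambda>n. \<sigma> (prod_encode (i, n)))" for i k
      using s[of "prod_encode (i, k)"] unfolding A'_def C'_def by simp
    then show "p \<in> (\<Inter>i. G i)" unfolding G wx(1) using wx(2) by blast
  qed
  moreover have "finitely_determined (A' k)" "finitely_determined (C' k)" for k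
  proof -
    have "A' k = (\<lambda>\<sigma>. A (?i k) (?k k) (\<lambda>n. \<sigma> (prod_encode (?i k, n))))" by (simp add: A'_def fun_eq_iff)
    then show "finitely_determined (A' k)"
      using finitely_determined_reindex[OF fd(1), of "?i k" "?k k" "\<lambda>n. prod_encode (?i k, n)"] by simp
    have "C' k = (\<lambda>\<sigma>. C (?i k) (?k k) (\<lambda>n. \<sigma> (prod_encode (?i k, n))))" by (simp add: C'_def fun_eq_iff)
    then show "finitely_determined (C' k)"
      using finitely_determined_reindex[OF fd(2), of "?i k" "?k k" "\<lambda>n. prod_encode (?i k, n)"] by simp
  qed
  moreover have "A' k \<sigma> \<in> sets M" "closed (C' k \<sigma>)" for k \<sigma>
    unfolding A'_def C'_def by (intro sets)+
  ultimately show ?thesis by (intro Souslin_setI[of A' C'])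
qed

lemma Souslin_set_Union:
  fixes G :: "nat \<Rightarrow> ('w \<times> 'x::topological_space) set"
  assumes "\<And>i. Souslin_set M (G i)"
  shows "Souslin_set M (\<Union>i. G i)"
proof -
  obtain A C where fd: "\<And>i (k::nat). finitely_determined (A i k)" "\<And>i (k::nat). finitely_determined (C i k)"
    and sets: "\<And>i k \<sigma>. A i k \<sigma> \<in> sets M" "\<And>i k \<sigma>. closed (C i k \<sigma>)"
    and G: "\<And>i. G i = {(w, x). w \<in> space M \<and> (\<exists>\<sigma>. \<forall>k. w \<in> A i k \<sigma> \<and> x \<in> C i k \<sigma>)}"
    by (rule Souslin_set_family[of M G], rule assms, rule that)
  define A' where "A' k \<sigma> = A (\<sigma> 0) k (\<lambda>n. \<sigma> (Suc n))" for k \<sigma>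
  define C' where "C' k \<sigma> = C (\<sigma> 0) k (\<lambda>n. \<sigma> (Suc n))" for k \<sigma>
  have "(\<Union>i. G i) = {(w, x). w \<in> space M \<and> (\<exists>\<sigma>. \<forall>k. w \<in> A' k \<sigma> \<and> x \<in> C' k \<sigma>)}" (is "_ = ?R")
  proof (intro equalityI subsetI)
    fix p assume "p \<in> (\<Union>i. G i)"
    then obtain i \<sigma> w x where "p = (w, x)" "w \<in> space M" "\<forall>k. w \<in> A i k \<sigma> \<and> x \<in> C i k \<sigma>"
      unfolding G by auto
    then show "p \<in> ?R" unfolding A'_def C'_def by (auto intro!: exI[of _ "case_nat i \<sigma>"])
  next
    fix p assume "p \<in> ?R"
    then show "p \<in> (\<Union>i. G i)" unfolding G A'_def C'_def by blast
  qed
  moreover have "finitely_determined (A' k)" "finitely_determined (C' k)" for k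
  proof -
    have "A' k = (\<lambda>\<sigma>. A (\<sigma> 0) k (\<lambda>n. \<sigma> (Suc n)))" by (simp add: A'_def fun_eq_iff)
    then show "finitely_determined (A' k)"
      using finitely_determined_head[of "\<lambda>i. A i k", OF fd(1)] by simp
    have "C' k = (\<lambda>\<sigma>. C (\<sigma> 0) k (\<lambda>n. \<sigma> (Suc n)))" by (simp add: C'_def fun_eq_iff)
    then show "finitely_determined (C' k)"
      using finitely_determined_head[of "\<lambda>i. C i k", OF fd(2)] by simp
  qed
  moreover have "A' k \<sigma> \<in> sets M" "closed (C' k \<sigma>)" for k \<sigma>
    unfolding A'_def C'_def by (intro sets)+
  ultimately show ?thesis by (intro Souslin_setI[of A' C'])
qed

lemma Souslin_set_Un:
  assumes "Souslin_set M G" "Souslin_set M H"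
  shows "Souslin_set M (G \<union> H)"
proof -
  have "G \<union> H = (\<Union>i::nat. if i = 0 then G else H)" by auto
  then show ?thesis using Souslin_set_Union[of M "\<lambda>i. if i = 0 then G else H"] assms by auto
qed

lemma Souslin_set_Int:
  assumes "Souslin_set M G" "Souslin_set M H"
  shows "Souslin_set M (G \<inter> H)"
proof -
  have "G \<inter> H = (\<Inter>i::nat. if i = 0 then G else H)" by (auto split: if_splits)
  then show ?thesis using Souslin_set_Inter[of M "\<lambda>i. if i = 0 then G else H"] assms by auto
qed

lemma Souslin_set_open_rectangle:
  fixes V :: "'x::metric_space set"
  assumes "A \<in> sets M" "open V"
  shows "Souslin_set M (A \<times> V)"
proof -
  show ?thesis
  proof (cases "V = UNIV")
    case True
    then show ?thesis using assms by (simp add: Souslin_set_rectangle)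
  next
    case False
    define F where "F n = {x. inverse (real (Suc n)) \<le> infdist x (- V)}" for n
    have cl: "closed (F n)" for n
      unfolding F_def by (intro closed_Collect_le continuous_intros)
    have "V = (\<Union>n. F n)"
    proof (intro equalityI subsetI)
      fix x assume "x \<in> V"
      then have "infdist x (- V) \<noteq> 0"
        using in_closed_iff_infdist_zero[of "- V" x] assms(2) False by auto
      then have "infdist x (- V) > 0" using infdist_nonneg[of x "- V"] by linarith
      then obtain n where "inverse (real (Suc n)) < infdist x (- V)" using reals_Archimedean by blast
      then show "x \<in> (\<Union>n. F n)" unfolding F_def by (auto intro: less_imp_le)
    next
      fix x assume "x \<in> (\<Union>n. F n)"
      then obtain n where "inverse (real (Suc n)) \<le> infdist x (- V)" unfolding F_def by blast
      then have "infdist x (- V) \<noteq> 0" using inverse_positive_iff_positive[of "real (Suc n)"] by linarith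
      then show "x \<in> V" using infdist_zero[of x "- V"] by blast
    qed
    then have "A \<times> V = (\<Union>n. A \<times> F n)" by auto
    then show ?thesis
      by (simp only:) (intro Souslin_set_Union Souslin_set_rectangle assms(1) cl)
  qed
qed

text \<open>Souslin sets are not closed under complements, so the sets considered are those that are
  Souslin together with their complement. Such sets form a \<open>\<sigma>\<close>-algebra containing all measurable rectangles.\<close>

lemma Souslin_set_of_measurable:
  fixes G :: "('w \<times> 'x::metric_space) set"
  assumes "G \<in> sets (M \<Otimes>\<^sub>M borel)"
  shows "Souslin_set M G"
proof -
  let ?U = "space M \<times> (UNIV :: 'x set)"
  let ?S = "\<lambda>G. G \<subseteq> ?U \<and> Souslin_set M G \<and> Souslin_set M (?U - G)"
  have S_compl: "?S (?U - G)" if "?S G" for G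
    using that by (auto simp: double_diff)
  have S_Union: "?S (\<Union>i. G i)" if "\<And>i::nat. ?S (G i)" for G
  proof -
    have e: "?U - (\<Union>i. G i) = (\<Inter>i. ?U - G i)" by auto
    have "Souslin_set M (?U - (\<Union>i. G i))"
      unfolding e using that by (intro Souslin_set_Inter) blast
    moreover have "Souslin_set M (\<Union>i. G i)"
      using that by (intro Souslin_set_Union) blast
    ultimately show ?thesis using that by blast
  qed
  have rect: "?S (A \<times> B)" if A: "A \<in> sets M" and "B \<in> sets borel" for A and B :: "'x set"
  proof -
    have "B \<in> sigma_sets UNIV (Collect closed)"
      using \<open>B \<in> sets borel\<close> unfolding borel_eq_closed by simp
    then show ?thesis
    proof induction
      case (Basic C)
      have "?U - A \<times> C = (space M - A) \<times> UNIV \<union> space M \<times> (- C)"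
        using sets.sets_into_space[OF A] by auto
      moreover have "Souslin_set M ((space M - A) \<times> (UNIV :: 'x set))" "Souslin_set M (A \<times> C)"
        using Basic A by (auto intro!: Souslin_set_rectangle)
      moreover have "Souslin_set M (space M \<times> (- C))"
        using Basic by (intro Souslin_set_open_rectangle) auto
      ultimately show ?case
        using sets.sets_into_space[OF A] by (auto intro!: Souslin_set_Un)
    next
      case Empty
      show ?case by (auto intro: Souslin_set_rectangle[of "{}" _ "{}", simplified] Souslin_set_rectangle)
    next
      case (Compl B)
      have 1: "A \<times> (UNIV - B) = (A \<times> UNIV) \<inter> (?U - A \<times> B)"
        and 2: "?U - A \<times> (UNIV - B) = (space M - A) \<times> UNIV \<union> A \<times> B"
        using sets.sets_into_space[OF A] by auto
      show ?case unfolding 2 unfolding 1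
        using Compl A sets.sets_into_space[OF A]
        by (auto intro!: Souslin_set_Un Souslin_set_Int Souslin_set_rectangle)
    next
      case (Union B)
      have "A \<times> (\<Union>i. B i) = (\<Union>i. A \<times> B i)" by auto
      then show ?case using S_Union[of "\<lambda>i. A \<times> B i"] Union by simp
    qed
  qed
  have "G \<in> sigma_sets ?U {A \<times> B | A B. A \<in> sets M \<and> B \<in> sets (borel :: 'x measure)}"
    using assms unfolding sets_pair_measure by simp
  then have "?S G"
  proof induction
    case (Basic a) then show ?case using rect by blast
  next
    case Empty
    show ?case by (auto intro: Souslin_set_rectangle[of "{}" _ "{}", simplified] Souslin_set_rectangle)
  next
    case (Compl a) show ?case by (rule S_compl[OF Compl.IH])
  next
    case (Union a) show ?case by (rule S_Union[OF Union.IH])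
  qed
  then show ?thesis by blast
qed

text \<open>After adding to the scheme a cover of the space by balls of radius \<open>2\<^sup>-\<^sup>k\<close> at each stage \<open>k\<close>, the closed sides
  shrink. By completeness they then meet as soon as all finite intersections are nonempty, so
  existence of \<open>x\<close> is a condition on each finite stage, and the projection is a Souslin
  set of measurable sets.\<close>

theorem (in finite_measure) measurable_projection:
  fixes G :: "('a \<times> 'x::{complete_space, second_countable_topology}) set"
  assumes complete: "\<And>N B. N \<in> null_sets M \<Longrightarrow> B \<subseteq> N \<Longrightarrow> B \<in> sets M"
    and G: "G \<in> sets (M \<Otimes>\<^sub>M borel)"
  shows "{w \<in> space M. \<exists>x. (w, x) \<in> G} \<in> sets M"
proof -
  obtain A C where fd: "\<And>k::nat. finitely_determined (A k)" "\<And>k::nat. finitely_determined (C k)"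
    and sets: "\<And>k \<sigma>. A k \<sigma> \<in> sets M" "\<And>k \<sigma>. closed (C k \<sigma>)"
    and G: "G = {(w, x). w \<in> space M \<and> (\<exists>\<sigma>. \<forall>k. w \<in> A k \<sigma> \<and> x \<in> C k \<sigma>)}"
    by (rule Souslin_set_family[of M "\<lambda>_::unit. G"], rule Souslin_set_of_measurable[OF G], rule that)
  obtain Dn :: "'x set" where Dn: "countable Dn" "\<And>X. open X \<Longrightarrow> X \<noteq> {} \<Longrightarrow> \<exists>d \<in> Dn. d \<in> X"
    by (rule countable_dense_setE) blast
  have "Dn \<noteq> {}" using Dn(2)[of UNIV] by auto
  define e where "e = from_nat_into Dn"
  have e: "\<exists>n. dist (e n) x < r" if r: "r > 0" for x r
  proof -
    obtain d where d: "d \<in> Dn" "d \<in> ball x r" using Dn(2)[of "ball x r"] r by auto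
    from from_nat_into_surj[OF Dn(1) d(1)] obtain n where "from_nat_into Dn n = d" ..
    then show ?thesis using d(2) by (auto simp: e_def dist_commute)
  qed
  let ?ev = "\<lambda>\<tau> n. \<tau> (2 * n) :: nat" and ?od = "\<lambda>\<tau> n. \<tau> (2 * n + 1) :: nat"
  \<comment> \<open>the even coordinates of \<open>\<tau>\<close> carry \<open>\<sigma>\<close>, the odd ones the centres of the balls\<close>
  define S where "S n \<tau> = (\<Inter>k<n. C k (?ev \<tau>) \<inter> cball (e (?od \<tau> k)) (inverse (2 ^ k)))" for n \<tau>
  define A' where "A' n \<tau> = (if S n \<tau> = {} then {} else space M \<inter> (\<Inter>k<n. A k (?ev \<tau>)))" for n \<tau>
  have "{w \<in> space M. \<exists>x. (w, x) \<in> G} = {w \<in> space M. \<exists>\<tau>. \<forall>n. w \<in> A' n \<tau>}"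
  proof (intro Collect_cong conj_cong refl iffI)
    fix w assume w: "w \<in> space M" and "\<exists>x. (w, x) \<in> G"
    then obtain x \<sigma> where x: "\<And>k. w \<in> A k \<sigma>" "\<And>k. x \<in> C k \<sigma>" unfolding G by auto
    have "\<exists>j. dist (e j) x < inverse (2 ^ k)" for k by (rule e) simp
    then obtain \<rho> where \<rho>: "\<And>k. dist (e (\<rho> k)) x < inverse (2 ^ k)" by metis
    define \<tau> where "\<tau> i = (if even i then \<sigma> (i div 2) else \<rho> (i div 2))" for i
    have ev: "?ev \<tau> = \<sigma>" and od: "?od \<tau> = \<rho>" by (auto simp: \<tau>_def fun_eq_iff)
    have "x \<in> S n \<tau>" for n
      unfolding S_def ev using x \<rho> by (auto simp: \<tau>_def intro: less_imp_le)
    then have "w \<in> A' n \<tau>" for n unfolding A'_def ev using x w by auto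
    then show "\<exists>\<tau>. \<forall>n. w \<in> A' n \<tau>" by blast
  next
    fix w assume w: "w \<in> space M" and "\<exists>\<tau>. \<forall>n. w \<in> A' n \<tau>"
    then obtain \<tau> where \<tau>: "\<And>n. w \<in> A' n \<tau>" by blast
    have wA': "S n \<tau> \<noteq> {} \<and> w \<in> (\<Inter>k<n. A k (?ev \<tau>))" for n
      using \<tau>[of n] unfolding A'_def by (auto split: if_splits)
    then have ne: "\<And>n. S n \<tau> \<noteq> {}" by blast
    have wA: "w \<in> A k (?ev \<tau>)" for k
      using wA'[of "Suc k"] by blast
    obtain x where x: "\<And>n. x \<in> S n \<tau>"
    proof (rule decreasing_closed_nest[of "\<lambda>n. S n \<tau>"])
      show "closed (S n \<tau>)" for n
        unfolding S_def by (intro closed_INT ballI closed_Int sets closed_cball)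
      show "S n \<tau> \<subseteq> S m \<tau>" if "m \<le> n" for m n unfolding S_def using that by auto
      fix r :: real assume "r > 0"
      then obtain k where k: "inverse (2 ^ k) < r / 2"
        using real_arch_pow_inv[of "r/2" "1/2"] by (auto simp: power_one_over inverse_eq_divide)
      have "dist x y < r" if "x \<in> S (Suc k) \<tau>" "y \<in> S (Suc k) \<tau>" for x y
      proof -
        have "dist (e (?od \<tau> k)) x \<le> inverse (2 ^ k)" "dist (e (?od \<tau> k)) y \<le> inverse (2 ^ k)"
          using that unfolding S_def by auto
        then show ?thesis using k dist_triangle3[of x y "e (?od \<tau> k)"] by linarith
      qed
      then show "\<exists>n. \<forall>x\<in>S n \<tau>. \<forall>y\<in>S n \<tau>. dist x y < r" by blast
    qed (use ne in auto)
    have "x \<in> C k (?ev \<tau>)" for k using x[of "Suc k"] unfolding S_def by auto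
    then show "\<exists>x. (w, x) \<in> G" unfolding G using w wA by blast
  qed
  moreover have "{w \<in> space M. \<exists>\<tau>. \<forall>n. w \<in> A' n \<tau>} \<in> sets M"
  proof (rule Souslin_operation_measurable[OF complete])
    show "A' n \<tau> \<in> sets M" for n \<tau>
    proof -
      have "space M \<inter> (\<Inter>k<n. A k (?ev \<tau>)) = {w \<in> space M. \<forall>k\<in>{..<n}. w \<in> A k (?ev \<tau>)}" by auto
      also have "\<dots> \<in> sets M" using sets(1)
        by (intro sets.sets_Collect_finite_All) (auto simp: Collect_conj_eq Int_def[symmetric])
      finally show ?thesis unfolding A'_def by simp
    qed
    show "finitely_determined (A' n)" for n
    proof -
      let ?f = "\<lambda>\<tau> k. if k < n then (A k (?ev \<tau>), C k (?ev \<tau>), ?od \<tau> k) else undefined"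
      define h :: "(nat \<Rightarrow> 'a set \<times> 'x set \<times> nat) \<Rightarrow> 'a set" where
        "h f = (if (\<Inter>k<n. fst (snd (f k)) \<inter> cball (e (snd (snd (f k)))) (inverse (2 ^ k))) = {} then {}
           else space M \<inter> (\<Inter>k<n. fst (f k)))" for f
      have "A' n = (\<lambda>\<tau>. h (?f \<tau>))"
        unfolding A'_def S_def h_def by (intro ext) simp
      moreover have "finitely_determined ?f"
        by (intro finitely_determined_initial finitely_determined_Pair finitely_determined_nth
            finitely_determined_reindex[of "A _" "\<lambda>n. 2 * n", OF fd(1)]
            finitely_determined_reindex[of "C _" "\<lambda>n. 2 * n", OF fd(2)])
      from finitely_determined_compose[OF this, of h] have "finitely_determined (\<lambda>\<tau>. h (?f \<tau>))" .
      ultimately show ?thesis by (simp only:)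
    qed
  qed
  ultimately show ?thesis by simp
qed

section \<open>Schauder's fixed point theorem\<close>

text \<open>The radius of the balls may vary with the centre, because in the gluing of selections each function comes with
  its own neighbourhood of validity.\<close>

lemma partition_of_unity_compact:
  fixes K :: "'v::metric_space set"
  assumes "compact K" and r: "\<And>x. x \<in> K \<Longrightarrow> 0 < r x"
  obtains N w where "finite N" "N \<subseteq> K" "\<And>c. continuous_on K (w c)"
    and "\<And>c x. x \<in> K \<Longrightarrow> 0 \<le> w c x" "\<And>x. x \<in> K \<Longrightarrow> (\<Sum>c\<in>N. w c x) = (1::real)"
    and "\<And>c x. w c x \<noteq> 0 \<Longrightarrow> dist x c < r c"
proof -
  obtain N where N: "N \<subseteq> K" "finite N" "K \<subseteq> (\<Union>c\<in>N. ball c (r c))"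
    by (rule compactE_image[OF assms(1), of K "\<lambda>c. ball c (r c)"]) (use r in auto)
  define \<phi> where "\<phi> c x = max 0 (r c - dist x c)" for c x
  define s where "s x = (\<Sum>c\<in>N. \<phi> c x)" for x
  have spos: "s x > 0" if x: "x \<in> K" for x
  proof -
    obtain c where c: "c \<in> N" "x \<in> ball c (r c)" using N(3) x by auto
    have "0 < \<phi> c x" using c by (simp add: \<phi>_def dist_commute)
    also have "\<dots> \<le> s x" unfolding s_def
      using N c by (intro member_le_sum) (auto simp: \<phi>_def)
    finally show ?thesis .
  qed
  show ?thesis
  proof (rule that[of N "\<lambda>c x. \<phi> c x / s x"])
    show "continuous_on K (\<lambda>x. \<phi> c x / s x)" for c
      using spos unfolding \<phi>_def s_def by (intro continuous_intros) (auto simp: less_le)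
    show "0 \<le> \<phi> c x / s x" if "x \<in> K" for c x
      using spos[OF that] by (simp add: \<phi>_def)
    show "(\<Sum>c\<in>N. \<phi> c x / s x) = 1" if "x \<in> K" for x
      using spos[OF that] by (simp add: s_def flip: sum_divide_distrib)
    show "dist x c < r c" if "\<phi> c x / s x \<noteq> 0" for c x
      using that by (auto simp: \<phi>_def max_def split: if_splits)
  qed (use N in auto)
qed

text \<open>Kuhn's lemma, with each grid point labelled in each coordinate by the sign of \<open>g x i - x i\<close>: some grid cell
  contains both labels in every coordinate, and in a small cell this forces \<open>g x i\<close> close to \<open>x i\<close>.
  The dimension is a number, not a type, since it is the cardinality of a net chosen during a proof.\<close>

lemma cube_approximate_fixed_point:
  fixes g :: "(nat \<Rightarrow> real) \<Rightarrow> nat \<Rightarrow> real" and n :: nat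
  defines "Q \<equiv> {x. \<forall>i<n. 0 \<le> x i \<and> x i \<le> 1}"
  assumes range: "\<And>x i. x \<in> Q \<Longrightarrow> i < n \<Longrightarrow> 0 \<le> g x i \<and> g x i \<le> 1"
    and uc: "\<And>e. e > 0 \<Longrightarrow> \<exists>d>0. \<forall>x\<in>Q. \<forall>y\<in>Q. (\<forall>i<n. \<bar>x i - y i\<bar> \<le> d) \<longrightarrow> (\<forall>i<n. \<bar>g x i - g y i\<bar> \<le> e)"
    and e: "e > 0"
  obtains x where "x \<in> Q" "\<And>i. i < n \<Longrightarrow> \<bar>g x i - x i\<bar> \<le> e"
proof -
  obtain d where d: "d > 0" and
    ucd: "\<And>x y i. x \<in> Q \<Longrightarrow> y \<in> Q \<Longrightarrow> \<forall>i<n. \<bar>x i - y i\<bar> \<le> d \<Longrightarrow> i < n \<Longrightarrow> \<bar>g x i - g y i\<bar> \<le> e / 2"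
    using uc[of "e / 2"] e by auto
  obtain p0 where p0: "inverse (real (Suc p0)) < min d (e / 2)"
    using reals_Archimedean[of "min d (e / 2)"] d e by auto
  define p where "p = Suc p0"
  have p: "0 < p" "1 / real p \<le> d" "1 / real p \<le> e / 2"
    using p0 by (auto simp: p_def inverse_eq_divide)
  define X where "X x i = real (x i) / real p" for x :: "nat \<Rightarrow> nat" and i
  have XQ: "X x \<in> Q" if "\<forall>i<n. x i \<le> p" for x
    using that p by (auto simp: Q_def X_def)
  \<comment> \<open>the exception at the upper face meets the boundary condition of the combinatorial lemma\<close>
  define label where "label x i = (if X x i \<le> g (X x) i \<and> x i \<noteq> p then 0 else 1 :: nat)" for x i
  obtain q where q: "\<forall>i<n. q i < p"
    and rs: "\<forall>i<n. \<exists>r s. (\<forall>j<n. q j \<le> r j \<and> r j \<le> q j + 1) \<and> (\<forall>j<n. q j \<le> s j \<and> s j \<le> q j + 1) \<and> label r i \<noteq> label s i"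
  proof (rule kuhn_lemma[of p n label])
    show "\<forall>x. (\<forall>i<n. x i \<le> p) \<longrightarrow> (\<forall>i<n. x i = 0 \<longrightarrow> label x i = 0)"
      using range XQ p by (auto simp: label_def X_def)
  qed (use p in \<open>auto simp: label_def\<close>)
  have "\<bar>g (X q) i - X q i\<bar> \<le> e" if i: "i < n" for i
  proof -
    have near: "\<bar>X q i - X r i\<bar> \<le> e / 2 \<and> \<bar>g (X q) i - g (X r) i\<bar> \<le> e / 2 \<and> X r \<in> Q \<and> r i \<le> p"
      if r: "\<forall>j<n. q j \<le> r j \<and> r j \<le> q j + 1" for r
    proof -
      have rp: "\<forall>j<n. r j \<le> p" 
      proof (intro allI impI)
        fix j assume "j < n"
        then have "r j \<le> q j + 1" "q j < p" using r q by auto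
        then show "r j \<le> p" by linarith
      qed
      have close: "\<bar>X q j - X r j\<bar> \<le> 1 / real p" if "j < n" for j
      proof -
        have "X q j - X r j = (real (q j) - real (r j)) / real p" by (simp add: X_def diff_divide_distrib)
        moreover have "\<bar>real (q j) - real (r j)\<bar> \<le> 1" using r that by force
        ultimately show ?thesis using p by (simp add: divide_right_mono)
      qed
      have "\<bar>g (X q) i - g (X r) i\<bar> \<le> e / 2"
      proof (rule ucd[OF XQ XQ[OF rp] _ i])
        show "\<forall>i<n. q i \<le> p" using q by (auto intro: less_imp_le)
        show "\<forall>i<n. \<bar>X q i - X r i\<bar> \<le> d" using close p(2) by (auto intro: order_trans)
      qed
      then show ?thesis using close[OF i] p XQ[OF rp] rp[rule_format, OF i] by simp
    qed
    obtain r s where "\<forall>j<n. q j \<le> r j \<and> r j \<le> q j + 1" "\<forall>j<n. q j \<le> s j \<and> s j \<le> q j + 1" "label r i \<noteq> label s i"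
      using rs i by blast
    then obtain r s where r: "\<forall>j<n. q j \<le> r j \<and> r j \<le> q j + 1" "label r i = 0"
      and s: "\<forall>j<n. q j \<le> s j \<and> s j \<le> q j + 1" "label s i = 1"
      unfolding label_def by (metis (full_types))
    have "X r i \<le> g (X r) i" using r(2) by (auto simp: label_def split: if_splits)
    moreover have "g (X s) i \<le> X s i"
    proof (cases "s i = p")
      case True
      then have "X s i = 1" using p by (simp add: X_def)
      then show ?thesis using range[of "X s" i] near[OF s(1)] i by auto
    next
      case False
      then show ?thesis using s(2) by (auto simp: label_def split: if_splits)
    qed
    ultimately show ?thesis using near[OF r(1)] near[OF s(1)] by linarith
  qed
  moreover have "X q \<in> Q" using q by (intro XQ) (auto intro: less_imp_le)
  ultimately show ?thesis using that by blast
qed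

text \<open>A retraction from the cube to the standard simplex: mass missing from a total of 1 goes to
  vertex 0, and excess mass is divided out.\<close>

definition simplex_retract :: "nat \<Rightarrow> (nat \<Rightarrow> real) \<Rightarrow> nat \<Rightarrow> real" where
  "simplex_retract n c i =
     (c i + (if i = 0 then max 0 (1 - (\<Sum>j<n. c j)) else 0)) / max 1 (\<Sum>j<n. c j)"

lemma simplex_retract_nonneg: "0 \<le> c i \<Longrightarrow> 0 \<le> simplex_retract n c i"
  by (auto simp: simplex_retract_def intro!: divide_nonneg_pos)

lemma sum_simplex_retract:
  assumes "0 < n"
  shows "(\<Sum>i<n. simplex_retract n c i) = 1"
proof -
  have "(\<Sum>i<n. c i + (if i = 0 then max 0 (1 - (\<Sum>j<n. c j)) else 0)) = max 1 (\<Sum>j<n. c j)"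
    using assms by (simp add: sum.distrib)
  moreover have "max 1 (\<Sum>j<n. c j) > 0" by simp
  ultimately show ?thesis
    unfolding simplex_retract_def by (simp flip: sum_divide_distrib)
qed

lemma simplex_retract_id:
  "(\<Sum>i<n. c i) = 1 \<Longrightarrow> simplex_retract n c i = c i"
  by (simp add: simplex_retract_def)

lemma divide_diff_divide:
  fixes N :: real
  assumes "D \<noteq> 0" "D' \<noteq> 0"
  shows "N / D - N' / D' = (N - N') / D + N' * (D' - D) / (D * D')"
  using assms by (simp add: field_simps)

lemma simplex_retract_lipschitz:
  assumes c: "\<forall>i<n. 0 \<le> c i \<and> c i \<le> 1" and c': "\<forall>i<n. 0 \<le> c' i \<and> c' i \<le> 1"
    and d: "\<forall>i<n. \<bar>c i - c' i\<bar> \<le> d" and i: "i < n"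
  shows "\<bar>simplex_retract n c i - simplex_retract n c' i\<bar> \<le> (3 * real n + 1) * d"
proof -
  let ?s = "\<Sum>j<n. c j" and ?s' = "\<Sum>j<n. c' j"
  let ?D = "max 1 ?s" and ?D' = "max 1 ?s'"
  let ?N = "c i + (if i = 0 then max 0 (1 - ?s) else 0)" and ?N' = "c' i + (if i = 0 then max 0 (1 - ?s') else 0)"
  have d0: "0 \<le> d" using d i by force
  have "\<bar>?s - ?s'\<bar> = \<bar>\<Sum>j<n. c j - c' j\<bar>" by (simp add: sum_subtractf)
  also have "\<dots> \<le> (\<Sum>j<n. \<bar>c j - c' j\<bar>)" by (rule sum_abs)
  also have "\<dots> \<le> (\<Sum>j<n. d)" using d by (intro sum_mono) auto
  finally have s: "\<bar>?s - ?s'\<bar> \<le> n * d" by simp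
  have s0: "0 \<le> ?s" "0 \<le> ?s'" using c c' by (auto intro: sum_nonneg)
  have N: "\<bar>?N - ?N'\<bar> \<le> d + n * d" using s d[rule_format, OF i] by (auto simp: max_def)
  have N2: "0 \<le> ?N'" "?N' \<le> 2" using c' i s0 by (auto simp: max_def)
  have D: "\<bar>?D - ?D'\<bar> \<le> n * d" using s by (auto simp: max_def)
  have eq: "?N / ?D - ?N' / ?D' = (?N - ?N') / ?D + ?N' * (?D' - ?D) / (?D * ?D')"
    by (rule divide_diff_divide) auto
  have "\<bar>(?N - ?N') / ?D\<bar> \<le> \<bar>?N - ?N'\<bar> / 1"
    unfolding abs_divide by (rule divide_left_mono) auto
  moreover have "\<bar>?N' * (?D' - ?D) / (?D * ?D')\<bar> \<le> 2 * (n * d)"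
  proof -
    have "1 * 1 \<le> ?D * ?D'" by (intro mult_mono) auto
    then have "\<bar>?N' * (?D' - ?D) / (?D * ?D')\<bar> \<le> \<bar>?N' * (?D' - ?D)\<bar> / 1"
      unfolding abs_divide by (intro divide_left_mono) auto
    also have "\<dots> = ?N' * \<bar>?D' - ?D\<bar>" using N2 by (simp only: abs_mult) simp
    also have "?N' * \<bar>?D' - ?D\<bar> \<le> 2 * (n * d)"
      using N2 D by (intro mult_mono) (simp_all only: abs_minus_commute[of ?D'] abs_ge_zero)
    finally show ?thesis .
  qed
  ultimately have "\<bar>?N / ?D - ?N' / ?D'\<bar> \<le> (d + n * d) + 2 * (n * d)"
    unfolding eq using N abs_triangle_ineq[of "(?N - ?N') / ?D" "?N' * (?D' - ?D) / (?D * ?D')"] by linarith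
  then show ?thesis unfolding simplex_retract_def by (simp add: algebra_simps)
qed

text \<open>The Schauder projection replaces \<open>f\<close> by convex combinations of a finite net, up to \<open>\<epsilon>\<close>. In coordinates this is
  a map of a cube to itself, with \<open>simplex_retract\<close> turning cube points into convex weights. An
  approximate fixed point is enough: compactness removes the error afterwards.\<close>

lemma Schauder_approximate:
  fixes f :: "'v::real_normed_vector \<Rightarrow> 'v"
  assumes K: "compact K" "convex K" "K \<noteq> {}" and f: "continuous_on K f" "f ` K \<subseteq> K" and \<epsilon>: "\<epsilon> > 0"
  obtains x where "x \<in> K" "norm (f x - x) \<le> 2 * \<epsilon>"
proof -
  obtain N w where N: "finite N" "N \<subseteq> K" and cont: "\<And>c. continuous_on K (w c)"
    and w0: "\<And>c x. x \<in> K \<Longrightarrow> 0 \<le> w c x" and w1: "\<And>x. x \<in> K \<Longrightarrow> (\<Sum>c\<in>N. w c x) = (1::real)"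
    and wd: "\<And>c x. w c x \<noteq> 0 \<Longrightarrow> dist x c < \<epsilon>"
    by (rule partition_of_unity_compact[OF K(1), of "\<lambda>_. \<epsilon>"]) (use \<epsilon> in auto)
  define n where "n = card N"
  have "\<exists>v. bij_betw v {..<n} N"
    using ex_bij_betw_nat_finite[OF N(1)] unfolding n_def atLeast0LessThan .
  then obtain v where v: "bij_betw v {..<n} N" by (rule exE)
  have vK: "v i \<in> K" if "i < n" for i using v N(2) that by (auto simp: bij_betw_def)
  have sumv: "(\<Sum>i<n. h (v i)) = (\<Sum>c\<in>N. h c)" for h :: "'v \<Rightarrow> 'b::comm_monoid_add"
    by (rule sum.reindex_bij_betw[OF v])
  obtain y where "y \<in> K" using K(3) by blast
  then have "N \<noteq> {}" using w1[of y] by auto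
  then have n: "0 < n" using N(1) by (simp add: n_def card_gt_0_iff)
  let ?Q = "{x. \<forall>i<n. 0 \<le> x i \<and> x i \<le> (1::real)}"
  define pt where "pt c = (\<Sum>i<n. simplex_retract n c i *\<^sub>R v i)" for c
  have ptK: "pt c \<in> K" if "c \<in> ?Q" for c
    unfolding pt_def using that vK n K(2)
    by (intro convex_sum) (auto simp: sum_simplex_retract intro: simplex_retract_nonneg)
  define R where "R = (\<Sum>i<n. norm (v i)) + 1"
  have R: "R > 0" unfolding R_def by (simp add: add_nonneg_pos sum_nonneg)
  have lip: "norm ((\<Sum>i<n. simplex_retract n c i *\<^sub>R v i) - (\<Sum>i<n. simplex_retract n c' i *\<^sub>R v i)) \<le> (3 * real n + 1) * d * R"
    if "c \<in> ?Q" "c' \<in> ?Q" "\<forall>i<n. \<bar>c i - c' i\<bar> \<le> d" for c c' d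
  proof -
    have d0: "0 \<le> d" using that(3) n by force
    have "norm ((\<Sum>i<n. simplex_retract n c i *\<^sub>R v i) - (\<Sum>i<n. simplex_retract n c' i *\<^sub>R v i)) =
       norm (\<Sum>i<n. (simplex_retract n c i - simplex_retract n c' i) *\<^sub>R v i)"
      by (simp add: sum_subtractf scaleR_left_diff_distrib)
    also have "\<dots> \<le> (\<Sum>i<n. (3 * real n + 1) * d * norm (v i))"
    proof (rule sum_norm_le)
      fix i assume "i \<in> {..<n}"
      then have "\<bar>simplex_retract n c i - simplex_retract n c' i\<bar> \<le> (3 * real n + 1) * d"
        using that by (intro simplex_retract_lipschitz) auto
      then show "norm ((simplex_retract n c i - simplex_retract n c' i) *\<^sub>R v i) \<le> (3 * real n + 1) * d * norm (v i)"
        by (simp add: mult_right_mono)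
    qed
    also have "\<dots> \<le> (3 * real n + 1) * d * R"
      unfolding R_def using d0 by (simp add: mult_left_mono flip: sum_distrib_left)
    finally show ?thesis .
  qed
  define g where "g c i = w (v i) (f (pt c))" for c i
  have fK: "f (pt c) \<in> K" if "c \<in> ?Q" for c using ptK[OF that] f(2) by blast
  have gsum: "(\<Sum>i<n. g c i) = 1" if "c \<in> ?Q" for c
    unfolding g_def using sumv[of "\<lambda>c'. w c' (f (pt c))"] w1[OF fK[OF that]] by simp
  have grange: "0 \<le> g c i \<and> g c i \<le> 1" if "c \<in> ?Q" "i < n" for c i
  proof -
    have "g c i \<le> (\<Sum>i<n. g c i)"
      using that w0[OF fK[OF that(1)]] by (intro member_le_sum) (auto simp: g_def)
    then show ?thesis using gsum[OF that(1)] w0[OF fK[OF that(1)]] by (simp add: g_def)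
  qed
  have guc: "\<exists>d>0. \<forall>x\<in>?Q. \<forall>y\<in>?Q. (\<forall>i<n. \<bar>x i - y i\<bar> \<le> d) \<longrightarrow> (\<forall>i<n. \<bar>g x i - g y i\<bar> \<le> e)" if e: "e > 0" for e
  proof -
    have "\<exists>\<delta>>0. \<forall>x\<in>K. \<forall>y\<in>K. dist x y < \<delta> \<longrightarrow> dist (w (v i) (f x)) (w (v i) (f y)) < e" for i
    proof -
      have "uniformly_continuous_on K (\<lambda>x. w (v i) (f x))"
        by (intro compact_uniformly_continuous K(1) continuous_on_compose2[OF cont f(1) f(2)])
      then show ?thesis using e unfolding uniformly_continuous_on_def by (metis dist_commute)
    qed
    then obtain \<delta> where \<delta>: "\<And>i. \<delta> i > 0" "\<And>i x y. x \<in> K \<Longrightarrow> y \<in> K \<Longrightarrow> dist x y < \<delta> i \<Longrightarrow> dist (w (v i) (f x)) (w (v i) (f y)) < e"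
      by metis
    define \<Delta> where "\<Delta> = Min (\<delta> ` {..<n})"
    have \<Delta>: "\<Delta> > 0" "\<And>i. i < n \<Longrightarrow> \<Delta> \<le> \<delta> i" 
    proof -
      show "\<Delta> > 0" unfolding \<Delta>_def using \<delta>(1) n by (subst Min_gr_iff) auto
    qed (auto simp: \<Delta>_def)
    let ?d = "\<Delta> / (2 * ((3 * real n + 1) * R))"
    have P: "(3 * real n + 1) * R > 0" using R by (intro mult_pos_pos) auto
    have "?d > 0" using \<Delta> P by simp
    moreover have "\<bar>g x i - g y i\<bar> \<le> e" if "x \<in> ?Q" "y \<in> ?Q" "\<forall>i<n. \<bar>x i - y i\<bar> \<le> ?d" "i < n" for x y i
    proof -
      have "dist (pt x) (pt y) \<le> (3 * real n + 1) * ?d * R"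
        unfolding dist_norm pt_def using that by (intro lip) auto
      also have "\<dots> = \<Delta> / 2" using P by (simp add: field_simps)
      also have "\<dots> < \<delta> i" using \<Delta>(1) \<Delta>(2)[OF that(4)] by linarith
      finally have "dist (w (v i) (f (pt x))) (w (v i) (f (pt y))) < e"
        by (intro \<delta>(2) ptK that)
      then show ?thesis unfolding g_def dist_real_def by simp
    qed
    ultimately show ?thesis by blast
  qed
  let ?e = "\<epsilon> / ((3 * real n + 1) * R)"
  have P: "(3 * real n + 1) * R > 0" using R by (intro mult_pos_pos) auto
  obtain c where c: "c \<in> ?Q" and cg: "\<And>i. i < n \<Longrightarrow> \<bar>g c i - c i\<bar> \<le> ?e"
    by (rule cube_approximate_fixed_point[of n g ?e]) (use grange guc \<epsilon> P in auto)
  have gQ: "g c \<in> ?Q" using grange[OF c] by auto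
  have "norm (pt c - (\<Sum>i<n. g c i *\<^sub>R v i)) \<le> (3 * real n + 1) * ?e * R"
  proof -
    have "(\<Sum>i<n. g c i *\<^sub>R v i) = (\<Sum>i<n. simplex_retract n (g c) i *\<^sub>R v i)"
      using simplex_retract_id[OF gsum[OF c]] by simp
    then show ?thesis unfolding pt_def using cg
      by (simp only:) (intro lip c gQ, auto simp: abs_minus_commute)
  qed
  also have "(3 * real n + 1) * ?e * R = \<epsilon>" using P by (simp add: field_simps)
  finally have 1: "norm (pt c - (\<Sum>i<n. g c i *\<^sub>R v i)) \<le> \<epsilon>" .
  let ?y = "f (pt c)"
  have "(\<Sum>i<n. g c i *\<^sub>R v i) - ?y = (\<Sum>i<n. g c i *\<^sub>R (v i - ?y))"
    using gsum[OF c] by (simp add: scaleR_right_diff_distrib sum_subtractf flip: scaleR_left.sum)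
  then have "norm ((\<Sum>i<n. g c i *\<^sub>R v i) - ?y) = norm (\<Sum>i<n. g c i *\<^sub>R (v i - ?y))"
    by (rule arg_cong)
  also have "\<dots> \<le> (\<Sum>i<n. g c i * \<epsilon>)"
  proof (rule sum_norm_le)
    fix i assume i: "i \<in> {..<n}"
    show "norm (g c i *\<^sub>R (v i - ?y)) \<le> g c i * \<epsilon>"
    proof (cases "g c i = 0")
      case False
      then have "dist ?y (v i) < \<epsilon>" unfolding g_def by (rule wd)
      then show ?thesis using grange[OF c] i
        by (simp add: dist_norm norm_minus_commute mult_left_mono)
    qed simp
  qed
  also have "\<dots> = \<epsilon>" using gsum[OF c] by (simp flip: sum_distrib_right)
  finally have 2: "norm ((\<Sum>i<n. g c i *\<^sub>R v i) - ?y) \<le> \<epsilon>" .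
  have "norm (?y - pt c) \<le> 2 * \<epsilon>"
    using norm_triangle_ineq[of "pt c - (\<Sum>i<n. g c i *\<^sub>R v i)" "(\<Sum>i<n. g c i *\<^sub>R v i) - ?y"] 1 2
    by (simp add: norm_minus_commute)
  then show ?thesis using that[OF ptK[OF c]] by blast
qed

theorem Schauder_fixed_point:
  fixes f :: "'v::real_normed_vector \<Rightarrow> 'v"
  assumes K: "compact K" "convex K" "K \<noteq> {}" and f: "continuous_on K f" "f ` K \<subseteq> K"
  obtains x where "x \<in> K" "f x = x"
proof -
  have "continuous_on K (\<lambda>x. norm (f x - x))" by (intro continuous_intros f(1))
  then obtain x where x: "x \<in> K" "\<And>y. y \<in> K \<Longrightarrow> norm (f x - x) \<le> norm (f y - y)"
    using continuous_attains_inf[OF K(1,3)] by blast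
  have "f x = x"
  proof (rule ccontr)
    assume "f x \<noteq> x"
    then have "norm (f x - x) / 4 > 0" by simp
    from Schauder_approximate[OF K f this] obtain y where "y \<in> K" "norm (f y - y) \<le> 2 * (norm (f x - x) / 4)" .
    moreover have "norm (f x - x) > 0" using \<open>f x \<noteq> x\<close> by simp
    ultimately show False using x(2)[of y] by linarith
  qed
  then show ?thesis using that x(1) by blast
qed

section \<open>Selections in the mean\<close>

text \<open>Measurability and lower semicontinuity of the values are expressed through distances to points,
  the only form in which the construction of selections uses them.\<close>

locale lsc_multifunction = finite_measure M
  for M :: "'w measure" +
  fixes K :: "'v::metric_space set"
    and G :: "'v \<Rightarrow> 'w \<Rightarrow> 'x::{banach, second_countable_topology} set"
    and m :: "'w \<Rightarrow> real"
  assumes compact_K: "compact K"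
    and G_nonempty: "v \<in> K \<Longrightarrow> w \<in> space M \<Longrightarrow> G v w \<noteq> {}"
    and G_convex: "v \<in> K \<Longrightarrow> w \<in> space M \<Longrightarrow> convex (G v w)"
    and G_closed: "v \<in> K \<Longrightarrow> w \<in> space M \<Longrightarrow> closed (G v w)"
    and G_measurable: "v \<in> K \<Longrightarrow> (\<lambda>w. infdist z (G v w)) \<in> borel_measurable M"
    and G_lsc: "v \<in> K \<Longrightarrow> w \<in> space M \<Longrightarrow> e > 0 \<Longrightarrow>
      \<exists>d>0. \<forall>v'\<in>K. dist v v' < d \<longrightarrow> infdist z (G v' w) \<le> infdist z (G v w) + e"
    and G_bound: "v \<in> K \<Longrightarrow> w \<in> space M \<Longrightarrow> z \<in> G v w \<Longrightarrow> norm z \<le> m w"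
    and m_integrable: "integrable M m"
begin

lemma infdist_norm_le:
  assumes "v \<in> K" "w \<in> space M"
  shows "infdist z (G v w) \<le> norm z + m w"
proof -
  obtain y where y: "y \<in> G v w" using G_nonempty assms by blast
  have "infdist z (G v w) \<le> dist z y" using y by (rule infdist_le)
  also have "\<dots> \<le> norm z + norm y" by (simp add: dist_norm norm_triangle_ineq4)
  finally show ?thesis using G_bound[OF assms y] by simp
qed

lemma infdist_measurable:
  assumes v: "v \<in> K" and h: "h \<in> borel_measurable M"
  shows "(\<lambda>w. infdist (h w) (G v w)) \<in> borel_measurable M"
proof -
  obtain s where s: "\<And>i. simple_function M (s i)" and lim: "\<And>x. x \<in> space M \<Longrightarrow> (\<lambda>i. s i x) \<longlonglongrightarrow> h x"
    using borel_measurable_implies_sequence_metric[OF h, of 0] by blast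
  show ?thesis
  proof (rule borel_measurable_LIMSEQ_real)
    fix i
    show "(\<lambda>w. infdist (s i w) (G v w)) \<in> borel_measurable M"
    proof (rule measurable_compose_countable'[where f = "\<lambda>y w. infdist y (G v w)" and I = "s i ` space M"])
      show "s i \<in> measurable M (count_space (s i ` space M))"
        using s[of i] by (subst measurable_count_space_eq2) (auto simp: simple_function_def)
      show "countable (s i ` space M)"
        using s[of i] by (auto simp: simple_function_def intro: countable_finite)
    qed (rule G_measurable[OF v])
  next
    fix w assume "w \<in> space M"
    from lim[OF this] show "(\<lambda>i. infdist (s i w) (G v w)) \<longlonglongrightarrow> infdist (h w) (G v w)"
      by (rule tendsto_infdist)
  qed
qed

text \<open>How far \<open>h\<close> is, in the mean, from being a selection of \<open>G v\<close>.\<close>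

definition defect :: "('w \<Rightarrow> 'x) \<Rightarrow> 'v \<Rightarrow> real" where
  "defect h v = (LINT w|M. infdist (h w) (G v w))"

lemma defect_integrable:
  assumes v: "v \<in> K" and h: "integrable M h"
  shows "integrable M (\<lambda>w. infdist (h w) (G v w))"
proof (rule Bochner_Integration.integrable_bound[where f = "\<lambda>w. norm (h w) + m w"])
  show "integrable M (\<lambda>w. norm (h w) + m w)" using h m_integrable by auto
  show "(\<lambda>w. infdist (h w) (G v w)) \<in> borel_measurable M"
    using v h by (intro infdist_measurable) auto
  show "AE w in M. norm (infdist (h w) (G v w)) \<le> norm (norm (h w) + m w)"
    using infdist_norm_le[OF v] by (auto intro!: AE_I2 simp: infdist_nonneg intro: order_trans[OF _ abs_ge_self])
qed

text \<open>Otherwise the defects would stay above along a sequence tending to \<open>v\<close>, whereas the positive parts of the pointwise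
  differences tend to 0 and are dominated.\<close>

lemma defect_upper_semicontinuous:
  assumes v: "v \<in> K" and h: "integrable M h" and e: "e > 0"
  shows "\<exists>d>0. \<forall>v'\<in>K. dist v v' < d \<longrightarrow> defect h v' \<le> defect h v + e"
proof (rule ccontr)
  assume "\<not> ?thesis"
  then have "\<forall>n. \<exists>v'\<in>K. dist v v' < inverse (real (Suc n)) \<and> defect h v' > defect h v + e"
    by (metis inverse_positive_iff_positive of_nat_0_less_iff zero_less_Suc not_le)
  then obtain u where u: "\<And>n. u n \<in> K" "\<And>n. dist v (u n) < inverse (real (Suc n))"
    "\<And>n. defect h (u n) > defect h v + e" by metis
  define x where "x n w = max 0 (infdist (h w) (G (u n) w) - infdist (h w) (G v w))" for n w
  have hm: "h \<in> borel_measurable M" using h by auto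
  have xm: "x n \<in> borel_measurable M" for n
    unfolding x_def using infdist_measurable[OF u(1) hm] infdist_measurable[OF v hm]
    by (intro borel_measurable_max borel_measurable_diff) auto
  have xb: "norm (x n w) \<le> norm (h w) + m w" if "w \<in> space M" for n w
    using infdist_norm_le[OF u(1)[of n] that, of "h w"] infdist_nonneg[of "h w" "G v w"] infdist_nonneg[of "h w" "G (u n) w"]
    unfolding x_def by (auto simp: max_def)
  have xi: "integrable M (x n)" for n
    by (rule Bochner_Integration.integrable_bound[where f = "\<lambda>w. norm (h w) + m w"])
       (use h m_integrable xm xb in \<open>auto intro!: AE_I2 intro: order_trans[OF _ abs_ge_self]\<close>)
  have xlim: "(\<lambda>n. x n w) \<longlonglongrightarrow> 0" if w: "w \<in> space M" for w
  proof (rule LIMSEQ_I)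
    fix r :: real assume r: "r > 0"
    obtain d where d: "d > 0" "\<And>v'. v' \<in> K \<Longrightarrow> dist v v' < d \<Longrightarrow> infdist (h w) (G v' w) \<le> infdist (h w) (G v w) + r / 2"
      using G_lsc[OF v w, of "r / 2" "h w"] r by auto
    obtain n0 where n0: "inverse (real (Suc n0)) < d" using reals_Archimedean[OF d(1)] by blast
    have "norm (x n w - 0) < r" if "n \<ge> n0" for n
    proof -
      have "inverse (real (Suc n)) \<le> inverse (real (Suc n0))" using that by (simp add: le_imp_inverse_le)
      then have "dist v (u n) < d" using u(2)[of n] n0 by linarith
      from d(2)[OF u(1) this] show ?thesis using r unfolding x_def by (auto simp: max_def)
    qed
    then show "\<exists>n0. \<forall>n\<ge>n0. norm (x n w - 0) < r" by blast
  qed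
  have "(\<lambda>n. LINT w|M. x n w) \<longlonglongrightarrow> (LINT w|M. 0)"
    by (rule integral_dominated_convergence[where w = "\<lambda>w. norm (h w) + m w"])
       (use h m_integrable xm xb xlim in auto)
  then have "eventually (\<lambda>n. (LINT w|M. x n w) < e) sequentially"
    using e by (intro order_tendstoD(2)) auto
  then obtain n where n: "(LINT w|M. x n w) < e" by (auto simp: eventually_sequentially)
  have "defect h (u n) \<le> (LINT w|M. infdist (h w) (G v w) + x n w)"
    unfolding defect_def
    by (intro integral_mono Bochner_Integration.integrable_add defect_integrable u v h xi) (auto simp: x_def)
  also have "\<dots> = defect h v + (LINT w|M. x n w)"
    unfolding defect_def by (intro Bochner_Integration.integral_add defect_integrable v h xi)
  finally show False using n u(3)[of n] by linarith
qed

text \<open>The value at \<open>w\<close> is the first suitable point of a countable dense set; taking the least index makes the choice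
  measurable.\<close>

lemma near_selection:
  assumes v: "v \<in> K" and h: "h \<in> borel_measurable M" and \<eta>: "\<eta> > 0"
  obtains g where "g \<in> borel_measurable M" "\<And>w. w \<in> space M \<Longrightarrow> infdist (g w) (G v w) < \<eta>"
    "\<And>w. w \<in> space M \<Longrightarrow> dist (g w) (h w) < infdist (h w) (G v w) + \<eta>"
proof -
  obtain D :: "'x set" where D: "countable D" "\<And>X. open X \<Longrightarrow> X \<noteq> {} \<Longrightarrow> \<exists>d \<in> D. d \<in> X"
    by (rule countable_dense_setE) blast
  define e where "e = from_nat_into D"
  define P where "P k w \<longleftrightarrow> infdist (e k) (G v w) < \<eta> \<and> dist (e k) (h w) < infdist (h w) (G v w) + \<eta>" for k w
  have ex: "\<exists>k. P k w" if w: "w \<in> space M" for w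
  proof -
    let ?i = "infdist (h w) (G v w)"
    obtain y where y: "y \<in> G v w" "dist (h w) y < ?i + \<eta> / 2"
    proof (rule ccontr)
      assume "\<not> thesis"
      then have "\<And>y. y \<in> G v w \<Longrightarrow> ?i + \<eta> / 2 \<le> dist (h w) y" using that by force
      then have "?i + \<eta> / 2 \<le> ?i"
        using G_nonempty[OF v w] by (subst (2) infdist_notempty) (auto intro!: cINF_greatest)
      then show False using \<eta> by simp
    qed
    obtain d where d: "d \<in> D" "d \<in> ball y (\<eta> / 2)"
      using D(2)[of "ball y (\<eta> / 2)"] \<eta> by auto
    from from_nat_into_surj[OF D(1) d(1)] obtain k where k: "e k = d" unfolding e_def ..
    have "infdist d (G v w) \<le> dist d y" by (rule infdist_le[OF y(1)])
    moreover have "dist d (h w) \<le> dist d y + dist (h w) y" by (rule dist_triangle2)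
    ultimately have "P k w" unfolding P_def k using d(2) y(2) \<eta> by (auto simp: dist_commute)
    then show ?thesis ..
  qed
  define k where "k w = (LEAST k. P k w)" for w
  have Pk: "P (k w) w" if "w \<in> space M" for w unfolding k_def using ex[OF that] by (rule LeastI_ex)
  have [measurable]: "(\<lambda>w. infdist (e k) (G v w)) \<in> borel_measurable M" for k by (rule G_measurable[OF v])
  have [measurable]: "(\<lambda>w. infdist (h w) (G v w)) \<in> borel_measurable M" by (rule infdist_measurable[OF v h])
  note h[measurable]
  have [measurable]: "Measurable.pred M (P k)" for k unfolding P_def by measurable
  have [measurable]: "k \<in> measurable M (count_space UNIV)" unfolding k_def by measurable
  show ?thesis
  proof (rule that[of "\<lambda>w. e (k w)"])
    show "(\<lambda>w. e (k w)) \<in> borel_measurable M" by measurable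
  qed (use Pk in \<open>auto simp: P_def\<close>)
qed

definition approximate_selection :: "real \<Rightarrow> ('v \<Rightarrow> 'w \<Rightarrow> 'x) \<Rightarrow> bool" where
  "approximate_selection \<epsilon> f \<longleftrightarrow>
     (\<forall>v\<in>K. integrable M (f v)) \<and>
     (\<forall>v\<in>K. \<forall>e>0. \<exists>d>0. \<forall>v'\<in>K. dist v v' < d \<longrightarrow> (LINT w|M. norm (f v w - f v' w)) \<le> e) \<and>
     (\<forall>v\<in>K. defect (f v) v \<le> \<epsilon>)"

lemma infdist_convex_combination:
  fixes g :: "'c \<Rightarrow> 'x"
  assumes "convex C" "C \<noteq> {}" "finite N" "\<And>c. c \<in> N \<Longrightarrow> 0 \<le> p c" "(\<Sum>c\<in>N. p c) = 1"
  shows "infdist (\<Sum>c\<in>N. p c *\<^sub>R g c) C \<le> (\<Sum>c\<in>N. p c * infdist (g c) C)"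
proof (rule field_le_epsilon)
  fix e :: real assume e: "e > 0"
  have "\<exists>y\<in>C. dist (g c) y < infdist (g c) C + e" for c
  proof (rule ccontr)
    assume "\<not> ?thesis"
    then have "infdist (g c) C + e \<le> infdist (g c) C"
      using assms(2) by (subst (2) infdist_notempty) (auto intro!: cINF_greatest simp: not_less)
    then show False using e by simp
  qed
  then obtain y where y: "\<And>c. y c \<in> C" "\<And>c. dist (g c) (y c) < infdist (g c) C + e" by metis
  have "(\<Sum>c\<in>N. p c *\<^sub>R y c) \<in> C" using assms y(1) by (intro convex_sum) auto
  then have "infdist (\<Sum>c\<in>N. p c *\<^sub>R g c) C \<le> dist (\<Sum>c\<in>N. p c *\<^sub>R g c) (\<Sum>c\<in>N. p c *\<^sub>R y c)"
    by (rule infdist_le)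
  also have "\<dots> = norm (\<Sum>c\<in>N. p c *\<^sub>R (g c - y c))"
    by (simp add: dist_norm sum_subtractf scaleR_right_diff_distrib)
  also have "\<dots> \<le> (\<Sum>c\<in>N. p c * (infdist (g c) C + e))"
  proof (rule sum_norm_le)
    fix c assume c: "c \<in> N"
    show "norm (p c *\<^sub>R (g c - y c)) \<le> p c * (infdist (g c) C + e)"
      using assms(4)[OF c] less_imp_le[OF y(2)[of c]] by (simp add: dist_norm mult_left_mono)
  qed
  also have "\<dots> = (\<Sum>c\<in>N. p c * infdist (g c) C) + e"
    using assms(5) by (simp add: ring_distribs sum.distrib flip: sum_distrib_right)
  finally show "infdist (\<Sum>c\<in>N. p c *\<^sub>R g c) C \<le> (\<Sum>c\<in>N. p c * infdist (g c) C) + e" .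
qed

text \<open>Near each \<open>c\<close> a function \<open>g c\<close> with values close to \<open>G c\<close>, and as close to \<open>f c\<close> as these sets permit, retains a
  small defect and a small distance from \<open>f v\<close> for all \<open>v\<close> near \<open>c\<close>, by the semicontinuity of the defect. A partition
  of unity glues these functions; convexity of the values keeps the defect small.\<close>

lemma approximate_selection_improve:
  assumes f: "approximate_selection \<epsilon> f" and \<epsilon>: "\<epsilon> > 0"
  obtains f' where "approximate_selection (\<epsilon> / 2) f'"
    "\<And>v. v \<in> K \<Longrightarrow> (LINT w|M. norm (f' v w - f v w)) \<le> 2 * \<epsilon>"
proof -
  have fint: "\<And>v. v \<in> K \<Longrightarrow> integrable M (f v)"
    and fcont: "\<And>v e. v \<in> K \<Longrightarrow> e > 0 \<Longrightarrow> \<exists>d>0. \<forall>v'\<in>K. dist v v' < d \<longrightarrow> (LINT w|M. norm (f v w - f v' w)) \<le> e"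
    and fdef: "\<And>v. v \<in> K \<Longrightarrow> defect (f v) v \<le> \<epsilon>"
    using f unfolding approximate_selection_def by blast+
  define \<eta> where "\<eta> = \<epsilon> / (8 * (measure M (space M) + 1))"
  have \<mu>: "measure M (space M) + 1 > 0" by (simp add: add_nonneg_pos)
  have \<eta>: "\<eta> > 0" unfolding \<eta>_def using \<epsilon> \<mu> by simp
  have "\<eta> * measure M (space M) \<le> \<eta> * (measure M (space M) + 1)" using \<eta> by simp
  also have "\<dots> = \<epsilon> / 8" using \<mu> by (simp add: \<eta>_def field_simps)
  finally have \<eta>\<mu>: "(LINT w|M. \<eta>) \<le> \<epsilon> / 8" by (simp add: mult.commute)
  define Q where "Q c g r \<longleftrightarrow> integrable M g \<and> r > (0::real) \<and> (\<forall>v\<in>K. dist v c < r \<longrightarrow>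
      defect g v \<le> \<epsilon> / 2 \<and> (LINT w|M. norm (g w - f v w)) \<le> 2 * \<epsilon>)" for c g r
  have "\<forall>c\<in>K. \<exists>g r. Q c g r"
  proof
    fix c assume c: "c \<in> K"
    obtain g where g: "g \<in> borel_measurable M" "\<And>w. w \<in> space M \<Longrightarrow> infdist (g w) (G c w) < \<eta>"
      "\<And>w. w \<in> space M \<Longrightarrow> dist (g w) (f c w) < infdist (f c w) (G c w) + \<eta>"
      by (rule near_selection[OF c borel_measurable_integrable[OF fint[OF c]] \<eta>], rule that)
    have gi: "integrable M g"
    proof (rule Bochner_Integration.integrable_bound)
      show "integrable M (\<lambda>w. norm (f c w) + infdist (f c w) (G c w) + \<eta>)"
        using fint[OF c] defect_integrable[OF c fint[OF c]] by auto
      show "AE w in M. norm (g w) \<le> norm (norm (f c w) + infdist (f c w) (G c w) + \<eta>)"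
      proof (rule AE_I2)
        fix w assume "w \<in> space M"
        have "norm (g w) \<le> norm (f c w) + dist (g w) (f c w)"
          unfolding dist_norm by (rule norm_triangle_sub)
        then show "norm (g w) \<le> norm (norm (f c w) + infdist (f c w) (G c w) + \<eta>)"
          using g(3)[OF \<open>w \<in> space M\<close>] by simp
      qed
    qed (rule g(1))
    have "defect g c \<le> (LINT w|M. \<eta>)"
      unfolding defect_def using g(2) by (intro integral_mono defect_integrable[OF c gi]) (auto intro: less_imp_le)
    then have d1: "defect g c \<le> \<epsilon> / 8" using \<eta>\<mu> by linarith
    have "(LINT w|M. norm (g w - f c w)) \<le> (LINT w|M. infdist (f c w) (G c w) + \<eta>)"
      using g(3) gi fint[OF c] defect_integrable[OF c fint[OF c]]
      by (intro integral_mono) (auto simp: dist_norm intro: less_imp_le)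
    also have "\<dots> = defect (f c) c + (LINT w|M. \<eta>)"
      unfolding defect_def using defect_integrable[OF c fint[OF c]] by (intro Bochner_Integration.integral_add) auto
    finally have d2: "(LINT w|M. norm (g w - f c w)) \<le> \<epsilon> + \<epsilon> / 8" using fdef[OF c] \<eta>\<mu> by linarith
    obtain r1 where r1: "r1 > 0" "\<And>v. v \<in> K \<Longrightarrow> dist c v < r1 \<Longrightarrow> defect g v \<le> defect g c + \<epsilon> / 8"
      using defect_upper_semicontinuous[OF c gi, of "\<epsilon> / 8"] \<epsilon> by auto
    obtain r2 where r2: "r2 > 0" "\<And>v. v \<in> K \<Longrightarrow> dist c v < r2 \<Longrightarrow> (LINT w|M. norm (f c w - f v w)) \<le> \<epsilon> / 8"
      using fcont[OF c, of "\<epsilon> / 8"] \<epsilon> by auto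
    have "defect g v \<le> \<epsilon> / 2 \<and> (LINT w|M. norm (g w - f v w)) \<le> 2 * \<epsilon>"
      if v: "v \<in> K" "dist v c < min r1 r2" for v
    proof
      show "defect g v \<le> \<epsilon> / 2" using r1(2)[OF v(1)] v(2) d1 \<epsilon> by (simp add: dist_commute)
      have "(LINT w|M. norm (g w - f v w)) \<le> (LINT w|M. norm (g w - f c w) + norm (f c w - f v w))"
        using gi fint[OF c] fint[OF v(1)]
        by (intro integral_mono) (auto intro: norm_diff_triangle_ineq[THEN order_trans] norm_triangle_le_diff norm_diff_triangle_le)
      also have "\<dots> = (LINT w|M. norm (g w - f c w)) + (LINT w|M. norm (f c w - f v w))"
        using gi fint[OF c] fint[OF v(1)] by (intro Bochner_Integration.integral_add) auto
      finally show "(LINT w|M. norm (g w - f v w)) \<le> 2 * \<epsilon>"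
        using d2 r2(2)[OF v(1)] v(2) \<epsilon> by (simp add: dist_commute)
    qed
    then show "\<exists>g r. Q c g r"
      using gi r1(1) r2(1) unfolding Q_def by (intro exI[of _ g] exI[of _ "min r1 r2"]) auto
  qed
  from bchoice[OF this] obtain g where "\<forall>c\<in>K. \<exists>r. Q c (g c) r" ..
  from bchoice[OF this] obtain r where Q: "\<forall>c\<in>K. Q c (g c) (r c)" ..
  have gr: "\<And>c. c \<in> K \<Longrightarrow> integrable M (g c)" "\<And>c. c \<in> K \<Longrightarrow> r c > 0"
      "\<And>c v. c \<in> K \<Longrightarrow> v \<in> K \<Longrightarrow> dist v c < r c \<Longrightarrow> defect (g c) v \<le> \<epsilon> / 2"
      "\<And>c v. c \<in> K \<Longrightarrow> v \<in> K \<Longrightarrow> dist v c < r c \<Longrightarrow> (LINT w|M. norm (g c w - f v w)) \<le> 2 * \<epsilon>"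
    using Q unfolding Q_def by blast+
  obtain N p where N: "finite N" "N \<subseteq> K" and cont: "\<And>c. continuous_on K (p c)"
    and p0: "\<And>c x. x \<in> K \<Longrightarrow> 0 \<le> p c x" and p1: "\<And>x. x \<in> K \<Longrightarrow> (\<Sum>c\<in>N. p c x) = (1::real)"
    and pd: "\<And>c x. p c x \<noteq> 0 \<Longrightarrow> dist x c < r c"
    by (rule partition_of_unity_compact[OF compact_K, of r]) (use gr(2) in auto)
  have average: "(\<Sum>c\<in>N. p c v * h c) \<le> B" if v: "v \<in> K" and h: "\<And>c. c \<in> N \<Longrightarrow> dist v c < r c \<Longrightarrow> h c \<le> B" for v h B
  proof -
    have "(\<Sum>c\<in>N. p c v * h c) \<le> (\<Sum>c\<in>N. p c v * B)"
    proof (rule sum_mono)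
      fix c assume c: "c \<in> N"
      show "p c v * h c \<le> p c v * B"
      proof (cases "p c v = 0")
        case False
        then show ?thesis using h[OF c pd] p0[OF v] by (intro mult_left_mono) auto
      qed simp
    qed
    also have "\<dots> = B" using p1[OF v] by (simp flip: sum_distrib_right)
    finally show ?thesis .
  qed
  define f' where "f' v w = (\<Sum>c\<in>N. p c v *\<^sub>R g c w)" for v w
  have gN: "integrable M (g c)" if "c \<in> N" for c using gr(1) N that by blast
  have f'int: "integrable M (f' v)" for v
    unfolding f'_def using gN by auto
  have f'def: "defect (f' v) v \<le> \<epsilon> / 2" if v: "v \<in> K" for v
  proof -
    have "defect (f' v) v \<le> (LINT w|M. (\<Sum>c\<in>N. p c v * infdist (g c w) (G v w)))"
      unfolding defect_def
    proof (rule integral_mono)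
      show "integrable M (\<lambda>w. \<Sum>c\<in>N. p c v * infdist (g c w) (G v w))"
        using defect_integrable[OF v gN] by auto
      show "infdist (f' v w) (G v w) \<le> (\<Sum>c\<in>N. p c v * infdist (g c w) (G v w))" if "w \<in> space M" for w
        unfolding f'_def using G_convex[OF v that] G_nonempty[OF v that] N(1) p0[OF v] p1[OF v]
        by (intro infdist_convex_combination) auto
    qed (rule defect_integrable[OF v f'int])
    also have "\<dots> = (\<Sum>c\<in>N. p c v * defect (g c) v)"
      unfolding defect_def using defect_integrable[OF v gN] by (subst Bochner_Integration.integral_sum) auto
    also have "\<dots> \<le> \<epsilon> / 2" using gr(3)[OF _ v] N(2) by (intro average[OF v]) auto
    finally show ?thesis .
  qed
  have close: "(LINT w|M. norm (f' v w - f v w)) \<le> 2 * \<epsilon>" if v: "v \<in> K" for v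
  proof -
    have i: "integrable M (\<lambda>w. norm (g c w - f v w))" if "c \<in> N" for c
      using gN[OF that] fint[OF v] by auto
    have "(LINT w|M. norm (f' v w - f v w)) \<le> (LINT w|M. (\<Sum>c\<in>N. p c v * norm (g c w - f v w)))"
    proof (rule integral_mono)
      show "integrable M (\<lambda>w. \<Sum>c\<in>N. p c v * norm (g c w - f v w))" using i by auto
      fix w
      have "f' v w - f v w = (\<Sum>c\<in>N. p c v *\<^sub>R (g c w - f v w))"
        using p1[OF v] by (simp add: f'_def scaleR_right_diff_distrib sum_subtractf flip: scaleR_left.sum)
      then show "norm (f' v w - f v w) \<le> (\<Sum>c\<in>N. p c v * norm (g c w - f v w))"
        using p0[OF v] by (auto intro!: sum_norm_le)
    qed (use f'int fint[OF v] in auto)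
    also have "\<dots> = (\<Sum>c\<in>N. p c v * (LINT w|M. norm (g c w - f v w)))"
      using i by (subst Bochner_Integration.integral_sum) auto
    also have "\<dots> \<le> 2 * \<epsilon>" using gr(4)[OF _ v] N(2) by (intro average[OF v]) auto
    finally show ?thesis .
  qed
  have f'cont: "\<exists>d>0. \<forall>v'\<in>K. dist v v' < d \<longrightarrow> (LINT w|M. norm (f' v w - f' v' w)) \<le> e" if v: "v \<in> K" and e: "e > 0" for v e
  proof -
    define B where "B v' = (\<Sum>c\<in>N. \<bar>p c v - p c v'\<bar> * (LINT w|M. norm (g c w)))" for v'
    have "continuous_on K B" unfolding B_def by (intro continuous_intros cont)
    moreover have "B v = 0" by (simp add: B_def)
    ultimately obtain d where d: "d > 0" "\<And>v'. v' \<in> K \<Longrightarrow> dist v' v < d \<Longrightarrow> dist (B v') 0 < e"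
      using v e unfolding continuous_on_iff by metis
    have bound: "(LINT w|M. norm (f' v w - f' v' w)) \<le> B v'" for v'
    proof -
      have "(LINT w|M. norm (f' v w - f' v' w)) \<le> (LINT w|M. (\<Sum>c\<in>N. \<bar>p c v - p c v'\<bar> * norm (g c w)))"
      proof (rule integral_mono)
        show "integrable M (\<lambda>w. \<Sum>c\<in>N. \<bar>p c v - p c v'\<bar> * norm (g c w))" using gN by auto
        fix w
        have "f' v w - f' v' w = (\<Sum>c\<in>N. (p c v - p c v') *\<^sub>R g c w)"
          by (simp add: f'_def scaleR_left_diff_distrib sum_subtractf)
        then show "norm (f' v w - f' v' w) \<le> (\<Sum>c\<in>N. \<bar>p c v - p c v'\<bar> * norm (g c w))"
          by (auto intro!: sum_norm_le)
      qed (use f'int in auto)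
      also have "\<dots> = B v'" unfolding B_def using gN by (subst Bochner_Integration.integral_sum) auto
      finally show ?thesis .
    qed
    have "(LINT w|M. norm (f' v w - f' v' w)) \<le> e" if v': "v' \<in> K" "dist v v' < d" for v'
      using bound[of v'] d(2)[of v'] v' by (simp add: dist_commute dist_real_def)
    then show ?thesis using d(1) by blast
  qed
  show ?thesis
    by (rule that[of f']) (use f'int f'def f'cont close in \<open>auto simp: approximate_selection_def\<close>)
qed

text \<open>Michael's construction in \<open>L\<^sup>1\<close>: halving the defect moves an approximate selection by at most
  a multiple of the defect, so the improvements converge geometrically, uniformly in \<open>v\<close>. The limit
  has defect 0, which means a selection almost everywhere as the values are closed.\<close>

theorem continuous_selection_in_mean:
  obtains f where "\<And>v. v \<in> K \<Longrightarrow> integrable M (f v)"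
    "\<And>v. v \<in> K \<Longrightarrow> AE w in M. f v w \<in> G v w"
    "\<And>v e. v \<in> K \<Longrightarrow> e > 0 \<Longrightarrow> \<exists>d>0. \<forall>v'\<in>K. dist v v' < d \<longrightarrow> (LINT w|M. norm (f v w - f v' w)) \<le> e"
proof -
  \<comment> \<open>the zero function is a first approximate selection with this defect\<close>
  define \<epsilon> where "\<epsilon> = \<bar>LINT w|M. m w\<bar> + 1"
  have \<epsilon>: "\<epsilon> > 0" unfolding \<epsilon>_def by linarith
  have start: "approximate_selection \<epsilon> (\<lambda>_ _. 0)"
  proof -
    have "defect (\<lambda>_. 0) v \<le> \<epsilon>" if v: "v \<in> K" for v
    proof -
      have "defect (\<lambda>_. 0) v \<le> (LINT w|M. m w)"
        unfolding defect_def using infdist_norm_le[OF v, of _ 0] m_integrable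
        by (intro integral_mono defect_integrable[OF v]) auto
      then show ?thesis unfolding \<epsilon>_def by linarith
    qed
    then show ?thesis unfolding approximate_selection_def by (auto intro: exI[of _ 1])
  qed
  have "\<exists>F. \<forall>n. approximate_selection (\<epsilon> / 2 ^ n) (F n) \<and>
      (\<forall>v\<in>K. (LINT w|M. norm (F (Suc n) v w - F n v w)) \<le> 2 * (\<epsilon> / 2 ^ n))"
  proof (rule dependent_nat_choice)
    show "\<exists>f. approximate_selection (\<epsilon> / 2 ^ 0) f" using start by auto
    fix f n assume "approximate_selection (\<epsilon> / 2 ^ n) f"
    from approximate_selection_improve[OF this] \<epsilon> obtain f' where
      "approximate_selection (\<epsilon> / 2 ^ n / 2) f'" "\<And>v. v \<in> K \<Longrightarrow> (LINT w|M. norm (f' v w - f v w)) \<le> 2 * (\<epsilon> / 2 ^ n)"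
      by auto
    then show "\<exists>f'. approximate_selection (\<epsilon> / 2 ^ Suc n) f' \<and>
      (\<forall>v\<in>K. (LINT w|M. norm (f' v w - f v w)) \<le> 2 * (\<epsilon> / 2 ^ n))"
      by (intro exI[of _ f']) (auto simp: mult.commute)
  qed
  then obtain F where F: "\<And>n. approximate_selection (\<epsilon> / 2 ^ n) (F n)"
    and step: "\<And>n v. v \<in> K \<Longrightarrow> (LINT w|M. norm (F (Suc n) v w - F n v w)) \<le> 2 * (\<epsilon> / 2 ^ n)"
    by blast
  have Fi: "\<And>n v. v \<in> K \<Longrightarrow> integrable M (F n v)"
    and Fc: "\<And>n v e. v \<in> K \<Longrightarrow> e > 0 \<Longrightarrow> \<exists>d>0. \<forall>v'\<in>K. dist v v' < d \<longrightarrow> (LINT w|M. norm (F n v w - F n v' w)) \<le> e"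
    and Fd: "\<And>n v. v \<in> K \<Longrightarrow> defect (F n v) v \<le> \<epsilon> / 2 ^ n"
    using F unfolding approximate_selection_def by blast+
  have tail: "(LINT w|M. norm (F (n + k) v w - F n v w)) \<le> 4 * (\<epsilon> / 2 ^ n) - 4 * (\<epsilon> / 2 ^ (n + k))"
    if v: "v \<in> K" for v n k
  proof (induction k)
    case (Suc k)
    have "(LINT w|M. norm (F (n + Suc k) v w - F n v w)) \<le>
        (LINT w|M. norm (F (Suc (n + k)) v w - F (n + k) v w) + norm (F (n + k) v w - F n v w))"
      using Fi[OF v] by (intro integral_mono) (auto intro: norm_diff_triangle_le)
    also have "\<dots> = (LINT w|M. norm (F (Suc (n + k)) v w - F (n + k) v w)) + (LINT w|M. norm (F (n + k) v w - F n v w))"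
      using Fi[OF v] by (intro Bochner_Integration.integral_add) auto
    also have "\<dots> \<le> 2 * (\<epsilon> / 2 ^ (n + k)) + (4 * (\<epsilon> / 2 ^ n) - 4 * (\<epsilon> / 2 ^ (n + k)))"
      by (intro add_mono step[OF v] Suc.IH)
    also have "\<dots> = 4 * (\<epsilon> / 2 ^ n) - 4 * (\<epsilon> / 2 ^ (n + Suc k))"
      by (simp add: field_simps)
    finally show ?case .
  qed simp
  define f where "f v w = lim (\<lambda>n. F n v w)" for v w
  have conv: "AE w in M. (\<lambda>n. F n v w) \<longlonglongrightarrow> f v w" if v: "v \<in> K" for v
  proof -
    let ?\<Delta> = "\<lambda>n w. norm (F (Suc n) v w - F n v w)"
    have \<Delta>: "integrable M (?\<Delta> n)" for n using Fi[OF v] by auto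
    have "(\<integral>\<^sup>+w. (\<Sum>n. ennreal (?\<Delta> n w)) \<partial>M) = (\<Sum>n. \<integral>\<^sup>+w. ennreal (?\<Delta> n w) \<partial>M)"
      using \<Delta> by (intro nn_integral_suminf) auto
    also have "\<dots> = (\<Sum>n. ennreal (LINT w|M. ?\<Delta> n w))"
      using \<Delta> by (subst nn_integral_eq_integral) auto
    also have "\<dots> \<le> (\<Sum>n. ennreal (2 * (\<epsilon> / 2 ^ n)))"
      using step[OF v] by (intro suminf_le ennreal_leI) auto
    also have "\<dots> < \<infinity>"
    proof -
      have "summable (\<lambda>n. 2 * \<epsilon> * (1 / 2) ^ n)" by (intro summable_mult summable_geometric) simp
      then have "summable (\<lambda>n. 2 * (\<epsilon> / 2 ^ n))" by (simp add: power_one_over field_simps)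
      then have "(\<Sum>n. ennreal (2 * (\<epsilon> / 2 ^ n))) \<noteq> top"
        by (rule ennreal_suminf_neq_top) (use \<epsilon> in auto)
      then show ?thesis unfolding infinity_ennreal_def less_top[symmetric] .
    qed
    finally have "AE w in M. (\<Sum>n. ennreal (?\<Delta> n w)) \<noteq> \<infinity>"
      using \<Delta> by (intro nn_integral_PInf_AE) auto
    then show ?thesis
    proof eventually_elim
      case (elim w)
      then have "summable (\<lambda>n. ?\<Delta> n w)" by (intro summable_suminf_not_top) auto
      then have "summable (\<lambda>n. F (Suc n) v w - F n v w)" by (rule summable_norm_cancel)
      then have "convergent (\<lambda>n. (\<Sum>i<n. F (Suc i) v w - F i v w))"
        by (simp add: summable_iff_convergent)
      then have "convergent (\<lambda>n. F n v w - F 0 v w)" by (simp add: sum_lessThan_telescope[of "\<lambda>n. F n v w"])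
      then have "convergent (\<lambda>n. (F n v w - F 0 v w) + F 0 v w)" by (intro convergent_add convergent_const)
      then have "convergent (\<lambda>n. F n v w)" by simp
      then show ?case unfolding f_def by (rule convergent_LIMSEQ_iff[THEN iffD1])
    qed
  qed
  have fm: "f v \<in> borel_measurable M" if v: "v \<in> K" for v
    unfolding f_def using Fi[OF v] by (intro borel_measurable_lim_metric) auto
  have nn: "(\<integral>\<^sup>+w. ennreal (norm (f v w - F n v w)) \<partial>M) \<le> ennreal (4 * (\<epsilon> / 2 ^ n))" if v: "v \<in> K" for v n
  proof -
    have "(\<integral>\<^sup>+w. ennreal (norm (f v w - F n v w)) \<partial>M) =
        (\<integral>\<^sup>+w. liminf (\<lambda>k. ennreal (norm (F (n + k) v w - F n v w))) \<partial>M)"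
    proof (rule nn_integral_cong_AE)
      show "AE w in M. ennreal (norm (f v w - F n v w)) = liminf (\<lambda>k. ennreal (norm (F (n + k) v w - F n v w)))"
        using conv[OF v]
      proof eventually_elim
        case (elim w)
        have "(\<lambda>k. F (n + k) v w) \<longlonglongrightarrow> f v w"
          using LIMSEQ_ignore_initial_segment[OF elim, of n] by (simp add: add.commute)
        then have l: "(\<lambda>k. ennreal (norm (F (n + k) v w - F n v w))) \<longlonglongrightarrow> ennreal (norm (f v w - F n v w))"
          by (intro tendsto_ennrealI tendsto_intros)
        show ?case by (rule lim_imp_Liminf[symmetric, OF _ l]) simp
      qed
    qed
    also have "\<dots> \<le> liminf (\<lambda>k. \<integral>\<^sup>+w. ennreal (norm (F (n + k) v w - F n v w)) \<partial>M)"
      using Fi[OF v] by (intro nn_integral_liminf) auto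
    also have "\<dots> \<le> liminf (\<lambda>k. ennreal (4 * (\<epsilon> / 2 ^ n)))"
    proof (intro Liminf_mono always_eventually allI)
      fix k
      have "(\<integral>\<^sup>+w. ennreal (norm (F (n + k) v w - F n v w)) \<partial>M) = ennreal (LINT w|M. norm (F (n + k) v w - F n v w))"
        using Fi[OF v] by (intro nn_integral_eq_integral) auto
      also have "\<dots> \<le> ennreal (4 * (\<epsilon> / 2 ^ n))"
      proof (rule ennreal_leI)
        have "0 \<le> 4 * (\<epsilon> / 2 ^ (n + k))" using \<epsilon> by simp
        then show "(LINT w|M. norm (F (n + k) v w - F n v w)) \<le> 4 * (\<epsilon> / 2 ^ n)"
          using tail[OF v, of n k] by linarith
      qed
      finally show "(\<integral>\<^sup>+w. ennreal (norm (F (n + k) v w - F n v w)) \<partial>M) \<le> ennreal (4 * (\<epsilon> / 2 ^ n))" .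
    qed
    also have "\<dots> = ennreal (4 * (\<epsilon> / 2 ^ n))" by (simp add: Liminf_const)
    finally show ?thesis .
  qed
  have di: "integrable M (\<lambda>w. f v w - F n v w)" if v: "v \<in> K" for v n
    using fm[OF v] Fi[OF v] nn[OF v, of n]
    by (intro integrableI_bounded) (auto intro: le_less_trans)
  have fi: "integrable M (f v)" if v: "v \<in> K" for v
    using Bochner_Integration.integrable_add[OF di[OF v, of 0] Fi[OF v, of 0]] by simp
  have near: "(LINT w|M. norm (f v w - F n v w)) \<le> 4 * (\<epsilon> / 2 ^ n)" if v: "v \<in> K" for v n
  proof -
    have "ennreal (LINT w|M. norm (f v w - F n v w)) \<le> ennreal (4 * (\<epsilon> / 2 ^ n))"
      using nn[OF v, of n] di[OF v, of n] by (subst nn_integral_eq_integral[symmetric]) auto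
    then show ?thesis using \<epsilon> by (subst (asm) ennreal_le_iff) auto
  qed
  have small: "\<exists>n. 9 * (\<epsilon> / 2 ^ n) < e" if e: "e > 0" for e
  proof -
    obtain n where "(1 / 2) ^ n < e / (9 * \<epsilon>)"
      using real_arch_pow_inv[of "e / (9 * \<epsilon>)" "1 / 2"] e \<epsilon> by auto
    then show ?thesis using \<epsilon> by (intro exI[of _ n]) (simp add: field_simps power_one_over)
  qed
  show ?thesis
  proof (rule that[of f])
    show "integrable M (f v)" if "v \<in> K" for v by (rule fi[OF that])
    show "AE w in M. f v w \<in> G v w" if v: "v \<in> K" for v
    proof -
      have "defect (f v) v \<le> 0"
      proof (rule field_le_epsilon)
        fix e :: real assume "e > 0"
        then obtain n where n: "9 * (\<epsilon> / 2 ^ n) < e" using small by blast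
        have "defect (f v) v \<le> (LINT w|M. infdist (F n v w) (G v w) + norm (f v w - F n v w))"
          unfolding defect_def
        proof (rule integral_mono)
          show "integrable M (\<lambda>w. infdist (F n v w) (G v w) + norm (f v w - F n v w))"
            using di[OF v, of n] defect_integrable[OF v Fi[OF v]] by auto
          show "infdist (f v w) (G v w) \<le> infdist (F n v w) (G v w) + norm (f v w - F n v w)" for w
            unfolding dist_norm[symmetric] by (rule infdist_triangle)
        qed (rule defect_integrable[OF v fi[OF v]])
        also have "\<dots> = defect (F n v) v + (LINT w|M. norm (f v w - F n v w))"
          unfolding defect_def using di[OF v, of n] defect_integrable[OF v Fi[OF v]]
          by (intro Bochner_Integration.integral_add) auto
        also have "\<dots> \<le> \<epsilon> / 2 ^ n + 4 * (\<epsilon> / 2 ^ n)" by (intro add_mono Fd near v)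
        also have "\<dots> \<le> 9 * (\<epsilon> / 2 ^ n)"
        proof -
          have "0 \<le> \<epsilon> / 2 ^ n" using \<epsilon> by simp
          then show ?thesis by linarith
        qed
        finally show "defect (f v) v \<le> 0 + e" using n by linarith
      qed
      moreover have "defect (f v) v \<ge> 0" unfolding defect_def by (intro integral_nonneg_AE AE_I2 infdist_nonneg)
      ultimately have "(LINT w|M. infdist (f v w) (G v w)) = 0" unfolding defect_def by linarith
      then have "AE w in M. infdist (f v w) (G v w) = 0"
        by (subst (asm) integral_nonneg_eq_0_iff_AE) (auto simp: infdist_nonneg defect_integrable[OF v fi[OF v]])
      moreover have "AE w in M. w \<in> space M" by (rule AE_space)
      ultimately show ?thesis
      proof eventually_elim
        case (elim w)
        then show ?case
          using in_closed_iff_infdist_zero[OF G_closed[OF v] G_nonempty[OF v]] by blast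
      qed
    qed
    show "\<exists>d>0. \<forall>v'\<in>K. dist v v' < d \<longrightarrow> (LINT w|M. norm (f v w - f v' w)) \<le> e" if v: "v \<in> K" and e: "e > 0" for v e
    proof -
      obtain n where n: "9 * (\<epsilon> / 2 ^ n) < e" using small e by blast
      have "\<epsilon> / 2 ^ n > 0" using \<epsilon> by simp
      then obtain d where d: "d > 0" "\<And>v'. v' \<in> K \<Longrightarrow> dist v v' < d \<Longrightarrow> (LINT w|M. norm (F n v w - F n v' w)) \<le> \<epsilon> / 2 ^ n"
        using Fc[OF v] by blast
      have "(LINT w|M. norm (f v w - f v' w)) \<le> e" if v': "v' \<in> K" "dist v v' < d" for v'
      proof -
        have i: "integrable M (\<lambda>w. norm (f v w - F n v w))" "integrable M (\<lambda>w. norm (F n v w - F n v' w))"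
          "integrable M (\<lambda>w. norm (f v' w - F n v' w))"
          using di[OF v, of n] di[OF v'(1), of n] Fi[OF v, of n] Fi[OF v'(1), of n] by auto
        have tri: "norm (f v w - f v' w) \<le> norm (f v w - F n v w) + norm (F n v w - F n v' w) + norm (f v' w - F n v' w)" for w
        proof -
          have "f v w - f v' w = (f v w - F n v w) + (F n v w - F n v' w) - (f v' w - F n v' w)" by simp
          also have "norm \<dots> \<le> norm (f v w - F n v w) + norm (F n v w - F n v' w) + norm (f v' w - F n v' w)"
            by (intro order_trans[OF norm_triangle_ineq4] add_mono norm_triangle_ineq order_refl)
          finally show ?thesis .
        qed
        have "(LINT w|M. norm (f v w - f v' w)) \<le> (LINT w|M. norm (f v w - F n v w) + norm (F n v w - F n v' w) + norm (f v' w - F n v' w))"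
          using fi[OF v] fi[OF v'(1)] i tri by (intro integral_mono) auto
        also have "\<dots> = (LINT w|M. norm (f v w - F n v w)) + (LINT w|M. norm (F n v w - F n v' w)) + (LINT w|M. norm (f v' w - F n v' w))"
          using i by simp
        also have "\<dots> \<le> 4 * (\<epsilon> / 2 ^ n) + \<epsilon> / 2 ^ n + 4 * (\<epsilon> / 2 ^ n)"
          by (intro add_mono near v v' d)
        also have "\<dots> \<le> e" using n by simp
        finally show ?thesis .
      qed
      then show ?thesis using d(1) by blast
    qed
  qed
qed

end

section \<open>The control system on a separable space\<close>

locale fractional_system =
  fixes a b \<alpha> \<beta> :: real and \<psi> \<psi>' :: "real \<Rightarrow> real"
    and T :: "real \<Rightarrow> 'a::{banach, second_countable_topology} \<Rightarrow>\<^sub>L 'a"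
    and B :: "'y::{real_inner, polish_space} \<Rightarrow>\<^sub>L 'a" and x0 :: 'a
  assumes ab: "a < b" and \<alpha>: "1 / 2 < \<alpha>" "\<alpha> \<le> 1" and \<beta>: "0 \<le> \<beta>" "\<beta> \<le> 1"
    and psi_deriv: "\<And>t. t \<in> {a..b} \<Longrightarrow> (\<psi> has_real_derivative \<psi>' t) (at t within {a..b})"
    and psi_C1: "continuous_on {a..b} \<psi>'"
    and psi_mono: "mono_on {a..b} \<psi>"
    and psi_nz: "\<And>t. t \<in> {a..b} \<Longrightarrow> \<psi>' t \<noteq> 0"
    and T_semigroup: "C0_semigroup T"
    and T_compact: "\<And>t. t > 0 \<Longrightarrow> compact_operator (T t)"
begin

lemma psi_deriv_pos:
  assumes t: "t \<in> {a..b}"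
  shows "0 < \<psi>' t"
proof (rule ccontr)
  assume "\<not> ?thesis"
  then have neg: "\<psi>' t < 0" using psi_nz[OF t] by simp
  show False
  proof (cases "t < b")
    case True
    from has_real_derivative_neg_dec_right[OF psi_deriv[OF t] neg] obtain d where
      d: "d > 0" "\<And>h. h > 0 \<Longrightarrow> t + h \<in> {a..b} \<Longrightarrow> h < d \<Longrightarrow> \<psi> (t + h) < \<psi> t" by blast
    define h where "h = min (d / 2) (b - t)"
    have h: "h > 0" "t + h \<in> {a..b}" "h < d" using True d(1) t by (auto simp: h_def min_def)
    have "\<psi> t \<le> \<psi> (t + h)" using psi_mono t h by (intro mono_onD[OF psi_mono]) auto
    then show False using d(2)[OF h] by simp
  next
    case False
    then have "t = b" using t by simp
    from has_real_derivative_neg_dec_left[OF psi_deriv[OF t] neg] obtain d where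
      d: "d > 0" "\<And>h. h > 0 \<Longrightarrow> t - h \<in> {a..b} \<Longrightarrow> h < d \<Longrightarrow> \<psi> t < \<psi> (t - h)" by blast
    define h where "h = min (d / 2) (b - a)"
    have h: "h > 0" "t - h \<in> {a..b}" "h < d" using d(1) ab \<open>t = b\<close> by (auto simp: h_def min_def)
    have "\<psi> (t - h) \<le> \<psi> t" using t h by (intro mono_onD[OF psi_mono]) auto
    then show False using d(2)[OF h] by simp
  qed
qed

lemma psi_increment:
  assumes "a \<le> s" "s < t" "t \<le> b"
  obtains x where "x \<in> {a..b}" "\<psi> t - \<psi> s = \<psi>' x * (t - s)"
proof -
  have "\<exists>x\<in>{s..t}. \<psi> t - \<psi> s = (\<lambda>h. \<psi>' x * h) (t - s)"
  proof (rule mvt_very_simple)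
    show "s \<le> t" using assms by simp
    fix x assume "s \<le> x" "x \<le> t"
    then have "(\<psi> has_real_derivative \<psi>' x) (at x within {s..t})"
      using assms by (intro DERIV_subset[OF psi_deriv]) auto
    then show "(\<psi> has_derivative (\<lambda>h. \<psi>' x * h)) (at x within {s..t})" by (simp add: has_field_derivative_def)
  qed
  then obtain x where x: "x \<in> {s..t}" "\<psi> t - \<psi> s = \<psi>' x * (t - s)" by auto
  show ?thesis by (rule that[of x]) (use x assms in auto)
qed

lemma psi_strict: "a \<le> s \<Longrightarrow> s < t \<Longrightarrow> t \<le> b \<Longrightarrow> \<psi> s < \<psi> t"
proof -
  assume st: "a \<le> s" "s < t" "t \<le> b"
  then obtain x where "x \<in> {a..b}" "\<psi> t - \<psi> s = \<psi>' x * (t - s)" by (rule psi_increment)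
  moreover from this have "0 < \<psi>' x * (t - s)" using psi_deriv_pos[of x] st by (intro mult_pos_pos) auto
  ultimately show "\<psi> s < \<psi> t" by simp
qed

lemma psi_continuous: "continuous_on {a..b} \<psi>"
  unfolding continuous_on_eq_continuous_within using psi_deriv by (blast intro: DERIV_continuous)

definition kernel :: "real \<Rightarrow> real \<Rightarrow> 'a \<Rightarrow>\<^sub>L 'a" where
  "kernel t s = \<psi>' s *\<^sub>R Blinfun (K_op T \<alpha> (\<psi> t - \<psi> s))"

lemma kernel_facts:
  obtains C where "weakly_singular_kernel a b \<alpha> C kernel"
    "\<And>s t x. a \<le> s \<Longrightarrow> s < t \<Longrightarrow> t \<le> b \<Longrightarrow> blinfun_apply (kernel t s) x = \<psi>' s *\<^sub>R K_op T \<alpha> (\<psi> t - \<psi> s) x"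
proof -
  define \<tau>m where "\<tau>m = \<psi> b - \<psi> a"
  have \<tau>m: "\<tau>m > 0" using psi_strict[of a b] ab by (simp add: \<tau>m_def)
  obtain K C0 where C0: "0 \<le> C0" and Kn: "\<And>\<tau>. 0 < \<tau> \<Longrightarrow> \<tau> \<le> \<tau>m \<Longrightarrow> norm (K \<tau>) \<le> C0 * \<tau> powr (\<alpha> - 1)"
    and Ka: "\<And>\<tau> x. 0 < \<tau> \<Longrightarrow> \<tau> \<le> \<tau>m \<Longrightarrow> K_op T \<alpha> \<tau> x = blinfun_apply (K \<tau>) x"
    and Kc: "continuous_on {0<..\<tau>m} K" and Kk: "\<And>\<tau>. 0 < \<tau> \<Longrightarrow> \<tau> \<le> \<tau>m \<Longrightarrow> compact_operator (K \<tau>)"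
    by (rule K_op_compact_family[OF T_semigroup T_compact \<alpha> \<tau>m], assumption, rule that)
  have range: "0 < \<psi> t - \<psi> s" "\<psi> t - \<psi> s \<le> \<tau>m" if "a \<le> s" "s < t" "t \<le> b" for s t
  proof -
    show "0 < \<psi> t - \<psi> s" using psi_strict[OF that] by simp
    have "\<psi> t \<le> \<psi> b" "\<psi> a \<le> \<psi> s" using that ab by (auto intro!: mono_onD[OF psi_mono])
    then show "\<psi> t - \<psi> s \<le> \<tau>m" unfolding \<tau>m_def by simp
  qed
  have keq: "kernel t s = \<psi>' s *\<^sub>R K (\<psi> t - \<psi> s)" if "a \<le> s" "s < t" "t \<le> b" for s t
  proof -
    have "K_op T \<alpha> (\<psi> t - \<psi> s) = blinfun_apply (K (\<psi> t - \<psi> s))" using Ka[OF range[OF that]] by (intro ext)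
    then show ?thesis by (simp add: kernel_def blinfun_apply_inverse)
  qed
  obtain x1 where x1: "x1 \<in> {a..b}" "\<And>y. y \<in> {a..b} \<Longrightarrow> \<psi>' x1 \<le> \<psi>' y"
    using continuous_attains_inf[OF _ _ psi_C1] ab by auto
  obtain x2 where x2: "x2 \<in> {a..b}" "\<And>y. y \<in> {a..b} \<Longrightarrow> \<psi>' y \<le> \<psi>' x2"
    using continuous_attains_sup[OF _ _ psi_C1] ab by auto
  define c0 where "c0 = \<psi>' x1"
  define c1 where "c1 = \<psi>' x2"
  have c: "0 < c0" "0 < c1" using psi_deriv_pos x1 x2 by (auto simp: c0_def c1_def)
  define C where "C = c1 * C0 * c0 powr (\<alpha> - 1) + 1"
  have C: "0 < C" unfolding C_def using c C0 by (intro add_nonneg_pos) auto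
  have bound: "norm (kernel t s) \<le> C * (t - s) powr (\<alpha> - 1)" if st: "a \<le> s" "s < t" "t \<le> b" for s t
  proof -
    obtain x where x: "x \<in> {a..b}" "\<psi> t - \<psi> s = \<psi>' x * (t - s)" by (rule psi_increment[OF st])
    have "c0 * (t - s) \<le> \<psi> t - \<psi> s" unfolding x(2) using x1(2)[OF x(1)] st by (intro mult_right_mono) (auto simp: c0_def)
    then have p: "(\<psi> t - \<psi> s) powr (\<alpha> - 1) \<le> (c0 * (t - s)) powr (\<alpha> - 1)"
      using c st \<alpha> by (intro powr_mono2') auto
    have "norm (kernel t s) = \<psi>' s * norm (K (\<psi> t - \<psi> s))"
      unfolding keq[OF st] using psi_deriv_pos[of s] st by simp
    also have "\<dots> \<le> c1 * (C0 * (\<psi> t - \<psi> s) powr (\<alpha> - 1))"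
      using x2(2)[of s] st Kn[OF range[OF st]] c psi_deriv_pos[of s] by (intro mult_mono) (auto simp: c1_def)
    also have "\<dots> \<le> c1 * (C0 * (c0 * (t - s)) powr (\<alpha> - 1))"
      using p c C0 by (intro mult_left_mono) auto
    also have "\<dots> = (C - 1) * (t - s) powr (\<alpha> - 1)"
      using c st by (simp add: C_def powr_mult)
    also have "\<dots> \<le> C * (t - s) powr (\<alpha> - 1)" by (intro mult_right_mono) auto
    finally show ?thesis .
  qed
  have "weakly_singular_kernel a b \<alpha> C kernel"
  proof
    show "continuous_on {(t, s). a \<le> s \<and> s < t \<and> t \<le> b} (\<lambda>(t, s). kernel t s)"
    proof -
      let ?D = "{(t, s). a \<le> s \<and> s < t \<and> t \<le> b}"
      have "continuous_on ?D (\<lambda>p. \<psi>' (snd p) *\<^sub>R K (\<psi> (fst p) - \<psi> (snd p)))"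
        by (intro continuous_intros continuous_on_compose2[OF psi_C1] continuous_on_compose2[OF Kc]
            continuous_on_compose2[OF psi_continuous]) (use range in auto)
      then show ?thesis
        by (rule continuous_on_cong[THEN iffD1, OF refl, rotated]) (auto simp: keq)
    qed
    show "compact_operator (kernel t s)" if "a \<le> s" "s < t" "t \<le> b" for s t
      unfolding keq[OF that] by (intro compact_operator_scaleR Kk range that)
  qed (use ab \<alpha> C bound in auto)
  moreover have "blinfun_apply (kernel t s) x = \<psi>' s *\<^sub>R K_op T \<alpha> (\<psi> t - \<psi> s) x" if "a \<le> s" "s < t" "t \<le> b" for s t x
    using Ka[OF range[OF that]] by (simp add: keq[OF that] blinfun.scaleR_left)
  ultimately show ?thesis by (rule that)
qed

text \<open>Some constant that works in the bound of the kernel, named so that the theory of weakly singular kernels can be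
  inherited.\<close>

definition kernel_constant :: real where
  "kernel_constant = (SOME C. weakly_singular_kernel a b \<alpha> C kernel)"

sublocale weakly_singular_kernel a b \<alpha> kernel_constant kernel
  unfolding kernel_constant_def by (rule someI_ex) (rule kernel_facts, blast)

lemma kernel_apply:
  "a \<le> s \<Longrightarrow> s < t \<Longrightarrow> t \<le> b \<Longrightarrow> blinfun_apply (kernel t s) x = \<psi>' s *\<^sub>R K_op T \<alpha> (\<psi> t - \<psi> s) x"
  by (rule kernel_facts) blast

text \<open>The integrand of the mild solution at \<open>s = t\<close> is 0, because \<open>0 powr (\<alpha> - 1) = 0\<close>; so it agrees with the
  integrand of the Volterra operator at every point.\<close>

lemma mild_integral:
  assumes h: "dominated h m" and m: "admissible m" and t: "t \<in> {a<..b}"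
  shows "bochner_integrable (lebesgue_on {a..t}) (\<lambda>s. \<psi>' s *\<^sub>R K_op T \<alpha> (\<psi> t - \<psi> s) (h s))"
    and "bochner_integral (lebesgue_on {a..t}) (\<lambda>s. \<psi>' s *\<^sub>R K_op T \<alpha> (\<psi> t - \<psi> s) (h s)) = volterra h t"
proof -
  let ?g = "\<lambda>s. \<psi>' s *\<^sub>R K_op T \<alpha> (\<psi> t - \<psi> s) (h s)"
  have eq: "indicator {a..t} s *\<^sub>R ?g s = indicator {a..b} s *\<^sub>R integrand h t s" for s
  proof (cases "s \<in> {a..<t}")
    case True
    then show ?thesis using t by (simp add: integrand_def kernel_apply)
  next
    case False
    have "?g t = 0" by (simp add: K_op_def)
    then show ?thesis using False t by (cases "s = t") (auto simp: integrand_def indicator_def)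
  qed
  have "integrable M (integrand h t)" using integrand_integrable[OF h m] t by auto
  then have i: "integrable lebesgue (\<lambda>s. indicator {a..b} s *\<^sub>R integrand h t s)"
    by (subst (asm) integrable_restrict_space) auto
  show "bochner_integrable (lebesgue_on {a..t}) ?g"
  proof -
    have "integrable (lebesgue_on {a..t}) ?g \<longleftrightarrow> integrable lebesgue (\<lambda>s. indicator {a..t} s *\<^sub>R ?g s)"
      by (rule integrable_restrict_space) simp
    then show ?thesis unfolding bochner_integral_eq_library eq using i by simp
  qed
  show "bochner_integral (lebesgue_on {a..t}) ?g = volterra h t"
  proof -
    have "integral\<^sup>L (lebesgue_on {a..t}) ?g = integral\<^sup>L lebesgue (\<lambda>s. indicator {a..t} s *\<^sub>R ?g s)"
      by (rule integral_restrict_space) simp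
    also have "\<dots> = integral\<^sup>L lebesgue (\<lambda>s. indicator {a..b} s *\<^sub>R integrand h t s)" unfolding eq ..
    also have "\<dots> = volterra h t"
      unfolding volterra_def by (rule integral_restrict_space[symmetric]) simp
    finally show ?thesis unfolding bochner_integral_eq_library .
  qed
qed

abbreviation free_part :: "real \<Rightarrow> 'a" where
  "free_part t \<equiv> S_op T \<alpha> \<beta> (\<psi> t - \<psi> a) x0"

abbreviation weight :: real where "weight \<equiv> 1 - hilfer_gamma \<alpha> \<beta>"

lemma weight_nonneg: "0 \<le> weight"
proof -
  have "\<beta> * (1 - \<alpha>) \<le> 1 * (1 - \<alpha>)" using \<alpha> \<beta> by (intro mult_right_mono) auto
  then show ?thesis by (simp add: hilfer_gamma_def)
qed

lemma psi_weight_limit: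
  obtains l where "((\<lambda>t. (\<psi> t - \<psi> a) powr weight) \<longlongrightarrow> l) (at_right a)"
proof (cases "weight = 0")
  case True
  have "eventually (\<lambda>t. (\<psi> t - \<psi> a) powr weight = 1) (at_right a)"
    unfolding eventually_at_right_field
  proof (intro exI conjI allI impI)
    show "b > a" by (rule ab)
    fix t assume "a < t" "t < b"
    then have "\<psi> a < \<psi> t" by (intro psi_strict) auto
    then show "(\<psi> t - \<psi> a) powr weight = 1" using True by simp
  qed
  from tendsto_eventually[OF this] show ?thesis by (rule that)
next
  case False
  then have w: "weight > 0" using weight_nonneg by simp
  have "(\<psi> \<longlongrightarrow> \<psi> a) (at a within {a..b})"
    using psi_continuous ab by (auto simp: continuous_on_def)
  then have "(\<psi> \<longlongrightarrow> \<psi> a) (at_right a)"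
    using ab by (simp add: at_within_Icc_at_right)
  then have "((\<lambda>t. \<psi> t - \<psi> a) \<longlongrightarrow> \<psi> a - \<psi> a) (at_right a)" by (intro tendsto_intros)
  moreover have "eventually (\<lambda>t. 0 \<le> \<psi> t - \<psi> a) (at_right a)"
    unfolding eventually_at_right_field using psi_strict[of a] ab by (intro exI[of _ b]) (auto intro: less_imp_le)
  ultimately have "((\<lambda>t. (\<psi> t - \<psi> a) powr weight) \<longlongrightarrow> 0 powr weight) (at_right a)"
    using w by (intro tendsto_powr') auto
  then show ?thesis by (rule that)
qed

text \<open>The singularity at \<open>a\<close> allowed by the weight is needed for the free evolution of the initial
  value only; all Volterra terms are continuous up to \<open>a\<close>.\<close>

lemma weighted_C_add_continuous:
  assumes q: "q \<in> weighted_C \<psi> weight a b" and v: "continuous_on {a..b} v"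
  shows "(\<lambda>t. q t + v t) \<in> weighted_C \<psi> weight a b"
proof -
  obtain l where l: "((\<lambda>t. (\<psi> t - \<psi> a) powr weight *\<^sub>R q t) \<longlongrightarrow> l) (at_right a)"
    using q unfolding weighted_C_def by blast
  obtain l' where l': "((\<lambda>t. (\<psi> t - \<psi> a) powr weight) \<longlongrightarrow> l') (at_right a)" by (rule psi_weight_limit)
  have "(v \<longlongrightarrow> v a) (at a within {a..b})" using v ab by (auto simp: continuous_on_def)
  then have "(v \<longlongrightarrow> v a) (at_right a)" using ab by (simp add: at_within_Icc_at_right)
  then have "((\<lambda>t. (\<psi> t - \<psi> a) powr weight *\<^sub>R q t + (\<psi> t - \<psi> a) powr weight *\<^sub>R v t) \<longlongrightarrow> l + l' *\<^sub>R v a) (at_right a)"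
    by (intro tendsto_intros l l')
  moreover have "continuous_on {a<..b} (\<lambda>t. q t + v t)"
    using q unfolding weighted_C_def by (auto intro!: continuous_intros intro: continuous_on_subset[OF v])
  ultimately show ?thesis
    unfolding weighted_C_def by (auto simp: scaleR_add_right)
qed

lemma weighted_C_cong:
  assumes "q \<in> weighted_C \<psi> weight a b" and eq: "\<And>t. t \<in> {a<..b} \<Longrightarrow> q' t = q t"
  shows "q' \<in> weighted_C \<psi> weight a b"
proof -
  obtain l where l: "((\<lambda>t. (\<psi> t - \<psi> a) powr weight *\<^sub>R q t) \<longlongrightarrow> l) (at_right a)" and c: "continuous_on {a<..b} q"
    using assms(1) unfolding weighted_C_def by blast
  have "eventually (\<lambda>t. (\<psi> t - \<psi> a) powr weight *\<^sub>R q t = (\<psi> t - \<psi> a) powr weight *\<^sub>R q' t) (at_right a)"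
    unfolding eventually_at_right_field using ab eq by (intro exI[of _ b]) auto
  from Lim_transform_eventually[OF l this] have "((\<lambda>t. (\<psi> t - \<psi> a) powr weight *\<^sub>R q' t) \<longlongrightarrow> l) (at_right a)" .
  moreover have "continuous_on {a<..b} q'" by (rule continuous_on_eq[OF c]) (simp add: eq)
  ultimately show ?thesis unfolding weighted_C_def by blast
qed

lemma mild_with_source_iff:
  assumes h: "dominated (\<lambda>s. f s + B (u s)) m" and m: "admissible m"
  shows "mild_with_source \<psi> \<psi>' a b \<alpha> \<beta> T B x0 f u q \<longleftrightarrow> q \<in> weighted_C \<psi> weight a b \<and>
     (\<forall>t\<in>{a<..b}. q t = free_part t + volterra (\<lambda>s. f s + B (u s)) t)"
  unfolding mild_with_source_def using mild_integral[OF h m] by auto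

text \<open>The inequality \<open>2 \<alpha> > 1\<close> is what makes square integrable sources admissible.\<close>

lemma control_dominated:
  assumes u: "u \<in> L2_functions a b"
  shows "dominated (\<lambda>s. B (u s)) (\<lambda>s. norm (B (u s)))" "admissible (\<lambda>s. norm (B (u s)))"
proof -
  have um: "u \<in> borel_measurable M" and ui: "integrable M (\<lambda>t. (norm (u t))\<^sup>2)"
    using u unfolding L2_functions_def by auto
  have Bm: "(\<lambda>s. B (u s)) \<in> borel_measurable M"
    by (rule measurable_compose[OF um borel_measurable_continuous_onI]) (intro continuous_intros)
  then show "dominated (\<lambda>s. B (u s)) (\<lambda>s. norm (B (u s)))" unfolding dominated_def by simp
  show "admissible (\<lambda>s. norm (B (u s)))"
  proof (rule admissible_Lp[of 2])
    show "integrable M (\<lambda>s. norm (B (u s)) powr 2)"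
    proof (rule Bochner_Integration.integrable_bound[where f = "\<lambda>t. (norm B)\<^sup>2 * (norm (u t))\<^sup>2"])
      show "integrable M (\<lambda>t. (norm B)\<^sup>2 * (norm (u t))\<^sup>2)" using ui by simp
      show "(\<lambda>s. norm (B (u s)) powr 2) \<in> borel_measurable M" using Bm by measurable
      have "norm (B (u s)) powr 2 \<le> (norm B)\<^sup>2 * (norm (u s))\<^sup>2" for s
        using power_mono[OF norm_blinfun[of B "u s"], of 2] by (simp add: power_mult_distrib)
      then show "AE s in M. norm (norm (B (u s)) powr 2) \<le> norm ((norm B)\<^sup>2 * (norm (u s))\<^sup>2)"
        by (intro AE_I2) simp
    qed
  qed (use \<alpha> Bm in auto)
qed

lemma linear_mild_solution_iff:
  assumes u: "u \<in> L2_functions a b"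
  shows "linear_mild_solution \<psi> \<psi>' a b \<alpha> \<beta> T B x0 u q \<longleftrightarrow> q \<in> weighted_C \<psi> weight a b \<and>
     (\<forall>t\<in>{a<..b}. q t = free_part t + volterra (\<lambda>s. B (u s)) t)"
  unfolding linear_mild_solution_def
  using mild_with_source_iff[of "\<lambda>_. 0" u _ q, simplified, OF control_dominated[OF u]] by simp

lemma L2_add:
  assumes "u \<in> L2_functions a b" "v \<in> L2_functions a b"
  shows "(\<lambda>t. u t + v t) \<in> L2_functions a b"
proof -
  have m: "u \<in> borel_measurable M" "v \<in> borel_measurable M"
    and i: "integrable M (\<lambda>t. (norm (u t))\<^sup>2)" "integrable M (\<lambda>t. (norm (v t))\<^sup>2)"
    using assms unfolding L2_functions_def by auto
  have s: "(\<lambda>t. u t + v t) \<in> borel_measurable M" using m by (rule borel_measurable_add)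
  have "integrable M (\<lambda>t. (norm (u t + v t))\<^sup>2)"
  proof (rule Bochner_Integration.integrable_bound[where f = "\<lambda>t. 2 * (norm (u t))\<^sup>2 + 2 * (norm (v t))\<^sup>2"])
    show "integrable M (\<lambda>t. 2 * (norm (u t))\<^sup>2 + 2 * (norm (v t))\<^sup>2)" using i by simp
    have "(norm (u t + v t))\<^sup>2 \<le> 2 * (norm (u t))\<^sup>2 + 2 * (norm (v t))\<^sup>2" for t
    proof -
      have "(norm (u t + v t))\<^sup>2 \<le> (norm (u t) + norm (v t))\<^sup>2" by (intro power_mono norm_triangle_ineq) simp
      also have "\<dots> \<le> 2 * (norm (u t))\<^sup>2 + 2 * (norm (v t))\<^sup>2"
        using sum_squares_bound[of "norm (u t)" "norm (v t)"] by (simp add: power2_sum)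
      finally show ?thesis .
    qed
    then show "AE t in M. norm ((norm (u t + v t))\<^sup>2) \<le> norm (2 * (norm (u t))\<^sup>2 + 2 * (norm (v t))\<^sup>2)"
      by (intro AE_I2) (simp add: abs_of_nonneg)
  qed (use s in measurable)
  then show ?thesis using s unfolding L2_functions_def by simp
qed

lemma L2_scaleR: "u \<in> L2_functions a b \<Longrightarrow> (\<lambda>t. c *\<^sub>R u t) \<in> L2_functions a b"
  unfolding L2_functions_def by (auto simp: power_mult_distrib intro: borel_measurable_const_scaleR)

lemma L2_zero: "(\<lambda>t. 0) \<in> L2_functions a b"
  unfolding L2_functions_def by simp

lemma L2_sum:
  "finite N \<Longrightarrow> (\<And>c. c \<in> N \<Longrightarrow> u c \<in> L2_functions a b) \<Longrightarrow> (\<lambda>t. \<Sum>c\<in>N. p c *\<^sub>R u c t) \<in> L2_functions a b"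
proof (induction N rule: finite_induct)
  case empty
  then show ?case using L2_zero by simp
next
  case (insert c N)
  then show ?case using L2_add[OF L2_scaleR[of "u c" "p c"], of "\<lambda>t. \<Sum>c\<in>N. p c *\<^sub>R u c t"] by simp
qed

lemma volterra_control_sum:
  assumes "finite N" "\<And>c. c \<in> N \<Longrightarrow> u c \<in> L2_functions a b" and t: "t \<in> {a..b}"
  shows "volterra (\<lambda>s. B (\<Sum>c\<in>N. p c *\<^sub>R u c s)) t = (\<Sum>c\<in>N. p c *\<^sub>R volterra (\<lambda>s. B (u c s)) t)"
  using assms(1,2)
proof (induction N rule: finite_induct)
  case empty
  show ?case by (simp add: volterra_def integrand_def blinfun.zero_right)
next
  case (insert c N)
  have 1: "(\<lambda>t. p c *\<^sub>R u c t) \<in> L2_functions a b" using insert.prems by (intro L2_scaleR) auto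
  have 2: "(\<lambda>t. \<Sum>c\<in>N. p c *\<^sub>R u c t) \<in> L2_functions a b" using insert by (intro L2_sum) auto
  have "volterra (\<lambda>s. B (\<Sum>c\<in>insert c N. p c *\<^sub>R u c s)) t =
      volterra (\<lambda>s. B (p c *\<^sub>R u c s) + B (\<Sum>c\<in>N. p c *\<^sub>R u c s)) t"
    using insert by (simp add: blinfun.add_right)
  also have "\<dots> = volterra (\<lambda>s. B (p c *\<^sub>R u c s)) t + volterra (\<lambda>s. B (\<Sum>c\<in>N. p c *\<^sub>R u c s)) t"
    by (rule volterra_add[OF control_dominated[OF 1] control_dominated[OF 2] t])
  also have "volterra (\<lambda>s. B (p c *\<^sub>R u c s)) t = p c *\<^sub>R volterra (\<lambda>s. B (u c s)) t"
    unfolding blinfun.scaleR_right by (rule volterra_scaleR)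
  finally show ?case using insert by simp
qed

end

lemma infdist_less_iff:
  assumes "A \<noteq> {}"
  shows "infdist z A < c \<longleftrightarrow> (\<exists>y\<in>A. dist z y < c)"
  unfolding infdist_notempty[OF assms]
  by (rule cINF_less_iff[OF assms]) (auto intro: bdd_belowI[of _ 0])

lemma lower_semicontinuous_infdist:
  fixes G :: "'a::metric_space \<Rightarrow> 'a set"
  assumes G: "lower_semicontinuous G" and ne: "\<And>x. G x \<noteq> {}" and e: "e > 0"
  shows "\<exists>d>0. \<forall>x'. dist x x' < d \<longrightarrow> infdist z (G x') \<le> infdist z (G x) + e"
proof -
  let ?V = "ball z (infdist z (G x) + e)"
  have "open {x. G x \<inter> ?V \<noteq> {}}" using G unfolding lower_semicontinuous_def by blast
  moreover have "\<exists>y\<in>G x. dist z y < infdist z (G x) + e"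
    using infdist_less_iff[OF ne, of z x "infdist z (G x) + e"] e by simp
  then have "x \<in> {x. G x \<inter> ?V \<noteq> {}}" by auto
  ultimately obtain d where d: "d > 0" "ball x d \<subseteq> {x. G x \<inter> ?V \<noteq> {}}"
    using open_contains_ball by metis
  have "infdist z (G x') \<le> infdist z (G x) + e" if "dist x x' < d" for x'
  proof -
    have "x' \<in> {x. G x \<inter> ?V \<noteq> {}}" using that d(2) by auto
    then have "\<exists>y\<in>G x'. dist z y < infdist z (G x) + e" by auto
    then show ?thesis using infdist_less_iff[OF ne, of z x' "infdist z (G x) + e"] by simp
  qed
  then show ?thesis using d(1) by blast
qed

lemma null_sets_lebesgue_on_complete:
  assumes S: "S \<in> sets lebesgue" and N: "N \<in> null_sets (lebesgue_on S)" and sub: "Z \<subseteq> N"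
  shows "Z \<in> sets (lebesgue_on S)"
proof -
  have "N \<in> null_sets lebesgue" "N \<subseteq> S"
    using N S by (auto simp: null_sets_restrict_space)
  then have "Z \<in> null_sets lebesgue" "Z \<subseteq> S"
    using sub by (auto intro: null_sets_completion_subset)
  then show ?thesis using S by (auto simp: sets_restrict_space_iff)
qed

lemma finite_measure_lebesgue_on_Icc: "finite_measure (lebesgue_on {a..b::real})"
  by (rule finite_measureI) (simp add: emeasure_restrict_space emeasure_lborel_Icc_eq)

text \<open>The distance is below \<open>c\<close> when the graph has a point over \<open>t\<close> within the ball of radius \<open>c\<close> around \<open>z\<close>: the
  set of such \<open>t\<close> is the projection of a measurable set of pairs.\<close>

lemma graph_measurable_infdist:
  fixes F :: "real \<Rightarrow> 'a::{complete_space, second_countable_topology} \<Rightarrow> 'a set"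
  assumes F: "graph_measurable a b F" and ne: "\<And>t x. t \<in> {a..b} \<Longrightarrow> F t x \<noteq> {}"
    and q: "q \<in> borel_measurable (lebesgue_on {a..b})"
  shows "(\<lambda>t. infdist z (F t (q t))) \<in> borel_measurable (lebesgue_on {a..b})"
  unfolding borel_measurable_iff_less
proof
  fix c :: real
  let ?M = "lebesgue_on {a..b}"
  let ?G = "{(t, x, z). t \<in> {a..b} \<and> z \<in> F t x}"
  let ?f = "\<lambda>p. (fst p, q (fst p), snd p)"
  interpret finite_measure ?M by (rule finite_measure_lebesgue_on_Icc)
  have "(\<lambda>p. (q (fst p), snd p)) \<in> measurable (?M \<Otimes>\<^sub>M borel) (borel :: ('a \<times> 'a) measure)"
    unfolding borel_prod[symmetric] using q by measurable
  then have f: "?f \<in> measurable (?M \<Otimes>\<^sub>M borel) (?M \<Otimes>\<^sub>M (borel :: ('a \<times> 'a) measure))"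
    by (intro measurable_Pair) auto
  have "?f -` ?G \<inter> space (?M \<Otimes>\<^sub>M borel) \<in> sets (?M \<Otimes>\<^sub>M borel)"
    using F unfolding graph_measurable_def by (rule measurable_sets[OF f])
  moreover have "space ?M \<times> ball z c \<in> sets (?M \<Otimes>\<^sub>M borel)" by (intro pair_measureI) auto
  ultimately have "(?f -` ?G \<inter> space (?M \<Otimes>\<^sub>M borel)) \<inter> (space ?M \<times> ball z c) \<in> sets (?M \<Otimes>\<^sub>M borel)"
    by (rule sets.Int)
  from measurable_projection[OF _ this]
  have "{t \<in> space ?M. \<exists>y. (t, y) \<in> (?f -` ?G \<inter> space (?M \<Otimes>\<^sub>M borel)) \<inter> (space ?M \<times> ball z c)} \<in> sets ?M"
    by (rule meta_mp) (rule null_sets_lebesgue_on_complete, auto)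
  also have "{t \<in> space ?M. \<exists>y. (t, y) \<in> (?f -` ?G \<inter> space (?M \<Otimes>\<^sub>M borel)) \<inter> (space ?M \<times> ball z c)} =
      {t \<in> space ?M. infdist z (F t (q t)) < c}"
    using ne by (auto simp: space_pair_measure infdist_less_iff)
  finally show "{t \<in> space ?M. infdist z (F t (q t)) < c} \<in> sets ?M" .
qed

context fractional_system
begin

text \<open>The vectors of \<open>K\<close> are reached up to \<open>e\<close> by finitely many controls. Convex weights from a partition of unity
  choose among these continuously, which is all the feedback has to do.\<close>

lemma control_net:
  assumes dense: "\<And>y e. e > 0 \<Longrightarrow> \<exists>u\<in>L2_functions a b. norm (volterra (\<lambda>s. B (u s)) b - y) < e"
    and K: "compact K" and e: "e > 0"
  obtains N :: "'a set" and U p where "finite N" "\<And>c. c \<in> N \<Longrightarrow> U c \<in> L2_functions a b" "\<And>c. continuous_on K (p c)"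
    "\<And>c y. c \<in> N \<Longrightarrow> y \<in> K \<Longrightarrow> 0 \<le> p c y \<and> p c y \<le> (1::real)"
    "\<And>y. y \<in> K \<Longrightarrow> norm ((\<Sum>c\<in>N. p c y *\<^sub>R volterra (\<lambda>s. B (U c s)) b) - y) \<le> e"
proof -
  have "\<forall>c. \<exists>u. u \<in> L2_functions a b \<and> norm (volterra (\<lambda>s. B (u s)) b - c) < e / 2"
    using dense[of "e / 2"] e by auto
  from choice[OF this] obtain U where U: "\<And>c. U c \<in> L2_functions a b"
    "\<And>c. norm (volterra (\<lambda>s. B (U c s)) b - c) < e / 2" by blast
  obtain N p where N: "finite N" "N \<subseteq> K" and cont: "\<And>c. continuous_on K (p c)"
    and p0: "\<And>c x. x \<in> K \<Longrightarrow> 0 \<le> p c x" and p1: "\<And>x. x \<in> K \<Longrightarrow> (\<Sum>c\<in>N. p c x) = (1::real)"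
    and pd: "\<And>c x. p c x \<noteq> 0 \<Longrightarrow> dist x c < e / 2"
    by (rule partition_of_unity_compact[OF K, of "\<lambda>_. e / 2"]) (use e in auto)
  have ple: "p c y \<le> 1" if "c \<in> N" "y \<in> K" for c y
    using member_le_sum[of c N "\<lambda>c. p c y"] that N(1) p0 p1 by auto
  have st: "norm ((\<Sum>c\<in>N. p c y *\<^sub>R volterra (\<lambda>s. B (U c s)) b) - y) \<le> e" if y: "y \<in> K" for y
  proof -
    have "(\<Sum>c\<in>N. p c y *\<^sub>R volterra (\<lambda>s. B (U c s)) b) - y = (\<Sum>c\<in>N. p c y *\<^sub>R (volterra (\<lambda>s. B (U c s)) b - y))"
      using p1[OF y] by (simp add: scaleR_right_diff_distrib sum_subtractf flip: scaleR_left.sum)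
    then have "norm ((\<Sum>c\<in>N. p c y *\<^sub>R volterra (\<lambda>s. B (U c s)) b) - y) =
        norm (\<Sum>c\<in>N. p c y *\<^sub>R (volterra (\<lambda>s. B (U c s)) b - y))" by (rule arg_cong)
    also have "\<dots> \<le> (\<Sum>c\<in>N. p c y * e)"
    proof (rule sum_norm_le)
      fix c assume "c \<in> N"
      show "norm (p c y *\<^sub>R (volterra (\<lambda>s. B (U c s)) b - y)) \<le> p c y * e"
      proof (cases "p c y = 0")
        case False
        have "norm (volterra (\<lambda>s. B (U c s)) b - y) \<le> norm (volterra (\<lambda>s. B (U c s)) b - c) + norm (c - y)"
          using norm_triangle_ineq[of "volterra (\<lambda>s. B (U c s)) b - c" "c - y"] by simp
        also have "\<dots> \<le> e" using U(2)[of c] pd[OF False] by (simp add: dist_norm norm_minus_commute)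
        finally show ?thesis using p0[OF y] by (simp add: mult_left_mono)
      qed simp
    qed
    also have "\<dots> = e" using p1[OF y] by (simp flip: sum_distrib_right)
    finally show ?thesis .
  qed
  show ?thesis
    by (rule that[of N U p]) (use N(1) U(1) cont p0 ple st in auto)
qed

text \<open>The unknown of the fixed point problem is \<open>v = q - S x\<^sub>0\<close>, which is continuous up to \<open>a\<close>. A path \<open>v\<close>
  determines a selection \<open>g v\<close>, hence the vector \<open>y v\<close> that the control has to supply, hence the weights \<open>w v\<close> of the
  finitely many controls, and the map \<open>\<Phi>\<close> sends \<open>v\<close> to the path with source \<open>g v + B (u v)\<close>. All sources stay below one
  admissible function \<open>m0\<close>.\<close>

theorem inclusion_approximately_controllable:
  assumes C: "approximately_controllable a b (linear_mild_solution \<psi> \<psi>' a b \<alpha> \<beta> T B x0)"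
    and F_nonempty: "\<And>t x. t \<in> {a..b} \<Longrightarrow> F t x \<noteq> {}"
    and F1: "graph_measurable a b F"
    and F2: "\<And>t x. t \<in> {a..b} \<Longrightarrow> closed (F t x) \<and> convex (F t x)"
    and F3: "\<And>t. t \<in> {a..b} \<Longrightarrow> lower_semicontinuous (F t)"
    and r: "0 < r" "r < \<alpha>"
    and m_nonneg: "\<And>t. t \<in> {a..b} \<Longrightarrow> 0 \<le> m t"
    and m_measurable: "m \<in> borel_measurable (lebesgue_on {a..b})"
    and m_Lp: "integrable (lebesgue_on {a..b}) (\<lambda>t. m t powr (1 / r))"
    and F4: "\<And>t x z. t \<in> {a..b} \<Longrightarrow> z \<in> F t x \<Longrightarrow> norm z \<le> m t"
  shows "approximately_controllable a b (inclusion_mild_solution \<psi> \<psi>' a b \<alpha> \<beta> T B x0 F)"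
  unfolding approximately_controllable_def
proof (intro allI impI)
  fix x1 :: 'a and \<epsilon> :: real assume \<epsilon>: "\<epsilon> > 0"
  have b_mem: "b \<in> {a<..b}" "b \<in> {a..b}" using ab by auto
  have m_adm: "admissible m"
    using r \<alpha> m_measurable m_nonneg m_Lp by (intro admissible_Lp[of "1 / r"]) (auto simp: field_simps)
  have dense: "\<exists>u\<in>L2_functions a b. norm (volterra (\<lambda>s. B (u s)) b - y) < e" if e: "e > 0" for y e
  proof -
    obtain u q where u: "u \<in> L2_functions a b" and q: "linear_mild_solution \<psi> \<psi>' a b \<alpha> \<beta> T B x0 u q"
      and "norm (q b - (free_part b + y)) < e"
      using C e unfolding approximately_controllable_def by blast
    moreover have "q b = free_part b + volterra (\<lambda>s. B (u s)) b"
      using q b_mem unfolding linear_mild_solution_iff[OF u] by blast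
    ultimately show ?thesis by (intro bexI[of _ u]) auto
  qed
  \<comment> \<open>that the free evolution belongs to the weighted space is read off from any linear mild solution, which differs from it by a continuous function\<close>
  have free: "free_part \<in> weighted_C \<psi> weight a b"
  proof -
    obtain u q where u: "u \<in> L2_functions a b" and q: "linear_mild_solution \<psi> \<psi>' a b \<alpha> \<beta> T B x0 u q"
      using C zero_less_one unfolding approximately_controllable_def by blast
    have qw: "q \<in> weighted_C \<psi> weight a b" and qv: "\<And>t. t \<in> {a<..b} \<Longrightarrow> q t = free_part t + volterra (\<lambda>s. B (u s)) t"
      using q unfolding linear_mild_solution_iff[OF u] by auto
    have "continuous_on {a..b} (\<lambda>t. - volterra (\<lambda>s. B (u s)) t)"
      by (intro continuous_intros volterra_continuous[OF control_dominated[OF u]])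
    from weighted_C_add_continuous[OF qw this] show ?thesis
      by (rule weighted_C_cong) (simp add: qv)
  qed
  define Z where "Z = {volterra h b |h. dominated h m}"
  define shift where "shift k = x1 - free_part b - k" for k
  have "compact (closure Z)" unfolding Z_def by (rule volterra_precompact[OF m_adm b_mem(2)])
  then have Kc: "compact (shift ` closure Z)"
    unfolding shift_def by (intro compact_continuous_image continuous_intros)
  have \<epsilon>2: "\<epsilon> / 2 > 0" using \<epsilon> by simp
  obtain N :: "'a set" and U p where N: "finite N" and U: "\<And>c. c \<in> N \<Longrightarrow> U c \<in> L2_functions a b"
    and pc: "\<And>c. continuous_on (shift ` closure Z) (p c)"
    and p01: "\<And>c y. c \<in> N \<Longrightarrow> y \<in> shift ` closure Z \<Longrightarrow> 0 \<le> p c y \<and> p c y \<le> (1::real)"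
    and steer: "\<And>y. y \<in> shift ` closure Z \<Longrightarrow> norm ((\<Sum>c\<in>N. p c y *\<^sub>R volterra (\<lambda>s. B (U c s)) b) - y) \<le> \<epsilon> / 2"
    by (rule control_net[OF dense Kc \<epsilon>2], assumption, rule that)
  define m0 where "m0 s = m s + (\<Sum>c\<in>N. norm (B (U c s)))" for s
  have m0_adm: "admissible m0"
    unfolding m0_def by (intro admissible_add m_adm admissible_sum N control_dominated U)
  define K where "K = closure {volterra_path h |h. dominated h m0}"
  have K: "compact K" "convex K" "K \<noteq> {}"
    using volterra_paths_compact_convex[OF m0_adm] by (auto simp: K_def)
  define q where "q v t = free_part t + apply_bcontfun v t" for v :: "real \<Rightarrow>\<^sub>C 'a" and t
  have q_meas: "q v \<in> borel_measurable M" for v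
  proof -
    have "continuous_on {a<..b} free_part" using free unfolding weighted_C_def by blast
    moreover have "continuous_on UNIV (apply_bcontfun v)" using apply_bcontfun[of v] by (simp add: bcontfun_def)
    ultimately have "continuous_on {a<..b} (q v)"
      unfolding q_def by (intro continuous_intros) (auto intro: continuous_on_subset)
    then have "(\<lambda>t. indicator {a<..b} t *\<^sub>R q v t) \<in> borel_measurable borel"
      by (intro borel_measurable_continuous_on_indicator) auto
    then have "(\<lambda>t. if t = a then q v a else indicator {a<..b} t *\<^sub>R q v t) \<in> borel_measurable borel"
      by (intro measurable_If) auto
    then have "(\<lambda>t. if t = a then q v a else indicator {a<..b} t *\<^sub>R q v t) \<in> borel_measurable M"
      by (rule borel_imp_lebesgue_on_measurable)
    then show ?thesis
      by (rule measurable_cong[THEN iffD1, rotated]) (auto simp: indicator_def)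
  qed
  interpret sel: lsc_multifunction M K "\<lambda>v t. F t (q v t)" m
  proof (intro lsc_multifunction.intro lsc_multifunction_axioms.intro)
    show "finite_measure M" by (rule finite_measure_lebesgue_on_Icc)
    show "compact K" by (rule K(1))
    show "integrable M m" by (rule admissibleD(1)[OF m_adm])
    show "(\<lambda>t. infdist z (F t (q v t))) \<in> borel_measurable M" for v z
      by (rule graph_measurable_infdist[OF F1 F_nonempty q_meas])
    show "\<exists>d>0. \<forall>v'\<in>K. dist v v' < d \<longrightarrow> infdist z (F t (q v' t)) \<le> infdist z (F t (q v t)) + e"
      if "t \<in> space M" and e: "e > 0" for v t e z
    proof -
      have t: "t \<in> {a..b}" using that by simp
      obtain d where d: "d > 0" "\<And>x'. dist (q v t) x' < d \<Longrightarrow> infdist z (F t x') \<le> infdist z (F t (q v t)) + e"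
        using lower_semicontinuous_infdist[OF F3[OF t] F_nonempty[OF t] e] by blast
      have "dist (q v t) (q v' t) \<le> dist v v'" for v'
        using dist_bounded[of v t v'] by (simp add: q_def dist_norm)
      then show ?thesis using d by (intro exI[of _ d]) (auto intro: le_less_trans)
    qed
  qed (use F_nonempty F2 F4 in auto)
  obtain f where f_int: "\<And>v. v \<in> K \<Longrightarrow> integrable M (f v)"
    and f_sel: "\<And>v. v \<in> K \<Longrightarrow> AE t in M. f v t \<in> F t (q v t)"
    and f_cont: "\<And>v e. v \<in> K \<Longrightarrow> e > 0 \<Longrightarrow> \<exists>d>0. \<forall>v'\<in>K. dist v v' < d \<longrightarrow> (LINT t|M. norm (f v t - f v' t)) \<le> e"
    by (rule sel.continuous_selection_in_mean, rule that)
  \<comment> \<open>a change on null sets that makes the bound by \<open>m\<close> hold everywhere\<close>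
  define g where "g v t = (if norm (f v t) \<le> m t then f v t else 0)" for v t
  have g_dom: "dominated (g v) m" if "v \<in> K" for v
    unfolding dominated_def g_def using f_int[OF that] m_measurable m_nonneg by auto
  have g_eq: "AE t in M. g v t = f v t" if "v \<in> K" for v
  proof -
    have "AE t in M. t \<in> space M" by (rule AE_space)
    with f_sel[OF that] show ?thesis by eventually_elim (auto simp: g_def dest: F4[rotated])
  qed
  have g_sel: "AE t in M. g v t \<in> F t (q v t)" if "v \<in> K" for v
    using g_eq[OF that] f_sel[OF that] by eventually_elim simp
  have g_int: "integrable M (g v)" if "v \<in> K" for v by (rule dominated_integrable[OF g_dom[OF that] m_adm])
  have g_cont: "\<exists>d>0. \<forall>v'\<in>K. dist v v' < d \<longrightarrow> (LINT t|M. norm (g v t - g v' t)) \<le> e" if v: "v \<in> K" and e: "e > 0" for v e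
  proof -
    have "(LINT t|M. norm (g v t - g v' t)) = (LINT t|M. norm (f v t - f v' t))" if v': "v' \<in> K" for v'
    proof (rule integral_cong_AE)
      show "AE t in M. norm (g v t - g v' t) = norm (f v t - f v' t)"
        using g_eq[OF v] g_eq[OF v'] by eventually_elim simp
    qed (use f_int[OF v] f_int[OF v'] g_int[OF v] g_int[OF v'] in auto)
    then show ?thesis using f_cont[OF v e] by auto
  qed
  define y where "y v = shift (volterra (g v) b)" for v
  have y_mem: "y v \<in> shift ` closure Z" if "v \<in> K" for v
  proof -
    have "volterra (g v) b \<in> Z" unfolding Z_def using g_dom[OF that] by blast
    then have "volterra (g v) b \<in> closure Z" by (rule subsetD[OF closure_subset])
    then show ?thesis unfolding y_def by (rule imageI)
  qed
  have y_cont: "continuous_on K y"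
    unfolding continuous_on_iff
  proof (intro ballI allI impI)
    fix v e assume v: "v \<in> K" and e: "(0::real) < e"
    then have "e / 2 > 0" by simp
    from volterra_mean_continuous[OF m_adm this] obtain d where d: "d > 0"
      "\<And>h h'. dominated h m \<Longrightarrow> dominated h' m \<Longrightarrow> (LINT s|M. norm (h s - h' s)) \<le> d \<Longrightarrow>
        norm (volterra h b - volterra h' b) \<le> e / 2" using b_mem(2) by blast
    obtain d' where d': "d' > 0" "\<And>v'. v' \<in> K \<Longrightarrow> dist v v' < d' \<Longrightarrow> (LINT t|M. norm (g v t - g v' t)) \<le> d"
      using g_cont[OF v d(1)] by blast
    have "dist (y v') (y v) < e" if v': "v' \<in> K" "dist v' v < d'" for v'
    proof -
      have "norm (volterra (g v) b - volterra (g v') b) \<le> e / 2"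
        using v' by (intro d(2) g_dom v d'(2)) (auto simp: dist_commute)
      moreover have "y v' - y v = volterra (g v) b - volterra (g v') b" by (simp add: y_def shift_def)
      ultimately show ?thesis using e by (simp add: dist_norm)
    qed
    then show "\<exists>d>0. \<forall>v'\<in>K. dist v' v < d \<longrightarrow> dist (y v') (y v) < e" using d'(1) by blast
  qed
  define w where "w v c = p c (y v)" for v c
  have w01: "0 \<le> w v c" "w v c \<le> 1" if "v \<in> K" "c \<in> N" for v c
    using p01[OF that(2) y_mem[OF that(1)]] by (auto simp: w_def)
  have w_cont: "continuous_on K (\<lambda>v. w v c)" for c
    unfolding w_def by (rule continuous_on_compose2[OF pc y_cont]) (use y_mem in blast)
  define u where "u v s = (\<Sum>c\<in>N. w v c *\<^sub>R U c s)" for v s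
  have u_L2: "u v \<in> L2_functions a b" for v
    unfolding u_def by (rule L2_sum[OF N U])
  define h where "h v s = g v s + B (u v s)" for v s
  have Bu: "B (u v s) = (\<Sum>c\<in>N. w v c *\<^sub>R B (U c s))" for v s
    by (simp add: u_def blinfun.sum_right blinfun.scaleR_right)
  have BU_int: "integrable M (\<lambda>s. B (U c s))" if "c \<in> N" for c
    using dominated_integrable[OF control_dominated[OF U[OF that]]] .
  have h_dom: "dominated (h v) m0" if v: "v \<in> K" for v
    unfolding dominated_def
  proof (intro conjI ballI)
    show "h v \<in> borel_measurable M"
      unfolding h_def using g_dom[OF v] control_dominated(1)[OF u_L2, of v] unfolding dominated_def by auto
    fix s assume s: "s \<in> {a..b}"
    have "norm (B (u v s)) \<le> (\<Sum>c\<in>N. norm (B (U c s)))"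
      unfolding Bu using w01[OF v] by (intro sum_norm_le) (simp add: mult_left_le_one_le)
    moreover have "norm (g v s) \<le> m s" using g_dom[OF v] s unfolding dominated_def by blast
    ultimately show "norm (h v s) \<le> m0 s" unfolding h_def m0_def by (intro norm_triangle_le) simp
  qed
  define \<Phi> where "\<Phi> v = volterra_path (h v)" for v
  have \<Phi>_mem: "\<Phi> ` K \<subseteq> K"
  proof
    fix x assume "x \<in> \<Phi> ` K"
    then obtain v where "v \<in> K" "x = volterra_path (h v)" unfolding \<Phi>_def by blast
    then have "x \<in> {volterra_path h |h. dominated h m0}" using h_dom by blast
    then show "x \<in> K" unfolding K_def by (rule subsetD[OF closure_subset])
  qed
  have \<Phi>_cont: "continuous_on K \<Phi>"
    unfolding continuous_on_iff
  proof (intro ballI allI impI)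
    fix v e assume v: "v \<in> K" and e: "(0::real) < e"
    then have "e / 2 > 0" by simp
    from volterra_mean_continuous[OF m0_adm this] obtain d where d: "d > 0"
      "\<And>h h' t. dominated h m0 \<Longrightarrow> dominated h' m0 \<Longrightarrow> (LINT s|M. norm (h s - h' s)) \<le> d \<Longrightarrow> t \<in> {a..b} \<Longrightarrow>
        norm (volterra h t - volterra h' t) \<le> e / 2" by blast
    have d2: "d / 2 > 0" using d(1) by simp
    obtain d1 where d1: "d1 > 0" "\<And>v'. v' \<in> K \<Longrightarrow> dist v v' < d1 \<Longrightarrow> (LINT t|M. norm (g v t - g v' t)) \<le> d / 2"
      using g_cont[OF v d2] by blast
    define R where "R v' = (\<Sum>c\<in>N. \<bar>w v c - w v' c\<bar> * (LINT s|M. norm (B (U c s))))" for v'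
    have "continuous_on K R" unfolding R_def by (intro continuous_intros w_cont)
    moreover have "R v = 0" by (simp add: R_def)
    ultimately obtain d3 where d3: "d3 > 0" "\<And>v'. v' \<in> K \<Longrightarrow> dist v' v < d3 \<Longrightarrow> dist (R v') 0 < d / 2"
      using v d2 unfolding continuous_on_iff by metis
    have "dist (\<Phi> v') (\<Phi> v) < e" if v': "v' \<in> K" "dist v' v < min d1 d3" for v'
    proof -
      have "(LINT s|M. norm (h v s - h v' s)) \<le>
          (LINT s|M. norm (g v s - g v' s) + (\<Sum>c\<in>N. \<bar>w v c - w v' c\<bar> * norm (B (U c s))))"
      proof (rule integral_mono)
        show "integrable M (\<lambda>s. norm (h v s - h v' s))"
          using dominated_integrable[OF h_dom[OF v] m0_adm] dominated_integrable[OF h_dom[OF v'(1)] m0_adm] by auto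
        show "integrable M (\<lambda>s. norm (g v s - g v' s) + (\<Sum>c\<in>N. \<bar>w v c - w v' c\<bar> * norm (B (U c s))))"
          using g_int[OF v] g_int[OF v'(1)] BU_int by auto
        fix s
        have "B (u v s) - B (u v' s) = (\<Sum>c\<in>N. (w v c - w v' c) *\<^sub>R B (U c s))"
          unfolding Bu by (simp add: scaleR_left_diff_distrib sum_subtractf)
        then have "norm (B (u v s) - B (u v' s)) \<le> (\<Sum>c\<in>N. \<bar>w v c - w v' c\<bar> * norm (B (U c s)))"
          by (auto intro!: sum_norm_le)
        then show "norm (h v s - h v' s) \<le> norm (g v s - g v' s) + (\<Sum>c\<in>N. \<bar>w v c - w v' c\<bar> * norm (B (U c s)))"
          using norm_triangle_ineq[of "g v s - g v' s" "B (u v s) - B (u v' s)"] by (simp add: h_def algebra_simps)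
      qed
      also have "\<dots> = (LINT s|M. norm (g v s - g v' s)) + R v'"
        unfolding R_def using g_int[OF v] g_int[OF v'(1)] BU_int
        by (subst Bochner_Integration.integral_add) (auto simp: Bochner_Integration.integral_sum)
      also have "\<dots> \<le> d / 2 + d / 2"
        using d1(2)[OF v'(1)] d3(2)[OF v'(1)] v'(2) by (intro add_mono) (auto simp: dist_commute dist_real_def)
      finally have close: "(LINT s|M. norm (h v s - h v' s)) \<le> d" by simp
      have "dist (\<Phi> v') (\<Phi> v) \<le> e / 2"
      proof (rule dist_bound)
        fix t
        have "max a (min b t) \<in> {a..b}" using ab by auto
        from d(2)[OF h_dom[OF v] h_dom[OF v'(1)] close this]
        show "dist (apply_bcontfun (\<Phi> v') t) (apply_bcontfun (\<Phi> v) t) \<le> e / 2"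
          unfolding \<Phi>_def volterra_path_apply[OF h_dom[OF v] m0_adm] volterra_path_apply[OF h_dom[OF v'(1)] m0_adm]
          by (simp add: dist_norm norm_minus_commute)
      qed
      then show ?thesis using e by simp
    qed
    then show "\<exists>d>0. \<forall>v'\<in>K. dist v' v < d \<longrightarrow> dist (\<Phi> v') (\<Phi> v) < e"
      using d1(1) d3(1) by (intro exI[of _ "min d1 d3"]) auto
  qed
  obtain v where v: "v \<in> K" and fixed: "\<Phi> v = v"
    by (rule Schauder_fixed_point[OF K \<Phi>_cont \<Phi>_mem])
  have v_eq: "apply_bcontfun v t = volterra (h v) t" if "t \<in> {a..b}" for t
  proof -
    have "max a (min b t) = t" using that by auto
    then show ?thesis using volterra_path_apply[OF h_dom[OF v] m0_adm, of t] fixed by (simp add: \<Phi>_def)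
  qed
  have sol: "inclusion_mild_solution \<psi> \<psi>' a b \<alpha> \<beta> T B x0 F (u v) (q v)"
    unfolding inclusion_mild_solution_def
  proof (intro exI conjI)
    show "bochner_integrable M (g v)" unfolding bochner_integral_eq_library by (rule g_int[OF v])
    show "AE t in M. g v t \<in> F t (q v t)" by (rule g_sel[OF v])
    have d: "dominated (\<lambda>s. g v s + B (u v s)) m0" using h_dom[OF v] unfolding h_def .
    have "continuous_on {a..b} (apply_bcontfun v)" using apply_bcontfun[of v] by (auto simp: bcontfun_def intro: continuous_on_subset)
    then have "q v \<in> weighted_C \<psi> weight a b" unfolding q_def by (rule weighted_C_add_continuous[OF free])
    moreover have "\<forall>t\<in>{a<..b}. q v t = free_part t + volterra (\<lambda>s. g v s + B (u v s)) t"
      using v_eq unfolding q_def h_def by auto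
    ultimately show "mild_with_source \<psi> \<psi>' a b \<alpha> \<beta> T B x0 (g v) (u v) (q v)"
      unfolding mild_with_source_iff[OF d m0_adm] by blast
  qed
  have "volterra (h v) b = volterra (g v) b + volterra (\<lambda>s. B (u v s)) b"
    unfolding h_def by (rule volterra_add[OF g_dom[OF v] m_adm control_dominated[OF u_L2] b_mem(2)])
  also have "volterra (\<lambda>s. B (u v s)) b = (\<Sum>c\<in>N. w v c *\<^sub>R volterra (\<lambda>s. B (U c s)) b)"
    unfolding u_def by (rule volterra_control_sum[OF N U b_mem(2)])
  finally have "q v b - x1 = (\<Sum>c\<in>N. p c (y v) *\<^sub>R volterra (\<lambda>s. B (U c s)) b) - y v"
    using v_eq[OF b_mem(2)] by (simp add: q_def y_def shift_def w_def)
  then have "norm (q v b - x1) \<le> \<epsilon> / 2" using steer[OF y_mem[OF v]] by simp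
  then have "norm (q v b - x1) < \<epsilon>" using \<epsilon> by linarith
  then show "\<exists>u\<in>L2_functions a b. \<exists>q. inclusion_mild_solution \<psi> \<psi>' a b \<alpha> \<beta> T B x0 F u q \<and> norm (q b - x1) < \<epsilon>"
    using u_L2 sol by blast
qed

end

section \<open>Reduction to a second countable type\<close>

definition separable_space :: "'a::metric_space itself \<Rightarrow> bool" where
  "separable_space _ \<longleftrightarrow> (\<exists>D :: 'a set. countable D \<and> closure D = UNIV)"

text \<open>Each \<open>x\<close> is the limit of \<open>T t x\<close> as \<open>t \<rightarrow> 0\<close>, and \<open>T t\<close> maps balls into totally bounded sets. Countably many
  times, radii and precisions suffice.\<close>

lemma compact_semigroup_separable:
  fixes T :: "real \<Rightarrow> 'a::banach \<Rightarrow>\<^sub>L 'a"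
  assumes T: "C0_semigroup T" and compact: "\<And>t. t > 0 \<Longrightarrow> compact_operator (T t)"
  shows "separable_space TYPE('a)"
proof -
  let ?e = "\<lambda>n. inverse (real (Suc n))"
  have "\<exists>N. finite N \<and> T (?e n) ` cball 0 (real n) \<subseteq> (\<Union>y\<in>N. ball y (?e j))" for n j
  proof -
    have "compact (closure (T (?e n) ` cball 0 (real n)))"
      using compact[of "?e n"] unfolding compact_operator_def by auto
    then show ?thesis unfolding precompact_iff_totally_bounded by auto
  qed
  then obtain N where N: "\<And>n j. finite (N n j)" "\<And>n j. T (?e n) ` cball 0 (real n) \<subseteq> (\<Union>y\<in>N n j. ball y (?e j))"
    by metis
  let ?D = "\<Union>n j. N n j"
  have "countable ?D" by (intro countable_UN countable_finite N(1) countableI_type)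
  moreover have "x \<in> closure ?D" for x
    unfolding closure_approachable
  proof (intro allI impI)
    fix e :: real assume e: "e > 0"
    then have "e / 2 > 0" by simp
    from semigroup_near_zero[OF T this, of x] obtain d where d: "d > 0" "\<And>t. 0 \<le> t \<Longrightarrow> t < d \<Longrightarrow> norm (T t x - x) < e / 2"
      by blast
    obtain n0 where n0: "?e n0 < d" using reals_Archimedean[OF d(1)] by blast
    obtain n1 where n1: "norm x \<le> real n1" using real_arch_simple by blast
    obtain j where j: "?e j < e / 2" using reals_Archimedean[of "e / 2"] e by auto
    define n where "n = max n0 n1"
    have "?e n \<le> ?e n0" by (simp add: n_def le_imp_inverse_le)
    then have "?e n < d" using n0 by linarith
    moreover have "0 \<le> ?e n" by simp
    ultimately have 1: "norm (T (?e n) x - x) < e / 2" by (intro d(2))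
    have "x \<in> cball 0 (real n)" using n1 by (simp add: n_def)
    then obtain y where y: "y \<in> N n j" "dist y (T (?e n) x) < ?e j" using N(2)[of n j] by fastforce
    have "dist y x \<le> dist y (T (?e n) x) + dist (T (?e n) x) x" by (rule dist_triangle)
    also have "\<dots> < e" using 1 y(2) j by (simp add: dist_norm)
    finally show "\<exists>y\<in>?D. dist y x < e" using y(1) by blast
  qed
  ultimately show ?thesis unfolding separable_space_def by blast
qed

text \<open>Second countability of a type is a matter of type classes and cannot be derived for \<open>'a\<close> itself inside a
  proof. This copy collapses to a point if \<open>'a\<close> is not separable, so it is second countable
  unconditionally and an instance can be declared; if \<open>'a\<close> is separable it is all of \<open>'a\<close>.\<close>

typedef (overloaded) 'a separable_copy =
  "{x :: 'a::banach. separable_space TYPE('a) \<or> x = 0}"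
  morphisms of_copy to_copy
  by auto

setup_lifting type_definition_separable_copy

instantiation separable_copy :: (banach) real_normed_vector
begin

lift_definition zero_separable_copy :: "'a separable_copy" is 0 by simp
lift_definition plus_separable_copy :: "'a separable_copy \<Rightarrow> 'a separable_copy \<Rightarrow> 'a separable_copy" is "(+)" by auto
lift_definition minus_separable_copy :: "'a separable_copy \<Rightarrow> 'a separable_copy \<Rightarrow> 'a separable_copy" is "(-)" by auto
lift_definition uminus_separable_copy :: "'a separable_copy \<Rightarrow> 'a separable_copy" is uminus by auto
lift_definition scaleR_separable_copy :: "real \<Rightarrow> 'a separable_copy \<Rightarrow> 'a separable_copy" is scaleR by auto
lift_definition norm_separable_copy :: "'a separable_copy \<Rightarrow> real" is norm .
definition dist_separable_copy :: "'a separable_copy \<Rightarrow> 'a separable_copy \<Rightarrow> real" where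
  "dist_separable_copy x y = norm (x - y)"
lift_definition sgn_separable_copy :: "'a separable_copy \<Rightarrow> 'a separable_copy" is sgn by auto
definition uniformity_separable_copy :: "('a separable_copy \<times> 'a separable_copy) filter" where
  "uniformity_separable_copy = (INF e\<in>{0 <..}. principal {(x, y). dist x y < e})"
definition open_separable_copy :: "'a separable_copy set \<Rightarrow> bool" where
  "open_separable_copy U \<longleftrightarrow> (\<forall>x\<in>U. \<forall>\<^sub>F (x', y) in uniformity. x' = x \<longrightarrow> y \<in> U)"

instance
proof
  fix x y z :: "'a separable_copy" and a b :: real and U :: "'a separable_copy set"
  show "x + y + z = x + (y + z)" by transfer (rule add.assoc)
  show "x + y = y + x" by transfer (rule add.commute)
  show "0 + x = x" by transfer simp
  show "- x + x = 0" by transfer simp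
  show "x - y = x + - y" by transfer simp
  show "a *\<^sub>R (x + y) = a *\<^sub>R x + a *\<^sub>R y" by transfer (rule scaleR_add_right)
  show "(a + b) *\<^sub>R x = a *\<^sub>R x + b *\<^sub>R x" by transfer (rule scaleR_add_left)
  show "a *\<^sub>R b *\<^sub>R x = (a * b) *\<^sub>R x" by transfer simp
  show "1 *\<^sub>R x = x" by transfer simp
  show "dist x y = norm (x - y)" by (rule dist_separable_copy_def)
  show "sgn x = inverse (norm x) *\<^sub>R x" by transfer (rule sgn_div_norm)
  show "uniformity = (INF e\<in>{0 <..}. principal {(x :: 'a separable_copy, y). dist x y < e})"
    by (rule uniformity_separable_copy_def)
  show "open U = (\<forall>x\<in>U. \<forall>\<^sub>F (x', y) in uniformity. x' = x \<longrightarrow> y \<in> U)" by (rule open_separable_copy_def)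
  show "(norm x = 0) = (x = 0)" by transfer simp
  show "norm (x + y) \<le> norm x + norm y" by transfer (rule norm_triangle_ineq)
  show "norm (a *\<^sub>R x) = \<bar>a\<bar> * norm x" by transfer simp
qed

end

lemma norm_of_copy [simp]: "norm (of_copy x) = norm x"
  by transfer simp

lemma bounded_linear_of_copy: "bounded_linear of_copy"
  by (rule bounded_linear_intro[of _ 1]) (simp_all add: plus_separable_copy.rep_eq scaleR_separable_copy.rep_eq)

lemma dist_of_copy: "dist (of_copy x) (of_copy y) = dist x y"
  by (simp add: dist_norm minus_separable_copy.rep_eq[symmetric])

instance separable_copy :: (banach) banach
proof
  fix X :: "nat \<Rightarrow> 'a separable_copy"
  assume "Cauchy X"
  then have "Cauchy (\<lambda>n. of_copy (X n))" by (simp add: Cauchy_def dist_of_copy)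
  then obtain l where l: "(\<lambda>n. of_copy (X n)) \<longlonglongrightarrow> l" using Cauchy_convergent convergent_def by blast
  have "l \<in> {x. separable_space TYPE('a) \<or> x = 0}"
  proof (cases "separable_space TYPE('a)")
    case False
    then have "of_copy (X n) = 0" for n using of_copy[of "X n"] by simp
    then show ?thesis using l LIMSEQ_unique[OF l, of 0] by simp
  qed simp
  then obtain y where "l = of_copy y" using of_copy_cases by blast
  then have "X \<longlonglongrightarrow> y" using l by (simp add: lim_sequentially dist_of_copy)
  then show "convergent X" by (auto simp: convergent_def)
qed

instance separable_copy :: (banach) second_countable_topology
proof
  have "\<exists>D :: 'a separable_copy set. countable D \<and> (\<forall>x. \<forall>e>0. \<exists>d\<in>D. dist d x < e)"
  proof (cases "separable_space TYPE('a)")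
    case True
    then obtain D :: "'a set" where D: "countable D" "closure D = UNIV" unfolding separable_space_def by blast
    have r: "of_copy (to_copy d) = d" for d :: 'a using True by (intro to_copy_inverse) simp
    have "\<exists>d\<in>to_copy ` D. dist d x < e" if e: "e > 0" for e and x :: "'a separable_copy"
    proof -
      have "of_copy x \<in> closure D" using D(2) by simp
      then obtain d where "d \<in> D" "dist d (of_copy x) < e" using e unfolding closure_approachable by blast
      then show ?thesis using dist_of_copy[of "to_copy d" x] r by auto
    qed
    then show ?thesis using D(1) by (intro exI[of _ "to_copy ` D"]) auto
  next
    case False
    then have "x = 0" for x :: "'a separable_copy" using of_copy[of x] by transfer simp
    then have "dist 0 x < e" if "e > 0" for e and x :: "'a separable_copy" using that by (metis dist_self)
    then show ?thesis by (intro exI[of _ "{0}"]) auto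
  qed
  then obtain D :: "'a separable_copy set" where D: "countable D" "\<And>x e. e > 0 \<Longrightarrow> \<exists>d\<in>D. dist d x < e" by blast
  let ?B = "(\<lambda>(d, n). ball d (inverse (real (Suc n)))) ` (D \<times> UNIV)"
  have "topological_basis ?B"
  proof (rule topological_basisI)
    fix U :: "'a separable_copy set" and x assume U: "open U" "x \<in> U"
    then obtain e where e: "e > 0" "ball x e \<subseteq> U" unfolding open_contains_ball by blast
    obtain n where n: "inverse (real (Suc n)) < e / 2" using reals_Archimedean[of "e / 2"] e by auto
    obtain d where d: "d \<in> D" "dist d x < inverse (real (Suc n))" using D(2)[of "inverse (real (Suc n))" x] by auto
    have "ball d (inverse (real (Suc n))) \<subseteq> ball x e"
    proof
      fix y assume "y \<in> ball d (inverse (real (Suc n)))"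
      then have "dist d y < inverse (real (Suc n))" by simp
      then show "y \<in> ball x e" using dist_triangle3[of x y d] d(2) n by simp
    qed
    then show "\<exists>B'\<in>?B. x \<in> B' \<and> B' \<subseteq> U" using d e(2) by (intro bexI[of _ "ball d (inverse (real (Suc n)))"]) auto
  qed auto
  then have "open = generate_topology ?B" by (rule topological_basis_imp_subbasis)
  moreover have "countable ?B" using D(1) by auto
  ultimately show "\<exists>B :: 'a separable_copy set set. countable B \<and> open = generate_topology B" by blast
qed

text \<open>An isometry carries approximation by simple functions along, without separability of the target.\<close>

lemma has_bochner_isometry:
  fixes J :: "'a::real_normed_vector \<Rightarrow> 'b::real_normed_vector"
  assumes J: "bounded_linear J" and iso: "\<And>x. norm (J x) = norm x" and f: "has_bochner N f x"
  shows "has_bochner N (\<lambda>w. J (f w)) (J x)"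
proof -
  interpret J: bounded_linear J by (rule J)
  obtain s where m: "f \<in> borel_measurable N" and s: "\<And>i. Bochner_Integration.simple_bochner_integrable N (s i)"
    and 1: "(\<lambda>i. \<integral>\<^sup>+ w. ennreal (norm (f w - s i w)) \<partial>N) \<longlonglongrightarrow> 0"
    and 2: "(\<lambda>i. Bochner_Integration.simple_bochner_integral N (s i)) \<longlonglongrightarrow> x"
    using f unfolding has_bochner_def by blast
  have "(\<lambda>w. J (f w)) \<in> borel_measurable N"
    by (rule measurable_compose[OF m borel_measurable_continuous_onI]) (rule J.continuous_on[OF continuous_on_id])
  moreover have "Bochner_Integration.simple_bochner_integrable N (\<lambda>w. J (s i w))" for i
    by (rule simple_bochner_integrable_compose2[OF _ s s, of "\<lambda>x _. J x"]) (rule J.zero)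
  moreover have "(\<lambda>i. \<integral>\<^sup>+ w. ennreal (norm (J (f w) - J (s i w))) \<partial>N) \<longlonglongrightarrow> 0"
    using 1 by (simp add: iso flip: J.diff)
  moreover have "(\<lambda>i. Bochner_Integration.simple_bochner_integral N (\<lambda>w. J (s i w))) \<longlonglongrightarrow> J x"
    using J.tendsto[OF 2] by (simp add: simple_bochner_integral_linear[OF J.linear s])
  ultimately show ?thesis unfolding has_bochner_def by (intro conjI exI[of _ "\<lambda>i w. J (s i w)"]) auto
qed

lemma bochner_isometric_isomorphism:
  fixes J :: "'a::real_normed_vector \<Rightarrow> 'b::real_normed_vector"
  assumes J: "bounded_linear J" "\<And>x. norm (J x) = norm x"
    and I: "bounded_linear I" "\<And>y. norm (I y) = norm y" and inv: "\<And>x. I (J x) = x" "\<And>y. J (I y) = y"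
  shows "bochner_integrable N (\<lambda>w. J (f w)) \<longleftrightarrow> bochner_integrable N f"
    and "bochner_integral N (\<lambda>w. J (f w)) = J (bochner_integral N f)"
proof -
  have iff: "has_bochner N (\<lambda>w. J (f w)) (J x) \<longleftrightarrow> has_bochner N f x" for x
    using has_bochner_isometry[OF J, of N f x] has_bochner_isometry[OF I, of N "\<lambda>w. J (f w)" "J x"] by (auto simp: inv)
  show 1: "bochner_integrable N (\<lambda>w. J (f w)) \<longleftrightarrow> bochner_integrable N f"
    unfolding bochner_integrable_def using iff inv by metis
  show "bochner_integral N (\<lambda>w. J (f w)) = J (bochner_integral N f)"
  proof (cases "bochner_integrable N f")
    case True
    then obtain x where x: "has_bochner N f x" unfolding bochner_integrable_def by blast
    then have "has_bochner N (\<lambda>w. J (f w)) (J x)" using iff by simp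
    then show ?thesis using bochner_integral_eqI[OF x] bochner_integral_eqI by metis
  next
    case False
    interpret J: bounded_linear J by (rule J)
    show ?thesis using False 1 by (simp add: bochner_integral_def J.zero)
  qed
qed

lemma weighted_C_bounded_linear:
  assumes "bounded_linear J" and q: "q \<in> weighted_C \<psi> \<mu> a b"
  shows "(\<lambda>t. J (q t)) \<in> weighted_C \<psi> \<mu> a b"
proof -
  interpret J: bounded_linear J by fact
  obtain l where l: "((\<lambda>t. (\<psi> t - \<psi> a) powr \<mu> *\<^sub>R q t) \<longlongrightarrow> l) (at_right a)" and c: "continuous_on {a<..b} q"
    using q unfolding weighted_C_def by blast
  show ?thesis
    unfolding weighted_C_def using J.continuous_on[OF c] J.tendsto[OF l] by (auto simp: J.scaleR)
qed

text \<open>All notions in the control problem are invariant under isometric isomorphisms; \<open>J\<close> will be the map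
  onto the separable copy and \<open>I\<close> its inverse.\<close>

locale isometric_isomorphism =
  fixes J :: "'a::banach \<Rightarrow> 'b::banach" and I :: "'b \<Rightarrow> 'a"
  assumes J: "bounded_linear J" "\<And>x. norm (J x) = norm x"
    and I: "bounded_linear I" "\<And>y. norm (I y) = norm y" and IJ: "\<And>x. I (J x) = x" and JI: "\<And>y. J (I y) = y"
begin

sublocale J: bounded_linear J by (rule J)
sublocale I: bounded_linear I by (rule I)

lemmas bochner_J = bochner_isometric_isomorphism[OF J I IJ JI]

definition conj_op :: "('a \<Rightarrow>\<^sub>L 'a) \<Rightarrow> ('b \<Rightarrow>\<^sub>L 'b)" where
  "conj_op L = Blinfun J o\<^sub>L L o\<^sub>L Blinfun I"

lemma conj_op_apply [simp]: "blinfun_apply (conj_op L) y = J (L (I y))"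
  by (simp add: conj_op_def bounded_linear_Blinfun_apply J I)

lemma image_J: "J ` S = I -` S"
  using IJ JI by (auto simp: image_iff) (metis)

lemma conj_C0_semigroup:
  assumes "C0_semigroup T"
  shows "C0_semigroup (\<lambda>t. conj_op (T t))"
  unfolding C0_semigroup_def
proof (intro conjI allI impI)
  have T: "T 0 = id_blinfun" "\<And>s t. 0 \<le> s \<Longrightarrow> 0 \<le> t \<Longrightarrow> T (s + t) = T s o\<^sub>L T t"
    "\<And>x. ((\<lambda>t. blinfun_apply (T t) x) \<longlongrightarrow> x) (at_right 0)"
    using assms unfolding C0_semigroup_def by auto
  show "conj_op (T 0) = id_blinfun" by (rule blinfun_eqI) (simp add: T JI)
  show "conj_op (T (s + t)) = conj_op (T s) o\<^sub>L conj_op (T t)" if "0 \<le> s" "0 \<le> t" for s t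
    by (rule blinfun_eqI) (simp add: T that IJ)
  show "((\<lambda>t. blinfun_apply (conj_op (T t)) x) \<longlongrightarrow> x) (at_right 0)" for x
    using J.tendsto[OF T(3), of "I x"] by (simp add: JI)
qed

lemma conj_compact_operator:
  assumes L: "compact_operator L"
  shows "compact_operator (conj_op L)"
  unfolding compact_operator_def
proof (intro allI impI)
  fix S :: "'b set" assume "bounded S"
  then have "bounded (I ` S)" by (rule bounded_linear_image) (rule I)
  then have "compact (closure (L ` I ` S))" using L unfolding compact_operator_def by blast
  then have c: "compact (J ` closure (L ` I ` S))"
    by (intro compact_continuous_image J.continuous_on continuous_on_id)
  show "compact (closure (conj_op L ` S))"
  proof (rule precompact_subset)
    show "compact (closure (J ` closure (L ` I ` S)))" using c by (simp add: compact_imp_closed closure_closed)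
    show "conj_op L ` S \<subseteq> J ` closure (L ` I ` S)" using closure_subset[of "L ` I ` S"] by auto
  qed
qed

lemma conj_P_op: "P_op (\<lambda>t. conj_op (T t)) \<alpha> t (J x) = J (P_op T \<alpha> t x)"
  unfolding P_op_def by (simp add: IJ J.scaleR[symmetric] bochner_J(2))

lemma conj_K_op: "K_op (\<lambda>t. conj_op (T t)) \<alpha> t (J x) = J (K_op T \<alpha> t x)"
  unfolding K_op_def by (simp add: conj_P_op J.scaleR)

lemma conj_S_op: "S_op (\<lambda>t. conj_op (T t)) \<alpha> \<beta> t (J x) = J (S_op T \<alpha> \<beta> t x)"
  unfolding S_op_def by (simp add: Let_def conj_K_op J.scaleR bochner_J(2) flip: J.scaleR)

lemma conj_mild_with_source:
  "mild_with_source \<psi> \<psi>' a b \<alpha> \<beta> (\<lambda>t. conj_op (T t)) (Blinfun J o\<^sub>L B) (J x0) (\<lambda>t. J (f t)) u (\<lambda>t. J (q t)) \<longleftrightarrow>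
   mild_with_source \<psi> \<psi>' a b \<alpha> \<beta> T B x0 f u q"
proof -
  have w: "(\<lambda>t. J (q t)) \<in> weighted_C \<psi> \<mu> a b \<longleftrightarrow> q \<in> weighted_C \<psi> \<mu> a b" for \<mu>
    using weighted_C_bounded_linear[OF J(1), of q \<psi> \<mu> a b] weighted_C_bounded_linear[OF I(1), of "\<lambda>t. J (q t)" \<psi> \<mu> a b]
    by (auto simp: IJ)
  have e: "\<psi>' s *\<^sub>R K_op (\<lambda>t. conj_op (T t)) \<alpha> \<tau> (J (f s) + blinfun_apply (Blinfun J o\<^sub>L B) (u s)) =
      J (\<psi>' s *\<^sub>R K_op T \<alpha> \<tau> (f s + B (u s)))" for s \<tau>
    by (simp add: bounded_linear_Blinfun_apply J conj_K_op J.scaleR flip: J.add)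
  have inj: "J x = J y \<longleftrightarrow> x = y" for x y using IJ by metis
  show ?thesis
    unfolding mild_with_source_def w e bochner_J conj_S_op J.add[symmetric] inj ..
qed

lemma graph_measurable_conj:
  assumes F: "graph_measurable a b F"
  shows "graph_measurable a b (\<lambda>t y. J ` F t (I y))"
  unfolding graph_measurable_def
proof -
  let ?M = "lebesgue_on {a..b}"
  let ?G = "{(t, x, z). t \<in> {a..b} \<and> z \<in> F t x}"
  let ?f = "\<lambda>p :: real \<times> 'b \<times> 'b. (fst p, I (fst (snd p)), I (snd (snd p)))"
  have "(\<lambda>p. (I (fst p), I (snd p))) \<in> borel_measurable (borel :: ('b \<times> 'b) measure)"
    by (intro borel_measurable_continuous_onI continuous_intros I.continuous_on)
  then have "?f \<in> measurable (?M \<Otimes>\<^sub>M borel) (?M \<Otimes>\<^sub>M borel)"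
    by (intro measurable_Pair measurable_fst) (rule measurable_compose[OF measurable_snd])
  then have "?f -` ?G \<inter> space (?M \<Otimes>\<^sub>M borel) \<in> sets (?M \<Otimes>\<^sub>M (borel :: ('b \<times> 'b) measure))"
    by (rule measurable_sets) (use F in \<open>simp add: graph_measurable_def\<close>)
  also have "?f -` ?G \<inter> space (?M \<Otimes>\<^sub>M borel) = {(t, x, z). t \<in> {a..b} \<and> z \<in> J ` F t (I x)}"
    by (auto simp: space_pair_measure image_J)
  finally show "{(t, x, z). t \<in> {a..b} \<and> z \<in> J ` F t (I x)} \<in> sets (?M \<Otimes>\<^sub>M borel)" .
qed

lemma lower_semicontinuous_conj:
  assumes G: "lower_semicontinuous G"
  shows "lower_semicontinuous (\<lambda>y. J ` G (I y))"
  unfolding lower_semicontinuous_def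
proof (intro allI impI)
  fix V :: "'b set" assume "open V"
  then have "open (J -` V)" by (intro open_vimage J.continuous_on continuous_on_id)
  then have "open {x. G x \<inter> J -` V \<noteq> {}}" using G unfolding lower_semicontinuous_def by blast
  then have "open (I -` {x. G x \<inter> J -` V \<noteq> {}})" by (intro open_vimage I.continuous_on continuous_on_id)
  also have "I -` {x. G x \<inter> J -` V \<noteq> {}} = {y. J ` G (I y) \<inter> V \<noteq> {}}" by auto
  finally show "open {y. J ` G (I y) \<inter> V \<noteq> {}}" .
qed

end

section \<open>Approximate controllability of the inclusion\<close>

theorem theorem5p1:
  fixes a b \<alpha> \<beta> \<gamma> r :: real
    and \<psi> \<psi>' m :: "real \<Rightarrow> real"
    and D :: "'a::banach set"
    and A :: "'a \<Rightarrow> 'a"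
    and T :: "real \<Rightarrow> 'a \<Rightarrow>\<^sub>L 'a"
    and B :: "'y::{real_inner, polish_space} \<Rightarrow>\<^sub>L 'a"
    and x0 :: 'a
    and F :: "real \<Rightarrow> 'a \<Rightarrow> 'a set"
  assumes "a < b"
    and "1 / 2 < \<alpha>" "\<alpha> \<le> 1" "0 \<le> \<beta>" "\<beta> \<le> 1"
    and gamma: "\<gamma> = hilfer_gamma \<alpha> \<beta>"
    and psi_deriv: "\<And>t. t \<in> {a..b} \<Longrightarrow> (\<psi> has_real_derivative \<psi>' t) (at t within {a..b})"
    and psi_C1: "continuous_on {a..b} \<psi>'"
    and psi_mono: "mono_on {a..b} \<psi>"
    and psi_nz: "\<And>t. t \<in> {a..b} \<Longrightarrow> \<psi>' t \<noteq> 0"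
    and reflexive: "reflexive_space TYPE('a)"
    and A: "closed_linear_operator D A"
    and T_semigroup: "C0_semigroup T"
    and T_generator: "generates D A T"
    and T_compact: "\<And>t. t > 0 \<Longrightarrow> compact_operator (T t)"
    and C: "approximately_controllable a b (linear_mild_solution \<psi> \<psi>' a b \<alpha> \<beta> T B x0)"
    and F_nonempty: "\<And>t x. t \<in> {a..b} \<Longrightarrow> F t x \<noteq> {}"
    and F1: "graph_measurable a b F"
    and F2: "\<And>t x. t \<in> {a..b} \<Longrightarrow> closed (F t x) \<and> convex (F t x)"
    and F3: "\<And>t. t \<in> {a..b} \<Longrightarrow> lower_semicontinuous (F t)"
    and r: "0 < r" "r < \<alpha>"
    and m_nonneg: "\<And>t. t \<in> {a..b} \<Longrightarrow> 0 \<le> m t"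
    and m_measurable: "m \<in> borel_measurable (lebesgue_on {a..b})"
    and m_Lp: "integrable (lebesgue_on {a..b}) (\<lambda>t. m t powr (1 / r))"
    and m_cont: "continuous_on {a<..b} (psi_integral \<psi> \<psi>' a \<alpha> m)"
    and m_integral_nonneg: "\<And>t. t \<in> {a<..b} \<Longrightarrow> 0 \<le> psi_integral \<psi> \<psi>' a \<alpha> m t"
    and m_lim: "((\<lambda>t. (\<psi> t - \<psi> a) powr (1 - \<gamma>) * psi_integral \<psi> \<psi>' a \<alpha> m t) \<longlongrightarrow> 0)
                  (at_right a)"
    and F4: "\<And>t x. t \<in> {a..b} \<Longrightarrow> (SUP z\<in>F t x. ereal (norm z)) \<le> ereal (m t)"
  shows "approximately_controllable a b (inclusion_mild_solution \<psi> \<psi>' a b \<alpha> \<beta> T B x0 F)"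
proof -
  have sep: "separable_space TYPE('a)"
    by (rule compact_semigroup_separable[OF T_semigroup T_compact])
  have of_to: "of_copy (to_copy x) = x" for x :: 'a
    using sep by (intro to_copy_inverse) simp
  have norm_to: "norm (to_copy x) = norm x" for x :: 'a
    using norm_of_copy[of "to_copy x"] by (simp add: of_to)
  have inj: "of_copy x = of_copy y \<longleftrightarrow> x = y" for x y :: "'a separable_copy"
    by (rule of_copy_inject)
  have bl: "bounded_linear (to_copy :: 'a \<Rightarrow> 'a separable_copy)"
  proof (rule bounded_linear_intro[of _ 1])
    show "to_copy (x + y) = to_copy x + to_copy y" for x y :: 'a
      unfolding inj[symmetric] by (simp add: plus_separable_copy.rep_eq of_to)
    show "to_copy (c *\<^sub>R x) = c *\<^sub>R to_copy x" for c and x :: 'a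
      unfolding inj[symmetric] by (simp add: scaleR_separable_copy.rep_eq of_to)
  qed (simp add: norm_to)
  interpret iso: isometric_isomorphism "to_copy :: 'a \<Rightarrow> 'a separable_copy" of_copy
    by (intro isometric_isomorphism.intro bl norm_to bounded_linear_of_copy norm_of_copy of_to of_copy_inverse)
  let ?T = "\<lambda>t. iso.conj_op (T t)" and ?B = "Blinfun to_copy o\<^sub>L B" and ?F = "\<lambda>t y. to_copy ` F t (of_copy y)"
  interpret S: fractional_system a b \<alpha> \<beta> \<psi> \<psi>' ?T ?B "to_copy x0"
    by (intro fractional_system.intro assms iso.conj_C0_semigroup iso.conj_compact_operator)
  have F4': "norm z \<le> m t" if "t \<in> {a..b}" "z \<in> F t x" for t x z
  proof -
    have "ereal (norm z) \<le> (SUP z\<in>F t x. ereal (norm z))" by (rule SUP_upper[OF that(2)])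
    then show ?thesis using F4[OF that(1), of x] by (metis ereal_less_eq(3) order_trans)
  qed
  have main: "approximately_controllable a b (inclusion_mild_solution \<psi> \<psi>' a b \<alpha> \<beta> ?T ?B (to_copy x0) ?F)"
  proof (rule S.inclusion_approximately_controllable[OF _ _ _ _ _ r m_nonneg m_measurable m_Lp])
    show "approximately_controllable a b (linear_mild_solution \<psi> \<psi>' a b \<alpha> \<beta> ?T ?B (to_copy x0))"
      unfolding approximately_controllable_def
    proof (intro allI impI)
      fix y :: "'a separable_copy" and e :: real assume "e > 0"
      then obtain u q where u: "u \<in> L2_functions a b" and q: "linear_mild_solution \<psi> \<psi>' a b \<alpha> \<beta> T B x0 u q"
        and n: "norm (q b - of_copy y) < e"
        using C unfolding approximately_controllable_def by blast
      have "linear_mild_solution \<psi> \<psi>' a b \<alpha> \<beta> ?T ?B (to_copy x0) u (\<lambda>t. to_copy (q t))"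
        using q iso.conj_mild_with_source[of \<psi> \<psi>' a b \<alpha> \<beta> T B x0 "\<lambda>_. 0" u q]
        unfolding linear_mild_solution_def by (simp add: iso.J.zero)
      moreover have "norm (to_copy (q b) - y) = norm (q b - of_copy y)"
        by (metis iso.J.diff of_copy_inverse norm_to)
      ultimately show "\<exists>u\<in>L2_functions a b. \<exists>q. linear_mild_solution \<psi> \<psi>' a b \<alpha> \<beta> ?T ?B (to_copy x0) u q \<and> norm (q b - y) < e"
        using u n by (intro bexI[of _ u] exI[of _ "\<lambda>t. to_copy (q t)"]) auto
    qed
    show "graph_measurable a b ?F" by (rule iso.graph_measurable_conj[OF F1])
    fix t :: real and y z :: "'a separable_copy" assume t: "t \<in> {a..b}"
    show "?F t y \<noteq> {}" using F_nonempty[OF t] by simp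
    have "closed (of_copy -` F t (of_copy y))"
      using F2[OF t] by (intro closed_vimage iso.I.continuous_on continuous_on_id) auto
    moreover have "convex (to_copy ` F t (of_copy y))"
      using F2[OF t] by (intro convex_linear_image iso.J.linear) auto
    ultimately show "closed (?F t y) \<and> convex (?F t y)" by (simp add: iso.image_J)
    show "lower_semicontinuous (?F t)" by (rule iso.lower_semicontinuous_conj[OF F3[OF t]])
    show "norm z \<le> m t" if "z \<in> ?F t y" using that F4'[OF t] by (auto simp: norm_to)
  qed
  show ?thesis
    unfolding approximately_controllable_def
  proof (intro allI impI)
    fix x1 :: 'a and e :: real assume "e > 0"
    then obtain u q where u: "u \<in> L2_functions a b" and n: "norm (q b - to_copy x1) < e"
      and sol: "inclusion_mild_solution \<psi> \<psi>' a b \<alpha> \<beta> ?T ?B (to_copy x0) ?F u q"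
      using main unfolding approximately_controllable_def by blast
    obtain f where f: "bochner_integrable (lebesgue_on {a..b}) f" "AE t in lebesgue_on {a..b}. f t \<in> ?F t (q t)"
      "mild_with_source \<psi> \<psi>' a b \<alpha> \<beta> ?T ?B (to_copy x0) f u q"
      using sol unfolding inclusion_mild_solution_def by blast
    have "inclusion_mild_solution \<psi> \<psi>' a b \<alpha> \<beta> T B x0 F u (\<lambda>t. of_copy (q t))"
      unfolding inclusion_mild_solution_def
    proof (intro exI conjI)
      show "bochner_integrable (lebesgue_on {a..b}) (\<lambda>t. of_copy (f t))"
        using f(1) iso.bochner_J(1)[of "lebesgue_on {a..b}" "\<lambda>t. of_copy (f t)"] by (simp add: of_copy_inverse)
      show "AE t in lebesgue_on {a..b}. of_copy (f t) \<in> F t (of_copy (q t))"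
        using f(2) by eventually_elim (auto simp: of_to)
      show "mild_with_source \<psi> \<psi>' a b \<alpha> \<beta> T B x0 (\<lambda>t. of_copy (f t)) u (\<lambda>t. of_copy (q t))"
        using f(3) iso.conj_mild_with_source[of \<psi> \<psi>' a b \<alpha> \<beta> T B x0 "\<lambda>t. of_copy (f t)" u "\<lambda>t. of_copy (q t)"]
        by (simp add: of_copy_inverse)
    qed
    moreover have "norm (of_copy (q b) - x1) = norm (q b - to_copy x1)"
      by (metis iso.I.diff of_to norm_of_copy)
    ultimately show "\<exists>u\<in>L2_functions a b. \<exists>q. inclusion_mild_solution \<psi> \<psi>' a b \<alpha> \<beta> T B x0 F u q \<and> norm (q b - x1) < e"
      using u n by (intro bexI[of _ u] exI[of _ "\<lambda>t. of_copy (q t)"]) auto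
  qed
qed

end
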